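(* Fix one type $\mathcal T\in\{K, WK, S, PL\}$; below, "$s$-Kähler" in quotation marks means generalized $s$-Kähler of type $\mathcal T$. Let $X$ be an $m$-dimensional Kähler manifold, and let $Y$ be an $n$-dimensional complex manifold which is "$s$-Kähler" for all $s$ with $q\le s<n$, where $1\le q\le n-1$. Then $X\times Y$ is "$s$-Kähler" for all $s$ with $m+q\le s<m+n$.
   Context: Positivity. Let $E$ be a complex vector space of dimension $n$, $\sigma_p:=i^{p^2}2^{-p}$. An $(n,n)$-form is strictly positive if it is $c\,dv$ with $c>0$, where $dv=\sigma_n\varphi_1\wedge\dots\wedge\varphi_n\wedge\overline{\varphi_1\wedge\dots\wedge\varphi_n}$ for a basis $\varphi_1,\dots,\varphi_n$ of $E^*$. Let $1\le p\le n-1$ and $k=n-p$. A real $(p,p)$-form $\Omega\in\Lambda^{p,p}_{\mathbb R}(E^* )$ is transverse if $\Omega\wedge\sigma_k\,\psi_1\wedge\dots\wedge\psi_k\wedge\overline{\psi_1\wedge\dots\wedge\psi_k}$ is a strictly positive $(n,n)$-form for all linearly independent $\psi_1,\dots,\psi_k\in E^*$. A smooth real $(p,p)$-form on a complex manifold is transverse if it is so at every point, with $E=T'_xX$ the holomorphic tangent space. Generalized $p$-Kähler manifolds. Let $X$ be a complex manifold of dimension $n$ and $1\le p\le n-1$. All forms are smooth. - Type K: $X$ has a transverse real $(p,p)$-form $\Omega$ with $d\Omega=0$. - Type WK: $X$ has a transverse real $(p,p)$-form $\Omega$ with $\partial\Omega=\partial\bar\partial\alpha$ for some form $\alpha$.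 - Type S: $X$ has a closed real $2p$-form $\Psi$ whose $(p,p)$-component $\Omega:=\Psi^{p,p}$ is transverse. - Type PL: $X$ has a transverse real $(p,p)$-form $\Omega$ with $\partial\bar\partial\Omega=0$. Complex manifolds need not be compact. *)

theory Defs
  imports "HOL-Analysis.Analysis"
begin

section \<open>The exterior algebra of the complexified cotangent space of $\mathbb{C}^n$\<close>

text \<open>
  The space C^n is the set of sequences vanishing from index n on (compare Euclidean_space in
  HOL-Analysis), so that the dimension is a natural number and products of manifolds do not leave
  the type. The coframe dz_0, ..., dz_(n-1), followed by the conjugates, is ordered as listed.
\<close>

definition Cn :: "nat \<Rightarrow> (nat \<Rightarrow> complex) set" where
  "Cn n = {z. \<forall>i\<ge>n. z i = 0}"

datatype coframe_elem = Dz nat | Dzbar nat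

instantiation coframe_elem :: linorder
begin

definition less_eq_coframe_elem :: "coframe_elem \<Rightarrow> coframe_elem \<Rightarrow> bool" where
  "less_eq_coframe_elem a b \<longleftrightarrow>
     (case a of
        Dz i \<Rightarrow> (case b of Dz j \<Rightarrow> i \<le> j | Dzbar j \<Rightarrow> True)
      | Dzbar i \<Rightarrow> (case b of Dz j \<Rightarrow> False | Dzbar j \<Rightarrow> i \<le> j))"

definition less_coframe_elem :: "coframe_elem \<Rightarrow> coframe_elem \<Rightarrow> bool" where
  "less_coframe_elem a b \<longleftrightarrow> a \<le> b \<and> \<not> b \<le> a"

instance
  by standard
    (auto simp: less_eq_coframe_elem_def less_coframe_elem_def split: coframe_elem.splits)

end

definition coframe :: "nat \<Rightarrow> coframe_elem set" where
  "coframe n = Dz ` {..<n} \<union> Dzbar ` {..<n}"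

text \<open>
  An element of the exterior algebra is given by its coefficients: \<open>w K\<close> is the coefficient of the
  wedge product of the elements of \<open>K\<close> in increasing order.
\<close>

type_synonym ext = "coframe_elem set \<Rightarrow> complex"

definition ext_on :: "nat \<Rightarrow> ext \<Rightarrow> bool" where
  "ext_on n w \<longleftrightarrow> (\<forall>K. w K \<noteq> 0 \<longrightarrow> K \<subseteq> coframe n)"

definition ext_one :: ext where
  "ext_one K = (if K = {} then 1 else 0)"

definition ext_gen :: "coframe_elem \<Rightarrow> ext" where
  "ext_gen g K = (if K = {g} then 1 else 0)"

definition ext_scale :: "complex \<Rightarrow> ext \<Rightarrow> ext" where
  "ext_scale c w K = c * w K"

text \<open>The sign of the permutation sorting the concatenation of \<open>A\<close> and \<open>B\<close>.\<close>

definition shuffle_sign :: "coframe_elem set \<Rightarrow> coframe_elem set \<Rightarrow> complex" where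
  "shuffle_sign A B = (- 1) ^ card {(a, b). a \<in> A \<and> b \<in> B \<and> b < a}"

definition wedge :: "ext \<Rightarrow> ext \<Rightarrow> ext" where
  "wedge v w K = (\<Sum>A\<in>Pow K. shuffle_sign A (K - A) * v A * w (K - A))"

definition wedge_list :: "ext list \<Rightarrow> ext" where
  "wedge_list ws = foldr wedge ws ext_one"

definition hol_degree :: "coframe_elem set \<Rightarrow> nat" where
  "hol_degree K = card {i. Dz i \<in> K}"

definition antihol_degree :: "coframe_elem set \<Rightarrow> nat" where
  "antihol_degree K = card {i. Dzbar i \<in> K}"

definition has_degree :: "nat \<Rightarrow> ext \<Rightarrow> bool" where
  "has_degree r w \<longleftrightarrow> (\<forall>K. w K \<noteq> 0 \<longrightarrow> card K = r)"

definition has_bidegree :: "nat \<Rightarrow> nat \<Rightarrow> ext \<Rightarrow> bool" where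
  "has_bidegree p q w \<longleftrightarrow> (\<forall>K. w K \<noteq> 0 \<longrightarrow> hol_degree K = p \<and> antihol_degree K = q)"

definition ext_component :: "nat \<Rightarrow> nat \<Rightarrow> ext \<Rightarrow> ext" where
  "ext_component p q w K = (if hol_degree K = p \<and> antihol_degree K = q then w K else 0)"

fun bar :: "coframe_elem \<Rightarrow> coframe_elem" where
  "bar (Dz i) = Dzbar i"
| "bar (Dzbar i) = Dz i"

text \<open>The sign comes from moving the conjugated dz-factors behind the conjugated dzbar-factors.\<close>

definition ext_cnj :: "ext \<Rightarrow> ext" where
  "ext_cnj w K = (- 1) ^ (hol_degree K * antihol_degree K) * cnj (w (bar ` K))"

definition ext_real :: "ext \<Rightarrow> bool" where
  "ext_real w \<longleftrightarrow> ext_cnj w = w"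

section \<open>Positivity\<close>

text \<open>
  A covector in E^*, for E = C^n, is given by its coefficients \<open>\<psi> i\<close>, i < n, with respect to
  dz_0, ..., dz_(n-1).
\<close>

definition covector :: "nat \<Rightarrow> (nat \<Rightarrow> complex) \<Rightarrow> ext" where
  "covector n \<psi> K = (\<Sum>i<n. \<psi> i * ext_gen (Dz i) K)"

definition covectors_independent :: "nat \<Rightarrow> nat \<Rightarrow> (nat \<Rightarrow> nat \<Rightarrow> complex) \<Rightarrow> bool" where
  "covectors_independent n k \<psi> \<longleftrightarrow>
     (\<forall>c :: nat \<Rightarrow> complex. (\<forall>i<n. (\<Sum>a<k. c a * \<psi> a i) = 0) \<longrightarrow> (\<forall>a<k. c a = 0))"

definition sigma :: "nat \<Rightarrow> complex" where
  "sigma p = \<i> ^ (p\<^sup>2) / 2 ^ p"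

definition simple_positive :: "nat \<Rightarrow> nat \<Rightarrow> (nat \<Rightarrow> nat \<Rightarrow> complex) \<Rightarrow> ext" where
  "simple_positive n k \<psi> =
     (let \<eta> = wedge_list (map (\<lambda>a. covector n (\<psi> a)) [0..<k])
      in ext_scale (sigma k) (wedge \<eta> (ext_cnj \<eta>)))"

definition strictly_positive :: "nat \<Rightarrow> ext \<Rightarrow> bool" where
  "strictly_positive n w \<longleftrightarrow>
     (\<exists>c::real. \<exists>\<phi>. c > 0 \<and> covectors_independent n n \<phi> \<and>
        w = ext_scale (of_real c) (simple_positive n n \<phi>))"

definition transverse :: "nat \<Rightarrow> nat \<Rightarrow> ext \<Rightarrow> bool" where
  "transverse n p w \<longleftrightarrow>
     ext_on n w \<and> has_bidegree p p w \<and> ext_real w \<and>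
     (\<forall>\<psi>. covectors_independent n (n - p) \<psi> \<longrightarrow>
        strictly_positive n (wedge w (simple_positive n (n - p) \<psi>)))"

text \<open>
  Writing a real (1,1)-covector as (i/2) times the sum of h_jk dz_j dzbar_k, with h Hermitian, this
  says that h is positive definite.
\<close>

definition positive_11 :: "nat \<Rightarrow> ext \<Rightarrow> bool" where
  "positive_11 n w \<longleftrightarrow>
     ext_on n w \<and> has_bidegree 1 1 w \<and> ext_real w \<and>
     (\<forall>v. (\<exists>i<n. v i \<noteq> 0) \<longrightarrow>
        (\<exists>r::real. r > 0 \<and>
           (\<Sum>j<n. \<Sum>k<n. (2 / \<i>) * w {Dz j, Dzbar k} * v j * cnj (v k)) = of_real r))"

section \<open>Calculus on open subsets of $\mathbb{C}^n$\<close>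

definition open_Cn :: "nat \<Rightarrow> (nat \<Rightarrow> complex) set \<Rightarrow> bool" where
  "open_Cn n V \<longleftrightarrow> openin (top_of_set (Cn n)) V"

text \<open>Restriction to the real line through \<open>z\<close> in direction \<open>u\<close> of the j-th coordinate.\<close>

definition along :: "complex \<Rightarrow> nat \<Rightarrow> ((nat \<Rightarrow> complex) \<Rightarrow> complex) \<Rightarrow> (nat \<Rightarrow> complex) \<Rightarrow> real \<Rightarrow> complex"
  where "along u j f z t = f (z(j := z j + of_real t * u))"

text \<open>With z_j = x_j + i y_j, this is the derivative in x_j for \<open>u = 1\<close> and in y_j for \<open>u = \<i>\<close>.\<close>

definition partial :: "complex \<Rightarrow> nat \<Rightarrow> ((nat \<Rightarrow> complex) \<Rightarrow> complex) \<Rightarrow> (nat \<Rightarrow> complex) \<Rightarrow> complex"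
  where "partial u j f z = vector_derivative (along u j f z) (at 0)"

primrec Ck_on :: "nat \<Rightarrow> nat \<Rightarrow> (nat \<Rightarrow> complex) set \<Rightarrow> ((nat \<Rightarrow> complex) \<Rightarrow> complex) \<Rightarrow> bool" where
  "Ck_on 0 n V f = continuous_on V f"
| "Ck_on (Suc k) n V f =
     (continuous_on V f \<and>
      (\<forall>j<n. \<forall>u\<in>{1, \<i>}.
         (\<forall>z\<in>V. along u j f z differentiable (at 0)) \<and> Ck_on k n V (partial u j f)))"

definition smooth_fun_on :: "nat \<Rightarrow> (nat \<Rightarrow> complex) set \<Rightarrow> ((nat \<Rightarrow> complex) \<Rightarrow> complex) \<Rightarrow> bool" where
  "smooth_fun_on n V f \<longleftrightarrow> (\<forall>k. Ck_on k n V f)"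

definition wirtinger :: "nat \<Rightarrow> ((nat \<Rightarrow> complex) \<Rightarrow> complex) \<Rightarrow> (nat \<Rightarrow> complex) \<Rightarrow> complex" where
  "wirtinger j f z = (partial 1 j f z - \<i> * partial \<i> j f z) / 2"

definition wirtinger_bar :: "nat \<Rightarrow> ((nat \<Rightarrow> complex) \<Rightarrow> complex) \<Rightarrow> (nat \<Rightarrow> complex) \<Rightarrow> complex" where
  "wirtinger_bar j f z = (partial 1 j f z + \<i> * partial \<i> j f z) / 2"

type_synonym local_form = "(nat \<Rightarrow> complex) \<Rightarrow> ext"

definition del :: "nat \<Rightarrow> local_form \<Rightarrow> local_form" where
  "del n w z K = (\<Sum>j<n. wedge (ext_gen (Dz j)) (\<lambda>L. wirtinger j (\<lambda>x. w x L) z) K)"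

definition delbar :: "nat \<Rightarrow> local_form \<Rightarrow> local_form" where
  "delbar n w z K = (\<Sum>j<n. wedge (ext_gen (Dzbar j)) (\<lambda>L. wirtinger_bar j (\<lambda>x. w x L) z) K)"

definition ext_d :: "nat \<Rightarrow> local_form \<Rightarrow> local_form" where
  "ext_d n w z K = del n w z K + delbar n w z K"

text \<open>Holomorphic in several variables: continuous and holomorphic in each variable.\<close>

definition holomorphic_fun_on :: "nat \<Rightarrow> (nat \<Rightarrow> complex) set \<Rightarrow> ((nat \<Rightarrow> complex) \<Rightarrow> complex) \<Rightarrow> bool" where
  "holomorphic_fun_on n V f \<longleftrightarrow>
     continuous_on V f \<and>
     (\<forall>z\<in>V. \<forall>j<n. (\<lambda>x. f (z(j := x))) field_differentiable (at (z j)))"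

definition hol_jacobian ::
  "((nat \<Rightarrow> complex) \<Rightarrow> nat \<Rightarrow> complex) \<Rightarrow> (nat \<Rightarrow> complex) \<Rightarrow> nat \<Rightarrow> nat \<Rightarrow> complex" where
  "hol_jacobian \<tau> z i j = deriv (\<lambda>x. \<tau> (z(j := x)) i) (z j)"

text \<open>
  Pullback along a holomorphic map with Jacobian \<open>J\<close>: the algebra homomorphism that maps dz_i to
  the sum of the J_ij dz_j, and dzbar_i to the conjugate.
\<close>

fun pullback_gen :: "nat \<Rightarrow> (nat \<Rightarrow> nat \<Rightarrow> complex) \<Rightarrow> coframe_elem \<Rightarrow> ext" where
  "pullback_gen n J (Dz i) = (\<lambda>K. \<Sum>j<n. J i j * ext_gen (Dz j) K)"
| "pullback_gen n J (Dzbar i) = (\<lambda>K. \<Sum>j<n. cnj (J i j) * ext_gen (Dzbar j) K)"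

definition pullback :: "nat \<Rightarrow> (nat \<Rightarrow> nat \<Rightarrow> complex) \<Rightarrow> ext \<Rightarrow> ext" where
  "pullback n J w M =
     (\<Sum>K\<in>Pow (coframe n).
        w K * wedge_list (map (pullback_gen n J) (sorted_list_of_set K)) M)"

section \<open>Complex manifolds and differential forms\<close>

text \<open>A chart is its domain together with its coordinate map, which is irrelevant off the domain.\<close>

type_synonym 'a chart = "'a set \<times> ('a \<Rightarrow> nat \<Rightarrow> complex)"

definition chart_image :: "'a chart \<Rightarrow> (nat \<Rightarrow> complex) set" where
  "chart_image c = snd c ` fst c"

definition chart_inv :: "'a chart \<Rightarrow> (nat \<Rightarrow> complex) \<Rightarrow> 'a" where
  "chart_inv c = the_inv_into (fst c) (snd c)"

definition overlap :: "'a chart \<Rightarrow> 'a chart \<Rightarrow> (nat \<Rightarrow> complex) set" where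
  "overlap c c' = snd c ` (fst c \<inter> fst c')"

definition transition :: "'a chart \<Rightarrow> 'a chart \<Rightarrow> (nat \<Rightarrow> complex) \<Rightarrow> nat \<Rightarrow> complex" where
  "transition c c' = snd c' \<circ> chart_inv c"

text \<open>The atlas is not required to be maximal.\<close>

record 'a cmanifold =
  cdim :: nat
  ctop :: "'a topology"
  atlas :: "'a chart set"

definition is_chart :: "nat \<Rightarrow> 'a topology \<Rightarrow> 'a chart \<Rightarrow> bool" where
  "is_chart n T c \<longleftrightarrow>
     openin T (fst c) \<and> open_Cn n (chart_image c) \<and>
     homeomorphic_map (subtopology T (fst c)) (top_of_set (chart_image c)) (snd c)"

definition complex_manifold :: "'a cmanifold \<Rightarrow> bool" where
  "complex_manifold X \<longleftrightarrow>
     Hausdorff_space (ctop X) \<and> second_countable (ctop X) \<and>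
     (\<forall>c\<in>atlas X. is_chart (cdim X) (ctop X) c) \<and>
     (\<Union>c\<in>atlas X. fst c) = topspace (ctop X) \<and>
     (\<forall>c\<in>atlas X. \<forall>c'\<in>atlas X. \<forall>i<cdim X.
        holomorphic_fun_on (cdim X) (overlap c c') (\<lambda>z. transition c c' z i))"

definition prod_chart :: "nat \<Rightarrow> 'a chart \<Rightarrow> 'b chart \<Rightarrow> ('a \<times> 'b) chart" where
  "prod_chart m c c' =
     (fst c \<times> fst c', \<lambda>(x, y) i. if i < m then snd c x i else snd c' y (i - m))"

definition prod_manifold :: "'a cmanifold \<Rightarrow> 'b cmanifold \<Rightarrow> ('a \<times> 'b) cmanifold" where
  "prod_manifold X Y =
     \<lparr>cdim = cdim X + cdim Y,
      ctop = prod_topology (ctop X) (ctop Y),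
      atlas = {prod_chart (cdim X) c c' |c c'. c \<in> atlas X \<and> c' \<in> atlas Y}\<rparr>"

text \<open>
  A differential form is given by its coordinate expressions, one for each chart of the atlas,
  which have to agree under pullback by the transition maps. Only their values on the images of
  the charts matter. Forms are complex-valued and may be inhomogeneous.
\<close>

type_synonym 'a form = "'a chart \<Rightarrow> local_form"

definition smooth_form :: "'a cmanifold \<Rightarrow> 'a form \<Rightarrow> bool" where
  "smooth_form X w \<longleftrightarrow>
     (\<forall>c\<in>atlas X.
        (\<forall>z\<in>chart_image c. ext_on (cdim X) (w c z)) \<and>
        (\<forall>K. smooth_fun_on (cdim X) (chart_image c) (\<lambda>z. w c z K))) \<and>
     (\<forall>c\<in>atlas X. \<forall>c'\<in>atlas X. \<forall>z\<in>overlap c c'.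
        w c z = pullback (cdim X) (hol_jacobian (transition c c') z) (w c' (transition c c' z)))"

definition form_all :: "'a cmanifold \<Rightarrow> (ext \<Rightarrow> bool) \<Rightarrow> 'a form \<Rightarrow> bool" where
  "form_all X P w \<longleftrightarrow> (\<forall>c\<in>atlas X. \<forall>z\<in>chart_image c. P (w c z))"

definition form_eq :: "'a cmanifold \<Rightarrow> 'a form \<Rightarrow> 'a form \<Rightarrow> bool" where
  "form_eq X v w \<longleftrightarrow> (\<forall>c\<in>atlas X. \<forall>z\<in>chart_image c. v c z = w c z)"

definition form_zero :: "'a form" where
  "form_zero c z K = 0"

definition form_component :: "nat \<Rightarrow> nat \<Rightarrow> 'a form \<Rightarrow> 'a form" where
  "form_component p q w c z = ext_component p q (w c z)"

definition form_del :: "'a cmanifold \<Rightarrow> 'a form \<Rightarrow> 'a form" where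
  "form_del X w c = del (cdim X) (w c)"

definition form_delbar :: "'a cmanifold \<Rightarrow> 'a form \<Rightarrow> 'a form" where
  "form_delbar X w c = delbar (cdim X) (w c)"

definition form_d :: "'a cmanifold \<Rightarrow> 'a form \<Rightarrow> 'a form" where
  "form_d X w c = ext_d (cdim X) (w c)"

definition transverse_form :: "'a cmanifold \<Rightarrow> nat \<Rightarrow> 'a form \<Rightarrow> bool" where
  "transverse_form X p w \<longleftrightarrow> smooth_form X w \<and> form_all X (transverse (cdim X) p) w"

section \<open>Kaehler and generalized p-Kaehler manifolds\<close>

definition kaehler_manifold :: "'a cmanifold \<Rightarrow> bool" where
  "kaehler_manifold X \<longleftrightarrow>
     complex_manifold X \<and>
     (\<exists>w. smooth_form X w \<and> form_all X (positive_11 (cdim X)) w \<and>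
        form_eq X (form_d X w) form_zero)"

datatype kaehler_type = Type_K | Type_WK | Type_S | Type_PL

text \<open>
  In type WK, only forms of degree 2p - 1 are admitted for \<open>\<alpha>\<close>: this is the degree in which the
  equation makes sense.
\<close>

definition generalized_kaehler :: "kaehler_type \<Rightarrow> nat \<Rightarrow> 'a cmanifold \<Rightarrow> bool" where
  "generalized_kaehler T p X \<longleftrightarrow>
     complex_manifold X \<and> 1 \<le> p \<and> p < cdim X \<and>
     (case T of
        Type_K \<Rightarrow>
          \<exists>\<Omega>. transverse_form X p \<Omega> \<and> form_eq X (form_d X \<Omega>) form_zero
      | Type_WK \<Rightarrow>
          \<exists>\<Omega> \<alpha>. transverse_form X p \<Omega> \<and>
            smooth_form X \<alpha> \<and> form_all X (has_degree (2 * p - 1)) \<alpha> \<and>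
            form_eq X (form_del X \<Omega>) (form_del X (form_delbar X \<alpha>))
      | Type_S \<Rightarrow>
          \<exists>\<Psi>. smooth_form X \<Psi> \<and> form_all X (has_degree (2 * p)) \<Psi> \<and> form_all X ext_real \<Psi> \<and>
            form_eq X (form_d X \<Psi>) form_zero \<and>
            transverse_form X p (form_component p p \<Psi>)
      | Type_PL \<Rightarrow>
          \<exists>\<Omega>. transverse_form X p \<Omega> \<and>
            form_eq X (form_del X (form_delbar X \<Omega>)) form_zero)"

end

theory Submission
  imports Defs
begin

text \<open>
  Let \<open>\<omega>\<close> be the Kaehler form of X and \<open>\<Omega>\<^sub>t\<close> the given forms on Y for q \<le> t < n, completed by a volume
  form for t = n and by 0 otherwise. On the product the form is the sum of \<open>\<omega>\<^sup>j / j!\<close> wedge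
  \<open>\<Omega>\<close> with index s - j, for j \<le> s. As \<open>\<omega>\<close> is closed of even degree, both Dolbeault operators act on the
  second factors only, which gives all four closedness conditions.

  Transversality is pointwise. Write \<open>\<omega>\<close> as a sum of squares \<open>(\<i>/2) \<theta> \<and> cnj \<theta>\<close> with triangular
  coefficients. The exponential of this sum is a product of factors 1 + \<open>(\<i>/2) \<theta> \<and> cnj \<theta>\<close>, so the
  coordinates of X can be added one at a time, and each time one pivot in the test covectors suffices.
  The test form is the product of the squares of its covectors, hence invariant under row operations.

  The term t = n cannot be omitted: for s \<ge> n it is the only one that is nonzero on products of
  a subspace with the whole tangent space of Y. The volume form is obtained from the transverse form
  of bidegree (n-1,n-1) on Y.
\<close>

section \<open>The exterior algebra as a ring\<close>

text \<open>The test covectors mix the coordinates of the two factors and a single summand is in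
  general not transverse, so positivity cannot be checked factor by factor. With one added
  coordinate the mixing is confined to one column; eliminating it leaves a strictly positive term
  and one that is only nonnegative, because its reduced test covectors may be dependent. The weights
  1/j! make the induction work: the exponential of P + W is 1 + P times that of W when P squares to
  zero. The range of s has a simple source: the j-th power of the Kaehler form vanishes for j > m,
  so for s \<ge> m + q every nonzero summand has index at least q on Y, while indices above n vanish
  by degree. Filling the family with 0 outside q, ..., n therefore loses nothing. The volume form on
  Y is given by a formula in the coefficients of one transverse form that transforms correctly under
  chart changes, so nothing has to be glued. The root of order n-1 makes sense because 1 \<le> q
  \<le> n-1 forces n \<ge> 2.\<close>

typedef extalg = "{w :: ext. finite {K. w K \<noteq> 0} \<and> (\<forall>K. w K \<noteq> 0 \<longrightarrow> finite K)}"
  morphisms coef Extalg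
  by (rule exI[of _ "\<lambda>_. 0"]) simp

setup_lifting type_definition_extalg

definition supp :: "extalg \<Rightarrow> coframe_elem set set" where
  "supp x = {K. coef x K \<noteq> 0}"

lemma finite_supp [simp]: "finite (supp x)"
  using coef[of x] by (simp add: supp_def)

lemma coef_nonzero_finite: "coef x K \<noteq> 0 \<Longrightarrow> finite K"
  using coef[of x] by blast

lemma coef_infinite: "infinite K \<Longrightarrow> coef x K = 0"
  using coef_nonzero_finite by blast

lemma extalg_eqI: "(\<And>K. finite K \<Longrightarrow> coef x K = coef y K) \<Longrightarrow> x = y"
  by (metis coef_infinite coef_inject ext)

section \<open>Signs of sorting permutations\<close>

lemma shuffle_sign_eq_card:
  "shuffle_sign A B = (- 1) ^ card (Set.filter (\<lambda>(a, b). b < a) (A \<times> B))"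
  unfolding shuffle_sign_def by (rule arg_cong[where f = "\<lambda>S. (-1) ^ card S"]) auto

lemma shuffle_sign_Un_left:
  assumes "finite A" "finite B" "finite C" "A \<inter> B = {}"
  shows "shuffle_sign (A \<union> B) C = shuffle_sign A C * shuffle_sign B C"
proof -
  have "Set.filter (\<lambda>(a, b). b < a) ((A \<union> B) \<times> C) =
        Set.filter (\<lambda>(a, b). b < a) (A \<times> C) \<union> Set.filter (\<lambda>(a, b). b < a) (B \<times> C)"
    by auto
  moreover have "card (Set.filter (\<lambda>(a, b). b < a) (A \<times> C) \<union> Set.filter (\<lambda>(a, b). b < a) (B \<times> C)) =
        card (Set.filter (\<lambda>(a, b). b < a) (A \<times> C)) + card (Set.filter (\<lambda>(a, b). b < a) (B \<times> C))"
    using assms by (intro card_Un_disjoint) auto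
  ultimately show ?thesis
    unfolding shuffle_sign_eq_card by (simp add: power_add)
qed

lemma shuffle_sign_Un_right:
  assumes "finite A" "finite B" "finite C" "B \<inter> C = {}"
  shows "shuffle_sign A (B \<union> C) = shuffle_sign A B * shuffle_sign A C"
proof -
  have "Set.filter (\<lambda>(a, b). b < a) (A \<times> (B \<union> C)) =
        Set.filter (\<lambda>(a, b). b < a) (A \<times> B) \<union> Set.filter (\<lambda>(a, b). b < a) (A \<times> C)"
    by auto
  moreover have "card (Set.filter (\<lambda>(a, b). b < a) (A \<times> B) \<union> Set.filter (\<lambda>(a, b). b < a) (A \<times> C)) =
        card (Set.filter (\<lambda>(a, b). b < a) (A \<times> B)) + card (Set.filter (\<lambda>(a, b). b < a) (A \<times> C))"
    using assms by (intro card_Un_disjoint) auto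
  ultimately show ?thesis
    unfolding shuffle_sign_eq_card by (simp add: power_add)
qed

lemma shuffle_sign_empty [simp]: "shuffle_sign {} B = 1" "shuffle_sign A {} = 1"
  by (simp_all add: shuffle_sign_def)

lemma shuffle_sign_ordered: "(\<And>a b. a \<in> A \<Longrightarrow> b \<in> B \<Longrightarrow> a \<le> b) \<Longrightarrow> shuffle_sign A B = 1"
proof -
  assume "\<And>a b. a \<in> A \<Longrightarrow> b \<in> B \<Longrightarrow> a \<le> b"
  then have "{(a, b). a \<in> A \<and> b \<in> B \<and> b < a} = {}" by fastforce
  then show ?thesis unfolding shuffle_sign_def by (simp only: card.empty power_0)
qed

lemma shuffle_sign_reversed:
  assumes "\<And>a b. a \<in> A \<Longrightarrow> b \<in> B \<Longrightarrow> b < a"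
  shows "shuffle_sign A B = (-1) ^ (card A * card B)"
proof -
  have "{(a, b). a \<in> A \<and> b \<in> B \<and> b < a} = A \<times> B" using assms by auto
  then show ?thesis by (simp add: shuffle_sign_def card_cartesian_product)
qed

text \<open>For disjoint sets every pair is an inversion in exactly one of the two orders, so the
  two inversion counts add up to \<open>card A * card B\<close>.\<close>

lemma shuffle_sign_swap:
  assumes "finite A" "finite B" "A \<inter> B = {}"
  shows "shuffle_sign A B = (-1) ^ (card A * card B) * shuffle_sign B A"
proof -
  let ?S = "Set.filter (\<lambda>(a, b). b < a) (A \<times> B)" and ?T = "Set.filter (\<lambda>(a, b). b < a) (B \<times> A)"
  have "A \<times> B = ?S \<union> prod.swap ` ?T"
  proof (intro set_eqI iffI)
    fix p assume "p \<in> A \<times> B"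
    then obtain a b where p: "p = (a, b)" "a \<in> A" "b \<in> B" by blast
    then have "a \<noteq> b" using assms(3) by blast
    then consider "b < a" | "a < b" by fastforce
    then show "p \<in> ?S \<union> prod.swap ` ?T"
      using p by cases (auto intro!: image_eqI[of _ _ "(b, a)"])
  qed auto
  moreover have "?S \<inter> prod.swap ` ?T = {}" by auto
  ultimately have "card (A \<times> B) = card ?S + card (prod.swap ` ?T)"
    using assms by (metis card_Un_disjoint finite_SigmaI finite_Un)
  then have c: "card A * card B = card ?S + card ?T"
    by (simp add: card_cartesian_product card_image)
  have "(-1::complex) ^ card ?S = (-1) ^ (card ?S + card ?T) * (-1) ^ card ?T"
    by (simp add: power_add mult.assoc flip: power_mult_distrib)
  then show ?thesis unfolding shuffle_sign_eq_card c .
qed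

lemma cnj_shuffle_sign [simp]: "cnj (shuffle_sign A B) = shuffle_sign A B"
  by (simp add: shuffle_sign_def)

lemma wedge_infinite: "infinite K \<Longrightarrow> wedge v w K = 0"
  by (simp add: wedge_def finite_Pow_iff)

text \<open>Both bracketings expand to a sum over ordered partitions of \<open>K\<close> into three
  blocks with the same product of signs, since the sign is multiplicative under disjoint unions in
  either argument. For infinite \<open>K\<close> both sides are 0 by the convention for infinite
  sums.\<close>

lemma wedge_assoc: "wedge (wedge u v) w = wedge u (wedge v w)"
proof
  fix K
  show "wedge (wedge u v) w K = wedge u (wedge v w) K"
  proof (cases "finite K")
    case False
    then show ?thesis by (simp add: wedge_infinite)
  next
    case fin: True
    have "wedge (wedge u v) w K =
        (\<Sum>(A, B)\<in>Sigma (Pow K) Pow.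
           shuffle_sign A (K - A) * shuffle_sign B (A - B) * u B * v (A - B) * w (K - A))"
      unfolding wedge_def using fin
      by (subst sum.Sigma[symmetric])
        (auto simp: finite_subset sum_distrib_left sum_distrib_right mult.assoc mult.left_commute
          intro!: sum.cong)
    \<comment> \<open>A pair \<open>A\<close>, \<open>B\<close> with \<open>B\<close> inside
      \<open>A\<close> stands for the blocks \<open>B\<close>, \<open>A - B\<close>,
      \<open>K - A\<close>; the other bracketing indexes the same partition by its first two
      blocks.\<close>
    also have "\<dots> = (\<Sum>(B, C)\<in>Sigma (Pow K) (\<lambda>B. Pow (K - B)).
           shuffle_sign B (K - B) * shuffle_sign C (K - B - C) * u B * v C * w (K - B - C))"
    proof (rule sum.reindex_bij_witness[where i = "\<lambda>(B, C). (B \<union> C, B)" and j = "\<lambda>(A, B). (B, A - B)"])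
      fix p assume "p \<in> Sigma (Pow K) Pow"
      then obtain A B where p: "p = (A, B)" "B \<subseteq> A" "A \<subseteq> K" by auto
      then have [simp]: "finite A" using fin by (metis finite_subset)
      then have [simp]: "finite B" using p by (metis finite_subset)
      have e: "K - B - (A - B) = K - A" "K - B = (A - B) \<union> (K - A)" "A = B \<union> (A - B)" using p by auto
      have 1: "shuffle_sign A (K - A) = shuffle_sign B (K - A) * shuffle_sign (A - B) (K - A)"
        using fin by (subst e(3), subst shuffle_sign_Un_left) auto
      have 2: "shuffle_sign B (K - B) = shuffle_sign B (A - B) * shuffle_sign B (K - A)"
        using fin by (subst e(2), subst shuffle_sign_Un_right) auto
      show "(case case p of (A, B) \<Rightarrow> (B, A - B) of
          (B, C) \<Rightarrow> shuffle_sign B (K - B) * shuffle_sign C (K - B - C) * u B * v C * w (K - B - C)) =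
          (case p of (A, B) \<Rightarrow> shuffle_sign A (K - A) * shuffle_sign B (A - B) * u B * v (A - B) * w (K - A))"
        by (simp add: p e(1) 1 2)
    qed auto
    also have "\<dots> = wedge u (wedge v w) K"
      unfolding wedge_def using fin
      by (subst sum.Sigma[symmetric])
        (auto simp: finite_subset sum_distrib_left sum_distrib_right mult.assoc mult.left_commute
          intro!: sum.cong)
    finally show ?thesis .
  qed
qed

lemma wedge_nonzeroE:
  assumes "wedge v w K \<noteq> 0"
  obtains A where "A \<subseteq> K" "v A \<noteq> 0" "w (K - A) \<noteq> 0" "finite K"
proof -
  have "finite K" using assms wedge_infinite by blast
  moreover from assms obtain A where "A \<in> Pow K" "shuffle_sign A (K - A) * v A * w (K - A) \<noteq> 0"
    unfolding wedge_def by (meson sum.neutral)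
  ultimately show ?thesis using that[of A] by auto
qed

instantiation extalg :: "{zero, one, plus, minus, uminus, times}"
begin

lift_definition zero_extalg :: extalg is "\<lambda>_. 0" by simp

lift_definition one_extalg :: extalg is ext_one
  by (simp add: ext_one_def)

lift_definition plus_extalg :: "extalg \<Rightarrow> extalg \<Rightarrow> extalg" is "\<lambda>v w K. v K + w K"
proof
  fix v w :: ext
  assume v: "finite {K. v K \<noteq> 0} \<and> (\<forall>K. v K \<noteq> 0 \<longrightarrow> finite K)"
    and w: "finite {K. w K \<noteq> 0} \<and> (\<forall>K. w K \<noteq> 0 \<longrightarrow> finite K)"
  show "finite {K. v K + w K \<noteq> 0}"
    by (rule finite_subset[of _ "{K. v K \<noteq> 0} \<union> {K. w K \<noteq> 0}"]) (use v w in auto)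
  show "\<forall>K. v K + w K \<noteq> 0 \<longrightarrow> finite K"
  proof (intro allI impI)
    fix K assume "v K + w K \<noteq> 0"
    then have "v K \<noteq> 0 \<or> w K \<noteq> 0" by auto
    then show "finite K" using v w by blast
  qed
qed

lift_definition uminus_extalg :: "extalg \<Rightarrow> extalg" is "\<lambda>v K. - v K"
  by simp

lift_definition minus_extalg :: "extalg \<Rightarrow> extalg \<Rightarrow> extalg" is "\<lambda>v w K. v K - w K"
proof
  fix v w :: ext
  assume v: "finite {K. v K \<noteq> 0} \<and> (\<forall>K. v K \<noteq> 0 \<longrightarrow> finite K)"
    and w: "finite {K. w K \<noteq> 0} \<and> (\<forall>K. w K \<noteq> 0 \<longrightarrow> finite K)"
  show "finite {K. v K - w K \<noteq> 0}"
    by (rule finite_subset[of _ "{K. v K \<noteq> 0} \<union> {K. w K \<noteq> 0}"]) (use v w in auto)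
  show "\<forall>K. v K - w K \<noteq> 0 \<longrightarrow> finite K"
  proof (intro allI impI)
    fix K assume "v K - w K \<noteq> 0"
    then have "v K \<noteq> 0 \<or> w K \<noteq> 0" by auto
    then show "finite K" using v w by blast
  qed
qed

lift_definition times_extalg :: "extalg \<Rightarrow> extalg \<Rightarrow> extalg" is wedge
proof
  fix v w :: ext
  assume v: "finite {K. v K \<noteq> 0} \<and> (\<forall>K. v K \<noteq> 0 \<longrightarrow> finite K)"
    and w: "finite {K. w K \<noteq> 0} \<and> (\<forall>K. w K \<noteq> 0 \<longrightarrow> finite K)"
  have "{K. wedge v w K \<noteq> 0} \<subseteq> (\<lambda>(A, B). A \<union> B) ` ({K. v K \<noteq> 0} \<times> {K. w K \<noteq> 0})"
  proof
    fix K assume "K \<in> {K. wedge v w K \<noteq> 0}"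
    then have "wedge v w K \<noteq> 0" by simp
    then obtain A where "A \<subseteq> K" "v A \<noteq> 0" "w (K - A) \<noteq> 0"
      by (rule wedge_nonzeroE)
    then show "K \<in> (\<lambda>(A, B). A \<union> B) ` ({K. v K \<noteq> 0} \<times> {K. w K \<noteq> 0})"
      by (auto intro!: image_eqI[of _ _ "(A, K - A)"])
  qed
  then show "finite {K. wedge v w K \<noteq> 0}"
    by (rule finite_subset) (use v w in auto)
  show "\<forall>K. wedge v w K \<noteq> 0 \<longrightarrow> finite K"
    using wedge_infinite by blast
qed

instance ..

end

lemma coef_simps [simp]:
  "coef 0 K = 0" "coef (x + y) K = coef x K + coef y K"
  "coef (x - y) K = coef x K - coef y K" "coef (- x) K = - coef x K"
  by (simp_all add: zero_extalg.rep_eq plus_extalg.rep_eq minus_extalg.rep_eq uminus_extalg.rep_eq)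

lemmas coef_one = one_extalg.rep_eq
lemmas coef_mult = times_extalg.rep_eq

lemma wedge_ext_one_left: "finite K \<Longrightarrow> wedge ext_one w K = w K"
  unfolding wedge_def ext_one_def
  by (subst sum.mono_neutral_right[where S = "{{}}"]) auto

lemma wedge_ext_one_right: "finite K \<Longrightarrow> wedge w ext_one K = w K"
  unfolding wedge_def ext_one_def
  by (subst sum.mono_neutral_right[where S = "{K}"]) auto

text \<open>The restriction to finite sets in the type gives the unit laws: on an infinite
  \<open>K\<close> every \<open>wedge\<close> is 0, including the one with \<open>ext_one\<close>.
  The restriction to finitely many nonzero coefficients makes every element a finite combination of
  monomials.\<close>

instance extalg :: ring_1
proof
  fix a b c :: extalg
  show "a * b * c = a * (b * c)"
    by transfer (simp add: wedge_assoc)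
  show "(a + b) * c = a * c + b * c"
    by (rule extalg_eqI)
      (simp add: coef_mult wedge_def distrib_left distrib_right sum.distrib)
  show "a * (b + c) = a * b + a * c"
    by (rule extalg_eqI)
      (simp add: coef_mult wedge_def distrib_left distrib_right sum.distrib)
  show "1 * a = a"
    by (rule extalg_eqI) (simp add: coef_mult coef_one wedge_ext_one_left)
  show "a * 1 = a"
    by (rule extalg_eqI) (simp add: coef_mult coef_one wedge_ext_one_right)
  show "(0::extalg) \<noteq> 1"
    by transfer (auto simp: ext_one_def fun_eq_iff)
qed (rule extalg_eqI; simp)+

lemma coef_sum [simp]: "coef (sum f A) K = (\<Sum>a\<in>A. coef (f a) K)"
  by (induction A rule: infinite_finite_induct) auto

text \<open>Scalars are embedded as elements of degree zero, so that scaling is multiplication by a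
  central ring element and no separate module structure has to be carried along.\<close>

lift_definition cst :: "complex \<Rightarrow> extalg" is "\<lambda>c K. if K = {} then c else 0"
  by simp

lemma coef_cst: "coef (cst c) K = (if K = {} then c else 0)"
  by transfer simp

lemma coef_cst_mult [simp]: "coef (cst c * x) K = c * coef x K"
proof (cases "finite K")
  case True
  then show ?thesis
    unfolding coef_mult wedge_def coef_cst
    by (subst sum.mono_neutral_right[where S = "{{}}"]) auto
qed (simp add: coef_infinite)

lemma coef_mult_cst: "coef (x * cst c) K = c * coef x K"
proof (cases "finite K")
  case True
  then show ?thesis
    unfolding coef_mult wedge_def coef_cst
    by (subst sum.mono_neutral_right[where S = "{K}"]) auto
qed (simp add: coef_infinite)

lemma cst_commute: "x * cst c = cst c * x"
  by (rule extalg_eqI) (simp add: coef_mult_cst)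

lemma cst_left_commute: "x * (cst c * y) = cst c * (x * y)"
  by (metis cst_commute mult.assoc)

lemma cst_1 [simp]: "cst 1 = 1" and cst_0 [simp]: "cst 0 = 0"
  by (rule extalg_eqI; simp add: coef_cst coef_one ext_one_def)+

lemma cst_add: "cst (a + b) = cst a + cst b"
  and cst_mult: "cst (a * b) = cst a * cst b"
  and cst_uminus: "cst (- a) = - cst a"
  and cst_diff: "cst (a - b) = cst a - cst b"
  by (rule extalg_eqI; simp add: coef_cst)+

lemma cst_mult_left: "cst a * (cst b * x) = cst (a * b) * x"
  by (simp add: cst_mult mult.assoc)

lemma cst_mult_cst_mult: "cst a * x * (cst b * y) = cst (a * b) * (x * y)"
  by (simp only: cst_mult mult.assoc cst_left_commute[of x b y])

lemma cst_linear_combination_mult: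
  "(\<Sum>i\<in>I. cst (a i) * X i) * (\<Sum>j\<in>J. cst (b j) * Y j) =
   (\<Sum>i\<in>I. \<Sum>j\<in>J. cst (a i * b j) * (X i * Y j))"
  unfolding sum_product by (intro sum.cong refl cst_mult_cst_mult)

lemma cst_sum: "cst (sum f A) = (\<Sum>a\<in>A. cst (f a))"
  by (induction A rule: infinite_finite_induct) (auto simp: cst_add)

lemma cst_mult_power: "(cst c * x) ^ k = cst (c ^ k) * x ^ k"
  by (induction k) (simp_all add: cst_mult_cst_mult)

lemma cst_of_nat: "cst (of_nat k) = of_nat k"
  by (induction k) (auto simp: cst_add)

lemma cst_mult_eq_0_iff: "cst c * x = 0 \<longleftrightarrow> c = 0 \<or> x = 0"
proof
  assume "cst c * x = 0"
  then have "c * coef x K = 0" for K by (metis coef_cst_mult coef_simps(1))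
  then show "c = 0 \<or> x = 0" by (metis coef_simps(1) extalg_eqI mult_eq_0_iff)
qed auto

text \<open>Passing from anticommutation to vanishing squares uses that 2 is invertible in the
  coefficients.\<close>

lemma eq_neg_self_extalg: "x = - x \<Longrightarrow> x = (0::extalg)"
proof (rule extalg_eqI)
  fix K assume "x = - x"
  then have "coef x K = - coef x K" by (metis coef_simps(4))
  then show "coef x K = coef 0 K" by simp
qed

section \<open>Monomials and commutation up to sign\<close>

lift_definition mon :: "coframe_elem set \<Rightarrow> extalg" is
  "\<lambda>K L. if L = K \<and> finite K then 1 else 0"
  by auto

lemma coef_mon: "finite K \<Longrightarrow> coef (mon K) L = (if L = K then 1 else 0)"
  by transfer simp

definition gen :: "coframe_elem \<Rightarrow> extalg" where
  "gen g = mon {g}"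

lemma coef_gen: "coef (gen g) = ext_gen g"
  by (rule ext) (simp add: gen_def coef_mon ext_gen_def)

lemma mon_empty [simp]: "mon {} = 1"
  by (rule extalg_eqI) (simp add: coef_mon coef_one ext_one_def)

lemma extalg_expand:
  assumes "finite S" "supp x \<subseteq> S"
  shows "x = (\<Sum>K\<in>S. cst (coef x K) * mon K)"
proof (rule extalg_eqI)
  fix L :: "coframe_elem set" assume "finite L"
  have "coef (\<Sum>K\<in>S. cst (coef x K) * mon K) L = (\<Sum>K\<in>S. if K = L then coef x L else 0)"
    unfolding coef_sum coef_cst_mult
    by (rule sum.cong) (use \<open>finite L\<close> coef_infinite in \<open>auto simp: coef_mon mon.rep_eq\<close>)
  also have "\<dots> = coef x L"
    using assms by (auto simp: supp_def sum.delta)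
  finally show "coef x L = coef (\<Sum>K\<in>S. cst (coef x K) * mon K) L" by simp
qed

lemma mon_mult:
  assumes "finite A" "finite B"
  shows "mon A * mon B = (if A \<inter> B = {} then cst (shuffle_sign A B) * mon (A \<union> B) else 0)"
proof (rule extalg_eqI)
  fix K :: "coframe_elem set" assume K: "finite K"
  have "coef (mon A * mon B) K =
      (\<Sum>C\<in>Pow K. if C = A then (if K - A = B then shuffle_sign A B else 0) else 0)"
    unfolding coef_mult wedge_def using assms
    by (intro sum.cong) (auto simp: coef_mon)
  also have "\<dots> = (if A \<subseteq> K \<and> K - A = B then shuffle_sign A B else 0)"
    using K by (simp add: sum.delta)
  finally show "coef (mon A * mon B) K =
      coef (if A \<inter> B = {} then cst (shuffle_sign A B) * mon (A \<union> B) else 0) K"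
    using assms by (auto simp: coef_mon)
qed

lemma gen_mult_mon:
  "finite B \<Longrightarrow> gen a * mon B = (if a \<in> B then 0 else cst (shuffle_sign {a} B) * mon (insert a B))"
  unfolding gen_def by (simp add: mon_mult)

definition parity_even :: "extalg \<Rightarrow> bool" where
  "parity_even x \<longleftrightarrow> (\<forall>K. coef x K \<noteq> 0 \<longrightarrow> even (card K))"

text \<open>Exchanging the block \<open>A\<close> with its complement costs the sign
  \<open>(-1) ^ (card A * card (K - A))\<close>, which is 1 wherever \<open>x\<close> has a nonzero
  coefficient. The squares of covectors below are central for this reason.\<close>

lemma parity_even_commute:
  assumes "parity_even x"
  shows "x * y = y * x"
proof (rule extalg_eqI)
  fix K :: "coframe_elem set" assume K: "finite K"
  have "coef (x * y) K = (\<Sum>A\<in>Pow K. shuffle_sign A (K - A) * coef x A * coef y (K - A))"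
    by (simp add: coef_mult wedge_def)
  also have "\<dots> = (\<Sum>A\<in>Pow K. shuffle_sign A (K - A) * coef y A * coef x (K - A))"
  proof (rule sum.reindex_bij_witness[where i = "\<lambda>A. K - A" and j = "\<lambda>A. K - A"])
    fix A assume A: "A \<in> Pow K"
    then have e: "K - (K - A) = A" by auto
    have f: "finite A" "finite (K - A)" using A K finite_subset[of A K] by auto
    show "shuffle_sign (K - A) (K - (K - A)) * coef y (K - A) * coef x (K - (K - A)) =
        shuffle_sign A (K - A) * coef x A * coef y (K - A)"
    proof (cases "coef x A = 0")
      case False
      then have "even (card A)" using assms by (auto simp: parity_even_def)
      then have "shuffle_sign A (K - A) = shuffle_sign (K - A) A"
        using shuffle_sign_swap[OF f] by simp
      then show ?thesis by (simp add: e)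
    qed (simp add: e)
  qed auto
  also have "\<dots> = coef (y * x) K"
    by (simp add: coef_mult wedge_def)
  finally show "coef (x * y) K = coef (y * x) K" .
qed

text \<open>Stated for raw coefficient functions, because the differential operators act on these;
  the version in the ring follows from it.\<close>

lemma wedge_has_degree_commute:
  assumes v: "has_degree r v" and w: "has_degree s w"
  shows "wedge v w K = (-1) ^ (r * s) * wedge w v K"
proof (cases "finite K")
  case K: True
  have "wedge v w K = (\<Sum>A\<in>Pow K. (-1) ^ (r * s) * (shuffle_sign A (K - A) * w A * v (K - A)))"
    unfolding wedge_def
  proof (rule sum.reindex_bij_witness[where i = "\<lambda>A. K - A" and j = "\<lambda>A. K - A"])
    fix A assume A: "A \<in> Pow K"
    then have e: "K - (K - A) = A" by auto
    have f: "finite A" "finite (K - A)" using A K finite_subset[of A K] by auto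
    show "(-1) ^ (r * s) * (shuffle_sign (K - A) (K - (K - A)) * w (K - A) * v (K - (K - A))) =
        shuffle_sign A (K - A) * v A * w (K - A)"
    proof (cases "v A = 0 \<or> w (K - A) = 0")
      case False
      then have "card A = r" "card (K - A) = s" using v w by (auto simp: has_degree_def)
      then have "shuffle_sign A (K - A) = (-1) ^ (r * s) * shuffle_sign (K - A) A"
        using shuffle_sign_swap[OF f] by auto
      then show ?thesis by (simp add: e)
    qed (auto simp: e)
  qed auto
  also have "\<dots> = (-1) ^ (r * s) * wedge w v K"
    by (simp add: wedge_def sum_distrib_left)
  finally show ?thesis .
qed (simp add: wedge_infinite)

lemma has_degree_commute:
  assumes "has_degree r (coef x)" "has_degree s (coef y)"
  shows "x * y = cst ((-1) ^ (r * s)) * (y * x)"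
  by (rule extalg_eqI) (simp add: coef_mult[of x y] coef_mult[of y x] wedge_has_degree_commute[OF assms])

lemma has_degree_1_mult:
  assumes "has_degree 1 (coef x)" "has_degree 1 (coef y)"
  shows "x * y = - (y * x)"
  using has_degree_commute[OF assms] by (simp add: cst_uminus)

lemma sorted_list_of_set_insert_min:
  assumes "finite (A :: 'a :: linorder set)" "\<And>b. b \<in> A \<Longrightarrow> a < b"
  shows "sorted_list_of_set (insert a A) = a # sorted_list_of_set A"
proof -
  have "A - {a} = A" using assms(2) by auto
  then show ?thesis
    using assms by (simp add: insort_is_Cons less_imp_le)
qed

text \<open>The universal property of the exterior algebra: pairwise anticommuting images of the
  generators extend to a ring homomorphism. The conjugation of generators, the pullback and the two
  halves of the pullback are instances.\<close>

locale odd_map =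
  fixes g :: "coframe_elem \<Rightarrow> extalg"
  assumes anticommute: "g a * g b = - (g b * g a)"
begin

definition mon_image :: "coframe_elem set \<Rightarrow> extalg" where
  "mon_image K = prod_list (map g (sorted_list_of_set K))"

definition hom :: "extalg \<Rightarrow> extalg" where
  "hom x = (\<Sum>K\<in>supp x. cst (coef x K) * mon_image K)"

lemma square: "g a * g a = 0"
  using anticommute eq_neg_self_extalg by blast

lemma mon_image_empty [simp]: "mon_image {} = 1"
  by (simp add: mon_image_def)

lemma mon_image_insert_min:
  "finite A \<Longrightarrow> (\<And>b. b \<in> A \<Longrightarrow> a < b) \<Longrightarrow> mon_image (insert a A) = g a * mon_image A"
  unfolding mon_image_def by (subst sorted_list_of_set_insert_min) auto

text \<open>One pass of insertion sort: each exchange with a smaller factor contributes -1, which is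
  exactly an inversion counted by \<open>shuffle_sign\<close>. A repeated factor meets its twin and
  gives zero by \<open>square\<close>.\<close>

lemma g_mult_mon_image:
  assumes "finite B"
  shows "g a * mon_image B = (if a \<in> B then 0 else cst (shuffle_sign {a} B) * mon_image (insert a B))"
  using assms
proof (induction B rule: finite_linorder_min_induct)
  case empty
  show ?case by (simp add: mon_image_def)
next
  case (insert b B)
  have ib: "mon_image (insert b B) = g b * mon_image B"
    using insert by (intro mon_image_insert_min) auto
  consider "a = b" | "a < b" | "b < a" by fastforce
  then show ?case
  proof cases
    case 1
    then show ?thesis by (simp add: ib mult.assoc[symmetric] square)
  next
    case 2
    then have n: "a \<notin> insert b B" and lt: "\<And>c. c \<in> insert b B \<Longrightarrow> a < c" using insert by force+
    have "shuffle_sign {a} (insert b B) = 1"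
      using lt by (intro shuffle_sign_ordered) (auto simp: less_imp_le)
    moreover have "mon_image (insert a (insert b B)) = g a * mon_image (insert b B)"
      using lt insert by (intro mon_image_insert_min) auto
    ultimately show ?thesis using n by simp
  next
    case 3
    have "g a * mon_image (insert b B) = - (g b * (g a * mon_image B))"
      using anticommute[of a b] by (simp add: ib flip: mult.assoc)
    also have "\<dots> = (if a \<in> insert b B then 0
        else cst (shuffle_sign {a} (insert b B)) * mon_image (insert a (insert b B)))"
    proof (cases "a \<in> B")
      case True
      then show ?thesis using insert by simp
    next
      case False
      have "shuffle_sign {a} ({b} \<union> B) = shuffle_sign {a} {b} * shuffle_sign {a} B"
        using insert by (intro shuffle_sign_Un_right) auto
      moreover have "shuffle_sign {a} {b} = - 1"
        using 3 by (subst shuffle_sign_reversed) auto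
      moreover have "mon_image (insert b (insert a B)) = g b * mon_image (insert a B)"
        using insert 3 by (intro mon_image_insert_min) auto
      ultimately show ?thesis
        using False 3 insert by (auto simp: insert_commute cst_left_commute cst_uminus)
    qed
    finally show ?thesis .
  qed
qed

lemma mon_image_mult:
  assumes "finite A" "finite B"
  shows "mon_image A * mon_image B =
    (if A \<inter> B = {} then cst (shuffle_sign A B) * mon_image (A \<union> B) else 0)"
  using assms(1)
proof (induction A rule: finite_linorder_min_induct)
  case empty
  show ?case by simp
next
  case (insert a A)
  have ia: "mon_image (insert a A) = g a * mon_image A"
    using insert by (intro mon_image_insert_min) auto
  show ?case
  proof (cases "A \<inter> B = {}")
    case False
    then show ?thesis using insert by (auto simp: ia mult.assoc)
  next
    case True
    have na: "a \<notin> A" using insert by auto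
    have "shuffle_sign ({a} \<union> A) B = shuffle_sign {a} B * shuffle_sign A B"
      using insert assms na by (intro shuffle_sign_Un_left) auto
    moreover have "shuffle_sign {a} (A \<union> B) = shuffle_sign {a} A * shuffle_sign {a} B"
      using insert assms True by (intro shuffle_sign_Un_right) auto
    moreover have "shuffle_sign {a} A = 1"
      using insert by (intro shuffle_sign_ordered) (auto simp: less_imp_le)
    ultimately have sg: "shuffle_sign (insert a A) B = shuffle_sign A B * shuffle_sign {a} (A \<union> B)"
      by simp
    have "mon_image (insert a A) * mon_image B = cst (shuffle_sign A B) * (g a * mon_image (A \<union> B))"
      using insert.IH True by (simp add: ia mult.assoc cst_left_commute)
    also have "\<dots> = (if insert a A \<inter> B = {}
        then cst (shuffle_sign (insert a A) B) * mon_image (insert a A \<union> B) else 0)"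
      using insert(1) assms na True by (auto simp: g_mult_mon_image sg cst_mult mult.assoc)
    finally show ?thesis .
  qed
qed

lemma hom_superset:
  assumes "finite S" "supp x \<subseteq> S"
  shows "hom x = (\<Sum>K\<in>S. cst (coef x K) * mon_image K)"
  unfolding hom_def using assms
  by (intro sum.mono_neutral_left) (auto simp: supp_def)

lemma hom_add: "hom (x + y) = hom x + hom y"
proof -
  have "supp (x + y) \<subseteq> supp x \<union> supp y" by (auto simp: supp_def)
  then have "hom (x + y) = (\<Sum>K\<in>supp x \<union> supp y. cst (coef (x + y) K) * mon_image K)"
    by (intro hom_superset) auto
  also have "\<dots> = hom x + hom y"
    by (simp add: hom_superset[of "supp x \<union> supp y" x] hom_superset[of "supp x \<union> supp y" y]
        cst_add distrib_right sum.distrib)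
  finally show ?thesis .
qed

lemma hom_cst_mult: "hom (cst c * x) = cst c * hom x"
proof -
  have "supp (cst c * x) \<subseteq> supp x" by (auto simp: supp_def)
  then show ?thesis
    by (simp add: hom_superset[of "supp x"] sum_distrib_left cst_mult mult.assoc)
qed

lemma hom_0 [simp]: "hom 0 = 0"
  by (simp add: hom_def supp_def)

lemma hom_sum: "hom (sum f A) = (\<Sum>a\<in>A. hom (f a))"
  by (induction A rule: infinite_finite_induct) (auto simp: hom_add)

lemma hom_mon: "finite K \<Longrightarrow> hom (mon K) = mon_image K"
  by (subst hom_superset[of "{K}"]) (auto simp: supp_def coef_mon split: if_splits)

lemma hom_1 [simp]: "hom 1 = 1"
  using hom_mon[of "{}"] by simp

lemma hom_cst [simp]: "hom (cst c) = cst c"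
  using hom_cst_mult[of c 1] by simp

lemma hom_gen [simp]: "hom (gen a) = g a"
  by (simp add: gen_def hom_mon mon_image_def)

lemma hom_mult: "hom (x * y) = hom x * hom y"
proof -
  have "x * y = (\<Sum>A\<in>supp x. \<Sum>B\<in>supp y. cst (coef x A * coef y B) * (mon A * mon B))"
    unfolding cst_linear_combination_mult[symmetric]
    using extalg_expand[OF finite_supp order_refl] by metis
  then have "hom (x * y) = (\<Sum>A\<in>supp x. \<Sum>B\<in>supp y. cst (coef x A * coef y B) * hom (mon A * mon B))"
    by (simp add: hom_sum hom_cst_mult)
  also have "\<dots> = (\<Sum>A\<in>supp x. \<Sum>B\<in>supp y. cst (coef x A * coef y B) * (mon_image A * mon_image B))"
  proof (intro sum.cong refl arg_cong2[where f = "(*)"])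
    fix A B assume "A \<in> supp x" "B \<in> supp y"
    then have "finite A" "finite B" using coef_nonzero_finite by (auto simp: supp_def)
    then show "hom (mon A * mon B) = mon_image A * mon_image B"
      by (simp add: mon_mult mon_image_mult hom_cst_mult hom_mon)
  qed
  also have "\<dots> = hom x * hom y"
    unfolding hom_def cst_linear_combination_mult ..
  finally show ?thesis .
qed

end

text \<open>Bidegrees such as (1,0) have to keep the numeral 1 in order to match the rules
  below.\<close>

declare One_nat_def [simp del]

section \<open>Support, degree and conjugation\<close>

text \<open>Arbitrary sets of generators are allowed, not only the full coframe of some dimension,
  because the coordinates of a product will be added one after the other.\<close>

definition supported :: "coframe_elem set \<Rightarrow> extalg \<Rightarrow> bool" where
  "supported S x \<longleftrightarrow> (\<forall>K. coef x K \<noteq> 0 \<longrightarrow> K \<subseteq> S)"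

abbreviation bideg :: "nat \<Rightarrow> nat \<Rightarrow> extalg \<Rightarrow> bool" where
  "bideg p q x \<equiv> has_bidegree p q (coef x)"

lemma coef_mult_nonzeroE:
  assumes "coef (x * y) K \<noteq> 0"
  obtains A where "A \<subseteq> K" "coef x A \<noteq> 0" "coef y (K - A) \<noteq> 0" "finite K"
  using assms unfolding coef_mult by (rule wedge_nonzeroE)

lemma supported_mult: "supported S x \<Longrightarrow> supported S y \<Longrightarrow> supported S (x * y)"
  unfolding supported_def by (blast elim: coef_mult_nonzeroE)

lemma supported_mono: "supported S x \<Longrightarrow> S \<subseteq> T \<Longrightarrow> supported T x"
  unfolding supported_def by blast

lemma supported_0 [simp]: "supported S 0" and supported_1 [simp]: "supported S 1"
  by (simp_all add: supported_def coef_one ext_one_def)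

lemma supported_add: "supported S x \<Longrightarrow> supported S y \<Longrightarrow> supported S (x + y)"
  unfolding supported_def by (metis add.right_neutral coef_simps(2))

lemma supported_cst_mult: "supported S x \<Longrightarrow> supported S (cst c * x)"
  unfolding supported_def by auto

lemma supported_gen: "g \<in> S \<Longrightarrow> supported S (gen g)"
  by (simp add: supported_def coef_gen ext_gen_def)

lemma supported_sum: "(\<And>i. i \<in> A \<Longrightarrow> supported S (f i)) \<Longrightarrow> supported S (sum f A)"
  by (induction A rule: infinite_finite_induct) (auto intro: supported_add)

lemma supported_prod_list: "(\<And>x. x \<in> set xs \<Longrightarrow> supported S x) \<Longrightarrow> supported S (prod_list xs)"
  by (induction xs) (auto intro: supported_mult)

lemma supported_power: "supported S x \<Longrightarrow> supported S (x ^ k)"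
  by (induction k) (auto intro: supported_mult)

section \<open>Bidegrees\<close>

lemma finite_Dz_part: "finite K \<Longrightarrow> finite {i. Dz i \<in> K}"
  and finite_Dzbar_part: "finite K \<Longrightarrow> finite {i. Dzbar i \<in> K}"
  using finite_vimageI[of K Dz] finite_vimageI[of K Dzbar]
  by (simp_all add: vimage_def inj_def)

lemma coframe_set_split: "K = Dz ` {i. Dz i \<in> K} \<union> Dzbar ` {i. Dzbar i \<in> K}"
proof (intro set_eqI iffI)
  fix g assume "g \<in> K"
  then show "g \<in> Dz ` {i. Dz i \<in> K} \<union> Dzbar ` {i. Dzbar i \<in> K}"
    by (cases g) auto
qed auto

lemma hol_degree_split:
  assumes "finite K" "A \<subseteq> K"
  shows "hol_degree K = hol_degree A + hol_degree (K - A)"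
proof -
  have "{i. Dz i \<in> K} = {i. Dz i \<in> A} \<union> {i. Dz i \<in> K - A}" using assms by auto
  then show ?thesis
    unfolding hol_degree_def using assms finite_subset[OF assms(2,1)]
    by (simp only:) (rule card_Un_disjoint, auto intro!: finite_Dz_part)
qed

lemma antihol_degree_split:
  assumes "finite K" "A \<subseteq> K"
  shows "antihol_degree K = antihol_degree A + antihol_degree (K - A)"
proof -
  have "{i. Dzbar i \<in> K} = {i. Dzbar i \<in> A} \<union> {i. Dzbar i \<in> K - A}" using assms by auto
  then show ?thesis
    unfolding antihol_degree_def using assms finite_subset[OF assms(2,1)]
    by (simp only:) (rule card_Un_disjoint, auto intro!: finite_Dzbar_part)
qed

lemma card_eq_bidegree:
  assumes "finite K"
  shows "card K = hol_degree K + antihol_degree K"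
proof -
  have "card (Dz ` {i. Dz i \<in> K} \<union> Dzbar ` {i. Dzbar i \<in> K}) =
      card (Dz ` {i. Dz i \<in> K}) + card (Dzbar ` {i. Dzbar i \<in> K})"
    using finite_Dz_part[OF assms] finite_Dzbar_part[OF assms] by (intro card_Un_disjoint) auto
  then show ?thesis
    using coframe_set_split[of K]
    by (simp add: hol_degree_def antihol_degree_def card_image inj_on_def)
qed

lemma bideg_mult: "bideg p q x \<Longrightarrow> bideg r s y \<Longrightarrow> bideg (p + r) (q + s) (x * y)"
  unfolding has_bidegree_def
  by (metis antihol_degree_split coef_mult_nonzeroE hol_degree_split)

lemma bideg_0 [simp]: "bideg p q 0"
  by (simp add: has_bidegree_def)

lemma bideg_1 [simp]: "bideg 0 0 1"
  by (simp add: has_bidegree_def coef_one ext_one_def hol_degree_def antihol_degree_def)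

lemma bideg_add: "bideg p q x \<Longrightarrow> bideg p q y \<Longrightarrow> bideg p q (x + y)"
  unfolding has_bidegree_def by (metis add.right_neutral coef_simps(2))

lemma bideg_cst_mult: "bideg p q x \<Longrightarrow> bideg p q (cst c * x)"
  unfolding has_bidegree_def by auto

lemma bideg_sum: "(\<And>i. i \<in> A \<Longrightarrow> bideg p q (f i)) \<Longrightarrow> bideg p q (sum f A)"
  by (induction A rule: infinite_finite_induct) (auto intro: bideg_add)

lemma bideg_gen_Dz: "bideg 1 0 (gen (Dz i))" and bideg_gen_Dzbar: "bideg 0 1 (gen (Dzbar i))"
  by (simp_all add: has_bidegree_def coef_gen ext_gen_def hol_degree_def antihol_degree_def)

lemma bideg_power: "bideg p q x \<Longrightarrow> bideg (k * p) (k * q) (x ^ k)"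
  by (induction k) (auto dest: bideg_mult)

lemma bideg_prod_list:
  "(\<And>x. x \<in> set xs \<Longrightarrow> bideg p q x) \<Longrightarrow> bideg (length xs * p) (length xs * q) (prod_list xs)"
  by (induction xs) (auto dest: bideg_mult)

lemma bideg_degree: "bideg p q x \<Longrightarrow> has_degree (p + q) (coef x)"
  unfolding has_bidegree_def has_degree_def using card_eq_bidegree coef_nonzero_finite by metis

lemma bideg_even: "bideg p p x \<Longrightarrow> parity_even x"
  using bideg_degree[of p p x] by (auto simp: has_degree_def parity_even_def)

lemma bideg_1_0_anticommute: "bideg 1 0 x \<Longrightarrow> bideg 1 0 y \<Longrightarrow> x * y = - (y * x)"
  and bideg_0_1_anticommute: "bideg 0 1 x \<Longrightarrow> bideg 0 1 y \<Longrightarrow> x * y = - (y * x)"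
  and bideg_1_0_0_1_anticommute: "bideg 1 0 x \<Longrightarrow> bideg 0 1 y \<Longrightarrow> x * y = - (y * x)"
  using has_degree_1_mult bideg_degree by fastforce+

lemma bideg_1_0_square: "bideg 1 0 x \<Longrightarrow> x * x = 0"
  and bideg_0_1_square: "bideg 0 1 x \<Longrightarrow> x * x = 0"
  using bideg_1_0_anticommute bideg_0_1_anticommute eq_neg_self_extalg by blast+

lemma has_degree_gen: "has_degree 1 (coef (gen g))"
  by (simp add: has_degree_def coef_gen ext_gen_def)

lemma gen_anticommute: "gen a * gen b = - (gen b * gen a)"
  using has_degree_1_mult has_degree_gen by blast

text \<open>Coefficientwise conjugation; it does not exchange the two halves of the coframe.\<close>

lift_definition coef_cnj :: "extalg \<Rightarrow> extalg" is "\<lambda>w K. cnj (w K)"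
  by simp

lemma coef_coef_cnj [simp]: "coef (coef_cnj x) K = cnj (coef x K)"
  by transfer simp

lemma coef_cnj_add: "coef_cnj (x + y) = coef_cnj x + coef_cnj y"
  and coef_cnj_cst: "coef_cnj (cst c) = cst (cnj c)"
  and coef_cnj_0 [simp]: "coef_cnj 0 = 0"
  and coef_cnj_1 [simp]: "coef_cnj 1 = 1"
  and coef_cnj_gen [simp]: "coef_cnj (gen g) = gen g"
  by (rule extalg_eqI; simp add: coef_cst coef_one ext_one_def coef_gen ext_gen_def)+

lemma coef_cnj_mult: "coef_cnj (x * y) = coef_cnj x * coef_cnj y"
  by (rule extalg_eqI) (simp add: coef_mult wedge_def)

lemma coef_cnj_sum: "coef_cnj (sum f A) = (\<Sum>a\<in>A. coef_cnj (f a))"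
  by (induction A rule: infinite_finite_induct) (auto simp: coef_cnj_add)

lemma coef_cnj_power: "coef_cnj (x ^ k) = coef_cnj x ^ k"
  by (induction k) (auto simp: coef_cnj_mult)

interpretation bar: odd_map "\<lambda>a. gen (bar a)"
  by standard (rule gen_anticommute)

text \<open>Built from two ring homomorphisms, so that multiplicativity is immediate;
  \<open>coef_conj\<close> identifies it with \<open>ext_cnj\<close>, whose sign comes out of
  sorting the conjugated monomials.\<close>

definition econj :: "extalg \<Rightarrow> extalg" where
  "econj x = bar.hom (coef_cnj x)"

lemma conj_add: "econj (x + y) = econj x + econj y"
  and conj_mult: "econj (x * y) = econj x * econj y"
  and conj_cst [simp]: "econj (cst c) = cst (cnj c)"
  and conj_gen [simp]: "econj (gen g) = gen (bar g)"
  and conj_0 [simp]: "econj 0 = 0"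
  and conj_1 [simp]: "econj 1 = 1"
  by (simp_all add: econj_def coef_cnj_add coef_cnj_mult coef_cnj_cst bar.hom_add bar.hom_mult)

lemma conj_sum: "econj (sum f A) = (\<Sum>a\<in>A. econj (f a))"
  by (induction A rule: infinite_finite_induct) (auto simp: conj_add)

lemma conj_power: "econj (x ^ k) = econj x ^ k"
  by (induction k) (auto simp: conj_mult)

lemma conj_prod_list: "econj (prod_list xs) = prod_list (map econj xs)"
  by (induction xs) (auto simp: conj_mult)

lemma prod_list_gen_sorted:
  "sorted_wrt (<) xs \<Longrightarrow> prod_list (map gen xs) = mon (set xs)"
proof (induction xs)
  case (Cons a xs)
  have "shuffle_sign {a} (set xs) = 1"
    using Cons.prems by (intro shuffle_sign_ordered) (auto simp: less_imp_le)
  then show ?case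
    using Cons by (auto simp: gen_mult_mon)
qed simp

lemma Dz_less [simp]: "Dz i < Dz j \<longleftrightarrow> i < j" "Dzbar i < Dzbar j \<longleftrightarrow> i < j" "Dz i < Dzbar j"
  by (auto simp: less_coframe_elem_def less_eq_coframe_elem_def)

lemma sorted_list_of_set_image_mono:
  fixes h :: "nat \<Rightarrow> coframe_elem"
  assumes "finite I" "\<And>i j. h i < h j \<longleftrightarrow> i < j"
  shows "sorted_list_of_set (h ` I) = map h (sorted_list_of_set I)"
  using assms(1)
proof (induction I rule: finite_linorder_min_induct)
  case (insert a A)
  have "sorted_list_of_set (insert (h a) (h ` A)) = h a # sorted_list_of_set (h ` A)"
    using insert assms(2) by (intro sorted_list_of_set_insert_min) auto
  moreover have "sorted_list_of_set (insert a A) = a # sorted_list_of_set A"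
    using insert by (intro sorted_list_of_set_insert_min) auto
  ultimately show ?case using insert by (simp only: image_insert list.map)
qed simp

lemma bar_mon_image:
  assumes "finite K"
  shows "bar.mon_image K = cst ((-1) ^ (hol_degree K * antihol_degree K)) * mon (bar ` K)"
proof -
  define I J where "I = {i. Dz i \<in> K}" and "J = {i. Dzbar i \<in> K}"
  have fin: "finite I" "finite J"
    using assms by (auto simp: I_def J_def finite_Dz_part finite_Dzbar_part)
  have K: "K = Dz ` I \<union> Dzbar ` J" unfolding I_def J_def by (rule coframe_set_split)
  have "bar.mon_image (Dz ` I) = prod_list (map gen (map Dzbar (sorted_list_of_set I)))"
    using fin by (simp add: bar.mon_image_def sorted_list_of_set_image_mono o_def)
  also have "\<dots> = mon (Dzbar ` I)"
    using fin by (subst prod_list_gen_sorted) (auto simp: sorted_wrt_map)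
  finally have 1: "bar.mon_image (Dz ` I) = mon (Dzbar ` I)" .
  have "bar.mon_image (Dzbar ` J) = prod_list (map gen (map Dz (sorted_list_of_set J)))"
    using fin by (simp add: bar.mon_image_def sorted_list_of_set_image_mono o_def)
  also have "\<dots> = mon (Dz ` J)"
    using fin by (subst prod_list_gen_sorted) (auto simp: sorted_wrt_map)
  finally have 2: "bar.mon_image (Dzbar ` J) = mon (Dz ` J)" .
  have s: "shuffle_sign (Dz ` I) (Dzbar ` J) = 1"
    by (rule shuffle_sign_ordered) (auto simp: less_imp_le)
  have dj: "Dz ` I \<inter> Dzbar ` J = {}" "Dzbar ` I \<inter> Dz ` J = {}" by auto
  have "bar.mon_image K = bar.mon_image (Dz ` I) * bar.mon_image (Dzbar ` J)"
    using bar.mon_image_mult[of "Dz ` I" "Dzbar ` J"] fin by (simp add: K s dj)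
  also have "\<dots> = cst (shuffle_sign (Dzbar ` I) (Dz ` J)) * mon (Dzbar ` I \<union> Dz ` J)"
    using fin by (simp add: 1 2 mon_mult dj)
  also have "shuffle_sign (Dzbar ` I) (Dz ` J) = (-1) ^ (card I * card J)"
    by (subst shuffle_sign_reversed) (auto simp: card_image inj_on_def)
  also have "Dzbar ` I \<union> Dz ` J = bar ` K"
    by (simp add: K image_Un image_image)
  also have "card I * card J = hol_degree K * antihol_degree K"
    by (simp add: hol_degree_def antihol_degree_def I_def J_def)
  finally show ?thesis .
qed

lemma bar_bar [simp]: "bar (bar g) = g"
  by (cases g) auto

lemma bar_image_image [simp]: "bar ` bar ` K = K"
  by (simp add: image_image)

lemma bar_Dz_iff: "Dz i \<in> bar ` K \<longleftrightarrow> Dzbar i \<in> K" "Dzbar i \<in> bar ` K \<longleftrightarrow> Dz i \<in> K"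
  by (metis bar.simps bar_bar image_iff)+

lemma hol_degree_bar [simp]: "hol_degree (bar ` K) = antihol_degree K"
  and antihol_degree_bar [simp]: "antihol_degree (bar ` K) = hol_degree K"
  by (simp_all add: hol_degree_def antihol_degree_def bar_Dz_iff)

lemma coef_conj: "coef (econj x) = ext_cnj (coef x)"
proof
  fix L
  have s: "supp (coef_cnj x) = supp x" by (auto simp: supp_def)
  show "coef (econj x) L = ext_cnj (coef x) L"
  proof (cases "finite L")
    case False
    then have "infinite (bar ` L)"
      by (metis bar_image_image finite_imageI)
    then show ?thesis using False by (simp add: coef_infinite ext_cnj_def)
  next
    case True
    have "coef (econj x) L = (\<Sum>K\<in>supp x. cnj (coef x K) * coef (bar.mon_image K) L)"
      by (simp add: econj_def bar.hom_def s)
    also have "\<dots> = (\<Sum>K\<in>supp x. if K = bar ` L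
        then (-1) ^ (hol_degree L * antihol_degree L) * cnj (coef x (bar ` L)) else 0)"
    proof (rule sum.cong)
      fix K assume "K \<in> supp x"
      then have "finite K" using coef_nonzero_finite by (auto simp: supp_def)
      moreover have "L = bar ` K \<longleftrightarrow> K = bar ` L" by (metis bar_image_image)
      ultimately show "cnj (coef x K) * coef (bar.mon_image K) L = (if K = bar ` L
        then (-1) ^ (hol_degree L * antihol_degree L) * cnj (coef x (bar ` L)) else 0)"
        by (auto simp: bar_mon_image coef_mon mult.commute)
    qed simp
    also have "\<dots> = ext_cnj (coef x) L"
      by (simp add: sum.delta) (auto simp: supp_def ext_cnj_def)
    finally show ?thesis .
  qed
qed

lemma conj_conj [simp]: "econj (econj x) = x"
proof (rule extalg_eqI)
  fix K
  let ?s = "(-1::complex) ^ (hol_degree K * antihol_degree K)"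
  have "?s * ?s = 1" by (simp flip: power_mult_distrib)
  then have "?s * (?s * coef x K) = coef x K" by (simp flip: mult.assoc)
  then show "coef (econj (econj x)) K = coef x K"
    by (simp add: coef_conj ext_cnj_def mult.commute[of "antihol_degree K"])
qed

lemma bideg_conj: "bideg p q x \<Longrightarrow> bideg q p (econj x)"
  unfolding has_bidegree_def coef_conj ext_cnj_def
  by (metis antihol_degree_bar complex_cnj_zero hol_degree_bar mult_zero_right)

lemma supported_conj:
  assumes "supported S x" "bar ` S = S"
  shows "supported S (econj x)"
  unfolding supported_def coef_conj ext_cnj_def
proof (intro allI impI)
  fix K assume "(- 1) ^ (hol_degree K * antihol_degree K) * cnj (coef x (bar ` K)) \<noteq> 0"
  then have "bar ` K \<subseteq> S" using assms(1) by (auto simp: supported_def)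
  then have "bar ` bar ` K \<subseteq> bar ` S" by (rule image_mono)
  then show "K \<subseteq> S" using assms(2) by simp
qed

section \<open>Elementary positive forms\<close>

text \<open>The lower end varies while \<open>N\<close> stays fixed: coordinates are split off at
  the front, and everything not involving the first of them lives over \<open>Suc a\<close>.\<close>

definition coframe_range :: "nat \<Rightarrow> nat \<Rightarrow> coframe_elem set" where
  "coframe_range a N = Dz ` {a..<N} \<union> Dzbar ` {a..<N}"

lemma coframe_range_0: "coframe_range 0 n = coframe n"
  by (simp add: coframe_range_def coframe_def atLeast0LessThan)

lemma bar_coframe_range [simp]: "bar ` coframe_range a N = coframe_range a N"
  by (auto simp: coframe_range_def image_Un image_image)

lemma finite_coframe_range [simp]: "finite (coframe_range a N)"
  by (simp add: coframe_range_def)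

lemma Dz_in_coframe_range [simp]:
  "Dz i \<in> coframe_range a N \<longleftrightarrow> a \<le> i \<and> i < N" "Dzbar i \<in> coframe_range a N \<longleftrightarrow> a \<le> i \<and> i < N"
  by (auto simp: coframe_range_def)

lemma coframe_range_mono: "a \<le> b \<Longrightarrow> N \<le> M \<Longrightarrow> coframe_range b N \<subseteq> coframe_range a M"
  by (auto simp: coframe_range_def)

definition cov :: "nat \<Rightarrow> nat \<Rightarrow> (nat \<Rightarrow> complex) \<Rightarrow> extalg" where
  "cov a N \<psi> = (\<Sum>i\<in>{a..<N}. cst (\<psi> i) * gen (Dz i))"

lemma coef_cov: "coef (cov 0 n \<psi>) = covector n \<psi>"
  by (rule ext) (simp add: cov_def covector_def coef_gen atLeast0LessThan)

lemma bideg_cov: "bideg 1 0 (cov a N \<psi>)"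
  unfolding cov_def by (intro bideg_sum bideg_cst_mult bideg_gen_Dz)

lemma supported_cov: "supported (coframe_range a N) (cov a N \<psi>)"
  unfolding cov_def by (intro supported_sum supported_cst_mult supported_gen) simp

lemma cov_add: "cov a N (\<lambda>i. \<phi> i + \<psi> i) = cov a N \<phi> + cov a N \<psi>"
  by (simp add: cov_def cst_add distrib_right sum.distrib)

lemma cov_scale: "cov a N (\<lambda>i. c * \<psi> i) = cst c * cov a N \<psi>"
  by (simp add: cov_def sum_distrib_left cst_mult mult.assoc)

lemma cov_split:
  assumes "a < N"
  shows "cov a N \<psi> = cst (\<psi> a) * gen (Dz a) + cov (Suc a) N \<psi>"
  unfolding cov_def using assms by (simp add: sum.atLeast_Suc_lessThan)

definition sq :: "extalg \<Rightarrow> extalg" where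
  "sq x = cst (\<i> / 2) * (x * econj x)"

lemma bideg_sq: "bideg 1 0 x \<Longrightarrow> bideg 1 1 (sq x)"
  unfolding sq_def using bideg_cst_mult bideg_mult[of 1 0 x 0 1 "econj x"] bideg_conj by fastforce

lemma sq_commute: "bideg 1 0 x \<Longrightarrow> sq x * y = y * sq x"
  using bideg_sq bideg_even parity_even_commute by blast

lemma supported_sq: "supported (coframe_range a N) x \<Longrightarrow> supported (coframe_range a N) (sq x)"
  unfolding sq_def by (simp add: supported_cst_mult supported_mult supported_conj)

lemma sq_scale: "sq (cst c * x) = cst ((cmod c)\<^sup>2) * sq x"
proof -
  have "sq (cst c * x) = cst (\<i> / 2) * (cst c * x * (cst (cnj c) * econj x))"
    by (simp add: sq_def conj_mult)
  also have "\<dots> = cst (\<i> / 2 * (c * cnj c)) * (x * econj x)"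
    by (simp only: cst_mult_cst_mult cst_mult_left)
  also have "\<dots> = cst ((cmod c)\<^sup>2) * sq x"
    by (simp add: sq_def cst_mult_left mult.commute complex_norm_square[symmetric])
  finally show ?thesis .
qed

lemma conj_sq: "bideg 1 0 x \<Longrightarrow> econj (sq x) = sq x"
proof -
  assume x: "bideg 1 0 x"
  have "econj (sq x) = cst (- (\<i> / 2)) * (econj x * x)"
    by (simp add: sq_def conj_mult)
  also have "econj x * x = - (x * econj x)"
    using bideg_1_0_0_1_anticommute[OF x, of "econj x"] bideg_conj[OF x] by simp
  finally show ?thesis by (simp add: sq_def cst_uminus)
qed

lemma sq_mult_self_left: "bideg 1 0 x \<Longrightarrow> sq x * x = 0"
  and sq_mult_conj_self_left: "bideg 1 0 x \<Longrightarrow> sq x * econj x = 0"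
proof -
  assume x: "bideg 1 0 x"
  have "econj x * x = - (x * econj x)"
    using bideg_1_0_0_1_anticommute[OF x, of "econj x"] bideg_conj[OF x] by simp
  then have "x * econj x * x = - (x * (x * econj x))"
    by (simp add: mult.assoc)
  then show "sq x * x = 0"
    using bideg_1_0_square[OF x] by (simp add: sq_def mult.assoc flip: mult.assoc[of x x])
  show "sq x * econj x = 0"
    using bideg_0_1_square[OF bideg_conj[OF x]] by (simp add: sq_def mult.assoc)
qed

text \<open>Multiplication by \<open>sq x\<close> annihilates \<open>x\<close> and its conjugate, so
  the other factors matter only modulo \<open>x\<close>. This is the algebraic form of a row
  operation.\<close>

lemma sq_mult_sq_add:
  assumes "bideg 1 0 x" "bideg 1 0 y"
  shows "sq x * sq (y + cst c * x) = sq x * sq y"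
proof -
  have "sq x * (y + cst c * x) = sq x * y"
    by (simp add: distrib_left cst_left_commute sq_mult_self_left assms)
  moreover have "sq x * econj (y + cst c * x) = sq x * econj y"
    by (simp add: distrib_left conj_add conj_mult cst_left_commute sq_mult_conj_self_left assms)
  ultimately have "sq x * ((y + cst c * x) * econj (y + cst c * x)) = sq x * (y * econj y)"
    by (metis assms(1) mult.assoc sq_commute)
  then show ?thesis
    unfolding sq_def[of y] sq_def[of "y + cst c * x"] by (simp add: cst_left_commute)
qed

lemma sq_mult_sq_self:
  assumes "bideg 1 0 x"
  shows "sq x * sq x = 0"
proof -
  have "sq x * (cst (\<i> / 2) * (x * econj x)) = cst (\<i> / 2) * (sq x * x * econj x)"
    by (simp only: cst_left_commute mult.assoc)
  then show ?thesis
    using sq_mult_self_left[OF assms] by (simp add: sq_def[symmetric])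
qed

lemma bideg_prod_list_sq:
  assumes "\<And>b. b \<in> set bs \<Longrightarrow> bideg 1 0 (x b)"
  shows "bideg (length bs) (length bs) (prod_list (map (\<lambda>b. sq (x b)) bs))"
proof -
  have "bideg (length (map (\<lambda>b. sq (x b)) bs) * 1) (length (map (\<lambda>b. sq (x b)) bs) * 1)
      (prod_list (map (\<lambda>b. sq (x b)) bs))"
    by (rule bideg_prod_list) (use assms in \<open>auto intro: bideg_sq\<close>)
  then show ?thesis by simp
qed

text \<open>The factors sigma_k absorb the signs from sorting the conjugate pairs.\<close>

lemma sigma_eta_conj_eta:
  assumes "\<And>b. b \<in> set bs \<Longrightarrow> bideg 1 0 (x b)"
  shows "cst (sigma (length bs)) * (prod_list (map x bs) * econj (prod_list (map x bs))) =
    prod_list (map (\<lambda>b. sq (x b)) bs)"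
  using assms
proof (induction bs rule: rev_induct)
  case Nil
  show ?case by (simp add: sigma_def)
next
  case (snoc b bs)
  define \<eta> where "\<eta> = prod_list (map x bs)"
  define k where "k = length bs"
  have \<eta>: "bideg 0 k (econj \<eta>)"
    unfolding \<eta>_def k_def using snoc.prems bideg_prod_list[of "map x bs" 1 0]
    by (intro bideg_conj) auto
  have xb: "bideg 1 0 (x b)" using snoc.prems by simp
  have "x b * econj \<eta> = cst ((-1) ^ k) * (econj \<eta> * x b)"
    using has_degree_commute[of 1 "x b" k "econj \<eta>"] bideg_degree[OF \<eta>] bideg_degree[OF xb] by simp
  then have "\<eta> * x b * econj (\<eta> * x b) = cst ((-1) ^ k) * (\<eta> * econj \<eta>) * (x b * econj (x b))"
    by (metis conj_mult cst_left_commute mult.assoc)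
  \<comment> \<open>Consecutive squares differ by 2k + 1, so \<open>sigma\<close> gains
    \<open>(-1) ^ k\<close> times i/2: the sign undoes moving the new covector past the
    \<open>k\<close> conjugates, and i/2 is the constant in \<open>sq\<close>.\<close>
  moreover have "(Suc k)\<^sup>2 = k\<^sup>2 + 2 * k + 1" by (simp add: power2_eq_square algebra_simps)
  then have "sigma (Suc k) = (-1) ^ k * sigma k * (\<i> / 2)"
    by (simp only: sigma_def power_add power_mult) (simp add: mult.commute)
  ultimately have "cst (sigma (Suc k)) * (\<eta> * x b * econj (\<eta> * x b)) =
      cst ((-1) ^ k * sigma k * (\<i> / 2) * (-1) ^ k) * ((\<eta> * econj \<eta>) * (x b * econj (x b)))"
    by (simp only: cst_mult mult.assoc)
  also have "(-1) ^ k * sigma k * (\<i> / 2) * (-1) ^ k = sigma k * (\<i> / 2)"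
  proof -
    have "(-1) ^ k * sigma k * (\<i> / 2) * (-1) ^ k = ((-1) ^ k * (-1) ^ k) * (sigma k * (\<i> / 2))"
      by (simp only: mult.assoc mult.commute mult.left_commute)
    also have "(-1) ^ k * (-1) ^ k = (1::complex)" by (simp flip: power_mult_distrib)
    finally show ?thesis by simp
  qed
  also have "cst (sigma k * (\<i> / 2)) * ((\<eta> * econj \<eta>) * (x b * econj (x b))) =
      (cst (sigma k) * (\<eta> * econj \<eta>)) * sq (x b)"
    by (simp only: sq_def cst_mult_cst_mult)
  also have "cst (sigma k) * (\<eta> * econj \<eta>) = prod_list (map (\<lambda>b. sq (x b)) bs)"
    unfolding \<eta>_def k_def using snoc by simp
  finally show ?case by (simp add: \<eta>_def k_def)
qed

text \<open>A product of central elements of degree two, so that permuting the covectors costs no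
  sign; \<open>coef_sq_prod\<close> shows that it is the test form in the definition of
  transversality.\<close>

definition sq_prod :: "nat \<Rightarrow> nat \<Rightarrow> nat \<Rightarrow> (nat \<Rightarrow> nat \<Rightarrow> complex) \<Rightarrow> extalg" where
  "sq_prod a N k \<psi> = prod_list (map (\<lambda>b. sq (cov a N (\<psi> b))) [0..<k])"

lemma coef_prod_list: "coef (prod_list xs) = wedge_list (map coef xs)"
  by (induction xs) (simp_all add: coef_one coef_mult wedge_list_def)

lemma coef_sq_prod: "coef (sq_prod 0 n k \<psi>) = simple_positive n k \<psi>"
proof -
  define \<eta> where "\<eta> = prod_list (map (\<lambda>b. cov 0 n (\<psi> b)) [0..<k])"
  have e: "coef \<eta> = wedge_list (map (\<lambda>a. covector n (\<psi> a)) [0..<k])"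
    by (simp add: \<eta>_def coef_prod_list o_def coef_cov)
  have "sq_prod 0 n k \<psi> = cst (sigma k) * (\<eta> * econj \<eta>)"
    unfolding sq_prod_def \<eta>_def
    using sigma_eta_conj_eta[of "[0..<k]" "\<lambda>b. cov 0 n (\<psi> b)"] bideg_cov by simp
  moreover have "coef (cst (sigma k) * (\<eta> * econj \<eta>)) = simple_positive n k \<psi>"
    by (rule ext) (simp add: simple_positive_def Let_def ext_scale_def coef_mult[of \<eta>] coef_conj e)
  ultimately show ?thesis by simp
qed

section \<open>The volume form of a range of coordinates\<close>

definition vol :: "nat \<Rightarrow> nat \<Rightarrow> extalg" where
  "vol a N = prod_list (map (\<lambda>i. sq (gen (Dz i))) [a..<N])"

lemma vol_eq_mon: "vol a N = cst (sigma (N - a)) * mon (coframe_range a N)"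
proof -
  have 1: "prod_list (map (\<lambda>i. gen (Dz i)) [a..<N]) = mon (Dz ` {a..<N})"
    using prod_list_gen_sorted[of "map Dz [a..<N]"] by (simp add: sorted_wrt_map o_def)
  have 2: "prod_list (map (\<lambda>i. gen (Dzbar i)) [a..<N]) = mon (Dzbar ` {a..<N})"
    using prod_list_gen_sorted[of "map Dzbar [a..<N]"] by (simp add: sorted_wrt_map o_def)
  have "vol a N = cst (sigma (N - a)) * (mon (Dz ` {a..<N}) * mon (Dzbar ` {a..<N}))"
    unfolding vol_def
    using sigma_eta_conj_eta[of "[a..<N]" "\<lambda>i. gen (Dz i)"] bideg_gen_Dz
    by (simp add: 1[symmetric] 2[symmetric] conj_prod_list o_def)
  also have "mon (Dz ` {a..<N}) * mon (Dzbar ` {a..<N}) = mon (coframe_range a N)"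
  proof -
    have "shuffle_sign (Dz ` {a..<N}) (Dzbar ` {a..<N}) = 1"
      by (rule shuffle_sign_ordered) (auto simp: less_imp_le)
    then show ?thesis by (subst mon_mult) (auto simp: coframe_range_def)
  qed
  finally show ?thesis .
qed

lemma sigma_nonzero [simp]: "sigma k \<noteq> 0"
  by (simp add: sigma_def)

lemma vol_nonzero: "vol a N \<noteq> 0"
proof -
  have "coef (vol a N) (coframe_range a N) = sigma (N - a)"
    by (simp add: vol_eq_mon coef_mon)
  then show ?thesis by (metis coef_simps(1) sigma_nonzero)
qed

lemma cst_mult_vol_eq_iff [simp]: "cst c * vol a N = cst d * vol a N \<longleftrightarrow> c = d"
proof
  assume "cst c * vol a N = cst d * vol a N"
  then have "cst (c - d) * vol a N = 0" by (simp add: cst_diff left_diff_distrib)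
  then show "c = d" using vol_nonzero by (auto simp: cst_mult_eq_0_iff)
qed simp

lemma bideg_vol: "bideg (N - a) (N - a) (vol a N)"
  unfolding vol_def using bideg_prod_list_sq[of "[a..<N]" "\<lambda>i. gen (Dz i)"] bideg_gen_Dz by simp

lemma supported_vol: "supported (coframe_range a N) (vol a N)"
  unfolding vol_def by (rule supported_prod_list) (auto intro!: supported_sq supported_gen)

lemma conj_vol: "econj (vol a N) = vol a N"
  unfolding vol_def by (simp add: conj_prod_list o_def conj_sq bideg_gen_Dz cong: map_cong)

lemma vol_commute: "vol a N * x = x * vol a N"
  using bideg_even[OF bideg_vol] parity_even_commute by blast

lemma vol_Suc: "a < N \<Longrightarrow> vol a N = sq (gen (Dz a)) * vol (Suc a) N"
  by (simp add: vol_def upt_conv_Cons)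

lemma degree_le_if_subset_coframe_range:
  assumes "K \<subseteq> coframe_range a N"
  shows "hol_degree K \<le> N - a" "antihol_degree K \<le> N - a"
proof -
  have "{i. Dz i \<in> K} \<subseteq> {a..<N}" "{i. Dzbar i \<in> K} \<subseteq> {a..<N}" using assms by auto
  then show "hol_degree K \<le> N - a" "antihol_degree K \<le> N - a"
    unfolding hol_degree_def antihol_degree_def by (metis card_atLeastLessThan card_mono finite_atLeastLessThan)+
qed

lemma eq_0_if_bideg_too_large:
  assumes "supported (coframe_range a N) x" "bideg p q x" "p > N - a \<or> q > N - a"
  shows "x = 0"
proof (rule extalg_eqI)
  fix K
  have "coef x K = 0"
  proof (rule ccontr)
    assume "coef x K \<noteq> 0"
    then have "K \<subseteq> coframe_range a N" "hol_degree K = p" "antihol_degree K = q"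
      using assms by (auto simp: supported_def has_bidegree_def)
    then show False using degree_le_if_subset_coframe_range[of K a N] assms(3) by linarith
  qed
  then show "coef x K = coef 0 K" by simp
qed

text \<open>Full bidegree leaves only the monomial of all generators; dividing by
  \<open>sigma\<close> turns its coefficient into the one relative to \<open>vol\<close>.\<close>

lemma top_form:
  assumes "supported (coframe_range a N) x" "bideg (N - a) (N - a) x"
  shows "x = cst (coef x (coframe_range a N) / sigma (N - a)) * vol a N"
proof (rule extalg_eqI)
  fix K :: "coframe_elem set" assume "finite K"
  have "K = coframe_range a N" if "coef x K \<noteq> 0"
  proof -
    have s: "K \<subseteq> coframe_range a N" "hol_degree K = N - a" "antihol_degree K = N - a"
      using assms that by (auto simp: supported_def has_bidegree_def)
    have "card {i. Dz i \<in> K} = card {a..<N}" "card {i. Dzbar i \<in> K} = card {a..<N}"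
      using s by (simp_all add: hol_degree_def antihol_degree_def)
    moreover have "{i. Dz i \<in> K} \<subseteq> {a..<N}" "{i. Dzbar i \<in> K} \<subseteq> {a..<N}" using s by auto
    ultimately have "{i. Dz i \<in> K} = {a..<N}" "{i. Dzbar i \<in> K} = {a..<N}"
      by (simp_all add: card_subset_eq)
    then show ?thesis using coframe_set_split[of K] by (simp add: coframe_range_def)
  qed
  then show "coef x K = coef (cst (coef x (coframe_range a N) / sigma (N - a)) * vol a N) K"
    by (auto simp: vol_eq_mon coef_mon)
qed

text \<open>The part of the covector in the coordinates after \<open>a\<close> is killed by the
  volume form of these coordinates for reasons of degree, so only the pivot coefficient survives,
  through its absolute value squared.\<close>

lemma sq_cov_mult_vol:
  assumes "a < N"
  shows "sq (cov a N \<theta>) * vol (Suc a) N = cst ((cmod (\<theta> a))\<^sup>2) * vol a N"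
proof -
  let ?e = "cst (\<theta> a) * gen (Dz a)" and ?\<beta> = "cov (Suc a) N \<theta>"
  have z: "y * vol (Suc a) N = 0"
    if "supported (coframe_range (Suc a) N) y" "bideg p q y" "p > 0 \<or> q > 0" for p q y
  proof (rule eq_0_if_bideg_too_large)
    show "supported (coframe_range (Suc a) N) (y * vol (Suc a) N)"
      using that supported_mult supported_vol by blast
    show "bideg (p + (N - Suc a)) (q + (N - Suc a)) (y * vol (Suc a) N)"
      using that bideg_mult bideg_vol by blast
  qed (use that in auto)
  have \<beta>: "?\<beta> * vol (Suc a) N = 0" "econj ?\<beta> * vol (Suc a) N = 0"
    using z[OF supported_cov bideg_cov] z[OF supported_conj[OF supported_cov] bideg_conj[OF bideg_cov]]
    by auto
  have "cov a N \<theta> * econj (cov a N \<theta>) * vol (Suc a) N = (?e + ?\<beta>) * ((econj ?e + econj ?\<beta>) * vol (Suc a) N)"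
    using assms by (simp add: cov_split conj_add mult.assoc)
  also have "\<dots> = (?e + ?\<beta>) * (vol (Suc a) N * econj ?e)"
    by (simp add: distrib_right \<beta> vol_commute)
  also have "\<dots> = ?e * (vol (Suc a) N * econj ?e)"
    by (simp add: distrib_right \<beta> flip: mult.assoc)
  also have "\<dots> = ?e * econj ?e * vol (Suc a) N"
    by (simp add: vol_commute mult.assoc)
  finally have "sq (cov a N \<theta>) * vol (Suc a) N = sq ?e * vol (Suc a) N"
    by (simp add: sq_def mult.assoc)
  also have "\<dots> = cst ((cmod (\<theta> a))\<^sup>2) * vol a N"
    using assms by (simp add: sq_scale vol_Suc mult.assoc)
  finally show ?thesis .
qed

section \<open>Transversality\<close>

definition indep :: "nat \<Rightarrow> nat \<Rightarrow> nat \<Rightarrow> (nat \<Rightarrow> nat \<Rightarrow> complex) \<Rightarrow> bool" where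
  "indep a N k \<psi> \<longleftrightarrow>
     (\<forall>c :: nat \<Rightarrow> complex. (\<forall>i\<in>{a..<N}. (\<Sum>b<k. c b * \<psi> b i) = 0) \<longrightarrow> (\<forall>b<k. c b = 0))"

lemma covectors_independent_iff: "covectors_independent n k \<psi> \<longleftrightarrow> indep 0 n k \<psi>"
  by (simp add: covectors_independent_def indep_def atLeast0LessThan Ball_def)

lemma indepD:
  "indep a N k \<psi> \<Longrightarrow> (\<And>i. a \<le> i \<Longrightarrow> i < N \<Longrightarrow> (\<Sum>b<k. c b * \<psi> b i) = 0) \<Longrightarrow> b < k \<Longrightarrow> c b = 0"
  unfolding indep_def by auto

lemma sq_left_commute: "bideg 1 0 x \<Longrightarrow> sq x * (y * z) = y * (sq x * z)"
  by (metis mult.assoc sq_commute)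

text \<open>In a noncommutative monoid central factors may still be reordered; this is applied to
  products of squares of covectors.\<close>

lemma prod_list_mset_eq_if_central:
  fixes xs :: "'a :: monoid_mult list"
  assumes "\<And>x y. x \<in> set xs \<Longrightarrow> x * y = y * x" "mset xs = mset ys"
  shows "prod_list xs = prod_list ys"
  using assms
proof (induction xs arbitrary: ys)
  case (Cons x xs)
  then have "x \<in> set ys" by (metis list.set_intros(1) mset_eq_setD)
  then obtain us vs where ys: "ys = us @ x # vs" by (meson split_list)
  have "prod_list xs = prod_list (us @ vs)"
    using Cons.prems by (intro Cons.IH) (auto simp: ys)
  moreover have "x * prod_list us = prod_list us * x"
    by (rule Cons.prems(1)) simp
  ultimately show ?case by (simp add: ys flip: mult.assoc)
qed simp

lemma bideg_sq_prod: "bideg k k (sq_prod a N k \<psi>)"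
  unfolding sq_prod_def using bideg_prod_list_sq[of "[0..<k]" "\<lambda>b. cov a N (\<psi> b)"] bideg_cov by simp

lemma sq_prod_commute: "sq_prod a N k \<psi> * x = x * sq_prod a N k \<psi>"
  using bideg_even[OF bideg_sq_prod] parity_even_commute by blast

lemma supported_sq_prod: "supported (coframe_range a N) (sq_prod a N k \<psi>)"
  unfolding sq_prod_def by (rule supported_prod_list) (auto intro!: supported_sq supported_cov)

lemma sq_prod_0 [simp]: "sq_prod a N 0 \<psi> = 1"
  by (simp add: sq_prod_def)

lemma sq_prod_Suc:
  "sq_prod a N (Suc k) \<psi> = sq (cov a N (\<psi> 0)) * sq_prod a N k (\<lambda>b. \<psi> (Suc b))"
proof -
  have "[0..<Suc k] = 0 # map Suc [0..<k]"
    by (simp add: map_Suc_upt upt_conv_Cons del: upt_Suc)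
  then show ?thesis by (simp add: sq_prod_def o_def del: upt_Suc)
qed

section \<open>Row operations on the test covectors\<close>

lemma cov_cong: "(\<And>i. a \<le> i \<Longrightarrow> i < N \<Longrightarrow> \<phi> i = \<psi> i) \<Longrightarrow> cov a N \<phi> = cov a N \<psi>"
  unfolding cov_def by (intro sum.cong) auto

lemma cov_Suc: "a < N \<Longrightarrow> \<psi> a = 0 \<Longrightarrow> cov a N \<psi> = cov (Suc a) N \<psi>"
  by (simp add: cov_split)

lemma sq_prod_Suc_lower:
  "a < N \<Longrightarrow> (\<And>b. b < k \<Longrightarrow> \<psi> b a = 0) \<Longrightarrow> sq_prod a N k \<psi> = sq_prod (Suc a) N k \<psi>"
  unfolding sq_prod_def by (intro arg_cong[where f = prod_list] map_cong) (auto simp: cov_Suc)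

lemma indep_Suc_lower:
  assumes "indep a N k \<psi>" "\<And>b. b < k \<Longrightarrow> \<psi> b a = 0"
  shows "indep (Suc a) N k \<psi>"
  unfolding indep_def
proof (intro allI impI)
  fix c :: "nat \<Rightarrow> complex" and b
  assume c: "\<forall>i\<in>{Suc a..<N}. (\<Sum>b<k. c b * \<psi> b i) = 0" and "b < k"
  have "(\<Sum>b<k. c b * \<psi> b i) = 0" if "a \<le> i" "i < N" for i
    using c assms(2) that by (cases "i = a") auto
  then show "c b = 0" using indepD[OF assms(1)] \<open>b < k\<close> by blast
qed

lemma sq_prod_transpose:
  assumes "b0 < k"
  shows "sq_prod a N k (\<lambda>b. \<psi> (Transposition.transpose 0 b0 b)) = sq_prod a N k \<psi>"
  unfolding sq_prod_def
proof (rule prod_list_mset_eq_if_central)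
  have p: "Transposition.transpose 0 b0 permutes {0..<k}" using assms by (intro permutes_swap_id) auto
  have "mset (map (\<lambda>b. sq (cov a N (\<psi> (Transposition.transpose 0 b0 b)))) [0..<k]) =
      image_mset (\<lambda>b. sq (cov a N (\<psi> b))) (image_mset (Transposition.transpose 0 b0) (mset_set {0..<k}))"
    by (simp add: image_mset.compositionality o_def)
  also have "image_mset (Transposition.transpose 0 b0) (mset_set {0..<k}) = mset_set {0..<k}"
    using p by (subst image_mset_mset_set) (auto simp: permutes_image intro: permutes_inj_on)
  finally show "mset (map (\<lambda>b. sq (cov a N (\<psi> (Transposition.transpose 0 b0 b)))) [0..<k]) =
      mset (map (\<lambda>b. sq (cov a N (\<psi> b))) [0..<k])" by simp
qed (auto simp: sq_commute bideg_cov)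

lemma indep_transpose:
  assumes "indep a N k \<psi>" "b0 < k"
  shows "indep a N k (\<lambda>b. \<psi> (Transposition.transpose 0 b0 b))"
  unfolding indep_def
proof (intro allI impI)
  let ?\<tau> = "Transposition.transpose 0 b0"
  fix c :: "nat \<Rightarrow> complex" and b
  assume c: "\<forall>i\<in>{a..<N}. (\<Sum>b<k. c b * \<psi> (?\<tau> b) i) = 0" and b: "b < k"
  have lt: "?\<tau> b < k" if "b < k" for b using that assms(2) by (auto simp: Transposition.transpose_def)
  have "(\<Sum>b<k. c (?\<tau> b) * \<psi> b i) = (\<Sum>b<k. c b * \<psi> (?\<tau> b) i)" for i
    by (rule sum.reindex_bij_witness[of _ ?\<tau> ?\<tau>]) (auto simp: lt)
  then have "c (?\<tau> (?\<tau> b)) = 0"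
    using c b lt indepD[OF assms(1), of "\<lambda>b. c (?\<tau> b)" "?\<tau> b"] by auto
  then show "c b = 0" by simp
qed

lemma sq_mult_prod_list_sq_add:
  assumes "bideg 1 0 x" "\<And>b. b \<in> set bs \<Longrightarrow> bideg 1 0 (y b)"
  shows "sq x * prod_list (map (\<lambda>b. sq (y b + cst (t b) * x)) bs) = sq x * prod_list (map (\<lambda>b. sq (y b)) bs)"
  using assms(2)
proof (induction bs)
  case (Cons b bs)
  let ?z = "y b + cst (t b) * x"
  have z: "bideg 1 0 ?z" using Cons.prems assms(1) by (auto intro!: bideg_add bideg_cst_mult)
  have yb: "bideg 1 0 (y b)" using Cons.prems by simp
  have "sq x * (sq ?z * prod_list (map (\<lambda>b. sq (y b + cst (t b) * x)) bs)) =
      sq ?z * (sq x * prod_list (map (\<lambda>b. sq (y b + cst (t b) * x)) bs))"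
    by (rule sq_left_commute[OF assms(1)])
  also have "\<dots> = sq ?z * sq x * prod_list (map (\<lambda>b. sq (y b)) bs)"
    using Cons by (simp add: mult.assoc)
  also have "sq ?z * sq x = sq x * sq (y b)"
    using sq_mult_sq_add[OF assms(1) yb] sq_commute[OF z] by simp
  finally show ?case by (simp add: mult.assoc)
qed simp

lemma indep_subtract_first:
  assumes "indep a N (Suc k) \<psi>"
  shows "indep a N (Suc k) (\<lambda>b i. if b = 0 then \<psi> 0 i else \<psi> b i + t b * \<psi> 0 i)"
  unfolding indep_def
proof (intro allI impI)
  fix c :: "nat \<Rightarrow> complex" and b
  let ?\<psi> = "\<lambda>b i. if b = 0 then \<psi> 0 i else \<psi> b i + t b * \<psi> 0 i"
  assume c: "\<forall>i\<in>{a..<N}. (\<Sum>b<Suc k. c b * ?\<psi> b i) = 0" and b: "b < Suc k"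
  \<comment> \<open>Rewriting the relation in the original rows collects all the multiples
    \<open>t\<close> in the coefficient of row 0.\<close>
  define c' where "c' b = (if b = 0 then c 0 + (\<Sum>b<k. c (Suc b) * t (Suc b)) else c b)" for b
  have e: "(\<Sum>b<Suc k. c b * ?\<psi> b i) = (\<Sum>b<Suc k. c' b * \<psi> b i)" for i
    unfolding sum.lessThan_Suc_shift
    by (simp add: c'_def algebra_simps sum.distrib sum_distrib_left)
  then have z: "c' b = 0" if "b < Suc k" for b
    using indepD[OF assms, of c' b] c that by auto
  then have z1: "c b = 0" if "b < Suc k" "b \<noteq> 0" for b
    using that z[of b] by (simp add: c'_def)
  then have "c 0 = c' 0" by (simp add: c'_def)
  then have "c 0 = 0" using z by simp
  then show "c b = 0" using z1 b by (cases "b = 0") auto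
qed

lemma indep_tail:
  assumes "indep a N (Suc k) \<psi>"
  shows "indep a N k (\<lambda>b. \<psi> (Suc b))"
  unfolding indep_def
proof (intro allI impI)
  fix c :: "nat \<Rightarrow> complex" and b
  assume c: "\<forall>i\<in>{a..<N}. (\<Sum>b<k. c b * \<psi> (Suc b) i) = 0" and b: "b < k"
  define c' where "c' b = (case b of 0 \<Rightarrow> 0 | Suc b \<Rightarrow> c b)" for b
  have "(\<Sum>b<Suc k. c' b * \<psi> b i) = (\<Sum>b<k. c b * \<psi> (Suc b) i)" for i
    unfolding sum.lessThan_Suc_shift by (simp add: c'_def)
  then have "c' (Suc b) = 0" using indepD[OF assms, of c' "Suc b"] c b by auto
  then show "c b = 0" by (simp add: c'_def)
qed

text \<open>One step of Gaussian elimination in the column \<open>a\<close>: a row with a nonzero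
  entry is moved to the front and multiples of it are subtracted from the others, which then involve
  only later coordinates. The test form is unchanged by either operation, its factors being central
  and \<open>sq\<close> of the first row absorbing multiples of that row.\<close>

lemma pivot:
  assumes "a < N" "indep a N k \<psi>" "b0 < k" "\<psi> b0 a \<noteq> 0"
  obtains l x \<phi> where "k = Suc l" "x a \<noteq> (0::complex)" "indep (Suc a) N l \<phi>"
    "sq_prod a N k \<psi> = sq (cov a N x) * sq_prod (Suc a) N l \<phi>"
proof -
  obtain l where l: "k = Suc l" using assms(3) by (cases k) auto
  define \<psi>1 where "\<psi>1 b = \<psi> (Transposition.transpose 0 b0 b)" for b
  define t where "t b = - (\<psi>1 b a / \<psi>1 0 a)" for b
  define \<phi> where "\<phi> b i = \<psi>1 (Suc b) i + t (Suc b) * \<psi>1 0 i" for b i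
  have x: "\<psi>1 0 a \<noteq> 0" using assms(4) by (simp add: \<psi>1_def)
  have "indep a N k \<psi>1"
    unfolding \<psi>1_def by (rule indep_transpose) (use assms in auto)
  then have "indep a N l (\<lambda>b i. if Suc b = 0 then \<psi>1 0 i else \<psi>1 (Suc b) i + t (Suc b) * \<psi>1 0 i)"
    unfolding l by (intro indep_tail indep_subtract_first)
  moreover have "(\<lambda>b i. if Suc b = 0 then \<psi>1 0 i else \<psi>1 (Suc b) i + t (Suc b) * \<psi>1 0 i) = \<phi>"
    by (intro ext) (simp add: \<phi>_def)
  ultimately have ind: "indep a N l \<phi>" by simp
  have za: "\<phi> b a = 0" for b using x by (simp add: \<phi>_def t_def)
  have c: "cov a N (\<phi> b) = cov a N (\<psi>1 (Suc b)) + cst (t (Suc b)) * cov a N (\<psi>1 0)" for b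
    unfolding \<phi>_def cov_add cov_scale ..
  have "sq_prod a N k \<psi> = sq_prod a N (Suc l) \<psi>1"
    unfolding \<psi>1_def l[symmetric] by (rule sq_prod_transpose[symmetric]) (use assms in auto)
  also have "\<dots> = sq (cov a N (\<psi>1 0)) * sq_prod a N l \<phi>"
    unfolding sq_prod_Suc unfolding sq_prod_def c
    by (rule sq_mult_prod_list_sq_add[symmetric]) (simp_all add: bideg_cov)
  also have "sq_prod a N l \<phi> = sq_prod (Suc a) N l \<phi>"
    using assms(1) za by (intro sq_prod_Suc_lower) auto
  finally show ?thesis
    using that[of l "\<psi>1 0" \<phi>] l x indep_Suc_lower[OF ind za] by simp
qed

text \<open>A row occurring in a relation with nonzero coefficient is a combination of the other
  rows, and each of these annihilates the product of squares that contains its own square.\<close>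

lemma sq_prod_eq_0_if_dependent:
  assumes "\<not> indep a N k \<psi>"
  shows "sq_prod a N k \<psi> = 0"
proof -
  obtain c b0 where c': "\<forall>i\<in>{a..<N}. (\<Sum>b<k. c b * \<psi> b i) = 0" and b0: "b0 < k" "c b0 \<noteq> 0"
    using assms unfolding indep_def by blast
  then have c: "(\<Sum>b<k. c b * \<psi> b i) = 0" if "a \<le> i" "i < N" for i
    using that by simp
  let ?\<tau> = "Transposition.transpose 0 b0"
  obtain l where l: "k = Suc l" using b0 by (cases k) auto
  define \<psi>1 where "\<psi>1 b = \<psi> (?\<tau> b)" for b
  define d where "d b = c (?\<tau> b)" for b
  define R where "R = sq_prod a N l (\<lambda>b. \<psi>1 (Suc b))"
  have lt: "?\<tau> b < k" if "b < k" for b using that b0 by (auto simp: Transposition.transpose_def)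
  have d0: "d 0 \<noteq> 0" using b0 by (simp add: d_def)
  have "(\<Sum>b<k. d b * \<psi>1 b i) = (\<Sum>b<k. c b * \<psi> b i)" for i
    unfolding d_def \<psi>1_def by (rule sum.reindex_bij_witness[of _ ?\<tau> ?\<tau>]) (auto simp: lt)
  then have dz: "(\<Sum>b<Suc l. d b * \<psi>1 b i) = 0" if "a \<le> i" "i < N" for i
    using c that l by simp
  have e: "\<psi>1 0 i = (\<Sum>b<l. (- (d (Suc b) / d 0)) * \<psi>1 (Suc b) i)" if "a \<le> i" "i < N" for i
  proof -
    have "d 0 * \<psi>1 0 i = - (\<Sum>b<l. d (Suc b) * \<psi>1 (Suc b) i)"
      using dz[OF that] unfolding sum.lessThan_Suc_shift by (simp add: eq_neg_iff_add_eq_0)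
    then have "\<psi>1 0 i = - (\<Sum>b<l. d (Suc b) * \<psi>1 (Suc b) i) / d 0"
      using d0 by (simp add: field_simps)
    then show ?thesis by (simp add: sum_negf sum_divide_distrib)
  qed
  have x: "cov a N (\<psi>1 0) = (\<Sum>b<l. cst (- (d (Suc b) / d 0)) * cov a N (\<psi>1 (Suc b)))"
  proof -
    have "cov a N (\<psi>1 0) = (\<Sum>i\<in>{a..<N}. \<Sum>b<l. cst (- (d (Suc b) / d 0) * \<psi>1 (Suc b) i) * gen (Dz i))"
      unfolding cov_def by (intro sum.cong refl) (simp only: e cst_sum sum_distrib_right atLeastLessThan_iff)
    also have "\<dots> = (\<Sum>b<l. cst (- (d (Suc b) / d 0)) * cov a N (\<psi>1 (Suc b)))"
      by (subst sum.swap) (simp only: cov_def sum_distrib_left cst_mult mult.assoc)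
    finally show ?thesis .
  qed
  have xb: "cov a N (\<psi>1 (Suc b)) * R = 0" if "b < l" for b
  proof -
    let ?x = "cov a N (\<psi>1 (Suc b))"
    have "b \<in> set [0..<l]" using that by simp
    then obtain us vs where uv: "[0..<l] = us @ b # vs" by (meson split_list)
    have "R = prod_list (map (\<lambda>b. sq (cov a N (\<psi>1 (Suc b)))) us) * (sq ?x *
        prod_list (map (\<lambda>b. sq (cov a N (\<psi>1 (Suc b)))) vs))" (is "_ = ?U * (_ * ?V)")
      by (simp add: R_def sq_prod_def uv)
    then have "?x * R = sq ?x * ?x * (?U * ?V)"
      by (simp only: sq_left_commute[OF bideg_cov, symmetric] mult.assoc)
    then show ?thesis by (simp add: sq_mult_self_left bideg_cov)
  qed
  have "cov a N (\<psi>1 0) * R = 0"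
    unfolding x sum_distrib_right mult.assoc using xb by simp
  moreover have "econj (cov a N (\<psi>1 0)) * R = R * econj (cov a N (\<psi>1 0))"
    unfolding R_def by (rule sq_prod_commute[symmetric])
  ultimately have "sq (cov a N (\<psi>1 0)) * R = 0"
    by (simp add: sq_def mult.assoc) (simp flip: mult.assoc)
  moreover have "sq_prod a N k \<psi> = sq_prod a N (Suc l) \<psi>1"
    unfolding \<psi>1_def l[symmetric] by (rule sq_prod_transpose[symmetric]) (use b0 in auto)
  ultimately show ?thesis by (simp add: sq_prod_Suc R_def)
qed

definition pos_top :: "nat \<Rightarrow> nat \<Rightarrow> extalg \<Rightarrow> bool" where
  "pos_top a N x \<longleftrightarrow> (\<exists>c::real. c > 0 \<and> x = cst (of_real c) * vol a N)"

text \<open>The weak version serves the products in which the test covectors may be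
  dependent.\<close>

definition nonneg_top :: "nat \<Rightarrow> nat \<Rightarrow> extalg \<Rightarrow> bool" where
  "nonneg_top a N x \<longleftrightarrow> (\<exists>c::real. c \<ge> 0 \<and> x = cst (of_real c) * vol a N)"

lemma pos_top_nonneg: "pos_top a N x \<Longrightarrow> nonneg_top a N x"
  unfolding pos_top_def nonneg_top_def using less_imp_le by blast

lemma nonneg_top_0: "nonneg_top a N 0"
  unfolding nonneg_top_def by (rule exI[of _ 0]) simp

lemma pos_top_add: "pos_top a N x \<Longrightarrow> nonneg_top a N y \<Longrightarrow> pos_top a N (x + y)"
  unfolding pos_top_def nonneg_top_def
  by (metis add_pos_nonneg cst_add distrib_right of_real_add)

lemma nonneg_top_sq_mult:
  assumes "a < N" "nonneg_top (Suc a) N y"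
  shows "nonneg_top a N (sq (cov a N \<theta>) * y)"
proof -
  obtain c :: real where c: "c \<ge> 0" "y = cst (of_real c) * vol (Suc a) N"
    using assms(2) by (auto simp: nonneg_top_def)
  have "sq (cov a N \<theta>) * y = cst (of_real c) * (sq (cov a N \<theta>) * vol (Suc a) N)"
    unfolding c(2) by (rule cst_left_commute)
  also have "\<dots> = cst (of_real (c * (cmod (\<theta> a))\<^sup>2)) * vol a N"
    unfolding sq_cov_mult_vol[OF assms(1)] by (simp add: cst_mult mult.assoc)
  finally show ?thesis using c(1) unfolding nonneg_top_def
    by (intro exI[of _ "c * (cmod (\<theta> a))\<^sup>2"]) simp
qed

lemma pos_top_sq_mult:
  assumes "a < N" "pos_top (Suc a) N y" "\<theta> a \<noteq> 0"
  shows "pos_top a N (sq (cov a N \<theta>) * y)"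
proof -
  obtain c :: real where c: "c > 0" "y = cst (of_real c) * vol (Suc a) N"
    using assms(2) by (auto simp: pos_top_def)
  have "sq (cov a N \<theta>) * y = cst (of_real c) * (sq (cov a N \<theta>) * vol (Suc a) N)"
    unfolding c(2) by (rule cst_left_commute)
  also have "\<dots> = cst (of_real (c * (cmod (\<theta> a))\<^sup>2)) * vol a N"
    unfolding sq_cov_mult_vol[OF assms(1)] by (simp add: cst_mult mult.assoc)
  finally show ?thesis using c(1) assms(3) unfolding pos_top_def
    by (intro exI[of _ "c * (cmod (\<theta> a))\<^sup>2"]) simp
qed

text \<open>The rank bound and the positivity come from the same elimination. In the square case
  there is a pivot in every column, and the product of their squared absolute values plays the role
  of the squared absolute value of a determinant.\<close>

lemma indep_card_le_and_pos_top:
  assumes "a \<le> N" "indep a N k \<psi>"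
  shows "k \<le> N - a \<and> (k = N - a \<longrightarrow> pos_top a N (sq_prod a N k \<psi>))"
  using assms
proof (induction "N - a" arbitrary: a k \<psi>)
  case 0
  then have "a = N" by simp
  have "k = 0"
  proof (rule ccontr)
    assume "k \<noteq> 0"
    then have "(1::complex) = 0"
      using indepD[OF 0(3), of "\<lambda>_. 1" 0] \<open>a = N\<close> by auto
    then show False by simp
  qed
  then show ?case
    by (auto simp: \<open>a = N\<close> pos_top_def vol_def intro!: exI[of _ "1::real"])
next
  case (Suc d)
  then have a: "a < N" and d: "d = N - Suc a" by auto
  show ?case
  proof (cases "\<exists>b0<k. \<psi> b0 a \<noteq> 0")
    case False
    then have "indep (Suc a) N k \<psi>" using Suc.prems by (intro indep_Suc_lower) auto
    then have "k \<le> N - Suc a" using Suc.hyps(1)[OF d] a by auto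
    then show ?thesis using a by auto
  next
    case True
    then obtain b0 where b0: "b0 < k" "\<psi> b0 a \<noteq> 0" by blast
    obtain l x \<phi> where p: "k = Suc l" "x a \<noteq> (0::complex)" "indep (Suc a) N l \<phi>"
      "sq_prod a N k \<psi> = sq (cov a N x) * sq_prod (Suc a) N l \<phi>"
      by (rule pivot[OF a Suc.prems(2) b0])
    have l: "l \<le> N - Suc a \<and> (l = N - Suc a \<longrightarrow> pos_top (Suc a) N (sq_prod (Suc a) N l \<phi>))"
      using Suc.hyps(1)[OF d _ p(3)] a by auto
    show ?thesis
    proof (intro conjI impI)
      show "k \<le> N - a" using l p(1) a by linarith
      assume "k = N - a"
      then have "l = N - Suc a" using p(1) by linarith
      then have "pos_top (Suc a) N (sq_prod (Suc a) N l \<phi>)" using l by blast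
      then show "pos_top a N (sq_prod a N k \<psi>)"
        unfolding p(4) by (rule pos_top_sq_mult[OF a]) (rule p(2))
    qed
  qed
qed

text \<open>The index p = N - a is included: then there are no test covectors, and the condition
  says that the form is a positive multiple of the volume form. The form of top degree on Y enters
  through this case.\<close>

definition trans_form :: "nat \<Rightarrow> nat \<Rightarrow> nat \<Rightarrow> extalg \<Rightarrow> bool" where
  "trans_form a N p x \<longleftrightarrow> supported (coframe_range a N) x \<and> bideg p p x \<and>
     (\<forall>\<psi>. indep a N (N - a - p) \<psi> \<longrightarrow> pos_top a N (x * sq_prod a N (N - a - p) \<psi>))"

text \<open>The basis in the definition can be fixed, since the product of the squares of any basis
  is a positive multiple of the standard volume form.\<close>

lemma strictly_positive_iff: "strictly_positive n (coef x) \<longleftrightarrow> pos_top 0 n x"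
proof
  assume "strictly_positive n (coef x)"
  then obtain c :: real and \<phi> where c: "c > 0" "indep 0 n n \<phi>"
    "coef x = ext_scale (of_real c) (simple_positive n n \<phi>)"
    unfolding strictly_positive_def covectors_independent_iff by blast
  have "x = cst (of_real c) * sq_prod 0 n n \<phi>"
    by (rule extalg_eqI) (simp add: c(3) ext_scale_def coef_sq_prod)
  moreover obtain d :: real where "d > 0" "sq_prod 0 n n \<phi> = cst (of_real d) * vol 0 n"
    using indep_card_le_and_pos_top[OF _ c(2)] by (auto simp: pos_top_def)
  ultimately have "x = cst (of_real (c * d)) * vol 0 n" by (simp add: cst_mult mult.assoc)
  then show "pos_top 0 n x"
    unfolding pos_top_def using c(1) \<open>d > 0\<close> by (intro exI[of _ "c * d"]) simp
next
  assume "pos_top 0 n x"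
  then obtain c :: real where c: "c > 0" "x = cst (of_real c) * vol 0 n"
    by (auto simp: pos_top_def)
  define \<phi> :: "nat \<Rightarrow> nat \<Rightarrow> complex" where "\<phi> b i = (if i = b then 1 else 0)" for b i
  have "indep 0 n n \<phi>"
    unfolding indep_def
  proof (intro allI impI)
    fix d :: "nat \<Rightarrow> complex" and b
    assume "\<forall>i\<in>{0..<n}. (\<Sum>b<n. d b * \<phi> b i) = 0" "b < n"
    then have "(\<Sum>b'<n. d b' * \<phi> b' b) = 0" by simp
    then show "d b = 0" using \<open>b < n\<close> by (simp add: \<phi>_def if_distrib sum.delta cong: if_cong)
  qed
  moreover have "cov 0 n (\<phi> b) = gen (Dz b)" if "b < n" for b
  proof -
    have "cov 0 n (\<phi> b) = (\<Sum>i\<in>{0..<n}. if i = b then gen (Dz i) else 0)"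
      unfolding cov_def by (intro sum.cong) (auto simp: \<phi>_def)
    then show ?thesis using that by (simp add: sum.delta)
  qed
  then have "sq_prod 0 n n \<phi> = vol 0 n"
    unfolding sq_prod_def vol_def by (intro arg_cong[where f = prod_list] map_cong) auto
  then have "coef x = ext_scale (of_real c) (simple_positive n n \<phi>)"
    by (intro ext) (simp add: c(2) ext_scale_def coef_sq_prod[symmetric])
  ultimately show "strictly_positive n (coef x)"
    unfolding strictly_positive_def covectors_independent_iff using c(1) by blast
qed

lemma ext_on_iff: "ext_on n (coef x) \<longleftrightarrow> supported (coframe_range 0 n) x"
  by (simp add: ext_on_def supported_def coframe_range_0)

lemma ext_real_iff: "ext_real (coef x) \<longleftrightarrow> econj x = x"
  by (simp add: ext_real_def coef_conj[symmetric] coef_inject)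

lemma transverse_iff: "transverse n p (coef x) \<longleftrightarrow> trans_form 0 n p x \<and> econj x = x"
  unfolding transverse_def trans_form_def ext_on_iff ext_real_iff covectors_independent_iff
    coef_sq_prod[symmetric] coef_mult[symmetric] strictly_positive_iff
  by auto

text \<open>
  One dimension is added by splitting off a pivot. If all test covectors vanish on the new
  coordinate, only the second summand contributes; otherwise one test covector can be taken to be
  the only one that does not vanish there, and the first summand contributes.
\<close>

lemma trans_form_step:
  fixes x :: "nat \<Rightarrow> extalg"
  assumes a: "a < N" and \<theta>: "\<theta> a \<noteq> 0"
    and supp: "\<And>s. supported (coframe_range (Suc a) N) (x s)" and bi: "\<And>s. bideg s s (x s)"
    and tr: "\<And>s. q \<le> s \<Longrightarrow> s \<le> N - Suc a \<Longrightarrow> trans_form (Suc a) N s (x s)"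
    and s: "q + 1 \<le> s" "s \<le> N - a"
  shows "trans_form a N s (x s + sq (cov a N \<theta>) * x (s - 1))"
  unfolding trans_form_def
proof (intro conjI allI impI)
  let ?P = "sq (cov a N \<theta>)"
  have sub: "coframe_range (Suc a) N \<subseteq> coframe_range a N" by (rule coframe_range_mono) auto
  show "supported (coframe_range a N) (x s + ?P * x (s - 1))"
    using supp sub by (intro supported_add supported_mult supported_sq supported_cov)
      (auto intro: supported_mono)
  have "bideg (1 + (s - 1)) (1 + (s - 1)) (?P * x (s - 1))"
    by (intro bideg_mult bideg_sq bideg_cov bi)
  then show "bideg s s (x s + ?P * x (s - 1))"
    using s bi by (intro bideg_add) auto
  define k where "k = N - a - s"
  fix \<psi> assume "indep a N (N - a - s) \<psi>"
  then have ind: "indep a N k \<psi>" by (simp add: k_def)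
  \<comment> \<open>The number of test covectors for index s over \<open>a\<close> is also the
    number for index s - 1 over \<open>Suc a\<close>.\<close>
  have k1: "k = N - Suc a - (s - 1)" using s by (simp add: k_def)
  have tr1: "trans_form (Suc a) N (s - 1) (x (s - 1))"
    using s by (intro tr) auto
  have "pos_top a N ((x s + ?P * x (s - 1)) * sq_prod a N k \<psi>)"
  proof (cases "\<exists>b0<k. \<psi> b0 a \<noteq> 0")
    case False
    then have e: "sq_prod a N k \<psi> = sq_prod (Suc a) N k \<psi>"
      using a by (intro sq_prod_Suc_lower) auto
    have "indep (Suc a) N k \<psi>" using False ind by (intro indep_Suc_lower) auto
    then have "pos_top (Suc a) N (x (s - 1) * sq_prod (Suc a) N k \<psi>)"
      using tr1 by (simp add: trans_form_def k1)
    then have "pos_top a N (?P * (x (s - 1) * sq_prod (Suc a) N k \<psi>))"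
      using a \<theta> by (intro pos_top_sq_mult)
    \<comment> \<open>Here s + k = N - a exceeds the number of coordinates after \<open>a\<close> by
      one.\<close>
    moreover have "x s * sq_prod (Suc a) N k \<psi> = 0"
    proof (rule eq_0_if_bideg_too_large)
      show "supported (coframe_range (Suc a) N) (x s * sq_prod (Suc a) N k \<psi>)"
        by (intro supported_mult supp supported_sq_prod)
      show "bideg (s + k) (s + k) (x s * sq_prod (Suc a) N k \<psi>)"
        by (intro bideg_mult bi bideg_sq_prod)
    qed (use a s in \<open>auto simp: k_def\<close>)
    ultimately show ?thesis by (simp add: e distrib_right mult.assoc)
  next
    case True
    then obtain b0 where b0: "b0 < k" "\<psi> b0 a \<noteq> 0" by blast
    obtain l y \<phi> where p: "k = Suc l" "y a \<noteq> (0::complex)" "indep (Suc a) N l \<phi>"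
      "sq_prod a N k \<psi> = sq (cov a N y) * sq_prod (Suc a) N l \<phi>"
      by (rule pivot[OF a ind b0])
    define R where "R = sq_prod (Suc a) N l \<phi>"
    have l: "l = N - Suc a - s" using p(1) by (simp add: k_def)
    have "trans_form (Suc a) N s (x s)"
      using p(1) s by (intro tr) (auto simp: k_def)
    then have "pos_top (Suc a) N (x s * R)"
      using p(3) by (simp add: trans_form_def R_def l)
    then have "pos_top a N (sq (cov a N y) * (x s * R))"
      using a p(2) by (intro pos_top_sq_mult)
    then have first: "pos_top a N (x s * (sq (cov a N y) * R))"
      by (simp only: sq_left_commute[OF bideg_cov])
    \<comment> \<open>Under multiplication by the square of \<theta> only \<open>y\<close> modulo
      \<theta> matters; this multiple of \<theta> is the one whose subtraction removes the
      coordinate \<open>a\<close> from \<open>y\<close>.\<close>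
    define t where "t = y a / \<theta> a"
    define \<gamma> where "\<gamma> i = y i - t * \<theta> i" for i
    have \<gamma>: "\<gamma> a = 0" using \<theta> by (simp add: \<gamma>_def t_def)
    have y: "cov a N y = cov (Suc a) N \<gamma> + cst t * cov a N \<theta>"
    proof -
      have "cov a N y = cov a N (\<lambda>i. \<gamma> i + t * \<theta> i)" by (intro cov_cong) (simp add: \<gamma>_def)
      then show ?thesis using a \<gamma> by (simp add: cov_add cov_scale cov_Suc)
    qed
    have Py: "?P * sq (cov a N y) = ?P * sq (cov (Suc a) N \<gamma>)"
      unfolding y by (rule sq_mult_sq_add) (rule bideg_cov)+
    \<comment> \<open>The reduced covector and the remaining ones together are \<open>k\<close> test
      covectors for \<open>x (s - 1)\<close> in the later coordinates. They may be dependent, hence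
      only nonnegativity.\<close>
    define \<rho> where "\<rho> b = (case b of 0 \<Rightarrow> \<gamma> | Suc b \<Rightarrow> \<phi> b)" for b
    have \<rho>: "sq (cov (Suc a) N \<gamma>) * R = sq_prod (Suc a) N k \<rho>"
      by (simp add: p(1) sq_prod_Suc \<rho>_def R_def)
    have "nonneg_top (Suc a) N (x (s - 1) * sq_prod (Suc a) N k \<rho>)"
    proof (cases "indep (Suc a) N k \<rho>")
      case True
      then show ?thesis using tr1 by (auto simp: trans_form_def k1 intro: pos_top_nonneg)
    next
      case False
      then show ?thesis by (simp add: sq_prod_eq_0_if_dependent nonneg_top_0)
    qed
    then have "nonneg_top a N (?P * (x (s - 1) * sq_prod (Suc a) N k \<rho>))"
      using a by (intro nonneg_top_sq_mult)
    moreover have "?P * (x (s - 1) * sq_prod (Suc a) N k \<rho>) = ?P * x (s - 1) * (sq (cov a N y) * R)"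
    proof -
      have c: "x (s - 1) * (sq (cov b N \<eta>) * R) = sq (cov b N \<eta>) * (x (s - 1) * R)" for b \<eta>
        by (rule sq_left_commute[OF bideg_cov, symmetric])
      have "?P * (x (s - 1) * (sq (cov (Suc a) N \<gamma>) * R)) = ?P * sq (cov (Suc a) N \<gamma>) * (x (s - 1) * R)"
        by (simp only: c mult.assoc)
      also have "\<dots> = ?P * (x (s - 1) * (sq (cov a N y) * R))"
        by (simp only: Py[symmetric] c mult.assoc)
      finally show ?thesis by (simp add: \<rho> mult.assoc)
    qed
    ultimately show ?thesis
      using pos_top_add[OF first] by (simp add: p(4) R_def distrib_right)
  qed
  then show "pos_top a N ((x s + ?P * x (s - 1)) * sq_prod a N (N - a - s) \<psi>)"
    by (simp add: k_def)
qed

section \<open>The exponential of a (1,1)-form acting on a family of forms\<close>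

definition exp_conv :: "extalg \<Rightarrow> (nat \<Rightarrow> extalg) \<Rightarrow> nat \<Rightarrow> extalg" where
  "exp_conv W x s = (\<Sum>j\<le>s. cst (1 / fact j) * (W ^ j * x (s - j)))"

lemma bideg_exp_conv:
  assumes "bideg 1 1 W" "\<And>s. bideg s s (x s)"
  shows "bideg s s (exp_conv W x s)"
  unfolding exp_conv_def
proof (intro bideg_sum bideg_cst_mult)
  fix j assume "j \<in> {..s}"
  then show "bideg s s (W ^ j * x (s - j))"
    using bideg_mult[OF bideg_power[OF assms(1), of j] assms(2)[of "s - j"]] by simp
qed

lemma supported_exp_conv:
  "supported S W \<Longrightarrow> (\<And>s. supported S (x s)) \<Longrightarrow> supported S (exp_conv W x s)"
  unfolding exp_conv_def by (intro supported_sum supported_cst_mult supported_mult supported_power)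

lemma econj_exp_conv:
  "econj W = W \<Longrightarrow> (\<And>s. econj (x s) = x s) \<Longrightarrow> econj (exp_conv W x s) = exp_conv W x s"
  by (simp add: exp_conv_def conj_sum conj_mult conj_power)

text \<open>In the binomial expansion all terms with two factors \<open>P\<close> vanish. The factor
  \<open>Suc j\<close> of the remaining mixed term will turn 1/(j+1)! into 1/j!, which is why the
  exponential of P + W is 1 + P times the exponential of W.\<close>

lemma power_add_square_zero:
  fixes P W :: extalg
  assumes "P * P = 0" "P * W = W * P"
  shows "(P + W) ^ Suc j = W ^ Suc j + of_nat (Suc j) * (P * W ^ j)"
proof (induction j)
  case (Suc j)
  have c: "W ^ j * P = P * W ^ j" by (simp add: assms(2) power_commuting_commutes)
  have c': "of_nat (Suc j) * (P * W ^ j) * P = 0"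
    by (simp only: mult.assoc c) (simp add: assms(1) flip: mult.assoc)
  have "(P + W) ^ Suc (Suc j) = (P + W) ^ Suc j * (P + W)" by (simp only: power_Suc2)
  also have "\<dots> = W ^ Suc j * P + W ^ Suc j * W + (of_nat (Suc j) * (P * W ^ j) * P +
      of_nat (Suc j) * (P * W ^ j) * W)"
    unfolding Suc by (simp only: distrib_left distrib_right) (simp only: add.assoc add.commute add.left_commute)
  also have "\<dots> = W ^ Suc (Suc j) + (P * W ^ Suc j + of_nat (Suc j) * (P * W ^ Suc j))"
    unfolding c' by (simp only: power_Suc2 mult.assoc c assms(2)[symmetric]) (simp add: c flip: mult.assoc)
  also have "P * W ^ Suc j + of_nat (Suc j) * (P * W ^ Suc j) = of_nat (Suc (Suc j)) * (P * W ^ Suc j)"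
    by (simp add: distrib_right)
  finally show ?case .
qed simp

lemma exp_conv_add:
  assumes "P * P = 0" "\<And>y. P * y = y * P"
  shows "exp_conv (P + W) x (Suc t) = exp_conv W x (Suc t) + P * exp_conv W x t"
proof -
  have e: "cst (1 / fact (Suc j)) * ((P + W) ^ Suc j * z) =
      cst (1 / fact (Suc j)) * (W ^ Suc j * z) + P * (cst (1 / fact j) * (W ^ j * z))" for j z
  proof -
    have "cst (1 / fact (Suc j)) * (of_nat (Suc j) * (P * W ^ j) * z) =
        cst (1 / fact (Suc j) * of_nat (Suc j)) * (P * (W ^ j * z))"
      by (simp only: cst_mult cst_of_nat mult.assoc)
    also have "1 / fact (Suc j) * of_nat (Suc j) = (1 / fact j :: complex)"
      by (simp add: field_simps del: of_nat_Suc)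
    finally show ?thesis
      unfolding power_add_square_zero[OF assms(1) assms(2)]
      by (simp only: distrib_left distrib_right cst_left_commute[of P])
  qed
  show ?thesis
    unfolding exp_conv_def sum.atMost_Suc_shift
    by (simp only: e sum.distrib sum_distrib_left diff_Suc_Suc power_0) simp
qed

text \<open>Coordinates are added from the last one of X down to the first. Each raises the least
  admissible index by one, since the summand containing the square of the new covector uses the
  index s - 1; after m coordinates the bound q has become m + q.\<close>

lemma trans_form_exp_conv:
  fixes x :: "nat \<Rightarrow> extalg" and \<theta> :: "nat \<Rightarrow> nat \<Rightarrow> complex"
  assumes mN: "m \<le> N" and \<theta>: "\<And>b. b < m \<Longrightarrow> \<theta> b b \<noteq> 0"
    and supp: "\<And>s. supported (coframe_range m N) (x s)" and bi: "\<And>s. bideg s s (x s)"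
    and tr: "\<And>s. q \<le> s \<Longrightarrow> s \<le> N - m \<Longrightarrow> trans_form m N s (x s)"
    and "a \<le> m" "q + (m - a) \<le> s" "s \<le> N - a"
  shows "trans_form a N s (exp_conv (\<Sum>b\<in>{a..<m}. sq (cov b N (\<theta> b))) x s)"
  using assms(6-8)
proof (induction "m - a" arbitrary: a s)
  case 0
  then have "a = m" by simp
  moreover have "exp_conv 0 x s = x s"
    unfolding exp_conv_def by (subst sum.remove[of _ 0]) (auto simp: power_0_left)
  ultimately show ?case using 0 tr[of s] by auto
next
  case (Suc d)
  then have a: "a < m" "d = m - Suc a" by auto
  let ?W = "\<Sum>b\<in>{Suc a..<m}. sq (cov b N (\<theta> b))"
  let ?P = "sq (cov a N (\<theta> a))"
  have W: "(\<Sum>b\<in>{a..<m}. sq (cov b N (\<theta> b))) = ?P + ?W"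
    using a by (simp add: sum.atLeast_Suc_lessThan)
  obtain t where t: "s = Suc t" using Suc.prems a by (cases s) auto
  have e: "exp_conv (?P + ?W) x s = exp_conv ?W x s + ?P * exp_conv ?W x (s - 1)"
    unfolding t diff_Suc_1
    by (rule exp_conv_add) (rule sq_mult_sq_self[OF bideg_cov] sq_commute[OF bideg_cov])+
  show ?case
    unfolding W e
  proof (rule trans_form_step[where q = "q + (m - Suc a)"])
    show "supported (coframe_range (Suc a) N) (exp_conv ?W x s)" for s
    proof (intro supported_exp_conv supported_sum supported_sq)
      show "supported (coframe_range (Suc a) N) (cov b N (\<theta> b))" if "b \<in> {Suc a..<m}" for b
        using that by (intro supported_mono[OF supported_cov] coframe_range_mono) auto
      show "supported (coframe_range (Suc a) N) (x s)" for s
        using a by (intro supported_mono[OF supp] coframe_range_mono) auto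
    qed
    show "bideg s s (exp_conv ?W x s)" for s
      by (intro bideg_exp_conv bideg_sum bideg_sq bideg_cov bi)
    show "trans_form (Suc a) N s (exp_conv ?W x s)"
      if "q + (m - Suc a) \<le> s" "s \<le> N - Suc a" for s
      using a that by (intro Suc.hyps(1)) auto
  qed (use a mN \<theta> Suc.prems in auto)
qed

section \<open>Hermitian matrices and (1,1)-forms\<close>

text \<open>The Cholesky decomposition: split off the first column divided by the root of the pivot
  and continue with the Schur complement. Triangularity is the point: the b-th covector starts with
  the coordinate b and has a nonzero coefficient there, as the addition of coordinates one at a time
  requires.\<close>

lemma hermitian_cholesky:
  fixes h :: "nat \<Rightarrow> nat \<Rightarrow> complex"
  assumes "a \<le> M"
    and "\<And>j k. j \<in> {a..<M} \<Longrightarrow> k \<in> {a..<M} \<Longrightarrow> h j k = cnj (h k j)"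
    and "\<And>v. \<exists>i\<in>{a..<M}. v i \<noteq> 0 \<Longrightarrow>
      \<exists>r::real. r > 0 \<and> (\<Sum>j\<in>{a..<M}. \<Sum>k\<in>{a..<M}. h j k * v j * cnj (v k)) = of_real r"
  shows "\<exists>\<theta>. (\<forall>b\<in>{a..<M}. \<theta> b b \<noteq> 0 \<and> (\<forall>i<b. \<theta> b i = 0)) \<and>
    (\<forall>j\<in>{a..<M}. \<forall>k\<in>{a..<M}. h j k = (\<Sum>b\<in>{a..<M}. \<theta> b j * cnj (\<theta> b k)))"
  using assms
proof (induction "M - a" arbitrary: a h)
  case 0
  then show ?case by simp
next
  case (Suc d)
  from Suc.hyps(2) have a: "a < M" "d = M - Suc a" by auto
  have split: "{a..<M} = insert a {Suc a..<M}" using a by auto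
  have s1: "(\<Sum>j\<in>{a..<M}. f j) = f a + (\<Sum>j\<in>{Suc a..<M}. f j)" for f :: "nat \<Rightarrow> complex"
    using a by (simp add: sum.atLeast_Suc_lessThan)
  obtain r :: real where r: "r > 0" "h a a = of_real r"
  proof -
    define v :: "nat \<Rightarrow> complex" where "v i = (if i = a then 1 else 0)" for i
    have "\<exists>r::real. r > 0 \<and> (\<Sum>j\<in>{a..<M}. \<Sum>k\<in>{a..<M}. h j k * v j * cnj (v k)) = of_real r"
      using a by (intro Suc.prems) (auto simp: v_def)
    moreover have "(\<Sum>j\<in>{a..<M}. \<Sum>k\<in>{a..<M}. h j k * v j * cnj (v k)) = h a a"
      unfolding s1 by (simp add: v_def)
    ultimately show ?thesis using that by auto
  qed
  define \<theta>a where "\<theta>a j = (if j < a then 0 else h j a / of_real (sqrt r))" for j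
  have ta: "\<theta>a a = of_real (sqrt r)"
    using r by (simp add: \<theta>a_def field_simps flip: of_real_mult)
  then have ta0: "\<theta>a a \<noteq> 0" using r by simp
  define h' where "h' j k = h j k - \<theta>a j * cnj (\<theta>a k)" for j k
  have ha: "h' a k = 0" "h' k a = 0" if "k \<in> {a..<M}" for k
  proof -
    have "\<theta>a a * cnj (\<theta>a k) = cnj (h k a)" "\<theta>a k * cnj (\<theta>a a) = h k a"
      using that r unfolding ta by (auto simp: \<theta>a_def)
    then show "h' a k = 0" "h' k a = 0"
      using Suc.prems(2)[of a k] that a by (simp_all add: h'_def)
  qed
  have "\<exists>\<theta>. (\<forall>b\<in>{Suc a..<M}. \<theta> b b \<noteq> 0 \<and> (\<forall>i<b. \<theta> b i = 0)) \<and>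
    (\<forall>j\<in>{Suc a..<M}. \<forall>k\<in>{Suc a..<M}. h' j k = (\<Sum>b\<in>{Suc a..<M}. \<theta> b j * cnj (\<theta> b k)))"
  proof (rule Suc.hyps(1)[OF a(2)])
    show "h' j k = cnj (h' k j)" if "j \<in> {Suc a..<M}" "k \<in> {Suc a..<M}" for j k
      using Suc.prems(2)[of j k] that by (simp add: h'_def mult.commute)
    fix v :: "nat \<Rightarrow> complex" assume v: "\<exists>i\<in>{Suc a..<M}. v i \<noteq> 0"
    \<comment> \<open>The first entry is chosen such that the split-off covector vanishes on
      \<open>v'\<close>; the value of \<open>h\<close> at \<open>v'\<close> is then that of the
      Schur complement at \<open>v\<close>.\<close>
    define v' where "v' = v(a := - (\<Sum>j\<in>{Suc a..<M}. \<theta>a j * v j) / \<theta>a a)"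
    have v'_eq: "v' j = v j" if "j \<in> {Suc a..<M}" for j using that by (simp add: v'_def)
    have z: "(\<Sum>j\<in>{a..<M}. \<theta>a j * v' j) = 0"
    proof -
      have "(\<Sum>j\<in>{Suc a..<M}. \<theta>a j * v' j) = (\<Sum>j\<in>{Suc a..<M}. \<theta>a j * v j)"
        by (intro sum.cong) (auto simp: v'_eq)
      then show ?thesis unfolding s1 using ta0 by (simp add: v'_def)
    qed
    have "\<exists>i\<in>{a..<M}. v' i \<noteq> 0" using v v'_eq split by fastforce
    then obtain r' :: real where r': "r' > 0"
      "(\<Sum>j\<in>{a..<M}. \<Sum>k\<in>{a..<M}. h j k * v' j * cnj (v' k)) = of_real r'"
      using Suc.prems(3)[of v'] by blast
    have "(\<Sum>j\<in>{a..<M}. \<Sum>k\<in>{a..<M}. h j k * v' j * cnj (v' k)) =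
        (\<Sum>j\<in>{a..<M}. \<Sum>k\<in>{a..<M}. h' j k * v' j * cnj (v' k)) +
        (\<Sum>j\<in>{a..<M}. \<theta>a j * v' j) * cnj (\<Sum>k\<in>{a..<M}. \<theta>a k * v' k)"
      unfolding cnj_sum sum_product sum.distrib[symmetric]
      by (intro sum.cong refl) (simp add: h'_def algebra_simps)
    also have "\<dots> = (\<Sum>j\<in>{a..<M}. \<Sum>k\<in>{a..<M}. h' j k * v' j * cnj (v' k))"
      unfolding z by simp
    also have "\<dots> = (\<Sum>j\<in>{Suc a..<M}. \<Sum>k\<in>{Suc a..<M}. h' j k * v j * cnj (v k))"
    proof -
      have "(\<Sum>k\<in>{a..<M}. h' a k * v' a * cnj (v' k)) = 0"
        by (intro sum.neutral) (auto simp: ha)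
      moreover have "(\<Sum>k\<in>{a..<M}. h' j k * v' j * cnj (v' k)) =
          (\<Sum>k\<in>{Suc a..<M}. h' j k * v j * cnj (v k))" if "j \<in> {Suc a..<M}" for j
        unfolding s1 using ha(2)[of j] that by (auto simp: v'_eq intro!: sum.cong)
      ultimately show ?thesis by (subst s1) simp
    qed
    finally show "\<exists>r::real. r > 0 \<and>
        (\<Sum>j\<in>{Suc a..<M}. \<Sum>k\<in>{Suc a..<M}. h' j k * v j * cnj (v k)) = of_real r"
      using r' by metis
  qed (use a in auto)
  then obtain \<theta> where \<theta>: "\<forall>b\<in>{Suc a..<M}. \<theta> b b \<noteq> 0 \<and> (\<forall>i<b. \<theta> b i = (0::complex))"
    "\<forall>j\<in>{Suc a..<M}. \<forall>k\<in>{Suc a..<M}. h' j k = (\<Sum>b\<in>{Suc a..<M}. \<theta> b j * cnj (\<theta> b k))"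
    by blast
  define \<theta>' where "\<theta>' = \<theta>(a := \<theta>a)"
  show ?case
  proof (intro exI[of _ \<theta>'] conjI ballI)
    fix b assume "b \<in> {a..<M}"
    then show "\<theta>' b b \<noteq> 0" "\<forall>i<b. \<theta>' b i = 0"
      using \<theta>(1) ta0 by (auto simp: \<theta>'_def \<theta>a_def split)
  next
    fix j k assume jk: "j \<in> {a..<M}" "k \<in> {a..<M}"
    have "h' j k = (\<Sum>b\<in>{Suc a..<M}. \<theta> b j * cnj (\<theta> b k))"
    proof (cases "j = a \<or> k = a")
      case True
      then have "(\<Sum>b\<in>{Suc a..<M}. \<theta> b j * cnj (\<theta> b k)) = 0"
        using \<theta>(1) by (intro sum.neutral) (auto simp: Suc_le_eq)
      then show ?thesis using True ha jk by auto
    next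
      case False
      then show ?thesis using \<theta>(2) jk by (auto simp: split)
    qed
    then show "h j k = (\<Sum>b\<in>{a..<M}. \<theta>' b j * cnj (\<theta>' b k))"
      unfolding s1 by (simp add: \<theta>'_def h'_def algebra_simps)
  qed
qed

lemma gen_Dz_mult_gen_Dzbar: "gen (Dz j) * gen (Dzbar k) = mon {Dz j, Dzbar k}"
proof -
  have "shuffle_sign {Dz j} {Dzbar k} = 1"
    by (rule shuffle_sign_ordered) (auto simp: less_imp_le)
  then show ?thesis unfolding gen_def by (subst mon_mult) (auto simp: insert_commute)
qed

text \<open>The same normalization i/2 as in \<open>positive_11\<close> and in \<open>sq\<close>, so
  that the square of a covector has the matrix \<open>\<theta> j * cnj (\<theta> k)\<close> of rank
  one.\<close>

definition form_11 :: "nat \<Rightarrow> (nat \<Rightarrow> nat \<Rightarrow> complex) \<Rightarrow> extalg" where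
  "form_11 n h = (\<Sum>j<n. \<Sum>k<n. cst (\<i> / 2 * h j k) * (gen (Dz j) * gen (Dzbar k)))"

lemma coef_form_11: "j < n \<Longrightarrow> k < n \<Longrightarrow> coef (form_11 n h) {Dz j, Dzbar k} = \<i> / 2 * h j k"
proof -
  assume jk: "j < n" "k < n"
  have "coef (form_11 n h) {Dz j, Dzbar k} =
      (\<Sum>j'<n. \<Sum>k'<n. if j' = j then (if k' = k then \<i> / 2 * h j k else 0) else 0)"
    unfolding form_11_def coef_sum
    by (intro sum.cong refl) (auto simp: gen_Dz_mult_gen_Dzbar coef_mon doubleton_eq_iff)
  also have "\<dots> = (\<Sum>j'<n. if j' = j then (\<Sum>k'<n. if k' = k then \<i> / 2 * h j k else 0) else 0)"
    by (intro sum.cong) auto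
  finally show ?thesis using jk by (simp add: sum.delta)
qed

lemma supported_form_11: "supported (coframe_range 0 n) (form_11 n h)"
  unfolding form_11_def
  by (intro supported_sum supported_cst_mult supported_mult supported_gen) auto

lemma bideg_form_11: "bideg 1 1 (form_11 n h)"
  unfolding form_11_def
  using bideg_mult[OF bideg_gen_Dz bideg_gen_Dzbar]
  by (intro bideg_sum bideg_cst_mult) simp

lemma eq_if_coef_11_eq:
  assumes "supported (coframe_range 0 n) x" "bideg 1 1 x"
    and "supported (coframe_range 0 n) y" "bideg 1 1 y"
    and "\<And>j k. j < n \<Longrightarrow> k < n \<Longrightarrow> coef x {Dz j, Dzbar k} = coef y {Dz j, Dzbar k}"
  shows "x = y"
proof (rule extalg_eqI, rule ccontr)
  fix K assume "coef x K \<noteq> coef y K"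
  then have "coef x K \<noteq> 0 \<or> coef y K \<noteq> 0" by auto
  then have K: "K \<subseteq> coframe_range 0 n" "card {i. Dz i \<in> K} = 1" "card {i. Dzbar i \<in> K} = 1"
    using assms(1-4) by (auto simp: supported_def has_bidegree_def hol_degree_def antihol_degree_def)
  then obtain j k where jk: "{i. Dz i \<in> K} = {j}" "{i. Dzbar i \<in> K} = {k}"
    by (auto simp: card_1_singleton_iff One_nat_def)
  then have "Dz j \<in> K" "Dzbar k \<in> K" by auto
  then have lt: "j < n" "k < n" using K(1) by auto
  have "K = {Dz j, Dzbar k}" using coframe_set_split[of K] jk by auto
  then show False using assms(5)[OF lt] \<open>coef x K \<noteq> coef y K\<close> by simp
qed

lemma sq_cov_eq_form_11: "sq (cov 0 n \<theta>) = form_11 n (\<lambda>j k. \<theta> j * cnj (\<theta> k))"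
proof -
  have "sq (cov 0 n \<theta>) = cst (\<i> / 2) * ((\<Sum>j<n. cst (\<theta> j) * gen (Dz j)) *
      (\<Sum>k<n. cst (cnj (\<theta> k)) * gen (Dzbar k)))"
    by (simp add: sq_def cov_def conj_sum conj_mult atLeast0LessThan)
  also have "\<dots> = form_11 n (\<lambda>j k. \<theta> j * cnj (\<theta> k))"
    by (simp only: cst_linear_combination_mult form_11_def) (simp only: sum_distrib_left cst_mult_left)
  finally show ?thesis .
qed

lemma form_11_sum: "(\<Sum>b\<in>B. form_11 n (h b)) = form_11 n (\<lambda>j k. \<Sum>b\<in>B. h b j k)"
  unfolding form_11_def
  by (subst sum.swap, intro sum.cong refl, subst sum.swap, intro sum.cong refl)
    (simp only: sum_distrib_left sum_distrib_right cst_sum)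

lemma form_11_cong:
  "(\<And>j k. j < n \<Longrightarrow> k < n \<Longrightarrow> h j k = h' j k) \<Longrightarrow> form_11 n h = form_11 n h'"
  unfolding form_11_def by (intro sum.cong) auto

lemma positive_form_11_decomposition:
  assumes "\<And>j k. j < n \<Longrightarrow> k < n \<Longrightarrow> h j k = cnj (h k j)"
    and "\<And>v. \<exists>i<n. v i \<noteq> 0 \<Longrightarrow>
      \<exists>r::real. r > 0 \<and> (\<Sum>j<n. \<Sum>k<n. h j k * v j * cnj (v k)) = of_real r"
  shows "\<exists>\<theta>. (\<forall>b<n. \<theta> b b \<noteq> 0) \<and> form_11 n h = (\<Sum>b<n. sq (cov b n (\<theta> b)))"
proof -
  have "\<exists>\<theta>. (\<forall>b\<in>{0..<n}. \<theta> b b \<noteq> 0 \<and> (\<forall>i<b. \<theta> b i = 0)) \<and>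
    (\<forall>j\<in>{0..<n}. \<forall>k\<in>{0..<n}. h j k = (\<Sum>b\<in>{0..<n}. \<theta> b j * cnj (\<theta> b k)))"
  proof (rule hermitian_cholesky)
    show "h j k = cnj (h k j)" if "j \<in> {0..<n}" "k \<in> {0..<n}" for j k
      using that by (intro assms(1)) auto
    show "\<exists>r::real. r > 0 \<and> (\<Sum>j\<in>{0..<n}. \<Sum>k\<in>{0..<n}. h j k * v j * cnj (v k)) = of_real r"
      if "\<exists>i\<in>{0..<n}. v i \<noteq> 0" for v
      using that unfolding atLeast0LessThan by (intro assms(2)) auto
  qed simp
  then obtain \<theta> where \<theta>': "\<forall>b\<in>{0..<n}. \<theta> b b \<noteq> 0 \<and> (\<forall>i<b. \<theta> b i = (0::complex))"
    "\<forall>j\<in>{0..<n}. \<forall>k\<in>{0..<n}. h j k = (\<Sum>b\<in>{0..<n}. \<theta> b j * cnj (\<theta> b k))"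
    by blast
  have \<theta>: "\<theta> b b \<noteq> 0" "i < b \<Longrightarrow> \<theta> b i = 0" if "b < n" for b i
    using \<theta>'(1) that by auto
  have \<theta>_eq: "h j k = (\<Sum>b<n. \<theta> b j * cnj (\<theta> b k))" if "j < n" "k < n" for j k
    using \<theta>'(2) that by (simp add: atLeast0LessThan)
  have "form_11 n h = form_11 n (\<lambda>j k. \<Sum>b<n. \<theta> b j * cnj (\<theta> b k))"
    by (intro form_11_cong \<theta>_eq)
  also have "\<dots> = (\<Sum>b<n. sq (cov 0 n (\<theta> b)))"
    by (simp add: form_11_sum[symmetric] sq_cov_eq_form_11)
  \<comment> \<open>Entries left of the diagonal vanish, so each covector may be read over the range
    starting at its own pivot, the shape in which coordinates are added.\<close>
  also have "\<dots> = (\<Sum>b<n. sq (cov b n (\<theta> b)))"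
  proof (intro sum.cong refl arg_cong[where f = sq])
    fix b assume "b \<in> {..<n}"
    then show "cov 0 n (\<theta> b) = cov b n (\<theta> b)"
      unfolding cov_def by (intro sum.mono_neutral_right) (auto simp: \<theta>(2))
  qed
  finally show ?thesis using \<theta>(1) by blast
qed

theorem trans_form_exp_conv_positive_11:
  fixes x :: "nat \<Rightarrow> extalg"
  assumes W: "positive_11 m (coef W)"
    and supp: "\<And>s. supported (coframe_range m (m + n)) (x s)" and bi: "\<And>s. bideg s s (x s)"
    and tr: "\<And>s. q \<le> s \<Longrightarrow> s \<le> n \<Longrightarrow> trans_form m (m + n) s (x s)"
    and s: "m + q \<le> s" "s \<le> m + n"
  shows "trans_form 0 (m + n) s (exp_conv W x s)"
proof -
  define h where "h j k = 2 / \<i> * coef W {Dz j, Dzbar k}" for j k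
  have W': "supported (coframe_range 0 m) W" "bideg 1 1 W" "econj W = W"
    using W by (simp_all add: positive_11_def ext_on_iff ext_real_iff)
  have herm: "h j k = cnj (h k j)" for j k
  proof -
    have b: "bar ` {Dz j, Dzbar k} = {Dz k, Dzbar j}" by auto
    have d: "hol_degree {Dz j, Dzbar k} = 1" "antihol_degree {Dz j, Dzbar k} = 1"
      by (simp_all add: hol_degree_def antihol_degree_def)
    have "coef W {Dz j, Dzbar k} = ext_cnj (coef W) {Dz j, Dzbar k}"
      using coef_conj[of W] W'(3) by simp
    \<comment> \<open>The sign of conjugation in bidegree (1,1) will cancel the one from conjugating
      the factor 2/i.\<close>
    also have "\<dots> = - cnj (coef W {Dz k, Dzbar j})"
      unfolding ext_cnj_def b d by simp
    finally have "coef W {Dz j, Dzbar k} = - cnj (coef W {Dz k, Dzbar j})" .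
    then show ?thesis by (simp add: h_def)
  qed
  have "\<exists>\<theta>. (\<forall>b<m. \<theta> b b \<noteq> 0) \<and> form_11 m h = (\<Sum>b<m. sq (cov b m (\<theta> b)))"
  proof (rule positive_form_11_decomposition)
    show "h j k = cnj (h k j)" for j k by (rule herm)
    show "\<exists>r::real. r > 0 \<and> (\<Sum>j<m. \<Sum>k<m. h j k * v j * cnj (v k)) = of_real r"
      if "\<exists>i<m. v i \<noteq> 0" for v
      using W that unfolding positive_11_def h_def by blast
  qed
  then obtain \<theta> where \<theta>: "\<And>b. b < m \<Longrightarrow> \<theta> b b \<noteq> 0"
    and \<theta>_eq: "form_11 m h = (\<Sum>b<m. sq (cov b m (\<theta> b)))"
    by blast
  have "W = form_11 m h"
    using W'(1,2) supported_form_11 bideg_form_11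
    by (rule eq_if_coef_11_eq) (simp add: coef_form_11 h_def)
  \<comment> \<open>The covectors of X are extended by zero to the coordinates of Y, because the
    upper end of the range stays at m + n while the coordinates of X are added.\<close>
  also have "\<dots> = (\<Sum>b\<in>{0..<m}. sq (cov b (m + n) (\<lambda>i. if i < m then \<theta> b i else 0)))"
    unfolding \<theta>_eq atLeast0LessThan
  proof (intro sum.cong refl arg_cong[where f = sq])
    fix b assume "b \<in> {..<m}"
    have "cov b (m + n) (\<lambda>i. if i < m then \<theta> b i else 0) =
        (\<Sum>i\<in>{b..<m}. cst (if i < m then \<theta> b i else 0) * gen (Dz i))"
      unfolding cov_def by (intro sum.mono_neutral_right) auto
    then show "cov b m (\<theta> b) = cov b (m + n) (\<lambda>i. if i < m then \<theta> b i else 0)"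
      by (auto simp: cov_def intro!: sum.cong)
  qed
  finally have W_eq: "W = (\<Sum>b\<in>{0..<m}. sq (cov b (m + n) (\<lambda>i. if i < m then \<theta> b i else 0)))" .
  show ?thesis
    unfolding W_eq by (rule trans_form_exp_conv[where q = q]) (use \<theta> supp bi tr s in auto)
qed

section \<open>Smooth functions\<close>

text \<open>An open set of \<open>Cn n\<close> is only relatively open among all sequences; lines in
  a direction \<open>j < n\<close> stay in \<open>Cn n\<close>, which makes the derivatives at a
  point of \<open>V\<close> depend on values in \<open>V\<close> alone.\<close>

lemma eventually_coordinate_line:
  assumes "open_Cn n V" "z \<in> V" "j < n"
  shows "\<forall>\<^sub>F x in nhds (z j). z(j := x) \<in> V"
proof -
  obtain U where U: "open U" "V = Cn n \<inter> U"
    using assms(1) unfolding open_Cn_def openin_open by blast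
  have c: "continuous_on UNIV (\<lambda>x. z(j := x))"
  proof (rule continuous_on_coordinatewise_then_product)
    fix i
    show "continuous_on UNIV (\<lambda>x. (z(j := x)) i)"
      by (cases "i = j") auto
  qed
  have "open ((\<lambda>x. z(j := x)) -` U)"
    using U(1) c by (rule open_vimage)
  moreover have "z j \<in> (\<lambda>x. z(j := x)) -` U" using assms U by simp
  moreover have "z(j := x) \<in> Cn n" for x using assms U by (auto simp: Cn_def)
  ultimately show ?thesis
    unfolding eventually_nhds U(2) by (intro exI[of _ "(\<lambda>x. z(j := x)) -` U"]) auto
qed

lemma eventually_along:
  assumes "open_Cn n V" "z \<in> V" "j < n"
  shows "\<forall>\<^sub>F t in nhds 0. z(j := z j + of_real t * u) \<in> V"
proof -
  have "filterlim (\<lambda>t. z j + of_real t * u) (nhds (z j + of_real 0 * u)) (nhds (0::real))"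
    by (intro tendsto_add tendsto_const tendsto_mult tendsto_of_real filterlim_ident)
  then have "filterlim (\<lambda>t. z j + of_real t * u) (nhds (z j)) (nhds (0::real))" by simp
  then show ?thesis
    using eventually_coordinate_line[OF assms] eventually_compose_filterlim by fast
qed

section \<open>Calculus rules for partial derivatives\<close>

lemma along_0 [simp]: "along u j f z 0 = f z"
  by (simp add: along_def)

lemma along_has_vector_derivative:
  "along u j f z differentiable (at 0) \<Longrightarrow>
   (along u j f z has_vector_derivative partial u j f z) (at 0)"
  by (simp add: partial_def vector_derivative_works[symmetric])

lemma along_has_vector_derivative_cong:
  assumes "open_Cn n V" "z \<in> V" "j < n" "\<And>x. x \<in> V \<Longrightarrow> f x = g x"
  shows "(along u j f z has_vector_derivative d) (at 0) \<longleftrightarrow>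
         (along u j g z has_vector_derivative d) (at 0)"
proof (rule has_vector_derivative_cong_ev)
  show "\<forall>\<^sub>F t in nhds 0. t \<in> UNIV \<longrightarrow> along u j f z t = along u j g z t"
    using eventually_along[OF assms(1-3), of u] by eventually_elim (simp add: along_def assms(4))
qed (simp add: assms)

lemma along_differentiable_cong:
  assumes "open_Cn n V" "z \<in> V" "j < n" "\<And>x. x \<in> V \<Longrightarrow> f x = g x"
    and "along u j f z differentiable (at 0)"
  shows "along u j g z differentiable (at 0)"
proof (rule differentiableI_vector)
  show "(along u j g z has_vector_derivative partial u j f z) (at 0)"
    using along_has_vector_derivative[OF assms(5)]
      along_has_vector_derivative_cong[of n V z j f g u "partial u j f z"] assms(1-4) by blast
qed

lemma partial_cong:
  assumes "open_Cn n V" "z \<in> V" "j < n" "\<And>x. x \<in> V \<Longrightarrow> f x = g x"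
  shows "partial u j f z = partial u j g z"
  unfolding partial_def vector_derivative_def
  using along_has_vector_derivative_cong[of n V z j f g u] assms by simp

lemma partial_const: "partial u j (\<lambda>_. c) z = 0"
  unfolding partial_def along_def by simp

lemma along_const: "along u j (\<lambda>_. c) z differentiable (at 0)"
  by (simp add: along_def[abs_def])

lemma along_add:
  assumes "along u j f z differentiable (at 0)" "along u j g z differentiable (at 0)"
  shows "along u j (\<lambda>x. f x + g x) z differentiable (at 0)"
    and "partial u j (\<lambda>x. f x + g x) z = partial u j f z + partial u j g z"
proof -
  have "((\<lambda>t. along u j f z t + along u j g z t) has_vector_derivative (partial u j f z + partial u j g z)) (at 0)"
    by (intro has_vector_derivative_add along_has_vector_derivative assms)
  then have d: "(along u j (\<lambda>x. f x + g x) z has_vector_derivative (partial u j f z + partial u j g z)) (at 0)"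
    by (simp add: along_def[abs_def])
  show "along u j (\<lambda>x. f x + g x) z differentiable (at 0)" using d by (rule differentiableI_vector)
  show "partial u j (\<lambda>x. f x + g x) z = partial u j f z + partial u j g z"
    unfolding partial_def[of u j "\<lambda>x. f x + g x"] using d by (rule vector_derivative_at)
qed

lemma along_mult:
  assumes "along u j f z differentiable (at 0)" "along u j g z differentiable (at 0)"
  shows "along u j (\<lambda>x. f x * g x) z differentiable (at 0)"
    and "partial u j (\<lambda>x. f x * g x) z = f z * partial u j g z + partial u j f z * g z"
proof -
  have "((\<lambda>t. along u j f z t * along u j g z t) has_vector_derivative
      (along u j f z 0 * partial u j g z + partial u j f z * along u j g z 0)) (at 0)"
    by (intro has_vector_derivative_mult along_has_vector_derivative assms)
  then have d: "(along u j (\<lambda>x. f x * g x) z has_vector_derivative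
      (f z * partial u j g z + partial u j f z * g z)) (at 0)"
    unfolding along_0 by (simp add: along_def[abs_def])
  show "along u j (\<lambda>x. f x * g x) z differentiable (at 0)" using d by (rule differentiableI_vector)
  show "partial u j (\<lambda>x. f x * g x) z = f z * partial u j g z + partial u j f z * g z"
    unfolding partial_def[of u j "\<lambda>x. f x * g x"] using d by (rule vector_derivative_at)
qed

lemma along_powr:
  assumes "along u j f z differentiable (at 0)" "f z \<notin> \<real>\<^sub>\<le>\<^sub>0"
  shows "along u j (\<lambda>x. f x powr a) z differentiable (at 0)"
    and "partial u j (\<lambda>x. f x powr a) z = partial u j f z * (a * f z powr (a - 1))"
proof -
  have "((\<lambda>w. w powr a) \<circ> along u j f z has_vector_derivative
      (partial u j f z * (a * f z powr (a - 1)))) (at 0)"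
    using assms
    by (intro field_vector_diff_chain_at along_has_vector_derivative)
      (simp_all add: has_field_derivative_powr)
  then have d: "(along u j (\<lambda>x. f x powr a) z has_vector_derivative
      (partial u j f z * (a * f z powr (a - 1)))) (at 0)"
    by (simp add: along_def[abs_def] o_def)
  show "along u j (\<lambda>x. f x powr a) z differentiable (at 0)" using d by (rule differentiableI_vector)
  show "partial u j (\<lambda>x. f x powr a) z = partial u j f z * (a * f z powr (a - 1))"
    unfolding partial_def[of u j "\<lambda>x. f x powr a"] using d by (rule vector_derivative_at)
qed

section \<open>Closure properties of functions of class k\<close>

lemma Ck_on_imp_continuous: "Ck_on k n V f \<Longrightarrow> continuous_on V f"
  by (cases k) auto

lemma Ck_on_SucD:
  assumes "Ck_on (Suc k) n V f" "j < n" "u \<in> {1, \<i>}"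
  shows "z \<in> V \<Longrightarrow> along u j f z differentiable (at 0)" "Ck_on k n V (partial u j f)"
  using assms unfolding Ck_on.simps by blast+

lemma Ck_on_SucI:
  assumes "continuous_on V f"
    and "\<And>j u z. j < n \<Longrightarrow> u \<in> {1, \<i>} \<Longrightarrow> z \<in> V \<Longrightarrow> along u j f z differentiable (at 0)"
    and "\<And>j u. j < n \<Longrightarrow> u \<in> {1, \<i>} \<Longrightarrow> Ck_on k n V (partial u j f)"
  shows "Ck_on (Suc k) n V f"
  using assms unfolding Ck_on.simps by blast

lemma Ck_on_Suc_imp: "Ck_on (Suc k) n V f \<Longrightarrow> Ck_on k n V f"
proof (induction k arbitrary: f)
  case (Suc k)
  show ?case
  proof (rule Ck_on_SucI)
    show "continuous_on V f" using Suc.prems by (rule Ck_on_imp_continuous)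
    fix j u assume ju: "j < n" "u \<in> {1, \<i>}"
    show "along u j f z differentiable (at 0)" if "z \<in> V" for z
      using Suc.prems ju that by (rule Ck_on_SucD)
    show "Ck_on k n V (partial u j f)"
      using Suc.prems ju by (intro Suc.IH Ck_on_SucD(2))
  qed
qed (simp add: Ck_on_imp_continuous)

text \<open>The derivatives of sums, products and powers are computed only at points of
  \<open>V\<close>, whereas the recursive definition speaks of the derivative as a function;
  openness of \<open>V\<close> bridges the difference.\<close>

lemma Ck_on_cong:
  assumes "open_Cn n V"
  shows "(\<And>x. x \<in> V \<Longrightarrow> f x = g x) \<Longrightarrow> Ck_on k n V f \<Longrightarrow> Ck_on k n V g"
proof (induction k arbitrary: f g)
  case 0
  then show ?case unfolding Ck_on.simps by (metis continuous_on_cong)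
next
  case (Suc k)
  show ?case
  proof (rule Ck_on_SucI)
    show "continuous_on V g"
      using Suc.prems(1) Ck_on_imp_continuous[OF Suc.prems(2)] by (metis continuous_on_cong)
    fix j u assume ju: "j < n" "u \<in> {1, \<i>}"
    show "along u j g z differentiable at 0" if "z \<in> V" for z
      using assms that ju(1) Suc.prems(1) Ck_on_SucD(1)[OF Suc.prems(2) ju that]
      by (rule along_differentiable_cong)
    show "Ck_on k n V (partial u j g)"
      using partial_cong[OF assms _ ju(1) Suc.prems(1)] Ck_on_SucD(2)[OF Suc.prems(2) ju]
      by (rule Suc.IH)
  qed
qed

lemma Ck_on_const: "Ck_on k n V (\<lambda>_. c)"
proof (induction k arbitrary: c)
  case (Suc k)
  have "partial u j (\<lambda>_. c) = (\<lambda>_. 0)" for u j by (rule ext) (rule partial_const)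
  then show ?case using Suc by (intro Ck_on_SucI) (simp_all add: along_const)
qed simp

lemma Ck_on_add:
  assumes "open_Cn n V"
  shows "Ck_on k n V f \<Longrightarrow> Ck_on k n V g \<Longrightarrow> Ck_on k n V (\<lambda>z. f z + g z)"
proof (induction k arbitrary: f g)
  case 0
  then show ?case by (auto intro: continuous_on_add)
next
  case (Suc k)
  show ?case
  proof (rule Ck_on_SucI)
    show "continuous_on V (\<lambda>z. f z + g z)"
      using Suc.prems by (intro continuous_on_add Ck_on_imp_continuous)
    fix j u assume ju: "j < n" "u \<in> {1, \<i>}"
    note d = Ck_on_SucD(1)[OF Suc.prems(1) ju] Ck_on_SucD(1)[OF Suc.prems(2) ju]
    show "along u j (\<lambda>z. f z + g z) z differentiable at 0" if "z \<in> V" for z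
      using d that by (intro along_add)
    have "Ck_on k n V (\<lambda>z. partial u j f z + partial u j g z)"
      by (rule Suc.IH[OF Ck_on_SucD(2)[OF Suc.prems(1) ju] Ck_on_SucD(2)[OF Suc.prems(2) ju]])
    then show "Ck_on k n V (partial u j (\<lambda>z. f z + g z))"
      by (rule Ck_on_cong[OF assms, rotated]) (simp add: along_add(2) d)
  qed
qed

lemma Ck_on_mult:
  assumes "open_Cn n V"
  shows "Ck_on k n V f \<Longrightarrow> Ck_on k n V g \<Longrightarrow> Ck_on k n V (\<lambda>z. f z * g z)"
proof (induction k arbitrary: f g)
  case 0
  then show ?case by (auto intro: continuous_on_mult)
next
  case (Suc k)
  show ?case
  proof (rule Ck_on_SucI)
    show "continuous_on V (\<lambda>z. f z * g z)"
      using Suc.prems by (intro continuous_on_mult Ck_on_imp_continuous)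
    fix j u assume ju: "j < n" "u \<in> {1, \<i>}"
    note d = Ck_on_SucD(1)[OF Suc.prems(1) ju] Ck_on_SucD(1)[OF Suc.prems(2) ju]
    show "along u j (\<lambda>z. f z * g z) z differentiable at 0" if "z \<in> V" for z
      using d that by (intro along_mult)
    have "Ck_on k n V (\<lambda>z. f z * partial u j g z + partial u j f z * g z)"
      by (rule Ck_on_add[OF assms Suc.IH[OF Ck_on_Suc_imp[OF Suc.prems(1)] Ck_on_SucD(2)[OF Suc.prems(2) ju]]
            Suc.IH[OF Ck_on_SucD(2)[OF Suc.prems(1) ju] Ck_on_Suc_imp[OF Suc.prems(2)]]])
    then show "Ck_on k n V (partial u j (\<lambda>z. f z * g z))"
      by (rule Ck_on_cong[OF assms, rotated]) (simp add: along_mult(2) d)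
  qed
qed

text \<open>The exponent is general in the induction because differentiation lowers it by one.
  Excluding the nonpositive reals keeps the values where the principal branch is
  holomorphic.\<close>

lemma Ck_on_powr:
  assumes "open_Cn n V" "\<And>z. z \<in> V \<Longrightarrow> f z \<notin> \<real>\<^sub>\<le>\<^sub>0"
  shows "Ck_on k n V f \<Longrightarrow> Ck_on k n V (\<lambda>z. f z powr a)"
proof (induction k arbitrary: a)
  have c: "continuous_on V (\<lambda>z. f z powr a)" if "continuous_on V f" for a
  proof (rule continuous_on_powr_complex)
    show "V \<subseteq> {z. 0 \<le> Re (f z) \<or> Im (f z) \<noteq> 0}"
    proof
      fix x assume "x \<in> V"
      then have "\<not> (Re (f x) \<le> 0 \<and> Im (f x) = 0)"
        using assms(2) by (simp add: complex_nonpos_Reals_iff)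
      then show "x \<in> {z. 0 \<le> Re (f z) \<or> Im (f z) \<noteq> 0}" by auto
    qed
    show "0 < Re a" if "z \<in> V" "f z = 0" for z
      using assms(2)[OF that(1)] that(2) by simp
  qed (use that in \<open>auto intro: continuous_intros\<close>)
  {
    case 0
    then show ?case using c by simp
  next
    case (Suc k)
    show ?case
    proof (rule Ck_on_SucI)
      show "continuous_on V (\<lambda>z. f z powr a)"
        using Suc.prems by (intro c Ck_on_imp_continuous)
      fix j u assume ju: "j < n" "u \<in> {1, \<i>}"
      note d = Ck_on_SucD(1)[OF Suc.prems(1) ju]
      show "along u j (\<lambda>z. f z powr a) z differentiable at 0" if "z \<in> V" for z
        using d assms(2) that by (intro along_powr)
      have "Ck_on k n V (\<lambda>z. partial u j f z * (a * f z powr (a - 1)))"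
        by (rule Ck_on_mult[OF assms(1) Ck_on_SucD(2)[OF Suc.prems(1) ju]
              Ck_on_mult[OF assms(1) Ck_on_const Suc.IH[OF Ck_on_Suc_imp[OF Suc.prems(1)]]]])
      then show "Ck_on k n V (partial u j (\<lambda>z. f z powr a))"
        by (rule Ck_on_cong[OF assms(1), rotated]) (simp add: along_powr(2) d assms(2))
    qed
  }
qed

lemma smooth_fun_onD:
  assumes "smooth_fun_on n V f" "j < n" "u \<in> {1, \<i>}"
  shows "z \<in> V \<Longrightarrow> along u j f z differentiable (at 0)" "smooth_fun_on n V (partial u j f)"
  using assms Ck_on_SucD unfolding smooth_fun_on_def by blast+

lemma smooth_fun_on_cong:
  "open_Cn n V \<Longrightarrow> (\<And>x. x \<in> V \<Longrightarrow> f x = g x) \<Longrightarrow> smooth_fun_on n V f \<Longrightarrow> smooth_fun_on n V g"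
  unfolding smooth_fun_on_def using Ck_on_cong by blast

lemma smooth_fun_on_const: "smooth_fun_on n V (\<lambda>_. c)"
  by (simp add: smooth_fun_on_def Ck_on_const)

lemma smooth_fun_on_add:
  "open_Cn n V \<Longrightarrow> smooth_fun_on n V f \<Longrightarrow> smooth_fun_on n V g \<Longrightarrow> smooth_fun_on n V (\<lambda>z. f z + g z)"
  by (simp add: smooth_fun_on_def Ck_on_add)

lemma smooth_fun_on_mult:
  "open_Cn n V \<Longrightarrow> smooth_fun_on n V f \<Longrightarrow> smooth_fun_on n V g \<Longrightarrow> smooth_fun_on n V (\<lambda>z. f z * g z)"
  by (simp add: smooth_fun_on_def Ck_on_mult)

lemma smooth_fun_on_sum:
  assumes "open_Cn n V" "\<And>i. i \<in> A \<Longrightarrow> smooth_fun_on n V (f i)"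
  shows "smooth_fun_on n V (\<lambda>z. \<Sum>i\<in>A. f i z)"
  using assms(2)
  by (induction A rule: infinite_finite_induct)
    (auto intro: smooth_fun_on_add[OF assms(1)] smooth_fun_on_const)

lemma smooth_fun_on_powr:
  "open_Cn n V \<Longrightarrow> (\<And>z. z \<in> V \<Longrightarrow> f z \<notin> \<real>\<^sub>\<le>\<^sub>0) \<Longrightarrow> smooth_fun_on n V f \<Longrightarrow>
   smooth_fun_on n V (\<lambda>z. f z powr a)"
  by (simp add: smooth_fun_on_def Ck_on_powr)

section \<open>The exterior derivatives\<close>

definition smooth_local :: "nat \<Rightarrow> (nat \<Rightarrow> complex) set \<Rightarrow> local_form \<Rightarrow> bool" where
  "smooth_local n V w \<longleftrightarrow> (\<forall>K. smooth_fun_on n V (\<lambda>z. w z K))"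

text \<open>For \<open>\<epsilon> = 1\<close> and \<open>\<epsilon> = -1\<close> these are the two Wirtinger derivatives.\<close>

definition wirt :: "complex \<Rightarrow> nat \<Rightarrow> ((nat \<Rightarrow> complex) \<Rightarrow> complex) \<Rightarrow> (nat \<Rightarrow> complex) \<Rightarrow> complex" where
  "wirt \<epsilon> j f z = (partial 1 j f z - \<epsilon> * (\<i> * partial \<i> j f z)) / 2"

text \<open>Both Dolbeault operators at once: \<open>G\<close> picks the half of the coframe that is
  wedged in, and \<epsilon> the matching derivative.\<close>

definition dolb :: "nat \<Rightarrow> complex \<Rightarrow> (nat \<Rightarrow> coframe_elem) \<Rightarrow> local_form \<Rightarrow> local_form" where
  "dolb n \<epsilon> G w z K = (\<Sum>j<n. wedge (ext_gen (G j)) (\<lambda>L. wirt \<epsilon> j (\<lambda>x. w x L) z) K)"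

lemma del_eq_dolb: "del n = dolb n 1 Dz"
  by (intro ext) (simp add: del_def dolb_def wirtinger_def wirt_def)

lemma delbar_eq_dolb: "delbar n = dolb n (-1) Dzbar"
  by (intro ext) (simp add: delbar_def dolb_def wirtinger_bar_def wirt_def)

lemma wirt_cong:
  assumes "open_Cn n V" "z \<in> V" "j < n" "\<And>x. x \<in> V \<Longrightarrow> f x = g x"
  shows "wirt \<epsilon> j f z = wirt \<epsilon> j g z"
  unfolding wirt_def using partial_cong[OF assms] by simp

lemma wirt_const [simp]: "wirt \<epsilon> j (\<lambda>_. c) z = 0"
  by (simp add: wirt_def partial_const)

lemma wirt_add:
  assumes "smooth_fun_on n V f" "smooth_fun_on n V g" "z \<in> V" "j < n"
  shows "wirt \<epsilon> j (\<lambda>x. f x + g x) z = wirt \<epsilon> j f z + wirt \<epsilon> j g z"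
proof -
  have "partial u j (\<lambda>x. f x + g x) z = partial u j f z + partial u j g z" if "u \<in> {1, \<i>}" for u
    using assms that by (intro along_add smooth_fun_onD)
  then show ?thesis by (simp add: wirt_def field_simps)
qed

lemma wirt_mult:
  assumes "smooth_fun_on n V f" "smooth_fun_on n V g" "z \<in> V" "j < n"
  shows "wirt \<epsilon> j (\<lambda>x. f x * g x) z = wirt \<epsilon> j f z * g z + f z * wirt \<epsilon> j g z"
proof -
  have "partial u j (\<lambda>x. f x * g x) z = f z * partial u j g z + partial u j f z * g z"
    if "u \<in> {1, \<i>}" for u
    using assms that by (intro along_mult smooth_fun_onD)
  then show ?thesis by (simp add: wirt_def field_simps)
qed

lemma wirt_sum:
  assumes "open_Cn n V" "\<And>i. i \<in> A \<Longrightarrow> smooth_fun_on n V (f i)" "z \<in> V" "j < n"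
  shows "wirt \<epsilon> j (\<lambda>x. \<Sum>i\<in>A. f i x) z = (\<Sum>i\<in>A. wirt \<epsilon> j (f i) z)"
  using assms(2)
proof (induction A rule: infinite_finite_induct)
  case (insert i A)
  have "wirt \<epsilon> j (\<lambda>x. f i x + (\<Sum>i\<in>A. f i x)) z = wirt \<epsilon> j (f i) z + wirt \<epsilon> j (\<lambda>x. \<Sum>i\<in>A. f i x) z"
    using insert.prems by (intro wirt_add[OF _ _ assms(3,4)] smooth_fun_on_sum[OF assms(1)]) auto
  then show ?case using insert by simp
qed simp_all

lemma wirt_cmult:
  assumes "smooth_fun_on n V f" "z \<in> V" "j < n"
  shows "wirt \<epsilon> j (\<lambda>x. c * f x) z = c * wirt \<epsilon> j f z"
  using wirt_mult[OF smooth_fun_on_const assms] by simp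

lemma smooth_wirt:
  assumes "open_Cn n V" "smooth_fun_on n V f" "j < n"
  shows "smooth_fun_on n V (wirt \<epsilon> j f)"
proof -
  have "smooth_fun_on n V (\<lambda>z. (1/2) * partial 1 j f z + (- (\<epsilon> * \<i>) / 2) * partial \<i> j f z)"
    using assms by (intro smooth_fun_on_add smooth_fun_on_mult smooth_fun_on_const smooth_fun_onD(2)) auto
  moreover have "(\<lambda>z. (1/2) * partial 1 j f z + (- (\<epsilon> * \<i>) / 2) * partial \<i> j f z) = wirt \<epsilon> j f"
    by (rule ext) (simp add: wirt_def field_simps)
  ultimately show ?thesis by simp
qed

section \<open>Linearity and smoothness of wedge products\<close>

lemma wedge_add_left: "wedge (\<lambda>L. u L + v L) w K = wedge u w K + wedge v w K"
  and wedge_add_right: "wedge w (\<lambda>L. u L + v L) K = wedge w u K + wedge w v K"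
  by (simp_all add: wedge_def algebra_simps sum.distrib)

lemma wedge_sum_left: "wedge (\<lambda>L. \<Sum>i\<in>I. v i L) w K = (\<Sum>i\<in>I. wedge (v i) w K)"
  by (induction I rule: infinite_finite_induct) (simp_all add: wedge_add_left, simp_all add: wedge_def)

lemma wedge_sum_right: "wedge w (\<lambda>L. \<Sum>i\<in>I. v i L) K = (\<Sum>i\<in>I. wedge w (v i) K)"
  by (induction I rule: infinite_finite_induct) (simp_all add: wedge_add_right, simp_all add: wedge_def)

lemma wedge_zero [simp]: "wedge (\<lambda>_. 0) w K = 0" "wedge w (\<lambda>_. 0) K = 0"
  by (simp_all add: wedge_def)

lemma wedge_cmult_right: "wedge w (\<lambda>L. c * v L) K = c * wedge w v K"
  by (simp add: wedge_def sum_distrib_left algebra_simps)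

lemma smooth_local_wedge:
  assumes "open_Cn n V" "smooth_local n V v" "smooth_local n V w"
  shows "smooth_local n V (\<lambda>z. wedge (v z) (w z))"
  unfolding smooth_local_def wedge_def using assms
  by (intro allI smooth_fun_on_sum smooth_fun_on_mult smooth_fun_on_const)
    (auto simp: smooth_local_def)

lemma smooth_local_dolb:
  assumes "open_Cn n V" "smooth_local n V w"
  shows "smooth_local n V (dolb n \<epsilon> G w)"
proof -
  have "smooth_local n V (\<lambda>z L. wirt \<epsilon> j (\<lambda>x. w x L) z)" if "j < n" for j
    using assms that smooth_wirt by (auto simp: smooth_local_def)
  moreover have "smooth_local n V (\<lambda>_. ext_gen (G j))" for j
    by (simp add: smooth_local_def smooth_fun_on_const)
  ultimately show ?thesis
    using smooth_local_wedge[OF assms(1)]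
    unfolding smooth_local_def dolb_def by (intro allI smooth_fun_on_sum[OF assms(1)]) auto
qed

lemma smooth_local_cong:
  "open_Cn n V \<Longrightarrow> (\<And>x. x \<in> V \<Longrightarrow> v x = w x) \<Longrightarrow> smooth_local n V v \<Longrightarrow> smooth_local n V w"
  unfolding smooth_local_def using smooth_fun_on_cong[of n V] by (metis (no_types, lifting))

lemma dolb_cong:
  assumes "open_Cn n V" "z \<in> V" "\<And>x. x \<in> V \<Longrightarrow> v x = w x"
  shows "dolb n \<epsilon> G v z = dolb n \<epsilon> G w z"
proof (rule ext)
  fix K
  have "wirt \<epsilon> j (\<lambda>x. v x L) z = wirt \<epsilon> j (\<lambda>x. w x L) z" if "j < n" for j L
    using assms(1,2) that by (rule wirt_cong) (simp add: assms(3))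
  then show "dolb n \<epsilon> G v z K = dolb n \<epsilon> G w z K"
    unfolding dolb_def by (intro sum.cong arg_cong2[where f = "\<lambda>a b. wedge a b K"] ext) auto
qed

lemma dolb_sum:
  assumes "open_Cn n V" "z \<in> V" "\<And>i. i \<in> I \<Longrightarrow> smooth_local n V (w i)"
  shows "dolb n \<epsilon> G (\<lambda>x K. \<Sum>i\<in>I. c i * w i x K) z K = (\<Sum>i\<in>I. c i * dolb n \<epsilon> G (w i) z K)"
proof -
  have "wirt \<epsilon> j (\<lambda>x. \<Sum>i\<in>I. c i * w i x L) z = (\<Sum>i\<in>I. c i * wirt \<epsilon> j (\<lambda>x. w i x L) z)"
    if "j < n" for j L
  proof -
    have "wirt \<epsilon> j (\<lambda>x. \<Sum>i\<in>I. c i * w i x L) z = (\<Sum>i\<in>I. wirt \<epsilon> j (\<lambda>x. c i * w i x L) z)"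
      using assms that
      by (intro wirt_sum smooth_fun_on_mult smooth_fun_on_const) (auto simp: smooth_local_def)
    also have "\<dots> = (\<Sum>i\<in>I. c i * wirt \<epsilon> j (\<lambda>x. w i x L) z)"
      using assms that by (intro sum.cong refl wirt_cmult) (auto simp: smooth_local_def)
    finally show ?thesis .
  qed
  then have "dolb n \<epsilon> G (\<lambda>x K. \<Sum>i\<in>I. c i * w i x K) z K =
      (\<Sum>j<n. \<Sum>i\<in>I. c i * wedge (ext_gen (G j)) (\<lambda>L. wirt \<epsilon> j (\<lambda>x. w i x L) z) K)"
    unfolding dolb_def
    by (intro sum.cong refl) (simp add: wedge_sum_right wedge_cmult_right cong: sum.cong)
  also have "\<dots> = (\<Sum>i\<in>I. c i * dolb n \<epsilon> G (w i) z K)"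
    unfolding dolb_def sum_distrib_left by (rule sum.swap)
  finally show ?thesis .
qed

text \<open>In the Leibniz rule the generators pass \<open>v z\<close> without a sign because its
  degree is even, and the terms with derivatives of \<open>v\<close> add up to a multiple of the
  derivative of \<open>v\<close>, which vanishes. Degree and closedness enter at the single point
  \<open>z\<close>.\<close>

lemma dolb_wedge_even_closed:
  assumes V: "open_Cn n V" and z: "z \<in> V" and v: "smooth_local n V v" and w: "smooth_local n V w"
    and deg: "has_degree r (v z)" "even r" and closed: "dolb n \<epsilon> G v z = (\<lambda>_. 0)"
  shows "dolb n \<epsilon> G (\<lambda>x. wedge (v x) (w x)) z = wedge (v z) (dolb n \<epsilon> G w z)"
proof (rule ext)
  fix K
  define Tv Tw where "Tv j = (\<lambda>L. wirt \<epsilon> j (\<lambda>x. v x L) z)" and "Tw j = (\<lambda>L. wirt \<epsilon> j (\<lambda>x. w x L) z)" for j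
  have T: "wirt \<epsilon> j (\<lambda>x. wedge (v x) (w x) L) z = wedge (Tv j) (w z) L + wedge (v z) (Tw j) L"
    if j: "j < n" for j L
  proof -
    have sm: "smooth_fun_on n V (\<lambda>x. v x A)" "smooth_fun_on n V (\<lambda>x. w x A)" for A
      using v w by (auto simp: smooth_local_def)
    have "wirt \<epsilon> j (\<lambda>x. wedge (v x) (w x) L) z =
        (\<Sum>A\<in>Pow L. wirt \<epsilon> j (\<lambda>x. shuffle_sign A (L - A) * v x A * w x (L - A)) z)"
      unfolding wedge_def
      by (intro wirt_sum[OF V _ z j] smooth_fun_on_mult[OF V] smooth_fun_on_const sm)
    also have "\<dots> = (\<Sum>A\<in>Pow L. shuffle_sign A (L - A) * Tv j A * w z (L - A) +
        shuffle_sign A (L - A) * v z A * Tw j (L - A))"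
    proof (intro sum.cong refl)
      fix A
      show "wirt \<epsilon> j (\<lambda>x. shuffle_sign A (L - A) * v x A * w x (L - A)) z =
          shuffle_sign A (L - A) * Tv j A * w z (L - A) + shuffle_sign A (L - A) * v z A * Tw j (L - A)"
        using wirt_mult[OF smooth_fun_on_mult[OF V smooth_fun_on_const sm(1)] sm(2) z j]
          wirt_cmult[OF sm(1) z j]
        by (simp add: Tv_def Tw_def)
    qed
    finally show ?thesis by (simp add: wedge_def sum.distrib)
  qed
  have g: "wedge (ext_gen g) (v z) = wedge (v z) (ext_gen g)" for g
  proof
    fix L
    have "has_degree 1 (ext_gen g)" by (simp add: has_degree_def ext_gen_def)
    then show "wedge (ext_gen g) (v z) L = wedge (v z) (ext_gen g) L"
      using wedge_has_degree_commute[OF _ deg(1), of 1 "ext_gen g" L] deg(2) by simp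
  qed
  have "dolb n \<epsilon> G (\<lambda>x. wedge (v x) (w x)) z K =
      (\<Sum>j<n. wedge (ext_gen (G j)) (\<lambda>L. wedge (Tv j) (w z) L + wedge (v z) (Tw j) L) K)"
    unfolding dolb_def using T
    by (intro sum.cong refl arg_cong2[where f = "\<lambda>a b. wedge a b K"] ext) auto
  also have "\<dots> = (\<Sum>j<n. wedge (wedge (ext_gen (G j)) (Tv j)) (w z) K) +
      (\<Sum>j<n. wedge (v z) (wedge (ext_gen (G j)) (Tw j)) K)"
    unfolding wedge_add_right sum.distrib wedge_assoc[symmetric] g ..
  also have "(\<Sum>j<n. wedge (wedge (ext_gen (G j)) (Tv j)) (w z) K) = wedge (dolb n \<epsilon> G v z) (w z) K"
    unfolding dolb_def[abs_def] Tv_def wedge_sum_left ..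
  also have "(\<Sum>j<n. wedge (v z) (wedge (ext_gen (G j)) (Tw j)) K) = wedge (v z) (dolb n \<epsilon> G w z) K"
    unfolding dolb_def[abs_def] Tw_def wedge_sum_right ..
  finally show "dolb n \<epsilon> G (\<lambda>x. wedge (v x) (w x)) z K = wedge (v z) (dolb n \<epsilon> G w z) K"
    by (simp add: closed)
qed

text \<open>A coefficient that vanishes on the whole open set has vanishing derivatives. Phrased as
  the existence of a point with nonzero value, this lets supports and bidegrees of derivatives be
  read off from those of the form.\<close>

lemma wirt_nonzeroE:
  assumes "open_Cn n V" "z \<in> V" "j < n" "wirt \<epsilon> j f z \<noteq> 0"
  obtains x where "x \<in> V" "f x \<noteq> 0"
proof -
  have "\<exists>x\<in>V. f x \<noteq> 0"
  proof (rule ccontr)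
    assume "\<not> (\<exists>x\<in>V. f x \<noteq> 0)"
    then have "wirt \<epsilon> j f z = wirt \<epsilon> j (\<lambda>_. 0) z"
      by (intro wirt_cong[OF assms(1-3)]) auto
    then show False using assms(4) by simp
  qed
  then show ?thesis using that by blast
qed

lemma dolb_nonzeroE:
  assumes "open_Cn n V" "z \<in> V" "dolb n \<epsilon> G w z K \<noteq> 0"
  obtains j x where "j < n" "G j \<in> K" "x \<in> V" "w x (K - {G j}) \<noteq> 0" "finite K"
proof -
  obtain j where j: "j < n" "wedge (ext_gen (G j)) (\<lambda>L. wirt \<epsilon> j (\<lambda>x. w x L) z) K \<noteq> 0"
    using assms(3) unfolding dolb_def by (metis (mono_tags, lifting) lessThan_iff sum.neutral)
  from j(2) obtain A where A: "A \<subseteq> K" "ext_gen (G j) A \<noteq> 0" "wirt \<epsilon> j (\<lambda>x. w x (K - A)) z \<noteq> 0" "finite K"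
    by (rule wedge_nonzeroE)
  then have "A = {G j}" by (auto simp: ext_gen_def split: if_splits)
  moreover from A(3) obtain x where "x \<in> V" "w x (K - A) \<noteq> 0"
    by (rule wirt_nonzeroE[OF assms(1,2) j(1)])
  ultimately show ?thesis using that j(1) A by auto
qed

lemma ext_on_dolb:
  assumes "open_Cn n V" "z \<in> V" "\<And>x. x \<in> V \<Longrightarrow> ext_on n (w x)" "\<And>j. j < n \<Longrightarrow> G j \<in> coframe n"
  shows "ext_on n (dolb n \<epsilon> G w z)"
  unfolding ext_on_def
proof (intro allI impI)
  fix K assume "dolb n \<epsilon> G w z K \<noteq> 0"
  then obtain j x where "j < n" "G j \<in> K" "x \<in> V" "w x (K - {G j}) \<noteq> 0"
    by (rule dolb_nonzeroE[OF assms(1,2)])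
  then show "K \<subseteq> coframe n"
    using assms(3)[of x] assms(4)[of j] by (auto simp: ext_on_def)
qed

lemma degrees_remove1:
  assumes "finite K" "g \<in> K"
  shows "hol_degree K = hol_degree {g} + hol_degree (K - {g})"
    and "antihol_degree K = antihol_degree {g} + antihol_degree (K - {g})"
  using assms hol_degree_split[of K "{g}"] antihol_degree_split[of K "{g}"] by auto

lemma degrees_single [simp]:
  "hol_degree {Dz j} = 1" "antihol_degree {Dz j} = 0" "hol_degree {Dzbar j} = 0" "antihol_degree {Dzbar j} = 1"
  by (simp_all add: hol_degree_def antihol_degree_def)

lemma has_bidegree_del:
  assumes "open_Cn n V" "z \<in> V" "\<And>x. x \<in> V \<Longrightarrow> has_bidegree p q (w x)"
  shows "has_bidegree (Suc p) q (del n w z)" and "has_bidegree p (Suc q) (delbar n w z)"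
proof -
  show "has_bidegree (Suc p) q (del n w z)"
    unfolding has_bidegree_def del_eq_dolb
  proof (intro allI impI)
    fix K assume "dolb n 1 Dz w z K \<noteq> 0"
    then obtain j x where "j < n" "Dz j \<in> K" "x \<in> V" "w x (K - {Dz j}) \<noteq> 0" "finite K"
      by (rule dolb_nonzeroE[OF assms(1,2)])
    then show "hol_degree K = Suc p \<and> antihol_degree K = q"
      using assms(3)[of x] degrees_remove1[of K "Dz j"] by (auto simp: has_bidegree_def)
  qed
  show "has_bidegree p (Suc q) (delbar n w z)"
    unfolding has_bidegree_def delbar_eq_dolb
  proof (intro allI impI)
    fix K assume "dolb n (-1) Dzbar w z K \<noteq> 0"
    then obtain j x where "j < n" "Dzbar j \<in> K" "x \<in> V" "w x (K - {Dzbar j}) \<noteq> 0" "finite K"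
      by (rule dolb_nonzeroE[OF assms(1,2)])
    then show "hol_degree K = p \<and> antihol_degree K = Suc q"
      using assms(3)[of x] degrees_remove1[of K "Dzbar j"] by (auto simp: has_bidegree_def)
  qed
qed

text \<open>The two parts of the exterior derivative have different bidegrees, so no monomial can
  occur in both and they cannot cancel.\<close>

lemma del_delbar_zero_if_ext_d_zero:
  assumes "open_Cn n V" "z \<in> V" "\<And>x. x \<in> V \<Longrightarrow> has_bidegree p q (w x)" "ext_d n w z = (\<lambda>_. 0)"
  shows "del n w z = (\<lambda>_. 0)" "delbar n w z = (\<lambda>_. 0)"
proof -
  have s: "del n w z K + delbar n w z K = 0" for K
    using assms(4) by (metis ext_d_def)
  have "del n w z K = 0" for K
  proof (rule ccontr)
    assume nz: "del n w z K \<noteq> 0"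
    then have nz': "delbar n w z K \<noteq> 0" using s[of K] by auto
    have "has_bidegree (Suc p) q (del n w z)"
      by (rule has_bidegree_del(1)[OF assms(1,2)]) (rule assms(3))
    then have "hol_degree K = Suc p" using nz unfolding has_bidegree_def by blast
    moreover have "has_bidegree p (Suc q) (delbar n w z)"
      by (rule has_bidegree_del(2)[OF assms(1,2)]) (rule assms(3))
    then have "hol_degree K = p" using nz' unfolding has_bidegree_def by blast
    ultimately show False by simp
  qed
  then show "del n w z = (\<lambda>_. 0)" by auto
  then show "delbar n w z = (\<lambda>_. 0)" using s by auto
qed

lemma eq_0_if_degree_too_large:
  assumes "ext_on n w" "has_bidegree p q w" "p > n \<or> q > n"
  shows "w = (\<lambda>_. 0)"
proof
  fix K
  show "w K = 0"
  proof (rule ccontr)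
    assume "w K \<noteq> 0"
    then have "K \<subseteq> coframe_range 0 n" "hol_degree K = p" "antihol_degree K = q"
      using assms by (auto simp: ext_on_def has_bidegree_def coframe_range_0)
    then show False using degree_le_if_subset_coframe_range[of K 0 n] assms(3) by linarith
  qed
qed

section \<open>Lifting forms to a product\<close>

definition fst_coords :: "nat \<Rightarrow> (nat \<Rightarrow> complex) \<Rightarrow> nat \<Rightarrow> complex" where
  "fst_coords m z i = (if i < m then z i else 0)"

definition snd_coords :: "nat \<Rightarrow> (nat \<Rightarrow> complex) \<Rightarrow> nat \<Rightarrow> complex" where
  "snd_coords m z i = z (i + m)"

fun shift_elem :: "nat \<Rightarrow> coframe_elem \<Rightarrow> coframe_elem" where
  "shift_elem m (Dz i) = Dz (i + m)"
| "shift_elem m (Dzbar i) = Dzbar (i + m)"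

text \<open>The pullback by the second projection in coordinates: the generators of Y are renumbered
  to follow those of X. Forms on X need no counterpart, since their generators keep their
  indices.\<close>

definition shift_ext :: "nat \<Rightarrow> ext \<Rightarrow> ext" where
  "shift_ext m w K = (if K \<subseteq> range (shift_elem m) then w (shift_elem m -` K) else 0)"

lemma fst_coords_upd [simp]: "fst_coords m (z(j := x)) = (if j < m then (fst_coords m z)(j := x) else fst_coords m z)"
  by (auto simp: fst_coords_def fun_eq_iff)

lemma snd_coords_upd [simp]: "snd_coords m (z(j := x)) = (if j < m then snd_coords m z else (snd_coords m z)(j - m := x))"
  by (auto simp: snd_coords_def fun_eq_iff)

section \<open>Functions of one group of coordinates\<close>

lemma partial_fst_coords:
  "partial u j (\<lambda>x. f (fst_coords m x)) z = (if j < m then partial u j f (fst_coords m z) else 0)"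
  "along u j (\<lambda>x. f (fst_coords m x)) z = (if j < m then along u j f (fst_coords m z) else (\<lambda>_. f (fst_coords m z)))"
proof -
  show *: "along u j (\<lambda>x. f (fst_coords m x)) z = (if j < m then along u j f (fst_coords m z) else (\<lambda>_. f (fst_coords m z)))"
    by (rule ext) (auto simp: along_def fst_coords_def)
  show "partial u j (\<lambda>x. f (fst_coords m x)) z = (if j < m then partial u j f (fst_coords m z) else 0)"
    unfolding partial_def * by simp
qed

lemma partial_snd_coords:
  "partial u j (\<lambda>x. f (snd_coords m x)) z = (if j < m then 0 else partial u (j - m) f (snd_coords m z))"
  "along u j (\<lambda>x. f (snd_coords m x)) z = (if j < m then (\<lambda>_. f (snd_coords m z)) else along u (j - m) f (snd_coords m z))"
proof -
  show *: "along u j (\<lambda>x. f (snd_coords m x)) z = (if j < m then (\<lambda>_. f (snd_coords m z)) else along u (j - m) f (snd_coords m z))"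
    by (rule ext) (auto simp: along_def snd_coords_def)
  show "partial u j (\<lambda>x. f (snd_coords m x)) z = (if j < m then 0 else partial u (j - m) f (snd_coords m z))"
    unfolding partial_def * by simp
qed

lemma continuous_on_fst_coords: "continuous_on V (fst_coords m)"
proof (rule continuous_on_coordinatewise_then_product)
  fix i
  have "continuous_on V (\<lambda>x. x i)"
    by (rule continuous_on_subset[OF continuous_on_product_coordinates subset_UNIV])
  then show "continuous_on V (\<lambda>x. fst_coords m x i)"
    by (cases "i < m") (auto simp: fst_coords_def)
qed

lemma continuous_on_snd_coords: "continuous_on V (snd_coords m)"
proof (rule continuous_on_coordinatewise_then_product)
  fix i
  show "continuous_on V (\<lambda>x. snd_coords m x i)"
    unfolding snd_coords_def
    by (rule continuous_on_subset[OF continuous_on_product_coordinates subset_UNIV])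
qed

lemma Ck_on_fst_coords:
  assumes "fst_coords m ` V \<subseteq> V1"
  shows "Ck_on k m V1 f \<Longrightarrow> Ck_on k (m + n) V (\<lambda>x. f (fst_coords m x))"
proof (induction k arbitrary: f)
  case 0
  then show ?case
    using continuous_on_compose2[OF _ continuous_on_fst_coords assms] by simp
next
  case (Suc k)
  show ?case
  proof (rule Ck_on_SucI)
    show "continuous_on V (\<lambda>x. f (fst_coords m x))"
      by (rule continuous_on_compose2[OF Ck_on_imp_continuous[OF Suc.prems] continuous_on_fst_coords assms])
    fix j u assume ju: "j < m + n" "u \<in> {1, \<i>}"
    show "along u j (\<lambda>x. f (fst_coords m x)) z differentiable at 0" if "z \<in> V" for z
      using assms that ju Ck_on_SucD(1)[OF Suc.prems] by (auto simp: partial_fst_coords)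
    show "Ck_on k (m + n) V (partial u j (\<lambda>x. f (fst_coords m x)))"
    proof (cases "j < m")
      case True
      then have "partial u j (\<lambda>x. f (fst_coords m x)) = (\<lambda>x. partial u j f (fst_coords m x))"
        by (intro ext) (simp add: partial_fst_coords)
      then show ?thesis using Suc.IH[OF Ck_on_SucD(2)[OF Suc.prems True ju(2)]] by simp
    next
      case False
      then have "partial u j (\<lambda>x. f (fst_coords m x)) = (\<lambda>x. 0)"
        by (intro ext) (simp add: partial_fst_coords)
      then show ?thesis by (simp add: Ck_on_const)
    qed
  qed
qed

lemma Ck_on_snd_coords:
  assumes "snd_coords m ` V \<subseteq> V2"
  shows "Ck_on k n V2 f \<Longrightarrow> Ck_on k (m + n) V (\<lambda>x. f (snd_coords m x))"
proof (induction k arbitrary: f)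
  case 0
  then show ?case
    using continuous_on_compose2[OF _ continuous_on_snd_coords assms] by simp
next
  case (Suc k)
  show ?case
  proof (rule Ck_on_SucI)
    show "continuous_on V (\<lambda>x. f (snd_coords m x))"
      by (rule continuous_on_compose2[OF Ck_on_imp_continuous[OF Suc.prems] continuous_on_snd_coords assms])
    fix j u assume ju: "j < m + n" "u \<in> {1, \<i>}"
    show "along u j (\<lambda>x. f (snd_coords m x)) z differentiable at 0" if "z \<in> V" for z
    proof (cases "j < m")
      case False
      then have "j - m < n" "snd_coords m z \<in> V2" using ju that assms by auto
      then show ?thesis using False Ck_on_SucD(1)[OF Suc.prems _ ju(2)] by (simp add: partial_snd_coords)
    qed (simp add: partial_snd_coords)
    show "Ck_on k (m + n) V (partial u j (\<lambda>x. f (snd_coords m x)))"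
    proof (cases "j < m")
      case False
      then have "partial u j (\<lambda>x. f (snd_coords m x)) = (\<lambda>x. partial u (j - m) f (snd_coords m x))"
        by (intro ext) (simp add: partial_snd_coords)
      moreover have "j - m < n" using False ju by auto
      ultimately show ?thesis using Suc.IH[OF Ck_on_SucD(2)[OF Suc.prems _ ju(2)]] by simp
    next
      case True
      then have "partial u j (\<lambda>x. f (snd_coords m x)) = (\<lambda>x. 0)"
        by (intro ext) (simp add: partial_snd_coords)
      then show ?thesis by (simp add: Ck_on_const)
    qed
  qed
qed

lemma smooth_local_fst_coords:
  "fst_coords m ` V \<subseteq> V1 \<Longrightarrow> smooth_local m V1 w \<Longrightarrow> smooth_local (m + n) V (\<lambda>x. w (fst_coords m x))"
  unfolding smooth_local_def smooth_fun_on_def using Ck_on_fst_coords[where n = n] by blast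

lemma smooth_local_snd_coords:
  assumes "snd_coords m ` V \<subseteq> V2" "smooth_local n V2 w"
  shows "smooth_local (m + n) V (\<lambda>x. shift_ext m (w (snd_coords m x)))"
  unfolding smooth_local_def
proof
  fix K
  show "smooth_fun_on (m + n) V (\<lambda>x. shift_ext m (w (snd_coords m x)) K)"
  proof (cases "K \<subseteq> range (shift_elem m)")
    case True
    have "Ck_on k n V2 (\<lambda>x. w x (shift_elem m -` K))" for k
      using assms(2) by (simp add: smooth_local_def smooth_fun_on_def)
    then have "Ck_on k (m + n) V (\<lambda>x. w (snd_coords m x) (shift_elem m -` K))" for k
      by (rule Ck_on_snd_coords[OF assms(1)])
    then show ?thesis
      using True by (simp add: shift_ext_def smooth_fun_on_def)
  qed (simp add: shift_ext_def smooth_fun_on_const)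
qed

section \<open>Renumbering the coframe\<close>

lemma inj_shift_elem: "inj (shift_elem m)"
proof (rule injI)
  fix a b assume "shift_elem m a = shift_elem m b"
  then show "a = b" by (cases a; cases b) auto
qed

lemma shift_elem_less [simp]: "shift_elem m a < shift_elem m b \<longleftrightarrow> a < b"
  by (cases a; cases b) (auto simp: less_coframe_elem_def less_eq_coframe_elem_def)

lemma shuffle_sign_shift:
  "shuffle_sign (shift_elem m ` A) (shift_elem m ` B) = shuffle_sign A B"
proof -
  have "{(a, b). a \<in> shift_elem m ` A \<and> b \<in> shift_elem m ` B \<and> b < a} =
      map_prod (shift_elem m) (shift_elem m) ` {(a, b). a \<in> A \<and> b \<in> B \<and> b < a}"
    by (auto simp: image_iff map_prod_def)
  moreover have "inj (map_prod (shift_elem m) (shift_elem m))"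
    by (simp add: inj_shift_elem map_prod_inj_on prod.inj_map)
  ultimately show ?thesis
    unfolding shuffle_sign_def by (simp add: card_image inj_on_subset[OF _ subset_UNIV])
qed

lemma vimage_shift_image [simp]: "shift_elem m -` shift_elem m ` A = A"
  by (rule inj_vimage_image_eq[OF inj_shift_elem])

lemma shift_ext_image [simp]: "shift_ext m w (shift_elem m ` K) = w K"
  by (auto simp: shift_ext_def)

lemma shift_ext_notin_range: "\<not> K \<subseteq> range (shift_elem m) \<Longrightarrow> shift_ext m w K = 0"
  by (simp add: shift_ext_def)

text \<open>Renumbering preserves the order of the generators, hence all shuffle signs.\<close>

lemma wedge_shift_ext: "wedge (shift_ext m v) (shift_ext m w) = shift_ext m (wedge v w)"
proof
  fix K
  show "wedge (shift_ext m v) (shift_ext m w) K = shift_ext m (wedge v w) K"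
  proof (cases "K \<subseteq> range (shift_elem m)")
    case False
    have "shuffle_sign A (K - A) * shift_ext m v A * shift_ext m w (K - A) = 0" if "A \<in> Pow K" for A
    proof -
      have "\<not> A \<subseteq> range (shift_elem m) \<or> \<not> K - A \<subseteq> range (shift_elem m)" using False that by auto
      then have "shift_ext m v A = 0 \<or> shift_ext m w (K - A) = 0"
        using shift_ext_notin_range by blast
      then show ?thesis by auto
    qed
    then have "wedge (shift_ext m v) (shift_ext m w) K = 0"
      unfolding wedge_def by (rule sum.neutral[OF ballI])
    then show ?thesis by (simp only: shift_ext_notin_range[OF False])
  next
    case True
    then obtain L where K: "K = shift_elem m ` L" by (auto simp: subset_image_iff)
    have "wedge (shift_ext m v) (shift_ext m w) K =
        (\<Sum>A\<in>(`) (shift_elem m) ` Pow L. shuffle_sign A (K - A) * shift_ext m v A * shift_ext m w (K - A))"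
      unfolding wedge_def K by (simp add: image_Pow_surj)
    also have "\<dots> = (\<Sum>A\<in>Pow L. shuffle_sign A (L - A) * v A * w (L - A))"
    proof (subst sum.reindex)
      show "inj_on ((`) (shift_elem m)) (Pow L)"
        using inj_shift_elem by (meson inj_image_eq_iff inj_onI)
      have "shift_elem m ` L - shift_elem m ` A = shift_elem m ` (L - A)" for A
        using inj_shift_elem by (simp add: image_set_diff)
      then show "sum ((\<lambda>A. shuffle_sign A (K - A) * shift_ext m v A * shift_ext m w (K - A)) \<circ> (`) (shift_elem m)) (Pow L) =
          (\<Sum>A\<in>Pow L. shuffle_sign A (L - A) * v A * w (L - A))"
        by (simp add: K shuffle_sign_shift)
    qed
    finally show ?thesis by (simp add: K wedge_def)
  qed
qed

lemma shift_ext_gen: "shift_ext m (ext_gen g) = ext_gen (shift_elem m g)"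
proof
  fix K
  show "shift_ext m (ext_gen g) K = ext_gen (shift_elem m g) K"
  proof (cases "K \<subseteq> range (shift_elem m)")
    case True
    then obtain L where "K = shift_elem m ` L" by (auto simp: subset_image_iff)
    moreover have "shift_elem m ` L = {shift_elem m g} \<longleftrightarrow> L = {g}"
      using inj_image_eq_iff[OF inj_shift_elem[of m], of L "{g}"] by simp
    ultimately show ?thesis by (simp add: ext_gen_def)
  next
    case False
    then have "K \<noteq> {shift_elem m g}" by auto
    then show ?thesis by (simp add: shift_ext_notin_range[OF False] ext_gen_def)
  qed
qed

lemma dolb_fst_coords:
  "dolb (m + n) \<epsilon> G (\<lambda>x. w (fst_coords m x)) z = dolb m \<epsilon> G w (fst_coords m z)"
proof
  fix K
  have T: "wirt \<epsilon> j (\<lambda>x. w (fst_coords m x) L) z = (if j < m then wirt \<epsilon> j (\<lambda>x. w x L) (fst_coords m z) else 0)" for j L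
    by (simp add: wirt_def partial_fst_coords[of _ _ "\<lambda>x. w x L"])
  have "dolb (m + n) \<epsilon> G (\<lambda>x. w (fst_coords m x)) z K =
      (\<Sum>j<m. wedge (ext_gen (G j)) (\<lambda>L. wirt \<epsilon> j (\<lambda>x. w (fst_coords m x) L) z) K)"
    unfolding dolb_def by (intro sum.mono_neutral_right) (auto simp: T)
  then show "dolb (m + n) \<epsilon> G (\<lambda>x. w (fst_coords m x)) z K = dolb m \<epsilon> G w (fst_coords m z) K"
    by (simp add: dolb_def T)
qed

text \<open>Only the last n directions contribute, and the condition on \<open>G\<close>, satisfied
  by \<open>Dz\<close> and by \<open>Dzbar\<close>, identifies their generators with the renumbered
  generators of Y.\<close>

lemma dolb_snd_coords:
  assumes "\<And>j. G (j + m) = shift_elem m (G j)"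
  shows "dolb (m + n) \<epsilon> G (\<lambda>x. shift_ext m (w (snd_coords m x))) z = shift_ext m (dolb n \<epsilon> G w (snd_coords m z))"
proof
  fix K
  have T: "(\<lambda>L. wirt \<epsilon> j (\<lambda>x. shift_ext m (w (snd_coords m x)) L) z) =
      (if j < m then (\<lambda>_. 0) else shift_ext m (\<lambda>L. wirt \<epsilon> (j - m) (\<lambda>x. w x L) (snd_coords m z)))" for j
  proof (rule ext)
    fix L
    show "wirt \<epsilon> j (\<lambda>x. shift_ext m (w (snd_coords m x)) L) z =
      (if j < m then (\<lambda>_. 0) else shift_ext m (\<lambda>L. wirt \<epsilon> (j - m) (\<lambda>x. w x L) (snd_coords m z))) L"
      unfolding shift_ext_def
      by (cases "L \<subseteq> range (shift_elem m)")
        (auto simp: wirt_def partial_snd_coords[of _ _ "\<lambda>x. w x (shift_elem m -` L)"] partial_const)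
  qed
  have "dolb (m + n) \<epsilon> G (\<lambda>x. shift_ext m (w (snd_coords m x))) z K =
      (\<Sum>j\<in>{m..<m + n}. wedge (ext_gen (G j)) (\<lambda>L. wirt \<epsilon> j (\<lambda>x. shift_ext m (w (snd_coords m x)) L) z) K)"
    unfolding dolb_def by (intro sum.mono_neutral_right) (auto simp: T)
  also have "\<dots> = (\<Sum>j\<in>{0..<n}. wedge (ext_gen (G (j + m))) (\<lambda>L. wirt \<epsilon> (j + m) (\<lambda>x. shift_ext m (w (snd_coords m x)) L) z) K)"
    using sum.shift_bounds_nat_ivl[of _ 0 m n] by (simp add: add.commute)
  also have "\<dots> = (\<Sum>j<n. shift_ext m (wedge (ext_gen (G j)) (\<lambda>L. wirt \<epsilon> j (\<lambda>x. w x L) (snd_coords m z))) K)"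
    by (intro sum.cong) (auto simp: T assms shift_ext_gen[symmetric] wedge_shift_ext)
  also have "\<dots> = shift_ext m (dolb n \<epsilon> G w (snd_coords m z)) K"
    by (simp add: shift_ext_def dolb_def)
  finally show "dolb (m + n) \<epsilon> G (\<lambda>x. shift_ext m (w (snd_coords m x))) z K =
      shift_ext m (dolb n \<epsilon> G w (snd_coords m z)) K" .
qed

section \<open>Algebra homomorphisms and pullbacks\<close>

definition alg_hom :: "(extalg \<Rightarrow> extalg) \<Rightarrow> bool" where
  "alg_hom h \<longleftrightarrow> (\<forall>x y. h (x + y) = h x + h y) \<and> (\<forall>x y. h (x * y) = h x * h y) \<and> (\<forall>c. h (cst c) = cst c)"

lemma alg_hom_simps:
  assumes "alg_hom h"
  shows "h (x + y) = h x + h y" "h (x * y) = h x * h y" "h (cst c) = cst c" "h 0 = 0" "h 1 = 1"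
proof -
  show *: "h (x + y) = h x + h y" "h (x * y) = h x * h y" "h (cst c) = cst c" for x y c
    using assms by (auto simp: alg_hom_def)
  show "h 0 = 0" "h 1 = 1" using *(3)[of 0] *(3)[of 1] by simp_all
qed

lemma alg_hom_sum: "alg_hom h \<Longrightarrow> h (sum f A) = (\<Sum>a\<in>A. h (f a))"
  by (induction A rule: infinite_finite_induct) (auto simp: alg_hom_simps)

lemma alg_hom_prod_list: "alg_hom h \<Longrightarrow> h (prod_list xs) = prod_list (map h xs)"
  by (induction xs) (auto simp: alg_hom_simps)

lemma alg_hom_power: "alg_hom h \<Longrightarrow> h (x ^ k) = h x ^ k"
  by (induction k) (auto simp: alg_hom_simps)

lemma alg_hom_comp: "alg_hom h \<Longrightarrow> alg_hom h' \<Longrightarrow> alg_hom (\<lambda>x. h (h' x))"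
  by (auto simp: alg_hom_def)

lemma (in odd_map) alg_hom_hom: "alg_hom hom"
  by (simp add: alg_hom_def hom_add hom_mult)

lemma mon_eq_prod_list: "finite K \<Longrightarrow> mon K = prod_list (map gen (sorted_list_of_set K))"
  by (subst prod_list_gen_sorted) auto

text \<open>Monomials are products of generators, so agreement on generators propagates. Identities
  between pullbacks, renumberings and the projection to degree zero are reduced to generators in
  this way.\<close>

lemma alg_hom_eq_on:
  assumes h: "alg_hom h" and h': "alg_hom h'" and S: "supported S x"
    and eq: "\<And>g. g \<in> S \<Longrightarrow> h (gen g) = h' (gen g)"
  shows "h x = h' x"
proof -
  have m: "h (mon K) = h' (mon K)" if "K \<in> supp x" for K
  proof -
    have K: "finite K" "K \<subseteq> S" using that S coef_nonzero_finite by (auto simp: supp_def supported_def)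
    have "map h (map gen (sorted_list_of_set K)) = map h' (map gen (sorted_list_of_set K))"
      using K eq by auto
    then show ?thesis
      unfolding mon_eq_prod_list[OF K(1)] alg_hom_prod_list[OF h] alg_hom_prod_list[OF h'] by (rule arg_cong)
  qed
  have x: "x = (\<Sum>K\<in>supp x. cst (coef x K) * mon K)" by (rule extalg_expand) auto
  have "h (\<Sum>K\<in>supp x. cst (coef x K) * mon K) = h' (\<Sum>K\<in>supp x. cst (coef x K) * mon K)"
    unfolding alg_hom_sum[OF h] alg_hom_sum[OF h'] alg_hom_simps(2,3)[OF h] alg_hom_simps(2,3)[OF h']
    by (intro sum.cong refl) (simp add: m)
  then show ?thesis using x by simp
qed

lemma alg_hom_exp_conv:
  assumes "alg_hom h"
  shows "h (exp_conv W x s) = exp_conv (h W) (\<lambda>t. h (x t)) s"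
  unfolding exp_conv_def alg_hom_sum[OF assms] alg_hom_simps(2,3)[OF assms] alg_hom_power[OF assms] ..

fun pull_gen :: "nat \<Rightarrow> (nat \<Rightarrow> nat \<Rightarrow> complex) \<Rightarrow> coframe_elem \<Rightarrow> extalg" where
  "pull_gen n J (Dz i) = cov 0 n (J i)"
| "pull_gen n J (Dzbar i) = econj (cov 0 n (J i))"

lemma has_degree_pull_gen: "has_degree 1 (coef (pull_gen n J g))"
  using bideg_degree[OF bideg_cov] bideg_degree[OF bideg_conj[OF bideg_cov]] by (cases g) auto

lemma odd_map_pull_gen: "odd_map (pull_gen n J)"
  by standard (intro has_degree_1_mult has_degree_pull_gen)

definition pull :: "nat \<Rightarrow> (nat \<Rightarrow> nat \<Rightarrow> complex) \<Rightarrow> extalg \<Rightarrow> extalg" where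
  "pull n J = odd_map.hom (pull_gen n J)"

lemma alg_hom_pull: "alg_hom (pull n J)"
  unfolding pull_def by (rule odd_map.alg_hom_hom[OF odd_map_pull_gen])

lemma pull_gen_eq [simp]: "pull n J (gen g) = pull_gen n J g"
  unfolding pull_def by (rule odd_map.hom_gen[OF odd_map_pull_gen])

lemma coef_pull_gen: "coef (pull_gen n J g) = pullback_gen n J g"
proof (cases g)
  case (Dz i)
  then show ?thesis by (simp add: coef_cov covector_def[abs_def])
next
  case (Dzbar i)
  have "econj (cov 0 n (J i)) = (\<Sum>j<n. cst (cnj (J i j)) * gen (Dzbar j))"
    by (simp add: cov_def conj_sum conj_mult atLeast0LessThan)
  then show ?thesis using Dzbar by (intro ext) (simp add: coef_gen)
qed

text \<open>The sum in \<open>pullback\<close> runs over subsets of the coframe of dimension n,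
  hence the condition on the support.\<close>

lemma coef_pull:
  assumes "supported (coframe_range 0 n) x"
  shows "coef (pull n J x) = pullback n J (coef x)"
proof
  fix M
  have "supp x \<subseteq> Pow (coframe n)" using assms by (auto simp: supp_def supported_def coframe_range_0)
  moreover have "finite (Pow (coframe n))" by (simp add: coframe_def)
  ultimately have "pull n J x = (\<Sum>K\<in>Pow (coframe n). cst (coef x K) * odd_map.mon_image (pull_gen n J) K)"
    unfolding pull_def by (intro odd_map.hom_superset[OF odd_map_pull_gen])
  then show "coef (pull n J x) M = pullback n J (coef x) M"
    by (simp add: pullback_def odd_map.mon_image_def[OF odd_map_pull_gen] coef_prod_list o_def coef_pull_gen)
qed

section \<open>Renumbering as a homomorphism of the algebra\<close>

lift_definition shift :: "nat \<Rightarrow> extalg \<Rightarrow> extalg" is shift_ext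
proof
  fix m and w :: ext
  assume w: "finite {K. w K \<noteq> 0} \<and> (\<forall>K. w K \<noteq> 0 \<longrightarrow> finite K)"
  have i: "\<exists>L. K = shift_elem m ` L \<and> w L \<noteq> 0" if nz: "shift_ext m w K \<noteq> 0" for K
  proof -
    have "K \<subseteq> range (shift_elem m)" using nz shift_ext_notin_range by blast
    then obtain L where "K = shift_elem m ` L" by (auto simp: subset_image_iff)
    then show ?thesis using nz by auto
  qed
  have "{K. shift_ext m w K \<noteq> 0} \<subseteq> (`) (shift_elem m) ` {K. w K \<noteq> 0}" using i by blast
  then show "finite {K. shift_ext m w K \<noteq> 0}" by (rule finite_subset) (use w in auto)
  show "\<forall>K. shift_ext m w K \<noteq> 0 \<longrightarrow> finite K" using i w by blast
qed

lemma coef_shift: "coef (shift m x) = shift_ext m (coef x)"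
  by transfer simp

lemma shift_gen [simp]: "shift m (gen g) = gen (shift_elem m g)"
  by (rule extalg_eqI) (simp add: coef_shift coef_gen shift_ext_gen)

lemma alg_hom_shift: "alg_hom (shift m)"
  unfolding alg_hom_def
proof (intro conjI allI)
  show "shift m (x + y) = shift m x + shift m y" for x y
    by (rule extalg_eqI) (simp add: coef_shift shift_ext_def)
  show "shift m (x * y) = shift m x * shift m y" for x y
    by (rule extalg_eqI) (simp add: coef_shift coef_mult wedge_shift_ext)
  show "shift m (cst c) = cst c" for c
  proof (rule extalg_eqI)
    fix K :: "coframe_elem set"
    show "coef (shift m (cst c)) K = coef (cst c) K"
    proof (cases "K \<subseteq> range (shift_elem m)")
      case True
      then obtain L where "K = shift_elem m ` L" by (auto simp: subset_image_iff)
      then show ?thesis by (simp add: coef_shift coef_cst)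
    next
      case False
      then have "K \<noteq> {}" by auto
      then show ?thesis by (simp add: coef_shift coef_cst shift_ext_notin_range[OF False])
    qed
  qed
qed

lemma coef_shift_nonzeroE:
  assumes "coef (shift m x) K \<noteq> 0"
  obtains L where "K = shift_elem m ` L" "coef x L \<noteq> 0"
proof -
  have "K \<subseteq> range (shift_elem m)" using assms[unfolded coef_shift] shift_ext_notin_range by blast
  then obtain L where "K = shift_elem m ` L" by (auto simp: subset_image_iff)
  then show ?thesis using that assms by (simp add: coef_shift)
qed

lemma shift_elem_iff [simp]:
  "Dz i \<in> shift_elem m ` L \<longleftrightarrow> m \<le> i \<and> Dz (i - m) \<in> L"
  "Dzbar i \<in> shift_elem m ` L \<longleftrightarrow> m \<le> i \<and> Dzbar (i - m) \<in> L"
proof -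
  have a: "\<exists>g\<in>L. Dz i = shift_elem m g" if "m \<le> i" "Dz (i - m) \<in> L"
    using that by (intro bexI[of _ "Dz (i - m)"]) auto
  have b: "\<exists>g\<in>L. Dzbar i = shift_elem m g" if "m \<le> i" "Dzbar (i - m) \<in> L"
    using that by (intro bexI[of _ "Dzbar (i - m)"]) auto
  have c: "m \<le> i \<and> Dz (i - m) \<in> L" if "Dz i = shift_elem m g" "g \<in> L" for g
    using that by (cases g) auto
  have d: "m \<le> i \<and> Dzbar (i - m) \<in> L" if "Dzbar i = shift_elem m g" "g \<in> L" for g
    using that by (cases g) auto
  show "Dz i \<in> shift_elem m ` L \<longleftrightarrow> m \<le> i \<and> Dz (i - m) \<in> L" using a c unfolding image_iff by blast
  show "Dzbar i \<in> shift_elem m ` L \<longleftrightarrow> m \<le> i \<and> Dzbar (i - m) \<in> L" using b d unfolding image_iff by blast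
qed

lemma degree_shift [simp]:
  "hol_degree (shift_elem m ` L) = hol_degree L" "antihol_degree (shift_elem m ` L) = antihol_degree L"
proof -
  have "{i. Dz i \<in> shift_elem m ` L} = (\<lambda>i. i + m) ` {i. Dz i \<in> L}"
  proof (intro set_eqI iffI)
    fix i assume "i \<in> {i. Dz i \<in> shift_elem m ` L}"
    then show "i \<in> (\<lambda>i. i + m) ` {i. Dz i \<in> L}"
      by (intro image_eqI[of _ _ "i - m"]) simp_all
  qed auto
  then show "hol_degree (shift_elem m ` L) = hol_degree L"
    unfolding hol_degree_def by (simp add: card_image)
  have "{i. Dzbar i \<in> shift_elem m ` L} = (\<lambda>i. i + m) ` {i. Dzbar i \<in> L}"
  proof (intro set_eqI iffI)
    fix i assume "i \<in> {i. Dzbar i \<in> shift_elem m ` L}"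
    then show "i \<in> (\<lambda>i. i + m) ` {i. Dzbar i \<in> L}"
      by (intro image_eqI[of _ _ "i - m"]) simp_all
  qed auto
  then show "antihol_degree (shift_elem m ` L) = antihol_degree L"
    unfolding antihol_degree_def by (simp add: card_image)
qed

lemma bideg_shift: "bideg p q x \<Longrightarrow> bideg p q (shift m x)"
  unfolding has_bidegree_def by (auto elim!: coef_shift_nonzeroE)

lemma supported_shift:
  assumes "supported (coframe_range 0 n) x"
  shows "supported (coframe_range m (m + n)) (shift m x)"
  unfolding supported_def
proof (intro allI impI)
  fix K assume "coef (shift m x) K \<noteq> 0"
  then obtain L where L: "K = shift_elem m ` L" "coef x L \<noteq> 0" by (rule coef_shift_nonzeroE)
  then have "L \<subseteq> coframe_range 0 n" using assms by (auto simp: supported_def)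
  then have "K \<subseteq> shift_elem m ` coframe_range 0 n" using L(1) by blast
  also have "\<dots> \<subseteq> coframe_range m (m + n)"
    by (auto simp: coframe_range_def)
  finally show "K \<subseteq> coframe_range m (m + n)" .
qed

lemma bar_image_shift: "bar ` shift_elem m ` L = shift_elem m ` bar ` L"
proof -
  have "bar (shift_elem m g) = shift_elem m (bar g)" for g by (cases g) auto
  then show ?thesis by (simp add: image_image)
qed

lemma econj_shift: "econj (shift m x) = shift m (econj x)"
proof (rule extalg_eqI)
  fix K
  show "coef (econj (shift m x)) K = coef (shift m (econj x)) K"
  proof (cases "K \<subseteq> range (shift_elem m)")
    case True
    then obtain L where "K = shift_elem m ` L" by (auto simp: subset_image_iff)
    then show ?thesis
      by (simp add: coef_conj coef_shift ext_cnj_def bar_image_shift)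
  next
    case False
    have "\<not> bar ` K \<subseteq> range (shift_elem m)"
    proof
      assume "bar ` K \<subseteq> range (shift_elem m)"
      then obtain L where "bar ` K = shift_elem m ` L" by (auto simp: subset_image_iff)
      then have "bar ` bar ` K = shift_elem m ` bar ` L" by (simp only: bar_image_shift)
      then show False using False by auto
    qed
    then show ?thesis
      by (simp add: coef_conj coef_shift ext_cnj_def shift_ext_notin_range[OF False] shift_ext_notin_range)
  qed
qed

lemma shift_cov: "shift m (cov 0 n \<psi>) = cov m (m + n) (\<lambda>i. \<psi> (i - m))"
proof -
  have "cov m (m + n) (\<lambda>i. \<psi> (i - m)) = (\<Sum>i\<in>{0..<n}. cst (\<psi> (i + m - m)) * gen (Dz (i + m)))"
    unfolding cov_def using sum.shift_bounds_nat_ivl[of "\<lambda>i. cst (\<psi> (i - m)) * gen (Dz i)" 0 m n]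
    by (simp add: add.commute)
  then show ?thesis
    by (simp add: cov_def alg_hom_sum[OF alg_hom_shift] alg_hom_simps[OF alg_hom_shift])
qed

lemma shift_sq: "shift m (sq x) = sq (shift m x)"
  by (simp add: sq_def alg_hom_simps[OF alg_hom_shift] econj_shift)

lemma shift_vol: "shift m (vol 0 n) = vol m (m + n)"
proof -
  have "[m..<m + n] = map (\<lambda>i. i + m) [0..<n]"
    using map_add_upt[of m n] by (simp add: add.commute)
  then show ?thesis
    by (simp add: vol_def alg_hom_prod_list[OF alg_hom_shift] o_def shift_sq)
qed

text \<open>Test covectors over the coordinates m, ..., m + n - 1 are exactly the renumbered ones,
  and renumbering respects products, squares and volume forms.\<close>

lemma trans_form_shift:
  assumes "trans_form 0 n p x"
  shows "trans_form m (m + n) p (shift m x)"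
  unfolding trans_form_def
proof (intro conjI allI impI)
  show "supported (coframe_range m (m + n)) (shift m x)" "bideg p p (shift m x)"
    using assms by (auto simp: trans_form_def intro: supported_shift bideg_shift)
  fix \<psi> assume ind: "indep m (m + n) (m + n - m - p) \<psi>"
  define \<psi>' where "\<psi>' b i = \<psi> b (i + m)" for b i
  have "indep 0 n (n - p) \<psi>'"
    unfolding indep_def
  proof (intro allI impI)
    fix c :: "nat \<Rightarrow> complex" and b
    assume c: "\<forall>i\<in>{0..<n}. (\<Sum>b<n - p. c b * \<psi>' b i) = 0" and b: "b < n - p"
    show "c b = 0"
    proof (rule indepD[OF ind])
      fix i assume "m \<le> i" "i < m + n"
      then show "(\<Sum>b<m + n - m - p. c b * \<psi> b i) = 0"
        using c[rule_format, of "i - m"] by (auto simp: \<psi>'_def)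
    qed (use b in auto)
  qed
  then have "pos_top 0 n (x * sq_prod 0 n (n - p) \<psi>')"
    using assms by (simp add: trans_form_def)
  then obtain c :: real where c: "c > 0" "x * sq_prod 0 n (n - p) \<psi>' = cst (of_real c) * vol 0 n"
    by (auto simp: pos_top_def)
  have "shift m (sq_prod 0 n (n - p) \<psi>') = sq_prod m (m + n) (n - p) \<psi>"
  proof -
    have "sq (cov m (m + n) (\<lambda>i. \<psi>' b (i - m))) = sq (cov m (m + n) (\<psi> b))" for b
      by (intro arg_cong[where f = sq] cov_cong) (simp add: \<psi>'_def)
    then show ?thesis
      unfolding sq_prod_def alg_hom_prod_list[OF alg_hom_shift]
      by (simp add: o_def shift_sq shift_cov)
  qed
  moreover have "shift m (x * sq_prod 0 n (n - p) \<psi>') = cst (of_real c) * vol m (m + n)"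
    unfolding c(2) by (simp add: alg_hom_simps[OF alg_hom_shift] shift_vol)
  ultimately show "pos_top m (m + n) (shift m x * sq_prod m (m + n) (m + n - m - p) \<psi>)"
    using c(1) by (auto simp: pos_top_def alg_hom_simps[OF alg_hom_shift])
qed

section \<open>Pullback by block diagonal matrices\<close>

definition block_matrix :: "nat \<Rightarrow> nat \<Rightarrow> (nat \<Rightarrow> nat \<Rightarrow> complex) \<Rightarrow> (nat \<Rightarrow> nat \<Rightarrow> complex) \<Rightarrow>
    (nat \<Rightarrow> nat \<Rightarrow> complex) \<Rightarrow> bool" where
  "block_matrix m n J J1 J2 \<longleftrightarrow>
     (\<forall>i<m + n. \<forall>j<m + n. J i j =
        (if i < m then (if j < m then J1 i j else 0) else (if j < m then 0 else J2 (i - m) (j - m))))"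

lemma cov_block_matrix_fst:
  assumes "block_matrix m n J J1 J2" "i < m"
  shows "cov 0 (m + n) (J i) = cov 0 m (J1 i)"
proof -
  have "cov 0 (m + n) (J i) = (\<Sum>j\<in>{0..<m}. cst (J i j) * gen (Dz j))"
    unfolding cov_def using assms by (intro sum.mono_neutral_right) (auto simp: block_matrix_def)
  also have "\<dots> = cov 0 m (J1 i)"
    unfolding cov_def using assms by (intro sum.cong) (auto simp: block_matrix_def)
  finally show ?thesis .
qed

lemma cov_block_matrix_snd:
  assumes "block_matrix m n J J1 J2" "i < n"
  shows "cov 0 (m + n) (J (i + m)) = shift m (cov 0 n (J2 i))"
proof -
  have "cov 0 (m + n) (J (i + m)) = cov m (m + n) (J (i + m))"
    unfolding cov_def using assms by (intro sum.mono_neutral_right) (auto simp: block_matrix_def)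
  also have "\<dots> = cov m (m + n) (\<lambda>j. J2 i (j - m))"
    using assms by (intro cov_cong) (auto simp: block_matrix_def)
  finally show ?thesis by (simp add: shift_cov)
qed

lemma pull_block_matrix_fst:
  assumes "block_matrix m n J J1 J2" "supported (coframe_range 0 m) x"
  shows "pull (m + n) J x = pull m J1 x"
proof (rule alg_hom_eq_on[OF alg_hom_pull alg_hom_pull assms(2)])
  fix g assume "g \<in> coframe_range 0 m"
  then show "pull (m + n) J (gen g) = pull m J1 (gen g)"
    using cov_block_matrix_fst[OF assms(1)] by (cases g) auto
qed

lemma pull_block_matrix_shift:
  assumes "block_matrix m n J J1 J2" "supported (coframe_range 0 n) x"
  shows "pull (m + n) J (shift m x) = shift m (pull n J2 x)"
proof (rule alg_hom_eq_on[OF alg_hom_comp[OF alg_hom_pull alg_hom_shift]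
      alg_hom_comp[OF alg_hom_shift alg_hom_pull] assms(2)])
  fix g assume "g \<in> coframe_range 0 n"
  then show "pull (m + n) J (shift m (gen g)) = shift m (pull n J2 (gen g))"
    using cov_block_matrix_snd[OF assms(1)] by (cases g) (auto simp: econj_shift)
qed

lemma coef_Extalg: "ext_on n w \<Longrightarrow> coef (Extalg w) = w"
proof (rule Extalg_inverse)
  assume w: "ext_on n w"
  then have "{K. w K \<noteq> 0} \<subseteq> Pow (coframe n)" by (auto simp: ext_on_def)
  moreover have "finite (coframe n)" by (simp add: coframe_def)
  ultimately show "w \<in> {w. finite {K. w K \<noteq> 0} \<and> (\<forall>K. w K \<noteq> 0 \<longrightarrow> finite K)}"
    by (auto intro: finite_subset)
qed

lemma supported_Extalg: "ext_on n w \<Longrightarrow> supported (coframe_range 0 n) (Extalg w)"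
  using ext_on_iff[of n "Extalg w"] by (simp add: coef_Extalg)

lemma Extalg_coef [simp]: "Extalg (coef x) = x"
  by (rule coef_inverse)

section \<open>The local product form\<close>

definition wedge_power :: "nat \<Rightarrow> ext \<Rightarrow> ext" where
  "wedge_power j w = (wedge w ^^ j) ext_one"

lemma coef_power: "coef (x ^ j) = wedge_power j (coef x)"
  by (induction j) (simp_all add: wedge_power_def coef_one coef_mult)

text \<open>The counterpart of \<open>exp_conv\<close> for raw forms depending on a point:
  derivatives are taken in this version and transversality is checked in the other, with
  \<open>conv_form_eq\<close> as the bridge.\<close>

definition conv_form :: "nat \<Rightarrow> nat \<Rightarrow> local_form \<Rightarrow> (nat \<Rightarrow> local_form) \<Rightarrow> local_form" where
  "conv_form m s \<omega> \<beta> z K =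
     (\<Sum>j\<le>s. (1 / fact j) * wedge (wedge_power j (\<omega> (fst_coords m z))) (shift_ext m (\<beta> (s - j) (snd_coords m z))) K)"

lemma conv_form_eq:
  assumes "ext_on m (\<omega> (fst_coords m z))" "\<And>t. ext_on n (\<beta> t (snd_coords m z))"
  shows "conv_form m s \<omega> \<beta> z =
    coef (exp_conv (Extalg (\<omega> (fst_coords m z))) (\<lambda>t. shift m (Extalg (\<beta> t (snd_coords m z)))) s)"
  unfolding conv_form_def[abs_def] exp_conv_def coef_sum coef_cst_mult
  by (rule ext) (simp only: coef_mult coef_power coef_shift coef_Extalg[OF assms(1)] coef_Extalg[OF assms(2)])

lemma has_degree_wedge:
  assumes "has_degree r v" "has_degree s w"
  shows "has_degree (r + s) (wedge v w)"
  unfolding has_degree_def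
proof (intro allI impI)
  fix K assume "wedge v w K \<noteq> 0"
  then obtain A where A: "A \<subseteq> K" "v A \<noteq> 0" "w (K - A) \<noteq> 0" "finite K"
    by (rule wedge_nonzeroE)
  then have "card A = r" "card (K - A) = s" using assms by (auto simp: has_degree_def)
  moreover have "card K = card A + card (K - A)"
    using A card_Un_disjoint[of A "K - A"] finite_subset[of A K] by (simp add: Un_absorb1)
  ultimately show "card K = r + s" by simp
qed

lemma has_degree_wedge_power: "has_degree r w \<Longrightarrow> has_degree (j * r) (wedge_power j w)"
  by (induction j) (auto simp: wedge_power_def has_degree_def[of 0] ext_one_def intro: has_degree_wedge)

lemma smooth_local_wedge_power:
  assumes "open_Cn n V" "smooth_local n V w"
  shows "smooth_local n V (\<lambda>z. wedge_power j (w z))"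
proof (induction j)
  case 0
  then show ?case by (simp add: wedge_power_def smooth_local_def smooth_fun_on_const)
next
  case (Suc j)
  have "smooth_local n V (\<lambda>z. wedge (w z) (wedge_power j (w z)))"
    by (rule smooth_local_wedge[OF assms Suc])
  then show ?case by (simp add: wedge_power_def)
qed

lemma dolb_const: "dolb n \<epsilon> G (\<lambda>_. w) z = (\<lambda>_. 0)"
  by (rule ext) (simp add: dolb_def)

lemma dolb_wedge_power_closed:
  assumes V: "open_Cn n V" "z \<in> V" and w: "smooth_local n V w"
    and deg: "has_degree r (w z)" "even r" and closed: "dolb n \<epsilon> G w z = (\<lambda>_. 0)"
  shows "dolb n \<epsilon> G (\<lambda>x. wedge_power j (w x)) z = (\<lambda>_. 0)"
proof (induction j)
  case 0
  then show ?case by (simp add: wedge_power_def dolb_const)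
next
  case (Suc j)
  have "dolb n \<epsilon> G (\<lambda>x. wedge (w x) (wedge_power j (w x))) z =
      wedge (w z) (dolb n \<epsilon> G (\<lambda>x. wedge_power j (w x)) z)"
    by (rule dolb_wedge_even_closed[OF V w smooth_local_wedge_power[OF V(1) w] deg closed])
  also have "\<dots> = (\<lambda>_. 0)" unfolding Suc by (rule ext) simp
  finally show ?case by (simp add: wedge_power_def)
qed

lemma smooth_local_sum:
  assumes "open_Cn n V" "\<And>i. i \<in> I \<Longrightarrow> smooth_local n V (w i)"
  shows "smooth_local n V (\<lambda>z K. \<Sum>i\<in>I. c i * w i z K)"
  unfolding smooth_local_def using assms
  by (intro allI smooth_fun_on_sum smooth_fun_on_mult smooth_fun_on_const) (auto simp: smooth_local_def)

context
  fixes m n :: nat and V V1 V2 :: "(nat \<Rightarrow> complex) set" and \<omega> :: local_form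
  assumes V: "open_Cn (m + n) V" "fst_coords m ` V \<subseteq> V1" "snd_coords m ` V \<subseteq> V2"
    and \<omega>: "smooth_local m V1 \<omega>"
begin

lemma smooth_local_conv_form_terms:
  assumes "smooth_local n V2 \<beta>"
  shows "smooth_local (m + n) V
    (\<lambda>z. wedge (wedge_power j (\<omega> (fst_coords m z))) (shift_ext m (\<beta> (snd_coords m z))))"
  by (intro smooth_local_wedge[OF V(1)] smooth_local_wedge_power[OF V(1)]
      smooth_local_fst_coords[OF V(2) \<omega>] smooth_local_snd_coords[OF V(3) assms])

lemma smooth_local_conv_form:
  assumes "\<And>t. smooth_local n V2 (\<beta> t)"
  shows "smooth_local (m + n) V (conv_form m s \<omega> \<beta>)"
  unfolding conv_form_def[abs_def]
  by (intro smooth_local_sum[OF V(1)] smooth_local_conv_form_terms assms)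

lemma dolb_conv_form:
  assumes \<beta>: "\<And>t. smooth_local n V2 (\<beta> t)" and z: "z \<in> V"
    and deg: "has_degree 2 (\<omega> (fst_coords m z))" and closed: "dolb m \<epsilon> G \<omega> (fst_coords m z) = (\<lambda>_. 0)"
    and G: "\<And>j. G (j + m) = shift_elem m (G j)"
  shows "dolb (m + n) \<epsilon> G (conv_form m s \<omega> \<beta>) z = conv_form m s \<omega> (\<lambda>t. dolb n \<epsilon> G (\<beta> t)) z"
proof
  fix K
  have "dolb (m + n) \<epsilon> G (\<lambda>x. wedge (wedge_power j (\<omega> (fst_coords m x))) (shift_ext m (\<beta> t (snd_coords m x)))) z =
      wedge (wedge_power j (\<omega> (fst_coords m z))) (shift_ext m (dolb n \<epsilon> G (\<beta> t) (snd_coords m z)))" for j t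
  proof -
    have sm: "smooth_local (m + n) V (\<lambda>x. \<omega> (fst_coords m x))"
      by (rule smooth_local_fst_coords[OF V(2) \<omega>])
    have "dolb (m + n) \<epsilon> G (\<lambda>x. wedge_power j (\<omega> (fst_coords m x))) z = (\<lambda>_. 0)"
      by (rule dolb_wedge_power_closed[OF V(1) z sm deg]) (simp_all add: dolb_fst_coords closed)
    then have "dolb (m + n) \<epsilon> G (\<lambda>x. wedge (wedge_power j (\<omega> (fst_coords m x))) (shift_ext m (\<beta> t (snd_coords m x)))) z =
      wedge (wedge_power j (\<omega> (fst_coords m z))) (dolb (m + n) \<epsilon> G (\<lambda>x. shift_ext m (\<beta> t (snd_coords m x))) z)"
      by (intro dolb_wedge_even_closed[OF V(1) z smooth_local_wedge_power[OF V(1) sm]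
            smooth_local_snd_coords[OF V(3) \<beta>] has_degree_wedge_power[OF deg]]) auto
    then show ?thesis by (simp add: dolb_snd_coords[of G m] G)
  qed
  then show "dolb (m + n) \<epsilon> G (conv_form m s \<omega> \<beta>) z K = conv_form m s \<omega> (\<lambda>t. dolb n \<epsilon> G (\<beta> t)) z K"
    unfolding conv_form_def[abs_def]
    by (subst dolb_sum[OF V(1) z smooth_local_conv_form_terms[OF \<beta>]]) simp
qed

lemma del_delbar_conv_form:
  assumes \<beta>: "\<And>t. smooth_local n V2 (\<beta> t)" and z: "z \<in> V"
    and deg: "has_degree 2 (\<omega> (fst_coords m z))"
    and closed: "del m \<omega> (fst_coords m z) = (\<lambda>_. 0)" "delbar m \<omega> (fst_coords m z) = (\<lambda>_. 0)"
  shows "del (m + n) (conv_form m s \<omega> \<beta>) z = conv_form m s \<omega> (\<lambda>t. del n (\<beta> t)) z"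
    and "delbar (m + n) (conv_form m s \<omega> \<beta>) z = conv_form m s \<omega> (\<lambda>t. delbar n (\<beta> t)) z"
  using closed unfolding del_eq_dolb delbar_eq_dolb
  by (intro dolb_conv_form[OF \<beta> z deg]; simp)+

end

lemma conv_form_add:
  "conv_form m s \<omega> (\<lambda>t z K. \<beta> t z K + \<gamma> t z K) z K = conv_form m s \<omega> \<beta> z K + conv_form m s \<omega> \<gamma> z K"
proof -
  have "shift_ext m (\<lambda>K. v K + w K) = (\<lambda>K. shift_ext m v K + shift_ext m w K)" for v w
    by (rule ext) (simp add: shift_ext_def)
  then show ?thesis
    by (simp add: conv_form_def wedge_add_right algebra_simps sum.distrib)
qed

lemma conv_form_cong:
  "(\<And>t. t \<le> s \<Longrightarrow> \<beta> t (snd_coords m z) = \<gamma> t (snd_coords m z)) \<Longrightarrow> conv_form m s \<omega> \<beta> z = conv_form m s \<omega> \<gamma> z"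
  by (rule ext) (simp add: conv_form_def)

lemma conv_form_zero:
  assumes "\<And>t. t \<le> s \<Longrightarrow> \<beta> t (snd_coords m z) = (\<lambda>_. 0)"
  shows "conv_form m s \<omega> \<beta> z = (\<lambda>_. 0)"
proof (rule ext)
  fix K
  have "shift_ext m (\<lambda>_. 0) = (\<lambda>_. 0)" by (rule ext) (simp add: shift_ext_def)
  then show "conv_form m s \<omega> \<beta> z K = 0"
    using assms by (simp add: conv_form_def)
qed

section \<open>Products of complex manifolds\<close>

definition join_coords :: "nat \<Rightarrow> (nat \<Rightarrow> complex) \<Rightarrow> (nat \<Rightarrow> complex) \<Rightarrow> nat \<Rightarrow> complex" where
  "join_coords m a b i = (if i < m then a i else b (i - m))"

lemma fst_coords_join [simp]: "a \<in> Cn m \<Longrightarrow> fst_coords m (join_coords m a b) = a"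
  by (auto simp: fst_coords_def join_coords_def Cn_def fun_eq_iff)

lemma snd_coords_join [simp]: "snd_coords m (join_coords m a b) = b"
  by (auto simp: snd_coords_def join_coords_def fun_eq_iff)

lemma join_fst_snd_coords [simp]: "join_coords m (fst_coords m z) (snd_coords m z) = z"
  by (auto simp: snd_coords_def fst_coords_def join_coords_def fun_eq_iff)

lemma open_Cn_subset: "open_Cn n V \<Longrightarrow> V \<subseteq> Cn n"
  unfolding open_Cn_def by (rule openin_imp_subset)

lemma open_Cn_product:
  assumes "open_Cn m V1" "open_Cn n V2"
  shows "open_Cn (m + n) {z. fst_coords m z \<in> V1 \<and> snd_coords m z \<in> V2}"
proof -
  obtain U1 where U1: "open U1" "V1 = Cn m \<inter> U1"
    using assms(1) unfolding open_Cn_def openin_open by blast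
  obtain U2 where U2: "open U2" "V2 = Cn n \<inter> U2"
    using assms(2) unfolding open_Cn_def openin_open by blast
  have o: "open (fst_coords m -` U1 \<inter> snd_coords m -` U2)"
    by (intro open_Int open_vimage U1 U2 continuous_on_fst_coords continuous_on_snd_coords)
  have "fst_coords m z \<in> Cn m" for z by (simp add: fst_coords_def Cn_def)
  moreover have "snd_coords m z \<in> Cn n \<longleftrightarrow> z \<in> Cn (m + n)" for z
  proof
    assume s: "snd_coords m z \<in> Cn n"
    show "z \<in> Cn (m + n)"
      unfolding Cn_def mem_Collect_eq
    proof (intro allI impI)
      fix i assume "m + n \<le> i"
      then have "snd_coords m z (i - m) = 0" using s by (auto simp: Cn_def)
      then show "z i = 0" using \<open>m + n \<le> i\<close> by (simp add: snd_coords_def)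
    qed
  qed (auto simp: Cn_def snd_coords_def)
  ultimately have "{z. fst_coords m z \<in> V1 \<and> snd_coords m z \<in> V2} =
      Cn (m + n) \<inter> (fst_coords m -` U1 \<inter> snd_coords m -` U2)"
    unfolding U1(2) U2(2) by blast
  then show ?thesis unfolding open_Cn_def openin_open using o by blast
qed

section \<open>Charts of the product\<close>

lemma is_chart_facts:
  assumes "is_chart n T c"
  shows "openin T (fst c)" "fst c \<subseteq> topspace T" "open_Cn n (chart_image c)" "chart_image c \<subseteq> Cn n"
    "inj_on (snd c) (fst c)"
    "homeomorphic_map (subtopology T (fst c)) (top_of_set (chart_image c)) (snd c)"
proof -
  show *: "openin T (fst c)" "open_Cn n (chart_image c)"
    "homeomorphic_map (subtopology T (fst c)) (top_of_set (chart_image c)) (snd c)"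
    using assms by (auto simp: is_chart_def)
  show s: "fst c \<subseteq> topspace T" using *(1) by (rule openin_subset)
  show "chart_image c \<subseteq> Cn n" using *(2) by (rule open_Cn_subset)
  have "topspace (subtopology T (fst c)) = fst c" using s by (simp add: Int_absorb1)
  then show "inj_on (snd c) (fst c)" using homeomorphic_imp_injective_map[OF *(3)] by simp
qed

lemma chart_inv_snd: "inj_on (snd c) (fst c) \<Longrightarrow> x \<in> fst c \<Longrightarrow> chart_inv c (snd c x) = x"
  by (simp add: chart_inv_def the_inv_into_f_f)

lemma overlap_subset: "overlap c d \<subseteq> chart_image c"
  by (auto simp: overlap_def chart_image_def)

lemma transition_in_chart_image:
  "inj_on (snd c) (fst c) \<Longrightarrow> z \<in> overlap c d \<Longrightarrow> transition c d z \<in> chart_image d"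
  by (auto simp: overlap_def transition_def chart_image_def chart_inv_snd)

lemma snd_prod_chart: "snd (prod_chart m c c') (x, y) = join_coords m (snd c x) (snd c' y)"
  by (rule ext) (simp add: prod_chart_def join_coords_def)

lemma fst_prod_chart: "fst (prod_chart m c c') = fst c \<times> fst c'"
  by (simp add: prod_chart_def)

text \<open>The condition on the first chart enters because \<open>fst_coords\<close> cuts off at m:
  only points of \<open>Cn m\<close> are recovered from the joined coordinates.\<close>

lemma image_prod_chart:
  assumes "snd c ` A \<subseteq> Cn m"
  shows "snd (prod_chart m c c') ` (A \<times> B) = {z. fst_coords m z \<in> snd c ` A \<and> snd_coords m z \<in> snd c' ` B}"
proof (intro set_eqI iffI)
  fix z assume "z \<in> snd (prod_chart m c c') ` (A \<times> B)"
  then obtain x y where xy: "x \<in> A" "y \<in> B" "z = join_coords m (snd c x) (snd c' y)"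
    by (auto simp: snd_prod_chart)
  then have "snd c x \<in> Cn m" using assms by blast
  then show "z \<in> {z. fst_coords m z \<in> snd c ` A \<and> snd_coords m z \<in> snd c' ` B}" using xy by auto
next
  fix z assume "z \<in> {z. fst_coords m z \<in> snd c ` A \<and> snd_coords m z \<in> snd c' ` B}"
  then obtain x y where xy: "x \<in> A" "y \<in> B" "fst_coords m z = snd c x" "snd_coords m z = snd c' y"
    by auto
  have "z = snd (prod_chart m c c') (x, y)"
    unfolding snd_prod_chart xy(3,4)[symmetric] by simp
  then show "z \<in> snd (prod_chart m c c') ` (A \<times> B)" using xy by blast
qed

lemma chart_image_prod_chart:
  assumes "chart_image c \<subseteq> Cn m"
  shows "chart_image (prod_chart m c c') = {z. fst_coords m z \<in> chart_image c \<and> snd_coords m z \<in> chart_image c'}"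
  using image_prod_chart[of c "fst c" m c' "fst c'"] assms by (simp add: chart_image_def fst_prod_chart)

lemma overlap_prod_chart:
  assumes "chart_image c \<subseteq> Cn m"
  shows "overlap (prod_chart m c c') (prod_chart m d d') =
    {z. fst_coords m z \<in> overlap c d \<and> snd_coords m z \<in> overlap c' d'}"
proof -
  have "snd c ` (fst c \<inter> fst d) \<subseteq> Cn m" using assms by (auto simp: chart_image_def)
  then show ?thesis
    unfolding overlap_def fst_prod_chart Times_Int_Times by (rule image_prod_chart)
qed

lemma inj_prod_chart:
  assumes "inj_on (snd c) (fst c)" "inj_on (snd c') (fst c')" "chart_image c \<subseteq> Cn m"
  shows "inj_on (snd (prod_chart m c c')) (fst (prod_chart m c c'))"
proof (rule inj_onI)
  fix p p' assume p: "p \<in> fst (prod_chart m c c')" "p' \<in> fst (prod_chart m c c')"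
    and e: "snd (prod_chart m c c') p = snd (prod_chart m c c') p'"
  obtain x y x' y' where xy: "p = (x, y)" "p' = (x', y')" by fastforce
  then have i: "x \<in> fst c" "y \<in> fst c'" "x' \<in> fst c" "y' \<in> fst c'" using p by (auto simp: fst_prod_chart)
  then have "snd c x \<in> Cn m" "snd c x' \<in> Cn m" using assms(3) by (auto simp: chart_image_def)
  then have "snd c x = snd c x'" "snd c' y = snd c' y'"
    using e xy by (metis fst_coords_join snd_prod_chart) (metis e xy snd_coords_join snd_prod_chart)
  then show "p = p'" using i xy assms(1,2) by (auto dest: inj_onD)
qed

lemma chart_inv_prod_chart:
  assumes "inj_on (snd c) (fst c)" "inj_on (snd c') (fst c')" "chart_image c \<subseteq> Cn m"
    and z: "z \<in> chart_image (prod_chart m c c')"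
  shows "chart_inv (prod_chart m c c') z = (chart_inv c (fst_coords m z), chart_inv c' (snd_coords m z))"
proof -
  obtain x y where xy: "x \<in> fst c" "y \<in> fst c'" "z = snd (prod_chart m c c') (x, y)"
    using z by (auto simp: chart_image_def fst_prod_chart)
  have "snd c x \<in> Cn m" using xy assms(3) by (auto simp: chart_image_def)
  then have "fst_coords m z = snd c x" "snd_coords m z = snd c' y" by (simp_all add: xy(3) snd_prod_chart)
  moreover have "chart_inv (prod_chart m c c') z = (x, y)"
    using chart_inv_snd[OF inj_prod_chart[OF assms(1-3)], of "(x, y)"] xy by (simp add: fst_prod_chart)
  ultimately show ?thesis using xy assms(1,2) by (simp add: chart_inv_snd)
qed

lemma transition_prod_chart:
  assumes "inj_on (snd c) (fst c)" "inj_on (snd c') (fst c')" "chart_image c \<subseteq> Cn m"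
    and "z \<in> chart_image (prod_chart m c c')"
  shows "transition (prod_chart m c c') (prod_chart m d d') z =
    join_coords m (transition c d (fst_coords m z)) (transition c' d' (snd_coords m z))"
  unfolding transition_def o_def chart_inv_prod_chart[OF assms] snd_prod_chart ..

lemma homeomorphic_map_prod_chart:
  assumes c: "is_chart m S c" and c': "is_chart n T c'"
  shows "homeomorphic_map (subtopology (prod_topology S T) (fst (prod_chart m c c')))
    (top_of_set (chart_image (prod_chart m c c'))) (snd (prod_chart m c c'))"
proof -
  note f = is_chart_facts[OF c] and f' = is_chart_facts[OF c']
  obtain g where g: "homeomorphic_maps (subtopology S (fst c)) (top_of_set (chart_image c)) (snd c) g"
    using f(6) homeomorphic_map_maps by blast
  obtain g' where g': "homeomorphic_maps (subtopology T (fst c')) (top_of_set (chart_image c')) (snd c') g'"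
    using f'(6) homeomorphic_map_maps by blast
  let ?C = "prod_chart m c c'"
  let ?P = "prod_topology (subtopology S (fst c)) (subtopology T (fst c'))"
  have P: "subtopology (prod_topology S T) (fst ?C) = ?P"
    by (simp add: fst_prod_chart subtopology_Times)
  have tP: "topspace ?P = fst c \<times> fst c'" using f(2) f'(2) by auto
  have im: "chart_image ?C = {z. fst_coords m z \<in> chart_image c \<and> snd_coords m z \<in> chart_image c'}"
    by (rule chart_image_prod_chart[OF f(4)])
  have cc: "continuous_map (subtopology S (fst c)) euclidean (snd c)"
    using g by (auto simp: homeomorphic_maps_def continuous_map_in_subtopology)
  have cc': "continuous_map (subtopology T (fst c')) euclidean (snd c')"
    using g' by (auto simp: homeomorphic_maps_def continuous_map_in_subtopology)
  have coord: "continuous_map euclidean euclidean (\<lambda>x :: nat \<Rightarrow> complex. x i)" for i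
    unfolding continuous_map_iff_continuous2 by (rule continuous_on_product_coordinates)
  have F: "continuous_map ?P (top_of_set (chart_image ?C)) (snd ?C)"
    unfolding continuous_map_in_subtopology
  proof
    have "continuous_map ?P euclidean (\<lambda>p. snd ?C p i)" for i
    proof (cases "i < m")
      case True
      have "continuous_map ?P euclidean (\<lambda>p. snd c (fst p) i)"
        using continuous_map_compose[OF continuous_map_compose[OF continuous_map_fst cc] coord]
        by (simp add: o_def)
      moreover have "(\<lambda>p. snd ?C p i) = (\<lambda>p. snd c (fst p) i)"
        using True by (auto simp: prod_chart_def)
      ultimately show ?thesis by simp
    next
      case False
      have "continuous_map ?P euclidean (\<lambda>p. snd c' (snd p) (i - m))"
        using continuous_map_compose[OF continuous_map_compose[OF continuous_map_snd cc'] coord]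
        by (simp add: o_def)
      moreover have "(\<lambda>p. snd ?C p i) = (\<lambda>p. snd c' (snd p) (i - m))"
        using False by (auto simp: prod_chart_def)
      ultimately show ?thesis by simp
    qed
    then have "continuous_map ?P (product_topology (\<lambda>i. euclidean) UNIV) (snd ?C)"
      by (simp add: continuous_map_componentwise_UNIV)
    then show "continuous_map ?P euclidean (snd ?C)" by (simp add: euclidean_product_topology)
    show "snd ?C \<in> topspace ?P \<rightarrow> chart_image ?C"
      unfolding tP chart_image_def fst_prod_chart by auto
  qed
  have gc: "continuous_map (top_of_set (chart_image c)) (subtopology S (fst c)) g"
    and gc': "continuous_map (top_of_set (chart_image c')) (subtopology T (fst c')) g'"
    using g g' unfolding homeomorphic_maps_def by blast+
  \<comment> \<open>The inverse is written down explicitly, so that continuity in both directions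
    can be checked by components.\<close>
  define G where "G z = (g (fst_coords m z), g' (snd_coords m z))" for z
  have "continuous_map (top_of_set (chart_image ?C)) (top_of_set (chart_image c)) (fst_coords m)"
    using im by (auto simp: continuous_map_in_subtopology continuous_map_iff_continuous continuous_on_fst_coords)
  then have G1: "continuous_map (top_of_set (chart_image ?C)) (subtopology S (fst c)) (\<lambda>z. g (fst_coords m z))"
    by (rule continuous_map_compose[OF _ gc, unfolded o_def])
  have "continuous_map (top_of_set (chart_image ?C)) (top_of_set (chart_image c')) (snd_coords m)"
    using im by (auto simp: continuous_map_in_subtopology continuous_map_iff_continuous continuous_on_snd_coords)
  then have G2: "continuous_map (top_of_set (chart_image ?C)) (subtopology T (fst c')) (\<lambda>z. g' (snd_coords m z))"
    by (rule continuous_map_compose[OF _ gc', unfolded o_def])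
  have G: "continuous_map (top_of_set (chart_image ?C)) ?P G"
    unfolding G_def by (rule continuous_map_pairedI[OF G1 G2])
  have "homeomorphic_maps ?P (top_of_set (chart_image ?C)) (snd ?C) G"
    unfolding homeomorphic_maps_def
  proof (intro conjI ballI F G)
    fix p assume "p \<in> topspace ?P"
    then obtain x y where p: "p = (x, y)" "x \<in> fst c" "y \<in> fst c'" unfolding tP by auto
    have "snd c x \<in> Cn m" using p f(4) by (auto simp: chart_image_def)
    moreover have "g (snd c x) = x" using g p f(2) by (auto simp: homeomorphic_maps_def)
    moreover have "g' (snd c' y) = y" using g' p f'(2) by (auto simp: homeomorphic_maps_def)
    ultimately show "G (snd ?C p) = p" by (simp add: G_def p(1) snd_prod_chart)
  next
    fix z assume "z \<in> topspace (top_of_set (chart_image ?C))"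
    then have z: "fst_coords m z \<in> chart_image c" "snd_coords m z \<in> chart_image c'" using im by auto
    have "snd c (g (fst_coords m z)) = fst_coords m z" using g z by (auto simp: homeomorphic_maps_def)
    moreover have "snd c' (g' (snd_coords m z)) = snd_coords m z" using g' z by (auto simp: homeomorphic_maps_def)
    ultimately show "snd ?C (G z) = z" by (simp add: G_def snd_prod_chart)
  qed
  then show ?thesis unfolding P using homeomorphic_map_maps by blast
qed

lemma is_chart_prod_chart:
  assumes "is_chart m S c" "is_chart n T c'"
  shows "is_chart (m + n) (prod_topology S T) (prod_chart m c c')"
  unfolding is_chart_def
proof (intro conjI homeomorphic_map_prod_chart[OF assms])
  show "openin (prod_topology S T) (fst (prod_chart m c c'))"
    using is_chart_facts(1)[OF assms(1)] is_chart_facts(1)[OF assms(2)]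
    by (simp add: fst_prod_chart openin_prod_Times_iff)
  show "open_Cn (m + n) (chart_image (prod_chart m c c'))"
    unfolding chart_image_prod_chart[OF is_chart_facts(4)[OF assms(1)]]
    by (rule open_Cn_product[OF is_chart_facts(3)[OF assms(1)] is_chart_facts(3)[OF assms(2)]])
qed

text \<open>Boxes formed from two countable bases are a countable basis.\<close>

lemma second_countable_prod_topology:
  assumes "second_countable S" "second_countable T"
  shows "second_countable (prod_topology S T)"
proof -
  obtain A where A: "countable A" "\<forall>V\<in>A. openin S V"
    "\<forall>U x. openin S U \<and> x \<in> U \<longrightarrow> (\<exists>V\<in>A. x \<in> V \<and> V \<subseteq> U)"
    using assms(1) unfolding second_countable_def by (elim exE conjE)
  obtain B where B: "countable B" "\<forall>V\<in>B. openin T V"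
    "\<forall>U x. openin T U \<and> x \<in> U \<longrightarrow> (\<exists>V\<in>B. x \<in> V \<and> V \<subseteq> U)"
    using assms(2) unfolding second_countable_def by (elim exE conjE)
  show ?thesis
    unfolding second_countable_def
  proof (intro exI[of _ "(\<lambda>(U, V). U \<times> V) ` (A \<times> B)"] conjI ballI allI impI)
    show "countable ((\<lambda>(U, V). U \<times> V) ` (A \<times> B))" using A(1) B(1) by simp
    show "openin (prod_topology S T) W" if "W \<in> (\<lambda>(U, V). U \<times> V) ` (A \<times> B)" for W
      using that A(2) B(2) by (auto simp: openin_prod_Times_iff)
    fix W p assume "openin (prod_topology S T) W \<and> p \<in> W"
    moreover obtain x y where p: "p = (x, y)" by fastforce
    ultimately obtain U V where UV: "openin S U" "openin T V" "x \<in> U" "y \<in> V" "U \<times> V \<subseteq> W"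
      unfolding openin_prod_topology_alt by blast
    obtain U' where U': "U' \<in> A" "x \<in> U'" "U' \<subseteq> U" using A(3) UV by blast
    obtain V' where V': "V' \<in> B" "y \<in> V'" "V' \<subseteq> V" using B(3) UV by blast
    show "\<exists>W'\<in>(\<lambda>(U, V). U \<times> V) ` (A \<times> B). p \<in> W' \<and> W' \<subseteq> W"
      using U' V' UV(5) p by (intro bexI[of _ "U' \<times> V'"]) auto
  qed
qed

lemma complex_manifold_chart:
  "complex_manifold X \<Longrightarrow> c \<in> atlas X \<Longrightarrow> is_chart (cdim X) (ctop X) c"
  by (simp add: complex_manifold_def)

lemma cdim_prod_manifold [simp]: "cdim (prod_manifold X Y) = cdim X + cdim Y"
  by (simp add: prod_manifold_def)

lemma prod_chart_in_atlas:
  "c \<in> atlas X \<Longrightarrow> c' \<in> atlas Y \<Longrightarrow> prod_chart (cdim X) c c' \<in> atlas (prod_manifold X Y)"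
  unfolding prod_manifold_def cmanifold.simps mem_Collect_eq by blast

lemma atlas_prod_manifoldE:
  assumes "C \<in> atlas (prod_manifold X Y)"
  obtains c c' where "c \<in> atlas X" "c' \<in> atlas Y" "C = prod_chart (cdim X) c c'"
  using assms by (auto simp: prod_manifold_def)

context
  fixes m n :: nat and S :: "'a topology" and T :: "'b topology"
    and c d :: "'a chart" and c' d' :: "'b chart"
  assumes charts: "is_chart m S c" "is_chart n T c'"
begin

private lemma facts:
  "inj_on (snd c) (fst c)" "inj_on (snd c') (fst c')" "chart_image c \<subseteq> Cn m"
  using is_chart_facts[OF charts(1)] is_chart_facts[OF charts(2)] by auto

lemma eventually_transition_prod_chart:
  assumes "z \<in> chart_image (prod_chart m c c')" "j < m + n"
  shows "\<forall>\<^sub>F x in nhds (z j). transition (prod_chart m c c') (prod_chart m d d') (z(j := x)) =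
    join_coords m (transition c d (fst_coords m (z(j := x)))) (transition c' d' (snd_coords m (z(j := x))))"
  using eventually_coordinate_line[OF is_chart_facts(3)[OF is_chart_prod_chart[OF charts]] assms]
  by eventually_elim (rule transition_prod_chart[OF facts])

text \<open>The transition map is a pair of transition maps only on the chart image, but derivatives
  see only a neighbourhood on the coordinate line. The mixed derivatives vanish because each
  component depends on one group of coordinates.\<close>

lemma hol_jacobian_prod_chart:
  assumes z: "z \<in> chart_image (prod_chart m c c')"
  shows "block_matrix m n (hol_jacobian (transition (prod_chart m c c') (prod_chart m d d')) z)
    (hol_jacobian (transition c d) (fst_coords m z)) (hol_jacobian (transition c' d') (snd_coords m z))"
  unfolding block_matrix_def
proof (intro allI impI)
  fix i j assume ij: "i < m + n" "j < m + n"
  let ?t = "\<lambda>x. join_coords m (transition c d (fst_coords m (z(j := x)))) (transition c' d' (snd_coords m (z(j := x)))) i"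
  have "hol_jacobian (transition (prod_chart m c c') (prod_chart m d d')) z i j = deriv ?t (z j)"
    unfolding hol_jacobian_def
  proof (rule deriv_cong_ev)
    show "\<forall>\<^sub>F x in nhds (z j). transition (prod_chart m c c') (prod_chart m d d') (z(j := x)) i = ?t x"
      using eventually_transition_prod_chart[OF z ij(2)] by eventually_elim simp
  qed simp
  also have "\<dots> = (if i < m then (if j < m then hol_jacobian (transition c d) (fst_coords m z) i j else 0)
      else (if j < m then 0 else hol_jacobian (transition c' d') (snd_coords m z) (i - m) (j - m)))"
  proof -
    have "fst_coords m z j = z j" if "j < m" using that by (simp add: fst_coords_def)
    moreover have "snd_coords m z (j - m) = z j" if "\<not> j < m" using that by (simp add: snd_coords_def)
    ultimately show ?thesis
      by (cases "i < m"; cases "j < m") (simp_all add: join_coords_def hol_jacobian_def)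
  qed
  finally show "hol_jacobian (transition (prod_chart m c c') (prod_chart m d d')) z i j =
      (if i < m then if j < m then hol_jacobian (transition c d) (fst_coords m z) i j else 0
       else if j < m then 0 else hol_jacobian (transition c' d') (snd_coords m z) (i - m) (j - m))" .
qed

lemma holomorphic_transition_prod_chart:
  assumes h: "\<And>i. i < m \<Longrightarrow> holomorphic_fun_on m (overlap c d) (\<lambda>z. transition c d z i)"
    and h': "\<And>i. i < n \<Longrightarrow> holomorphic_fun_on n (overlap c' d') (\<lambda>z. transition c' d' z i)"
    and i: "i < m + n"
  shows "holomorphic_fun_on (m + n) (overlap (prod_chart m c c') (prod_chart m d d'))
    (\<lambda>z. transition (prod_chart m c c') (prod_chart m d d') z i)"
  unfolding holomorphic_fun_on_def
proof (intro conjI ballI allI impI)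
  let ?O = "overlap (prod_chart m c c') (prod_chart m d d')"
  let ?t = "\<lambda>z. transition (prod_chart m c c') (prod_chart m d d') z i"
  have O: "?O = {z. fst_coords m z \<in> overlap c d \<and> snd_coords m z \<in> overlap c' d'}"
    by (rule overlap_prod_chart[OF facts(3)])
  have t: "?t z = (if i < m then transition c d (fst_coords m z) i else transition c' d' (snd_coords m z) (i - m))"
    if "z \<in> chart_image (prod_chart m c c')" for z
    using transition_prod_chart[OF facts that] by (simp add: join_coords_def)
  have "continuous_on ?O (\<lambda>z. if i < m then transition c d (fst_coords m z) i else transition c' d' (snd_coords m z) (i - m))"
  proof (cases "i < m")
    case True
    have "continuous_on ?O (\<lambda>z. transition c d (fst_coords m z) i)"
      by (rule continuous_on_compose2[OF _ continuous_on_fst_coords])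
        (use h[OF True] O in \<open>auto simp: holomorphic_fun_on_def\<close>)
    then show ?thesis using True by simp
  next
    case False
    then have i': "i - m < n" using i by simp
    have "continuous_on ?O (\<lambda>z. transition c' d' (snd_coords m z) (i - m))"
      by (rule continuous_on_compose2[OF _ continuous_on_snd_coords])
        (use h'[OF i'] O in \<open>auto simp: holomorphic_fun_on_def\<close>)
    then show ?thesis using False by simp
  qed
  then show "continuous_on ?O ?t"
  proof (rule continuous_on_eq)
    fix z assume "z \<in> ?O"
    then have "z \<in> chart_image (prod_chart m c c')" by (rule subsetD[OF overlap_subset])
    then show "(if i < m then transition c d (fst_coords m z) i else transition c' d' (snd_coords m z) (i - m)) = ?t z"
      by (simp add: t)
  qed
  fix z j assume z: "z \<in> ?O" and j: "j < m + n"
  have zi: "z \<in> chart_image (prod_chart m c c')" using z overlap_subset by blast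
  have z12: "fst_coords m z \<in> overlap c d" "snd_coords m z \<in> overlap c' d'" using z O by auto
  let ?u = "\<lambda>x. join_coords m (transition c d (fst_coords m (z(j := x)))) (transition c' d' (snd_coords m (z(j := x)))) i"
  have "?u field_differentiable (at (z j))"
  proof (cases "i < m"; cases "j < m")
    assume ij: "i < m" "j < m"
    have "fst_coords m z j = z j" using ij by (simp add: fst_coords_def)
    moreover have "(\<lambda>x. transition c d ((fst_coords m z)(j := x)) i) field_differentiable (at (fst_coords m z j))"
      using h[OF ij(1)] z12(1) ij(2) unfolding holomorphic_fun_on_def by blast
    ultimately show ?thesis using ij by (simp add: join_coords_def)
  next
    assume ij: "\<not> i < m" "\<not> j < m"
    then have lt: "i - m < n" "j - m < n" using i j by auto
    have "snd_coords m z (j - m) = z j" using ij by (simp add: snd_coords_def)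
    moreover have "(\<lambda>x. transition c' d' ((snd_coords m z)(j - m := x)) (i - m))
        field_differentiable (at (snd_coords m z (j - m)))"
      using h'[OF lt(1)] z12(2) lt(2) unfolding holomorphic_fun_on_def by blast
    ultimately show ?thesis using ij by (simp add: join_coords_def)
  qed (simp_all add: join_coords_def)
  then obtain D where "(?u has_field_derivative D) (at (z j))" by (auto simp: field_differentiable_def)
  moreover have "\<forall>\<^sub>F x in nhds (z j). ?u x = ?t (z(j := x))"
    using eventually_transition_prod_chart[OF zi j] by eventually_elim simp
  ultimately have "((\<lambda>x. ?t (z(j := x))) has_field_derivative D) (at (z j))"
    using DERIV_cong_ev[OF refl _ refl, of ?u "\<lambda>x. ?t (z(j := x))" "z j" D] by blast
  then show "(\<lambda>x. ?t (z(j := x))) field_differentiable (at (z j))"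
    by (auto simp: field_differentiable_def)
qed

end

theorem complex_manifold_prod_manifold:
  assumes X: "complex_manifold X" and Y: "complex_manifold Y"
  shows "complex_manifold (prod_manifold X Y)"
  unfolding complex_manifold_def
proof (intro conjI ballI allI impI)
  show "Hausdorff_space (ctop (prod_manifold X Y))"
    using X Y by (simp add: complex_manifold_def prod_manifold_def Hausdorff_space_prod_topology)
  show "second_countable (ctop (prod_manifold X Y))"
    using X Y by (auto simp: complex_manifold_def prod_manifold_def second_countable_prod_topology)
  show "is_chart (cdim (prod_manifold X Y)) (ctop (prod_manifold X Y)) C"
    if C: "C \<in> atlas (prod_manifold X Y)" for C
    using C
  proof (rule atlas_prod_manifoldE)
    fix c c' assume c: "c \<in> atlas X" "c' \<in> atlas Y" and C_eq: "C = prod_chart (cdim X) c c'"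
    have "is_chart (cdim X + cdim Y) (prod_topology (ctop X) (ctop Y)) (prod_chart (cdim X) c c')"
      by (rule is_chart_prod_chart[OF complex_manifold_chart[OF X c(1)] complex_manifold_chart[OF Y c(2)]])
    then show ?thesis unfolding C_eq by (simp add: prod_manifold_def)
  qed
  have "(\<Union>C\<in>atlas (prod_manifold X Y). fst C) = (\<Union>c\<in>atlas X. fst c) \<times> (\<Union>c'\<in>atlas Y. fst c')"
  proof (intro set_eqI iffI)
    fix p assume "p \<in> (\<Union>c\<in>atlas X. fst c) \<times> (\<Union>c'\<in>atlas Y. fst c')"
    then obtain x y c c' where "p = (x, y)" "c \<in> atlas X" "x \<in> fst c" "c' \<in> atlas Y" "y \<in> fst c'" by blast
    then have "prod_chart (cdim X) c c' \<in> atlas (prod_manifold X Y)" "p \<in> fst (prod_chart (cdim X) c c')"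
      by (simp_all add: prod_chart_in_atlas fst_prod_chart)
    then show "p \<in> (\<Union>C\<in>atlas (prod_manifold X Y). fst C)" by blast
  next
    fix p assume "p \<in> (\<Union>C\<in>atlas (prod_manifold X Y). fst C)"
    then obtain C where C: "C \<in> atlas (prod_manifold X Y)" "p \<in> fst C" by blast
    from C(1) show "p \<in> (\<Union>c\<in>atlas X. fst c) \<times> (\<Union>c'\<in>atlas Y. fst c')"
    proof (rule atlas_prod_manifoldE)
      fix c c' assume "c \<in> atlas X" "c' \<in> atlas Y" "C = prod_chart (cdim X) c c'"
      then show ?thesis using C(2) by (auto simp only: fst_prod_chart)
    qed
  qed
  then show "(\<Union>C\<in>atlas (prod_manifold X Y). fst C) = topspace (ctop (prod_manifold X Y))"
    using X Y by (simp add: complex_manifold_def) (simp add: prod_manifold_def)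
  fix C D i assume C: "C \<in> atlas (prod_manifold X Y)" and D: "D \<in> atlas (prod_manifold X Y)"
    and i: "i < cdim (prod_manifold X Y)"
  obtain c c' where c: "c \<in> atlas X" "c' \<in> atlas Y" "C = prod_chart (cdim X) c c'"
    using C by (rule atlas_prod_manifoldE)
  obtain d d' where d: "d \<in> atlas X" "d' \<in> atlas Y" "D = prod_chart (cdim X) d d'"
    using D by (rule atlas_prod_manifoldE)
  show "holomorphic_fun_on (cdim (prod_manifold X Y)) (overlap C D) (\<lambda>z. transition C D z i)"
    unfolding c d cdim_prod_manifold
  proof (rule holomorphic_transition_prod_chart[OF complex_manifold_chart[OF X c(1)] complex_manifold_chart[OF Y c(2)]])
    show "holomorphic_fun_on (cdim X) (overlap c d) (\<lambda>z. transition c d z i)" if "i < cdim X" for i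
      using X c d that by (simp add: complex_manifold_def)
    show "holomorphic_fun_on (cdim Y) (overlap c' d') (\<lambda>z. transition c' d' z i)" if "i < cdim Y" for i
      using Y c d that by (simp add: complex_manifold_def)
  qed (use i in simp)
qed

section \<open>The product form\<close>

text \<open>
  Several pairs of charts may have the same product chart; any of them computes the same form.
\<close>

definition factor_charts :: "'a cmanifold \<Rightarrow> 'b cmanifold \<Rightarrow> ('a \<times> 'b) chart \<Rightarrow> 'a chart \<times> 'b chart" where
  "factor_charts X Y C =
     (SOME p. fst p \<in> atlas X \<and> snd p \<in> atlas Y \<and> C = prod_chart (cdim X) (fst p) (snd p))"

lemma factor_charts:
  assumes "C \<in> atlas (prod_manifold X Y)"
  obtains c c' where "factor_charts X Y C = (c, c')" "c \<in> atlas X" "c' \<in> atlas Y" "C = prod_chart (cdim X) c c'"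
proof -
  have "\<exists>p. fst p \<in> atlas X \<and> snd p \<in> atlas Y \<and> C = prod_chart (cdim X) (fst p) (snd p)"
    using assms by (auto elim!: atlas_prod_manifoldE)
  then have "fst (factor_charts X Y C) \<in> atlas X \<and> snd (factor_charts X Y C) \<in> atlas Y \<and>
      C = prod_chart (cdim X) (fst (factor_charts X Y C)) (snd (factor_charts X Y C))"
    unfolding factor_charts_def by (rule someI_ex)
  then show ?thesis using that[of "fst (factor_charts X Y C)" "snd (factor_charts X Y C)"] by simp
qed

definition prod_form :: "'a cmanifold \<Rightarrow> 'b cmanifold \<Rightarrow> nat \<Rightarrow> 'a form \<Rightarrow> (nat \<Rightarrow> 'b form) \<Rightarrow> ('a \<times> 'b) form" where
  "prod_form X Y s \<omega> \<beta> C =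
     conv_form (cdim X) s (\<omega> (fst (factor_charts X Y C))) (\<lambda>t. \<beta> t (snd (factor_charts X Y C)))"

lemma smooth_form_iff:
  "smooth_form X w \<longleftrightarrow>
     (\<forall>c\<in>atlas X. (\<forall>z\<in>chart_image c. ext_on (cdim X) (w c z)) \<and> smooth_local (cdim X) (chart_image c) (w c)) \<and>
     (\<forall>c\<in>atlas X. \<forall>c'\<in>atlas X. \<forall>z\<in>overlap c c'.
        w c z = pullback (cdim X) (hol_jacobian (transition c c') z) (w c' (transition c c' z)))"
  by (simp add: smooth_form_def smooth_local_def)

lemma smooth_formD:
  assumes "smooth_form X w" "c \<in> atlas X"
  shows "z \<in> chart_image c \<Longrightarrow> ext_on (cdim X) (w c z)" "smooth_local (cdim X) (chart_image c) (w c)"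
    "c' \<in> atlas X \<Longrightarrow> z \<in> overlap c c' \<Longrightarrow>
      w c z = pullback (cdim X) (hol_jacobian (transition c c') z) (w c' (transition c c' z))"
  using assms unfolding smooth_form_iff by blast+

lemma smooth_form_pull:
  assumes "complex_manifold X" "smooth_form X w" "c \<in> atlas X" "c' \<in> atlas X" "z \<in> overlap c c'"
  shows "Extalg (w c z) = pull (cdim X) (hol_jacobian (transition c c') z) (Extalg (w c' (transition c c' z)))"
proof -
  have "inj_on (snd c) (fst c)" using is_chart_facts(5)[OF complex_manifold_chart[OF assms(1,3)]] .
  then have e: "ext_on (cdim X) (w c' (transition c c' z))"
    using transition_in_chart_image assms(5) by (intro smooth_formD(1)[OF assms(2,4)])
  have "w c z = coef (pull (cdim X) (hol_jacobian (transition c c') z) (Extalg (w c' (transition c c' z))))"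
    using smooth_formD(3)[OF assms(2-5)] by (simp add: coef_pull[OF supported_Extalg[OF e]] coef_Extalg[OF e])
  then show ?thesis by simp
qed

text \<open>Pullback is a homomorphism of the algebra and so commutes with the exponential
  construction. The Jacobian of a chart change is block diagonal, so on each factor it acts as the
  pullback of that factor, where compatibility is known.\<close>

lemma smooth_form_prod_form:
  assumes X: "complex_manifold X" and Y: "complex_manifold Y"
    and \<omega>: "smooth_form X \<omega>" and \<beta>: "\<And>t. smooth_form Y (\<beta> t)"
  shows "smooth_form (prod_manifold X Y) (prod_form X Y s \<omega> \<beta>)"
  unfolding smooth_form_iff cdim_prod_manifold
proof (intro conjI ballI)
  let ?m = "cdim X" and ?n = "cdim Y"
  \<comment> \<open>Stated for an arbitrary chart with its factors, because it is applied to both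
    charts of an overlap.\<close>
  have eq: "prod_form X Y s \<omega> \<beta> C z = coef (exp_conv (Extalg (\<omega> c (fst_coords ?m z)))
        (\<lambda>t. shift ?m (Extalg (\<beta> t c' (snd_coords ?m z)))) s)"
    "fst_coords ?m z \<in> chart_image c" "snd_coords ?m z \<in> chart_image c'"
    "supported (coframe_range 0 ?m) (Extalg (\<omega> c (fst_coords ?m z)))"
    "\<And>t. supported (coframe_range 0 ?n) (Extalg (\<beta> t c' (snd_coords ?m z)))"
    "supported (coframe_range 0 (?m + ?n)) (exp_conv (Extalg (\<omega> c (fst_coords ?m z)))
        (\<lambda>t. shift ?m (Extalg (\<beta> t c' (snd_coords ?m z)))) s)"
    if "factor_charts X Y C = (c, c')" "c \<in> atlas X" "c' \<in> atlas Y" "C = prod_chart ?m c c'"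
      "z \<in> chart_image C" for C c c' z
  proof -
    note im = chart_image_prod_chart[OF is_chart_facts(4)[OF complex_manifold_chart[OF X that(2)]]]
    show zi: "fst_coords ?m z \<in> chart_image c" "snd_coords ?m z \<in> chart_image c'"
      using that(5) im[of c'] unfolding that(4) by auto
    have e: "ext_on ?m (\<omega> c (fst_coords ?m z))" "ext_on ?n (\<beta> t c' (snd_coords ?m z))" for t
      using smooth_formD(1)[OF \<omega> that(2) zi(1)] smooth_formD(1)[OF \<beta> that(3) zi(2)] by auto
    show "prod_form X Y s \<omega> \<beta> C z = coef (exp_conv (Extalg (\<omega> c (fst_coords ?m z)))
        (\<lambda>t. shift ?m (Extalg (\<beta> t c' (snd_coords ?m z)))) s)"
      unfolding prod_form_def that(1) fst_conv snd_conv by (rule conv_form_eq) (rule e)+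
    show s: "supported (coframe_range 0 ?m) (Extalg (\<omega> c (fst_coords ?m z)))"
      "supported (coframe_range 0 ?n) (Extalg (\<beta> t c' (snd_coords ?m z)))" for t
      using e by (auto intro: supported_Extalg)
    show "supported (coframe_range 0 (?m + ?n)) (exp_conv (Extalg (\<omega> c (fst_coords ?m z)))
        (\<lambda>t. shift ?m (Extalg (\<beta> t c' (snd_coords ?m z)))) s)"
      by (intro supported_exp_conv supported_mono[OF s(1)] supported_mono[OF supported_shift[OF s(2)]]
          coframe_range_mono) auto
  qed
  fix C assume C: "C \<in> atlas (prod_manifold X Y)"
  obtain c c' where c: "factor_charts X Y C = (c, c')" "c \<in> atlas X" "c' \<in> atlas Y" "C = prod_chart ?m c c'"
    using C by (rule factor_charts)
  note cX = complex_manifold_chart[OF X c(2)] and cY = complex_manifold_chart[OF Y c(3)]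
  show "ext_on (?m + ?n) (prod_form X Y s \<omega> \<beta> C z)" if "z \<in> chart_image C" for z
    unfolding eq(1)[OF c that] ext_on_iff by (rule eq(6)[OF c that])
  show "smooth_local (?m + ?n) (chart_image C) (prod_form X Y s \<omega> \<beta> C)"
    unfolding prod_form_def c(1) fst_conv snd_conv
  proof (rule smooth_local_conv_form)
    show "open_Cn (?m + ?n) (chart_image C)"
      unfolding c(4) by (rule is_chart_facts(3)[OF is_chart_prod_chart[OF cX cY]])
    show "fst_coords ?m ` chart_image C \<subseteq> chart_image c" "snd_coords ?m ` chart_image C \<subseteq> chart_image c'"
      using eq(2,3)[OF c] by auto
  qed (use smooth_formD(2)[OF \<omega> c(2)] smooth_formD(2)[OF \<beta> c(3)] in auto)
  fix D z assume D: "D \<in> atlas (prod_manifold X Y)" and z: "z \<in> overlap C D"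
  obtain d d' where d: "factor_charts X Y D = (d, d')" "d \<in> atlas X" "d' \<in> atlas Y" "D = prod_chart ?m d d'"
    using D by (rule factor_charts)
  note dX = complex_manifold_chart[OF X d(2)] and dY = complex_manifold_chart[OF Y d(3)]
  have zC: "z \<in> chart_image C" using z overlap_subset by blast
  have z12: "fst_coords ?m z \<in> overlap c d" "snd_coords ?m z \<in> overlap c' d'"
    using z unfolding c(4) d(4) overlap_prod_chart[OF is_chart_facts(4)[OF cX]] by blast+
  define z' where "z' = transition C D z"
  have zD: "z' \<in> chart_image D"
    unfolding z'_def
    using is_chart_facts(5)[OF is_chart_prod_chart[OF cX cY]] z unfolding c(4) by (rule transition_in_chart_image)
  have z': "z' = join_coords ?m (transition c d (fst_coords ?m z)) (transition c' d' (snd_coords ?m z))"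
    unfolding z'_def c(4) d(4)
    using is_chart_facts[OF cX] is_chart_facts[OF cY] zC unfolding c(4) by (intro transition_prod_chart)
  have "transition c d (fst_coords ?m z) \<in> Cn ?m"
    using transition_in_chart_image[OF is_chart_facts(5)[OF cX] z12(1)] is_chart_facts(4)[OF dX] by blast
  then have f: "fst_coords ?m z' = transition c d (fst_coords ?m z)"
    "snd_coords ?m z' = transition c' d' (snd_coords ?m z)"
    unfolding z' by simp_all
  let ?J = "hol_jacobian (transition C D) z"
  have J: "block_matrix ?m ?n ?J (hol_jacobian (transition c d) (fst_coords ?m z))
      (hol_jacobian (transition c' d') (snd_coords ?m z))"
    using hol_jacobian_prod_chart[OF cX cY] zC unfolding c(4) d(4) by blast
  have "prod_form X Y s \<omega> \<beta> C z = coef (exp_conv (Extalg (\<omega> c (fst_coords ?m z)))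
        (\<lambda>t. shift ?m (Extalg (\<beta> t c' (snd_coords ?m z)))) s)"
    by (rule eq(1)[OF c zC])
  also have "Extalg (\<omega> c (fst_coords ?m z)) = pull (?m + ?n) ?J (Extalg (\<omega> d (fst_coords ?m z')))"
    unfolding pull_block_matrix_fst[OF J eq(4)[OF d zD]] unfolding f
    by (rule smooth_form_pull[OF X \<omega> c(2) d(2) z12(1)])
  also have "(\<lambda>t. shift ?m (Extalg (\<beta> t c' (snd_coords ?m z)))) =
      (\<lambda>t. pull (?m + ?n) ?J (shift ?m (Extalg (\<beta> t d' (snd_coords ?m z')))))"
    unfolding pull_block_matrix_shift[OF J eq(5)[OF d zD]] unfolding f
    using smooth_form_pull[OF Y \<beta> c(3) d(3) z12(2)] by simp
  also have "exp_conv (pull (?m + ?n) ?J (Extalg (\<omega> d (fst_coords ?m z'))))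
      (\<lambda>t. pull (?m + ?n) ?J (shift ?m (Extalg (\<beta> t d' (snd_coords ?m z'))))) s =
      pull (?m + ?n) ?J (exp_conv (Extalg (\<omega> d (fst_coords ?m z'))) (\<lambda>t. shift ?m (Extalg (\<beta> t d' (snd_coords ?m z')))) s)"
    by (rule alg_hom_exp_conv[OF alg_hom_pull, symmetric])
  also have "coef \<dots> = pullback (?m + ?n) ?J (prod_form X Y s \<omega> \<beta> D z')"
    unfolding eq(1)[OF d zD] by (rule coef_pull[OF eq(6)[OF d zD]])
  finally show "prod_form X Y s \<omega> \<beta> C z = pullback (?m + ?n) ?J (prod_form X Y s \<omega> \<beta> D (transition C D z))"
    unfolding z'_def .
qed

section \<open>A volume form from a transverse form of codimension one\<close>

text \<open>
  A transverse form of bidegree (n-1,n-1) induces a positive definite Hermitian form on covectors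
  with values in (n,n)-forms. Its determinant is a density of weight n-1, represented here by the
  n-th power of a (1,1)-form, and the root of order n-1 of this density is a volume form.
\<close>

definition raw_11 :: "nat \<Rightarrow> (nat \<Rightarrow> nat \<Rightarrow> complex) \<Rightarrow> extalg" where
  "raw_11 n h = (\<Sum>j<n. \<Sum>k<n. cst (h j k) * (gen (Dz j) * gen (Dzbar k)))"

lemma form_11_eq_raw: "form_11 n h = raw_11 n (\<lambda>j k. \<i> / 2 * h j k)"
  by (simp add: form_11_def raw_11_def)

lemma supported_raw_11: "supported (coframe_range 0 n) (raw_11 n h)"
  unfolding raw_11_def
  by (intro supported_sum supported_cst_mult supported_mult supported_gen) auto

lemma bideg_raw_11: "bideg 1 1 (raw_11 n h)"
  unfolding raw_11_def
  using bideg_mult[OF bideg_gen_Dz bideg_gen_Dzbar]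
  by (intro bideg_sum bideg_cst_mult) simp

lemma raw_11_cong:
  "(\<And>j k. j < n \<Longrightarrow> k < n \<Longrightarrow> h j k = h' j k) \<Longrightarrow> raw_11 n h = raw_11 n h'"
  unfolding raw_11_def by (intro sum.cong) auto

lemma cst_mult_raw_11: "cst c * raw_11 n h = raw_11 n (\<lambda>j k. c * h j k)"
  unfolding raw_11_def sum_distrib_left cst_mult_left ..

lemma raw_11_sum: "(\<Sum>b\<in>B. raw_11 n (h b)) = raw_11 n (\<lambda>j k. \<Sum>b\<in>B. h b j k)"
  unfolding raw_11_def
  by (subst sum.swap, intro sum.cong refl, subst sum.swap, intro sum.cong refl)
    (simp only: sum_distrib_right cst_sum)

lemma econj_cov: "econj (cov 0 n \<psi>) = (\<Sum>k<n. cst (cnj (\<psi> k)) * gen (Dzbar k))"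
  by (simp add: cov_def conj_sum conj_mult atLeast0LessThan)

lemma cov_mult_econj_cov: "cov 0 n \<phi> * econj (cov 0 n \<psi>) = raw_11 n (\<lambda>j k. \<phi> j * cnj (\<psi> k))"
  unfolding econj_cov unfolding cov_def atLeast0LessThan cst_linear_combination_mult raw_11_def ..

lemma coef_cnj_raw_11: "coef_cnj (raw_11 n h) = raw_11 n (\<lambda>j k. cnj (h j k))"
  by (simp add: raw_11_def coef_cnj_sum coef_cnj_mult coef_cnj_cst)

lemma top_form_mon:
  assumes "supported (coframe_range 0 n) x" "bideg n n x"
  shows "x = cst (coef x (coframe_range 0 n)) * mon (coframe_range 0 n)"
  using top_form[of 0 n x] assms by (simp add: vol_eq_mon cst_mult_left)

text \<open>Up to a nonzero constant depending on \<open>n\<close> alone this is the determinant of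
  \<open>h\<close>; the constant is \<open>raw_det n delta_matrix\<close>. Powers of (1,1)-forms are
  used in place of determinants because homomorphisms of the algebra respect them.\<close>

definition raw_det :: "nat \<Rightarrow> (nat \<Rightarrow> nat \<Rightarrow> complex) \<Rightarrow> complex" where
  "raw_det n h = coef (raw_11 n h ^ n) (coframe_range 0 n)"

lemma raw_11_power: "raw_11 n h ^ n = cst (raw_det n h) * mon (coframe_range 0 n)"
  unfolding raw_det_def
  using bideg_power[OF bideg_raw_11, of n n h]
  by (intro top_form_mon supported_power supported_raw_11) simp

lemma raw_det_cnj: "raw_det n (\<lambda>j k. cnj (h j k)) = cnj (raw_det n h)"
  unfolding raw_det_def coef_cnj_raw_11[symmetric] coef_cnj_power[symmetric] by simp

lemma raw_det_cong:
  "(\<And>j k. j < n \<Longrightarrow> k < n \<Longrightarrow> h j k = h' j k) \<Longrightarrow> raw_det n h = raw_det n h'"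
  unfolding raw_det_def using raw_11_cong[of n h h'] by simp

text \<open>The exponential construction without a second factor: with 1 in index 0 and zero
  elsewhere, the part of degree n is the n-th power divided by n!, and transversality in top degree
  is positivity.\<close>

lemma positive_form_11_power:
  assumes "\<And>j k. j < n \<Longrightarrow> k < n \<Longrightarrow> h j k = cnj (h k j)"
    and "\<And>v. \<exists>i<n. v i \<noteq> 0 \<Longrightarrow>
      \<exists>r::real. r > 0 \<and> (\<Sum>j<n. \<Sum>k<n. h j k * v j * cnj (v k)) = of_real r"
  shows "pos_top 0 n (form_11 n h ^ n)"
proof -
  have "\<exists>\<theta>. (\<forall>b<n. \<theta> b b \<noteq> 0) \<and> form_11 n h = (\<Sum>b<n. sq (cov b n (\<theta> b)))"
    by (rule positive_form_11_decomposition) (rule assms; assumption)+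
  then obtain \<theta> where \<theta>: "\<And>b. b < n \<Longrightarrow> \<theta> b b \<noteq> 0" and h: "form_11 n h = (\<Sum>b\<in>{0..<n}. sq (cov b n (\<theta> b)))"
    unfolding atLeast0LessThan by blast
  define x :: "nat \<Rightarrow> extalg" where "x s = (if s = 0 then 1 else 0)" for s
  have "trans_form 0 n n (exp_conv (form_11 n h) x n)"
    unfolding h
  proof (rule trans_form_exp_conv[where q = 0 and m = n])
    show "trans_form n n s (x s)" if "0 \<le> s" "s \<le> n - n" for s
      using that by (auto simp: trans_form_def x_def pos_top_def vol_def intro: exI[of _ "1::real"])
  qed (auto simp: x_def \<theta>)
  then have "pos_top 0 n (exp_conv (form_11 n h) x n * sq_prod 0 n (n - 0 - n) (\<lambda>_ _. 0))"
    unfolding trans_form_def by (auto simp: indep_def)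
  moreover have "exp_conv (form_11 n h) x n = cst (1 / fact n) * form_11 n h ^ n"
    unfolding exp_conv_def by (subst sum.remove[of _ n]) (auto simp: x_def)
  ultimately obtain c :: real where c: "c > 0" "cst (1 / fact n) * form_11 n h ^ n = cst (of_real c) * vol 0 n"
    by (auto simp: pos_top_def)
  have "form_11 n h ^ n = cst (fact n) * (cst (1 / fact n) * form_11 n h ^ n)"
    unfolding cst_mult_left by simp
  also have "\<dots> = cst (of_real (fact n * c)) * vol 0 n"
    unfolding c(2) cst_mult_left by simp
  finally show ?thesis
    unfolding pos_top_def using c(1) by (intro exI[of _ "fact n * c"]) simp
qed

abbreviation delta_matrix :: "nat \<Rightarrow> nat \<Rightarrow> complex" where
  "delta_matrix \<equiv> \<lambda>j k. if j = k then 1 else 0"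

lemma raw_11_delta: "raw_11 n delta_matrix = (\<Sum>i<n. gen (Dz i) * gen (Dzbar i))"
proof -
  have "(\<Sum>k<n. cst (delta_matrix j k) * (gen (Dz j) * gen (Dzbar k))) = gen (Dz j) * gen (Dzbar j)"
    if "j < n" for j
  proof -
    have "(\<Sum>k<n. cst (delta_matrix j k) * (gen (Dz j) * gen (Dzbar k))) =
        (\<Sum>k<n. if k = j then gen (Dz j) * gen (Dzbar j) else 0)"
      by (intro sum.cong) auto
    then show ?thesis using that by (simp add: sum.delta)
  qed
  then show ?thesis by (simp add: raw_11_def)
qed

text \<open>The identity matrix is positive definite, so the n-th power of its form is a positive
  multiple of the volume form.\<close>

lemma raw_det_delta_nonzero: "raw_det n delta_matrix \<noteq> 0"
proof
  assume z: "raw_det n delta_matrix = 0"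
  have "pos_top 0 n (form_11 n delta_matrix ^ n)"
  proof (rule positive_form_11_power)
    fix v :: "nat \<Rightarrow> complex" assume "\<exists>i<n. v i \<noteq> 0"
    then obtain i where i: "i < n" "v i \<noteq> 0" by blast
    have "(\<Sum>j<n. \<Sum>k<n. delta_matrix j k * v j * cnj (v k)) = (\<Sum>j<n. of_real ((cmod (v j))\<^sup>2))"
    proof (intro sum.cong refl)
      fix j assume "j \<in> {..<n}"
      have "(\<Sum>k<n. delta_matrix j k * v j * cnj (v k)) = (\<Sum>k<n. if k = j then v j * cnj (v j) else 0)"
        by (intro sum.cong) auto
      then show "(\<Sum>k<n. delta_matrix j k * v j * cnj (v k)) = of_real ((cmod (v j))\<^sup>2)"
        using \<open>j \<in> {..<n}\<close> by (simp only: complex_norm_square) (simp add: sum.delta)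
    qed
    also have "\<dots> = of_real (\<Sum>j<n. (cmod (v j))\<^sup>2)" by simp
    finally have "(\<Sum>j<n. \<Sum>k<n. delta_matrix j k * v j * cnj (v k)) = of_real (\<Sum>j<n. (cmod (v j))\<^sup>2)" .
    moreover have "(\<Sum>j<n. (cmod (v j))\<^sup>2) > 0"
      using i by (intro sum_pos2[of _ i]) auto
    ultimately show "\<exists>r::real. r > 0 \<and> (\<Sum>j<n. \<Sum>k<n. delta_matrix j k * v j * cnj (v k)) = of_real r"
      by blast
  qed auto
  moreover have "form_11 n delta_matrix = cst (\<i> / 2) * raw_11 n delta_matrix"
    by (simp add: form_11_eq_raw cst_mult_raw_11)
  then have "form_11 n delta_matrix ^ n = cst ((\<i> / 2) ^ n) * raw_11 n delta_matrix ^ n"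
    by (simp add: cst_mult_power)
  then have "form_11 n delta_matrix ^ n = 0" unfolding raw_11_power z by simp
  ultimately show False using vol_nonzero by (auto simp: pos_top_def cst_mult_eq_0_iff)
qed

lemma raw_det_delta_real: "cnj (raw_det n delta_matrix) = raw_det n delta_matrix"
  unfolding raw_det_cnj[symmetric] by (rule raw_det_cong) simp

text \<open>The pullback is split into a homomorphism acting on the dz-generators only and, with
  \<open>antihol_gen\<close>, one acting on their conjugates only; each multiplies the top monomial
  by a single determinant.\<close>

fun hol_gen :: "nat \<Rightarrow> (nat \<Rightarrow> nat \<Rightarrow> complex) \<Rightarrow> coframe_elem \<Rightarrow> extalg" where
  "hol_gen n M (Dz i) = cov 0 n (M i)"
| "hol_gen n M (Dzbar i) = gen (Dzbar i)"

fun antihol_gen :: "nat \<Rightarrow> (nat \<Rightarrow> nat \<Rightarrow> complex) \<Rightarrow> coframe_elem \<Rightarrow> extalg" where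
  "antihol_gen n M (Dz i) = gen (Dz i)"
| "antihol_gen n M (Dzbar i) = econj (cov 0 n (M i))"

lemma odd_map_hol_gen: "odd_map (hol_gen n M)"
proof
  have "has_degree 1 (coef (hol_gen n M g))" for g
    using bideg_degree[OF bideg_cov] has_degree_gen by (cases g) auto
  then show "hol_gen n M a * hol_gen n M b = - (hol_gen n M b * hol_gen n M a)" for a b
    by (intro has_degree_1_mult)
qed

lemma odd_map_antihol_gen: "odd_map (antihol_gen n M)"
proof
  have "has_degree 1 (coef (antihol_gen n M g))" for g
    using bideg_degree[OF bideg_conj[OF bideg_cov]] has_degree_gen by (cases g) auto
  then show "antihol_gen n M a * antihol_gen n M b = - (antihol_gen n M b * antihol_gen n M a)" for a b
    by (intro has_degree_1_mult)
qed

definition hol_pull :: "nat \<Rightarrow> (nat \<Rightarrow> nat \<Rightarrow> complex) \<Rightarrow> extalg \<Rightarrow> extalg" where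
  "hol_pull n M = odd_map.hom (hol_gen n M)"

definition antihol_pull :: "nat \<Rightarrow> (nat \<Rightarrow> nat \<Rightarrow> complex) \<Rightarrow> extalg \<Rightarrow> extalg" where
  "antihol_pull n M = odd_map.hom (antihol_gen n M)"

lemma alg_hom_hol_pull: "alg_hom (hol_pull n M)" and alg_hom_antihol_pull: "alg_hom (antihol_pull n M)"
  unfolding hol_pull_def antihol_pull_def
  by (rule odd_map.alg_hom_hom[OF odd_map_hol_gen] odd_map.alg_hom_hom[OF odd_map_antihol_gen])+

lemma hol_pull_gen [simp]: "hol_pull n M (gen g) = hol_gen n M g"
  and antihol_pull_gen [simp]: "antihol_pull n M (gen g) = antihol_gen n M g"
  unfolding hol_pull_def antihol_pull_def
  by (rule odd_map.hom_gen[OF odd_map_hol_gen] odd_map.hom_gen[OF odd_map_antihol_gen])+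

lemma pull_eq_hol_antihol:
  assumes "supported (coframe_range 0 n) x"
  shows "pull n M x = hol_pull n M (antihol_pull n M x)"
proof (rule alg_hom_eq_on[OF alg_hom_pull alg_hom_comp[OF alg_hom_hol_pull alg_hom_antihol_pull] assms])
  fix g
  have "hol_pull n M (econj (cov 0 n \<psi>)) = econj (cov 0 n \<psi>)" for \<psi>
    by (simp add: econj_cov alg_hom_sum[OF alg_hom_hol_pull] alg_hom_simps[OF alg_hom_hol_pull])
  then show "pull n M (gen g) = hol_pull n M (antihol_pull n M (gen g))"
    by (cases g) auto
qed

text \<open>The homomorphism takes the form of the identity matrix to the form of the transpose of
  \<open>M\<close>. Comparing the top coefficients of their n-th powers gives the determinant as a
  quotient.\<close>

lemma hol_pull_mon:
  "hol_pull n M (mon (coframe_range 0 n)) =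
     cst (raw_det n (\<lambda>j k. M k j) / raw_det n delta_matrix) * mon (coframe_range 0 n)"
proof -
  let ?d = "raw_det n delta_matrix" and ?mon = "mon (coframe_range 0 n)"
  have "hol_pull n M (raw_11 n delta_matrix) = (\<Sum>k<n. cov 0 n (M k) * gen (Dzbar k))"
    by (simp add: raw_11_delta alg_hom_sum[OF alg_hom_hol_pull] alg_hom_simps[OF alg_hom_hol_pull])
  also have "\<dots> = (\<Sum>k<n. \<Sum>j<n. cst (M k j) * (gen (Dz j) * gen (Dzbar k)))"
    by (simp add: cov_def atLeast0LessThan sum_distrib_right mult.assoc)
  also have "\<dots> = raw_11 n (\<lambda>j k. M k j)"
    unfolding raw_11_def by (rule sum.swap)
  finally have "hol_pull n M (raw_11 n delta_matrix ^ n) = raw_11 n (\<lambda>j k. M k j) ^ n"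
    by (simp add: alg_hom_power[OF alg_hom_hol_pull])
  then have "cst ?d * hol_pull n M ?mon = cst (raw_det n (\<lambda>j k. M k j)) * ?mon"
    unfolding raw_11_power by (simp add: alg_hom_simps[OF alg_hom_hol_pull])
  then have "cst (1 / ?d) * (cst ?d * hol_pull n M ?mon) = cst (1 / ?d) * (cst (raw_det n (\<lambda>j k. M k j)) * ?mon)"
    by simp
  then show ?thesis
    using raw_det_delta_nonzero[of n] unfolding cst_mult_left by simp
qed

lemma antihol_pull_mon:
  "antihol_pull n M (mon (coframe_range 0 n)) =
     cst (raw_det n (\<lambda>j k. cnj (M j k)) / raw_det n delta_matrix) * mon (coframe_range 0 n)"
proof -
  let ?d = "raw_det n delta_matrix" and ?mon = "mon (coframe_range 0 n)"
  have "antihol_pull n M (raw_11 n delta_matrix) = (\<Sum>j<n. gen (Dz j) * econj (cov 0 n (M j)))"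
    by (simp add: raw_11_delta alg_hom_sum[OF alg_hom_antihol_pull] alg_hom_simps[OF alg_hom_antihol_pull])
  also have "\<dots> = raw_11 n (\<lambda>j k. cnj (M j k))"
    unfolding raw_11_def econj_cov by (simp add: sum_distrib_left cst_left_commute)
  finally have "antihol_pull n M (raw_11 n delta_matrix ^ n) = raw_11 n (\<lambda>j k. cnj (M j k)) ^ n"
    by (simp add: alg_hom_power[OF alg_hom_antihol_pull])
  then have "cst ?d * antihol_pull n M ?mon = cst (raw_det n (\<lambda>j k. cnj (M j k))) * ?mon"
    unfolding raw_11_power by (simp add: alg_hom_simps[OF alg_hom_antihol_pull])
  then have "cst (1 / ?d) * (cst ?d * antihol_pull n M ?mon) = cst (1 / ?d) * (cst (raw_det n (\<lambda>j k. cnj (M j k))) * ?mon)"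
    by simp
  then show ?thesis
    using raw_det_delta_nonzero[of n] unfolding cst_mult_left by simp
qed

text \<open>The squared absolute value of the determinant of \<open>M\<close>: after division by the
  constant, the two factors are the determinants of its conjugate and of its transpose.\<close>

definition vol_factor :: "nat \<Rightarrow> (nat \<Rightarrow> nat \<Rightarrow> complex) \<Rightarrow> complex" where
  "vol_factor n M = raw_det n (\<lambda>j k. cnj (M j k)) * raw_det n (\<lambda>j k. M k j) / (raw_det n delta_matrix)\<^sup>2"

lemma supported_mon: "finite K \<Longrightarrow> K \<subseteq> S \<Longrightarrow> supported S (mon K)"
  by (auto simp: supported_def coef_mon split: if_splits)

lemma pull_mon_top:
  "pull n M (mon (coframe_range 0 n)) = cst (vol_factor n M) * mon (coframe_range 0 n)"
proof -
  have "pull n M (mon (coframe_range 0 n)) = hol_pull n M (antihol_pull n M (mon (coframe_range 0 n)))"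
    by (rule pull_eq_hol_antihol) (simp add: supported_mon)
  also have "\<dots> = cst (raw_det n (\<lambda>j k. cnj (M j k)) / raw_det n delta_matrix) *
      hol_pull n M (mon (coframe_range 0 n))"
    unfolding antihol_pull_mon by (simp add: alg_hom_simps[OF alg_hom_hol_pull])
  finally show ?thesis
    unfolding hol_pull_mon cst_mult_left by (simp add: vol_factor_def power2_eq_square)
qed

lemma pull_vol: "pull n M (vol 0 n) = cst (vol_factor n M) * vol 0 n"
proof -
  have "pull n M (vol 0 n) = cst (sigma n) * (cst (vol_factor n M) * mon (coframe_range 0 n))"
    by (simp add: vol_eq_mon alg_hom_simps[OF alg_hom_pull] pull_mon_top)
  then show ?thesis by (simp add: vol_eq_mon cst_mult_left mult.commute)
qed

text \<open>The volume form is the product of the squares of the coordinate covectors, so its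
  pullback is the product of the squares of the rows of \<open>M\<close>.\<close>

lemma pull_vol_nonneg: "nonneg_top 0 n (pull n M (vol 0 n))"
proof -
  have "pull n M (vol 0 n) = prod_list (map (\<lambda>i. pull n M (sq (gen (Dz i)))) [0..<n])"
    by (simp add: vol_def alg_hom_prod_list[OF alg_hom_pull] o_def)
  also have "\<dots> = sq_prod 0 n n M"
    by (simp add: sq_prod_def sq_def alg_hom_simps[OF alg_hom_pull])
  finally have e: "pull n M (vol 0 n) = sq_prod 0 n n M" .
  show ?thesis
  proof (cases "indep 0 n n M")
    case True
    then show ?thesis
      using indep_card_le_and_pos_top[of 0 n n M] by (auto simp: e intro: pos_top_nonneg)
  next
    case False
    then show ?thesis by (simp add: e sq_prod_eq_0_if_dependent nonneg_top_0)
  qed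
qed

lemma vol_factor_nonneg: "\<exists>\<rho>::real. \<rho> \<ge> 0 \<and> vol_factor n M = of_real \<rho>"
  using pull_vol_nonneg[of n M] unfolding pull_vol nonneg_top_def by auto

text \<open>Transposing the matrix conjugates the two factors and exchanges them, and the value is
  real.\<close>

lemma vol_factor_transpose: "vol_factor n (\<lambda>i j. M j i) = vol_factor n M"
proof -
  obtain \<rho> :: real where \<rho>: "vol_factor n M = of_real \<rho>" using vol_factor_nonneg by blast
  have "vol_factor n (\<lambda>i j. M j i) = cnj (vol_factor n M)"
    unfolding vol_factor_def complex_cnj_divide complex_cnj_mult complex_cnj_power
      raw_det_cnj raw_det_delta_real by (simp add: mult.commute)
  then show ?thesis by (simp add: \<rho>)
qed

lemma pull_raw_11:
  "pull n M (raw_11 n h) = raw_11 n (\<lambda>j k. \<Sum>a<n. \<Sum>b<n. h a b * (M a j * cnj (M b k)))"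
proof -
  have "pull n M (raw_11 n h) = (\<Sum>a<n. \<Sum>b<n. cst (h a b) * raw_11 n (\<lambda>j k. M a j * cnj (M b k)))"
    unfolding raw_11_def[of n h]
    by (simp add: alg_hom_sum[OF alg_hom_pull] alg_hom_simps[OF alg_hom_pull] cov_mult_econj_cov)
  then show ?thesis by (simp add: cst_mult_raw_11 raw_11_sum)
qed

section \<open>The Hermitian matrix of a form of codimension one and its determinant\<close>

definition pair_matrix :: "nat \<Rightarrow> extalg \<Rightarrow> nat \<Rightarrow> nat \<Rightarrow> complex" where
  "pair_matrix n w j k =
     coef (w * (cst (\<i> / 2) * (gen (Dz j) * gen (Dzbar k)))) (coframe_range 0 n) / sigma n"

text \<open>By the expansion of the n-th power of a (1,1)-form this is n! times the determinant of
  \<open>pair_matrix n w\<close>.\<close>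

definition density :: "nat \<Rightarrow> extalg \<Rightarrow> complex" where
  "density n w = coef (form_11 n (pair_matrix n w) ^ n) (coframe_range 0 n) / sigma n"

lemma form_11_power: "form_11 n (pair_matrix n w) ^ n = cst (density n w) * vol 0 n"
  unfolding density_def
  using top_form[of 0 n "form_11 n (pair_matrix n w) ^ n"]
    supported_power[OF supported_form_11] bideg_power[OF bideg_form_11, of n n]
  by simp

context
  fixes n :: nat and w :: extalg
  assumes n: "1 \<le> n" and w: "trans_form 0 n (n - 1) w" "econj w = w"
begin

lemma mult_pair_matrix:
  assumes "j < n" "k < n"
  shows "w * (cst (\<i> / 2) * (gen (Dz j) * gen (Dzbar k))) = cst (pair_matrix n w j k) * vol 0 n"
proof -
  have "supported (coframe_range 0 n) (w * (cst (\<i> / 2) * (gen (Dz j) * gen (Dzbar k))))"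
    using assms w by (intro supported_mult supported_cst_mult supported_gen) (auto simp: trans_form_def)
  moreover have "bideg (n - 1 + (1 + 0)) (n - 1 + (0 + 1)) (w * (cst (\<i> / 2) * (gen (Dz j) * gen (Dzbar k))))"
    using w by (intro bideg_mult bideg_cst_mult bideg_gen_Dz bideg_gen_Dzbar) (auto simp: trans_form_def)
  ultimately show ?thesis
    using top_form[of 0 n "w * (cst (\<i> / 2) * (gen (Dz j) * gen (Dzbar k)))"] n
    by (simp add: pair_matrix_def)
qed

lemma mult_form_11: "w * form_11 n h = cst (\<Sum>j<n. \<Sum>k<n. h j k * pair_matrix n w j k) * vol 0 n"
proof -
  have "w * form_11 n h = (\<Sum>j<n. \<Sum>k<n. cst (h j k) * (w * (cst (\<i> / 2) * (gen (Dz j) * gen (Dzbar k)))))"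
    unfolding form_11_def sum_distrib_left
    by (intro sum.cong refl) (simp only: cst_left_commute[of w] cst_mult_left mult.commute)
  also have "\<dots> = (\<Sum>j<n. \<Sum>k<n. cst (h j k * pair_matrix n w j k) * vol 0 n)"
    by (intro sum.cong refl) (simp add: mult_pair_matrix cst_mult_left)
  finally show ?thesis by (simp add: cst_sum sum_distrib_right)
qed

lemma pair_matrix_hermitian:
  assumes "j < n" "k < n"
  shows "pair_matrix n w j k = cnj (pair_matrix n w k j)"
proof -
  have "econj (w * (cst (\<i> / 2) * (gen (Dz k) * gen (Dzbar j)))) =
      w * (cst (- (\<i> / 2)) * (gen (Dzbar k) * gen (Dz j)))"
    by (simp add: conj_mult w(2))
  also have "gen (Dzbar k) * gen (Dz j) = - (gen (Dz j) * gen (Dzbar k))"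
    by (rule gen_anticommute)
  finally have "econj (cst (pair_matrix n w k j) * vol 0 n) = cst (pair_matrix n w j k) * vol 0 n"
    by (simp add: mult_pair_matrix assms cst_uminus)
  then show ?thesis by (simp add: conj_mult conj_vol)
qed

text \<open>In codimension one there is a single test covector \<open>v\<close>, independent as soon
  as it is nonzero; wedging with its square gives the value of the Hermitian form at
  \<open>v\<close>.\<close>

lemma pair_matrix_positive:
  assumes "\<exists>i<n. v i \<noteq> 0"
  shows "\<exists>r::real. r > 0 \<and> (\<Sum>j<n. \<Sum>k<n. pair_matrix n w j k * v j * cnj (v k)) = of_real r"
proof -
  obtain i where i: "i < n" "v i \<noteq> 0" using assms by blast
  have "indep 0 n (n - 0 - (n - 1)) (\<lambda>_. v)"
    unfolding indep_def
  proof (intro allI impI)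
    fix c :: "nat \<Rightarrow> complex" and b
    assume c: "\<forall>i\<in>{0..<n}. (\<Sum>b<n - 0 - (n - 1). c b * v i) = 0" and "b < n - 0 - (n - 1)"
    then have "b = 0" by auto
    moreover have "n - 0 - (n - 1) = Suc 0" using n by auto
    then have "c 0 * v i = 0" using c[rule_format, of i] i by (simp add: One_nat_def)
    ultimately show "c b = 0" using i by simp
  qed
  then have "pos_top 0 n (w * sq_prod 0 n (n - 0 - (n - 1)) (\<lambda>_. v))"
    using w by (auto simp: trans_form_def)
  moreover have "n - 0 - (n - 1) = Suc 0" using n by auto
  then have "sq_prod 0 n (n - 0 - (n - 1)) (\<lambda>_. v) = form_11 n (\<lambda>j k. v j * cnj (v k))"
    by (simp add: sq_prod_Suc sq_cov_eq_form_11)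
  ultimately have "pos_top 0 n (w * form_11 n (\<lambda>j k. v j * cnj (v k)))" by (simp only:)
  then obtain r :: real where "r > 0"
    "cst (\<Sum>j<n. \<Sum>k<n. v j * cnj (v k) * pair_matrix n w j k) * vol 0 n = cst (of_real r) * vol 0 n"
    unfolding pos_top_def mult_form_11 by blast
  moreover have "(\<Sum>j<n. \<Sum>k<n. v j * cnj (v k) * pair_matrix n w j k) =
      (\<Sum>j<n. \<Sum>k<n. pair_matrix n w j k * v j * cnj (v k))"
    by (intro sum.cong refl) (simp add: mult.commute mult.left_commute)
  ultimately show ?thesis by auto
qed

lemma density_positive: "\<exists>r::real. r > 0 \<and> density n w = of_real r"
proof -
  have "pos_top 0 n (form_11 n (pair_matrix n w) ^ n)"
    by (rule positive_form_11_power) (rule pair_matrix_hermitian pair_matrix_positive; assumption)+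
  then show ?thesis unfolding form_11_power by (auto simp: pos_top_def)
qed

end

text \<open>Let B and B' be the pair matrices of \<open>w\<close> and \<open>w'\<close>, let \<rho>
  be the squared absolute value of det J, and write J^H for the conjugate transpose. Pulling back
  the products that define B' gives J B J^H = \<rho> B'. Taking determinants gives \<rho> det B =
  \<rho>^n det B', and cancelling one \<rho> leaves the weight n - 1.\<close>

lemma density_transform:
  assumes n: "2 \<le> n" and w: "trans_form 0 n (n - 1) w" "econj w = w"
    and w': "trans_form 0 n (n - 1) w'" "econj w' = w'" and J: "w = pull n J w'"
  shows "\<exists>\<rho>::real. \<rho> > 0 \<and> pull n J (vol 0 n) = cst (of_real \<rho>) * vol 0 n \<and>
    density n w = of_real (\<rho> ^ (n - 1)) * density n w'"
proof -
  have n1: "1 \<le> n" using n by simp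
  obtain \<rho> :: real where \<rho>: "\<rho> \<ge> 0" "vol_factor n J = of_real \<rho>" using vol_factor_nonneg by blast
  let ?B = "pair_matrix n w" and ?B' = "pair_matrix n w'"
  have B: "(\<Sum>a<n. \<Sum>b<n. J j a * cnj (J k b) * ?B a b) = of_real \<rho> * ?B' j k" if "j < n" "k < n" for j k
  proof -
    have "pull n J (w' * (cst (\<i> / 2) * (gen (Dz j) * gen (Dzbar k)))) =
        w * (cst (\<i> / 2) * (cov 0 n (J j) * econj (cov 0 n (J k))))"
      by (simp add: alg_hom_simps[OF alg_hom_pull] J)
    also have "\<dots> = w * form_11 n (\<lambda>a b. J j a * cnj (J k b))"
      by (simp add: cov_mult_econj_cov cst_mult_raw_11 form_11_eq_raw)
    also have "\<dots> = cst (\<Sum>a<n. \<Sum>b<n. J j a * cnj (J k b) * ?B a b) * vol 0 n"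
      by (rule mult_form_11[OF n1 w])
    finally have "pull n J (cst (?B' j k) * vol 0 n) = cst (\<Sum>a<n. \<Sum>b<n. J j a * cnj (J k b) * ?B a b) * vol 0 n"
      unfolding mult_pair_matrix[OF n1 w' that] .
    then show ?thesis
      by (simp add: alg_hom_simps[OF alg_hom_pull] pull_vol \<rho>(2) cst_mult_left mult.commute)
  qed
  \<comment> \<open>A singular Jacobian is excluded by transversality: otherwise the form of B would
    vanish on all rows of \<open>J\<close>, so \<open>J\<close> would be zero and with it
    \<open>w\<close>, which has positive degree because of n \<ge> 2.\<close>
  have "\<rho> \<noteq> 0"
  proof
    assume "\<rho> = 0"
    have Jz: "J i a = 0" if ia: "i < n" "a < n" for i a
    proof (rule ccontr)
      assume "J i a \<noteq> 0"
      then obtain r :: real where "r > 0" "(\<Sum>a<n. \<Sum>b<n. ?B a b * J i a * cnj (J i b)) = of_real r"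
        using pair_matrix_positive[OF n1 w, of "J i"] ia by blast
      moreover have "(\<Sum>a<n. \<Sum>b<n. ?B a b * J i a * cnj (J i b)) = (\<Sum>a<n. \<Sum>b<n. J i a * cnj (J i b) * ?B a b)"
        by (intro sum.cong refl) (simp add: mult.commute mult.left_commute)
      ultimately show False using B[OF ia(1) ia(1)] \<open>\<rho> = 0\<close> by simp
    qed
    \<comment> \<open>The pullback by the zero matrix is the projection to degree zero.\<close>
    have h: "alg_hom (\<lambda>x. cst (coef x {}))"
      by (simp add: alg_hom_def cst_add coef_mult wedge_def cst_mult coef_cst)
    have "pull n J w' = cst (coef w' {})"
    proof (rule alg_hom_eq_on[OF alg_hom_pull h])
      show "supported (coframe_range 0 n) w'" using w' by (simp add: trans_form_def)
      fix g assume g: "g \<in> coframe_range 0 n"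
      have "cov 0 n (J i) = 0" if "i < n" for i
        unfolding cov_def using Jz that by (intro sum.neutral) auto
      then show "pull n J (gen g) = cst (coef (gen g) {})"
        using g by (cases g) (auto simp: coef_gen ext_gen_def)
    qed
    moreover have "coef w' {} = 0"
    proof (rule ccontr)
      assume "coef w' {} \<noteq> 0"
      then have "hol_degree {} = n - 1" using w'(1) by (auto simp: trans_form_def has_bidegree_def)
      then show False using n by (simp add: hol_degree_def)
    qed
    ultimately have "w = 0" using J by simp
    then have "?B j k = 0" for j k by (simp add: pair_matrix_def)
    moreover have "\<exists>i<n. (1::complex) \<noteq> 0" using n by (intro exI[of _ 0]) simp
    ultimately show False using pair_matrix_positive[OF n1 w, of "\<lambda>_. 1"] by auto
  qed
  then have \<rho>0: "\<rho> > 0" using \<rho>(1) by simp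
  \<comment> \<open>Pullback by \<open>M\<close> multiplies the matrix of a (1,1)-form by the
    transpose of \<open>M\<close> from the left and by the conjugate of \<open>M\<close> from the
    right, so the transpose of \<open>J\<close> is what produces J B J^H.\<close>
  define M where "M i j = J j i" for i j
  have "pull n M (form_11 n ?B) = raw_11 n (\<lambda>j k. \<Sum>a<n. \<Sum>b<n. \<i> / 2 * ?B a b * (J j a * cnj (J k b)))"
    by (simp add: form_11_eq_raw pull_raw_11 M_def)
  also have "\<dots> = raw_11 n (\<lambda>j k. of_real \<rho> * (\<i> / 2 * ?B' j k))"
  proof (rule raw_11_cong)
    fix j k assume jk: "j < n" "k < n"
    have "(\<Sum>a<n. \<Sum>b<n. \<i> / 2 * ?B a b * (J j a * cnj (J k b))) =
        \<i> / 2 * (\<Sum>a<n. \<Sum>b<n. J j a * cnj (J k b) * ?B a b)"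
      unfolding sum_distrib_left by (intro sum.cong refl) (simp add: mult.commute mult.left_commute)
    then show "(\<Sum>a<n. \<Sum>b<n. \<i> / 2 * ?B a b * (J j a * cnj (J k b))) = of_real \<rho> * (\<i> / 2 * ?B' j k)"
      unfolding B[OF jk] by simp
  qed
  also have "\<dots> = cst (of_real \<rho>) * form_11 n ?B'"
    by (simp add: form_11_eq_raw cst_mult_raw_11)
  finally have P: "pull n M (form_11 n ?B) = cst (of_real \<rho>) * form_11 n ?B'" .
  have "pull n M (form_11 n ?B ^ n) = cst (of_real \<rho> ^ n) * form_11 n ?B' ^ n"
    by (simp only: alg_hom_power[OF alg_hom_pull] P cst_mult_power)
  moreover have "vol_factor n M = of_real \<rho>"
    unfolding M_def vol_factor_transpose[of n J] by (rule \<rho>(2))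
  ultimately have "cst (density n w * of_real \<rho>) * vol 0 n = cst (of_real \<rho> ^ n * density n w') * vol 0 n"
    unfolding form_11_power by (simp add: alg_hom_simps[OF alg_hom_pull] pull_vol cst_mult_left)
  then have "density n w * of_real \<rho> = of_real \<rho> ^ n * density n w'" by simp
  moreover have "(of_real \<rho> :: complex) ^ n = of_real \<rho> ^ (n - 1) * of_real \<rho>"
    using n by (cases n) auto
  ultimately have "density n w = of_real (\<rho> ^ (n - 1)) * density n w'"
    using \<rho>0 by simp
  then show ?thesis using \<rho>0 \<rho>(2) pull_vol[of n J] by auto
qed

definition vol_form :: "'a cmanifold \<Rightarrow> 'a form \<Rightarrow> 'a form" where
  "vol_form Y \<Omega> c z K =
     density (cdim Y) (Extalg (\<Omega> c z)) powr (1 / of_nat (cdim Y - 1)) * coef (vol 0 (cdim Y)) K"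

lemma smooth_density:
  assumes V: "open_Cn n V" and w: "smooth_local n V w" and e: "\<And>z. z \<in> V \<Longrightarrow> ext_on n (w z)"
  shows "smooth_fun_on n V (\<lambda>z. density n (Extalg (w z)))"
proof -
  define B where "B j k z = wedge (w z) (coef (cst (\<i> / 2) * (gen (Dz j) * gen (Dzbar k)))) (coframe_range 0 n) / sigma n"
    for j k z
  have "smooth_local n V (\<lambda>z. wedge (w z) (coef (cst (\<i> / 2) * (gen (Dz j) * gen (Dzbar k)))))" for j k
    by (rule smooth_local_wedge[OF V w]) (simp add: smooth_local_def smooth_fun_on_const)
  then have "smooth_fun_on n V (\<lambda>z. (1 / sigma n) * wedge (w z) (coef (cst (\<i> / 2) * (gen (Dz j) * gen (Dzbar k)))) (coframe_range 0 n))" for j k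
    by (intro smooth_fun_on_mult[OF V] smooth_fun_on_const) (simp add: smooth_local_def)
  then have B: "smooth_fun_on n V (B j k)" for j k by (simp add: B_def[abs_def])
  have "smooth_local n V (\<lambda>z. coef (form_11 n (\<lambda>j k. B j k z)))"
    unfolding smooth_local_def form_11_def coef_sum coef_cst_mult mult.assoc
    by (intro allI smooth_fun_on_sum[OF V] smooth_fun_on_mult[OF V] smooth_fun_on_const B)
  then have "smooth_local n V (\<lambda>z. wedge_power n (coef (form_11 n (\<lambda>j k. B j k z))))"
    by (rule smooth_local_wedge_power[OF V])
  then have "smooth_fun_on n V (\<lambda>z. (1 / sigma n) * wedge_power n (coef (form_11 n (\<lambda>j k. B j k z))) (coframe_range 0 n))"
    by (intro smooth_fun_on_mult[OF V] smooth_fun_on_const) (simp add: smooth_local_def)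
  moreover have "(1 / sigma n) * wedge_power n (coef (form_11 n (\<lambda>j k. B j k z))) (coframe_range 0 n) =
      density n (Extalg (w z))" if "z \<in> V" for z
  proof -
    have "B j k z = pair_matrix n (Extalg (w z)) j k" for j k
      unfolding B_def pair_matrix_def coef_mult[of "Extalg (w z)"] coef_Extalg[OF e[OF that]] ..
    then show ?thesis by (simp add: density_def coef_power)
  qed
  ultimately show ?thesis by (rule smooth_fun_on_cong[OF V, rotated])
qed

text \<open>The density of weight n - 1 is scaled by the power n - 1 of the factor that scales the
  volume form, so its root makes the local formulas agree on overlaps. The density takes positive
  real values, which keeps the principal branch of the root smooth.\<close>

theorem exists_volume_form:
  assumes Y: "complex_manifold Y" and n: "cdim Y = n" "2 \<le> n" and \<Omega>: "transverse_form Y (n - 1) \<Omega>"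
  shows "smooth_form Y (vol_form Y \<Omega>)" "form_all Y (transverse n n) (vol_form Y \<Omega>)"
proof -
  let ?a = "1 / real (n - 1)"
  have sm: "smooth_form Y \<Omega>" using \<Omega> by (simp add: transverse_form_def)
  have e: "ext_on n (\<Omega> c z)" and tr: "trans_form 0 n (n - 1) (Extalg (\<Omega> c z))"
    "econj (Extalg (\<Omega> c z)) = Extalg (\<Omega> c z)"
    if "c \<in> atlas Y" "z \<in> chart_image c" for c z
  proof -
    show e: "ext_on n (\<Omega> c z)" using smooth_formD(1)[OF sm that] n(1) by simp
    have "transverse n (n - 1) (\<Omega> c z)" using \<Omega> that n(1) unfolding transverse_form_def form_all_def by blast
    then have "transverse n (n - 1) (coef (Extalg (\<Omega> c z)))" by (simp only: coef_Extalg[OF e])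
    then show "trans_form 0 n (n - 1) (Extalg (\<Omega> c z))" "econj (Extalg (\<Omega> c z)) = Extalg (\<Omega> c z)"
      unfolding transverse_iff by blast+
  qed
  have n1: "1 \<le> n" using n by simp
  note dpos = density_positive[OF n1 tr]
  have f: "\<exists>r::real. r > 0 \<and> density n (Extalg (\<Omega> c z)) = of_real r \<and>
      vol_form Y \<Omega> c z = coef (cst (of_real (r powr ?a)) * vol 0 n)"
    if cz: "c \<in> atlas Y" "z \<in> chart_image c" for c z
  proof -
    obtain r :: real where r: "r > 0" "density n (Extalg (\<Omega> c z)) = of_real r"
      using dpos[OF cz cz] by blast
    have "(of_real r :: complex) powr (1 / of_nat (n - 1)) = of_real (r powr ?a)"
      using powr_of_real[of r ?a] r(1) by simp
    then have "vol_form Y \<Omega> c z = coef (cst (of_real (r powr ?a)) * vol 0 n)"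
      by (intro ext) (simp add: vol_form_def n(1) r(2))
    then show ?thesis using r by blast
  qed
  have sv: "supported (coframe_range 0 n) (cst b * vol 0 n)" for b
    by (intro supported_cst_mult supported_vol)
  show "form_all Y (transverse n n) (vol_form Y \<Omega>)"
    unfolding form_all_def
  proof (intro ballI)
    fix c z assume "c \<in> atlas Y" "z \<in> chart_image c"
    then obtain r :: real where r: "r > 0" "vol_form Y \<Omega> c z = coef (cst (of_real (r powr ?a)) * vol 0 n)"
      using f by blast
    have "trans_form 0 n n (cst (of_real (r powr ?a)) * vol 0 n)"
      unfolding trans_form_def
    proof (intro conjI allI impI sv)
      show "bideg n n (cst (of_real (r powr ?a)) * vol 0 n)"
        using bideg_cst_mult[OF bideg_vol[of n 0]] by simp
      show "pos_top 0 n (cst (of_real (r powr ?a)) * vol 0 n * sq_prod 0 n (n - 0 - n) \<psi>)" for \<psi>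
        using r(1) by (auto simp: pos_top_def intro!: exI[of _ "r powr ?a"])
    qed
    then show "transverse n n (vol_form Y \<Omega> c z)"
      unfolding r(2) transverse_iff by (simp add: conj_mult conj_vol)
  qed
  show "smooth_form Y (vol_form Y \<Omega>)"
    unfolding smooth_form_iff n(1)
  proof (intro conjI ballI)
    fix c assume c: "c \<in> atlas Y"
    have V: "open_Cn n (chart_image c)"
      using is_chart_facts(3)[OF complex_manifold_chart[OF Y c]] n(1) by simp
    show "ext_on n (vol_form Y \<Omega> c z)" if zc: "z \<in> chart_image c" for z
    proof -
      obtain r :: real where "vol_form Y \<Omega> c z = coef (cst (of_real (r powr ?a)) * vol 0 n)"
        using f[OF c zc] by blast
      then show ?thesis by (simp only: ext_on_iff sv)
    qed
    have "smooth_fun_on n (chart_image c) (\<lambda>z. density n (Extalg (\<Omega> c z)))"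
      using smooth_formD(2)[OF sm c] e[OF c] n(1) by (intro smooth_density[OF V]) auto
    moreover have "density n (Extalg (\<Omega> c z)) \<notin> \<real>\<^sub>\<le>\<^sub>0" if z: "z \<in> chart_image c" for z
    proof -
      obtain r :: real where "r > 0" "density n (Extalg (\<Omega> c z)) = of_real r"
        using f[OF c z] by blast
      then show ?thesis by simp
    qed
    ultimately have "smooth_fun_on n (chart_image c) (\<lambda>z. density n (Extalg (\<Omega> c z)) powr (1 / of_nat (n - 1)))"
      by (intro smooth_fun_on_powr[OF V])
    then show "smooth_local n (chart_image c) (vol_form Y \<Omega> c)"
      unfolding smooth_local_def vol_form_def n(1)
      by (intro allI smooth_fun_on_mult[OF V] smooth_fun_on_const)
    fix c' z assume c': "c' \<in> atlas Y" and z: "z \<in> overlap c c'"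
    let ?J = "hol_jacobian (transition c c') z" and ?z' = "transition c c' z"
    have zc: "z \<in> chart_image c" using z overlap_subset by blast
    have zc': "?z' \<in> chart_image c'"
      using transition_in_chart_image[OF is_chart_facts(5)[OF complex_manifold_chart[OF Y c]] z] .
    obtain r :: real where r: "r > 0" "density n (Extalg (\<Omega> c z)) = of_real r"
      "vol_form Y \<Omega> c z = coef (cst (of_real (r powr ?a)) * vol 0 n)"
      using f[OF c zc] by blast
    obtain r' :: real where r': "r' > 0" "density n (Extalg (\<Omega> c' ?z')) = of_real r'"
      "vol_form Y \<Omega> c' ?z' = coef (cst (of_real (r' powr ?a)) * vol 0 n)"
      using f[OF c' zc'] by blast
    have "Extalg (\<Omega> c z) = pull n ?J (Extalg (\<Omega> c' ?z'))"
      using smooth_form_pull[OF Y sm c c' z] n(1) by simp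
    then obtain \<rho> :: real where \<rho>: "\<rho> > 0" "pull n ?J (vol 0 n) = cst (of_real \<rho>) * vol 0 n"
      "density n (Extalg (\<Omega> c z)) = of_real (\<rho> ^ (n - 1)) * density n (Extalg (\<Omega> c' ?z'))"
      using density_transform[OF n(2) tr[OF c zc] tr[OF c' zc']] by blast
    have "r = \<rho> ^ (n - 1) * r'"
      using \<rho>(3) unfolding r(2) r'(2) of_real_mult[symmetric] of_real_eq_iff .
    moreover have "(\<rho> ^ (n - 1)) powr ?a = \<rho>"
    proof -
      have "(\<rho> ^ (n - 1)) powr ?a = (\<rho> powr real (n - 1)) powr ?a"
        using \<rho>(1) by (simp add: powr_realpow)
      also have "\<dots> = \<rho>" using \<rho>(1) n(2) by (simp add: powr_powr)
      finally show ?thesis .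
    qed
    ultimately have "r powr ?a = \<rho> * r' powr ?a"
      using \<rho>(1) r'(1) by (simp add: powr_mult)
    then have "cst (of_real (r powr ?a)) * vol 0 n = pull n ?J (cst (of_real (r' powr ?a)) * vol 0 n)"
      by (simp add: alg_hom_simps[OF alg_hom_pull] \<rho>(2) cst_mult_left mult.commute)
    then show "vol_form Y \<Omega> c z = pullback n ?J (vol_form Y \<Omega> c' ?z')"
      unfolding r(3) r'(3) by (simp only: coef_pull[OF sv])
  qed
qed

section \<open>The product theorem\<close>

text \<open>Meant for type S, where the closed form on Y need not be of pure type: the factor from X
  is of pure type, so taking a component of the product amounts to taking a component of the other
  factor.\<close>

lemma ext_component_wedge:
  assumes "has_bidegree j k u"
  shows "ext_component (j + a) (k + b) (wedge u v) = wedge u (ext_component a b v)"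
proof
  fix K
  show "ext_component (j + a) (k + b) (wedge u v) K = wedge u (ext_component a b v) K"
  proof (cases "finite K")
    case False
    then show ?thesis by (simp add: ext_component_def wedge_infinite)
  next
    case True
    have iff: "hol_degree K = j + a \<and> antihol_degree K = k + b \<longleftrightarrow>
        hol_degree (K - A) = a \<and> antihol_degree (K - A) = b" if "A \<subseteq> K" "u A \<noteq> 0" for A
      using hol_degree_split[OF True that(1)] antihol_degree_split[OF True that(1)] assms that(2)
      by (auto simp: has_bidegree_def)
    show ?thesis
    proof (cases "hol_degree K = j + a \<and> antihol_degree K = k + b")
      case True
      then have "shuffle_sign A (K - A) * u A * v (K - A) =
          shuffle_sign A (K - A) * u A * ext_component a b v (K - A)" if "A \<subseteq> K" for A
        using iff[OF that] by (cases "u A = 0") (auto simp: ext_component_def)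
      then have "wedge u v K = wedge u (ext_component a b v) K"
        unfolding wedge_def by (intro sum.cong) auto
      then show ?thesis using True by (simp add: ext_component_def[of "j + a"])
    next
      case False
      then have "shuffle_sign A (K - A) * u A * ext_component a b v (K - A) = 0" if "A \<subseteq> K" for A
        using iff[OF that] by (cases "u A = 0") (auto simp: ext_component_def)
      then have "wedge u (ext_component a b v) K = 0"
        unfolding wedge_def by (intro sum.neutral) blast
      then show ?thesis using False by (auto simp: ext_component_def[of "j + a"])
    qed
  qed
qed

lemma ext_component_shift: "ext_component a b (shift_ext m v) = shift_ext m (ext_component a b v)"
proof
  fix K
  show "ext_component a b (shift_ext m v) K = shift_ext m (ext_component a b v) K"
  proof (cases "K \<subseteq> range (shift_elem m)")
    case True
    then obtain L where "K = shift_elem m ` L" by (auto simp: subset_image_iff)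
    then show ?thesis by (simp add: ext_component_def)
  next
    case False
    then show ?thesis by (simp add: ext_component_def shift_ext_notin_range[OF False])
  qed
qed

lemma ext_component_conv_form:
  assumes "\<And>j. has_bidegree j j (wedge_power j (\<omega> (fst_coords m z)))"
  shows "ext_component s s (conv_form m s \<omega> \<beta> z) = conv_form m s \<omega> (\<lambda>t z. ext_component t t (\<beta> t z)) z"
proof
  fix K
  have "ext_component s s (wedge (wedge_power j (\<omega> (fst_coords m z))) (shift_ext m w)) =
      wedge (wedge_power j (\<omega> (fst_coords m z))) (shift_ext m (ext_component (s - j) (s - j) w))" if "j \<le> s" for j w
    using ext_component_wedge[OF assms[of j], of "s - j" "s - j" "shift_ext m w"] that
    by (simp add: ext_component_shift)
  then have "conv_form m s \<omega> (\<lambda>t z. ext_component t t (\<beta> t z)) z K =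
      (\<Sum>j\<le>s. (1 / fact j) * ext_component s s (wedge (wedge_power j (\<omega> (fst_coords m z)))
        (shift_ext m (\<beta> (s - j) (snd_coords m z)))) K)"
    unfolding conv_form_def by (intro sum.cong refl) simp
  note eq = this
  show "ext_component s s (conv_form m s \<omega> \<beta> z) K = conv_form m s \<omega> (\<lambda>t z. ext_component t t (\<beta> t z)) z K"
  proof (cases "hol_degree K = s \<and> antihol_degree K = s")
    case True
    then have "ext_component s s w K = w K" for w by (simp add: ext_component_def)
    then show ?thesis unfolding eq by (simp add: conv_form_def)
  next
    case False
    then have "ext_component s s w K = 0" for w by (auto simp: ext_component_def)
    then show ?thesis unfolding eq by simp
  qed
qed

lemma has_degree_shift_ext: "has_degree r w \<Longrightarrow> has_degree r (shift_ext m w)"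
  unfolding has_degree_def
proof (intro allI impI)
  fix K assume w: "\<forall>K. w K \<noteq> 0 \<longrightarrow> card K = r" and K: "shift_ext m w K \<noteq> 0"
  have "K \<subseteq> range (shift_elem m)" using K shift_ext_notin_range by blast
  then obtain L where "K = shift_elem m ` L" by (auto simp: subset_image_iff)
  then show "card K = r"
    using K w by (simp add: card_image inj_on_subset[OF inj_shift_elem subset_UNIV])
qed

text \<open>The alternative for each \<open>j\<close> accommodates the indices at which the family
  on Y is zero; there the difference \<open>R - 2 * j\<close> may be truncated.\<close>

lemma has_degree_conv_form:
  assumes "has_degree 2 (\<omega> (fst_coords m z))"
    and "\<And>j. j \<le> s \<Longrightarrow> 2 * j \<le> R \<and> has_degree (R - 2 * j) (\<beta> (s - j) (snd_coords m z)) \<or>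
      \<beta> (s - j) (snd_coords m z) = (\<lambda>_. 0)"
  shows "has_degree R (conv_form m s \<omega> \<beta> z)"
  unfolding has_degree_def
proof (intro allI impI)
  fix K assume "conv_form m s \<omega> \<beta> z K \<noteq> 0"
  then obtain j where j: "j \<le> s"
    "wedge (wedge_power j (\<omega> (fst_coords m z))) (shift_ext m (\<beta> (s - j) (snd_coords m z))) K \<noteq> 0"
    unfolding conv_form_def by (metis (no_types, lifting) atMost_iff mult_zero_right sum.neutral)
  have "shift_ext m (\<lambda>_. 0) = (\<lambda>_. 0)" by (rule ext) (simp add: shift_ext_def)
  then have "\<beta> (s - j) (snd_coords m z) \<noteq> (\<lambda>_. 0)" using j(2) by auto
  then have d: "2 * j \<le> R" "has_degree (R - 2 * j) (\<beta> (s - j) (snd_coords m z))"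
    using assms(2)[OF j(1)] by auto
  have "has_degree (j * 2 + (R - 2 * j))
      (wedge (wedge_power j (\<omega> (fst_coords m z))) (shift_ext m (\<beta> (s - j) (snd_coords m z))))"
    by (intro has_degree_wedge has_degree_wedge_power[OF assms(1)] has_degree_shift_ext d(2))
  then show "card K = R" using j(2) d(1) by (auto simp: has_degree_def)
qed

text \<open>Two forms are compared on chart images only. These are open, so derivatives see nothing
  else, and transition maps lead from one chart image into another. Type S uses the transfer for the
  component of the product form.\<close>

lemma smooth_form_cong:
  assumes X: "complex_manifold X" and eq: "form_eq X v w" and v: "smooth_form X v"
  shows "smooth_form X w"
  unfolding smooth_form_iff
proof (intro conjI ballI)
  fix c assume c: "c \<in> atlas X"
  note cX = complex_manifold_chart[OF X c]
  have e: "v c z = w c z" if "c \<in> atlas X" "z \<in> chart_image c" for c z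
    using eq that unfolding form_eq_def by blast
  show "ext_on (cdim X) (w c z)" if "z \<in> chart_image c" for z
    using smooth_formD(1)[OF v c that] e[OF c that] by simp
  show "smooth_local (cdim X) (chart_image c) (w c)"
    by (rule smooth_local_cong[OF is_chart_facts(3)[OF cX] e[OF c] smooth_formD(2)[OF v c]])
  fix c' z assume c': "c' \<in> atlas X" and z: "z \<in> overlap c c'"
  have "z \<in> chart_image c" using z by (rule subsetD[OF overlap_subset])
  moreover have "transition c c' z \<in> chart_image c'"
    by (rule transition_in_chart_image[OF is_chart_facts(5)[OF cX] z])
  ultimately show "w c z = pullback (cdim X) (hol_jacobian (transition c c') z) (w c' (transition c c' z))"
    using smooth_formD(3)[OF v c c' z] e[OF c] e[OF c'] by simp
qed

lemma form_all_cong: "form_eq X v w \<Longrightarrow> form_all X P v \<Longrightarrow> form_all X P w"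
  unfolding form_eq_def form_all_def by metis

lemma smooth_form_zero: "smooth_form X form_zero"
proof -
  have z: "form_zero c z = (\<lambda>_. 0)" for c :: "'b chart" and z
    by (rule ext) (simp add: form_zero_def)
  have "pullback (cdim X) J (\<lambda>_. 0) = (\<lambda>_. 0)" for J
    by (rule ext) (simp add: pullback_def)
  then show ?thesis
    unfolding smooth_form_iff z by (simp add: smooth_local_def form_zero_def smooth_fun_on_const ext_on_def)
qed

lemma derivatives_form_zero:
  "form_del X form_zero c z = (\<lambda>_. 0)" "form_delbar X form_zero c z = (\<lambda>_. 0)" "form_d X form_zero c z = (\<lambda>_. 0)"
proof -
  have e: "form_zero c = (\<lambda>_ _. 0)" by (intro ext) (simp add: form_zero_def)
  show *: "form_del X form_zero c z = (\<lambda>_. 0)" "form_delbar X form_zero c z = (\<lambda>_. 0)"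
    unfolding form_del_def form_delbar_def e del_eq_dolb delbar_eq_dolb by (rule dolb_const)+
  then show "form_d X form_zero c z = (\<lambda>_. 0)"
    by (intro ext) (simp add: form_d_def ext_d_def form_del_def form_delbar_def)
qed

text \<open>Either derivative of a form of top bidegree would have a degree exceeding the
  dimension.\<close>

lemma derivatives_top_form:
  assumes Y: "complex_manifold Y" and V: "smooth_form Y V" "form_all Y (has_bidegree (cdim Y) (cdim Y)) V"
    and c: "c \<in> atlas Y" "z \<in> chart_image c"
  shows "form_del Y V c z = (\<lambda>_. 0)" "form_delbar Y V c z = (\<lambda>_. 0)" "form_d Y V c z = (\<lambda>_. 0)"
proof -
  let ?n = "cdim Y"
  note o = is_chart_facts(3)[OF complex_manifold_chart[OF Y c(1)]]
  have b: "has_bidegree ?n ?n (V c x)" if "x \<in> chart_image c" for x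
    using V(2) c(1) that unfolding form_all_def by blast
  have "ext_on ?n (dolb ?n \<epsilon> G (V c) z)" if "\<And>j. j < ?n \<Longrightarrow> G j \<in> coframe ?n" for \<epsilon> G
    by (rule ext_on_dolb[OF o c(2)]) (use smooth_formD(1)[OF V(1) c(1)] that in auto)
  then have "ext_on ?n (del ?n (V c) z)" "ext_on ?n (delbar ?n (V c) z)"
    unfolding del_eq_dolb delbar_eq_dolb by (auto simp: coframe_def)
  then show *: "form_del Y V c z = (\<lambda>_. 0)" "form_delbar Y V c z = (\<lambda>_. 0)"
    unfolding form_del_def form_delbar_def
    using has_bidegree_del[OF o c(2), of ?n ?n "V c"] b
    by (intro eq_0_if_degree_too_large[where p = "Suc ?n" and q = ?n], auto)
      (intro eq_0_if_degree_too_large[where p = ?n and q = "Suc ?n"], auto)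
  then show "form_d Y V c z = (\<lambda>_. 0)"
    by (intro ext) (simp add: form_d_def ext_d_def form_del_def form_delbar_def)
qed

context
  fixes X :: "'a cmanifold" and Y :: "'b cmanifold" and \<omega> :: "'a form"
  assumes X: "complex_manifold X" and Y: "complex_manifold Y"
    and \<omega>: "smooth_form X \<omega>" "form_all X (positive_11 (cdim X)) \<omega>" "form_eq X (form_d X \<omega>) form_zero"
begin

private abbreviation (input) "m \<equiv> cdim X"
private abbreviation (input) "n \<equiv> cdim Y"
private abbreviation (input) "Z \<equiv> prod_manifold X Y"

section \<open>The product form in charts of the product\<close>

lemma kaehler_form_facts:
  assumes c: "c \<in> atlas X" "z \<in> chart_image c"
  shows "has_bidegree 1 1 (\<omega> c z)" "has_degree 2 (\<omega> c z)" "ext_on m (\<omega> c z)" "ext_real (\<omega> c z)"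
    "del m (\<omega> c) z = (\<lambda>_. 0)" "delbar m (\<omega> c) z = (\<lambda>_. 0)"
    "positive_11 m (coef (Extalg (\<omega> c z)))" "coef (Extalg (\<omega> c z)) = \<omega> c z"
    "has_bidegree j j (wedge_power j (\<omega> c z))"
proof -
  have p: "positive_11 m (\<omega> c x)" if "x \<in> chart_image c" for x
    using \<omega>(2) c(1) that unfolding form_all_def by blast
  then show b: "has_bidegree 1 1 (\<omega> c z)" and e: "ext_on m (\<omega> c z)" and "ext_real (\<omega> c z)"
    using c(2) unfolding positive_11_def by blast+
  show E: "coef (Extalg (\<omega> c z)) = \<omega> c z" by (rule coef_Extalg[OF e])
  then show "positive_11 m (coef (Extalg (\<omega> c z)))" using p c(2) by simp
  show "has_degree 2 (\<omega> c z)" using bideg_degree[of 1 1 "Extalg (\<omega> c z)"] b by (simp add: E)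
  show "has_bidegree j j (wedge_power j (\<omega> c z))"
    using bideg_power[of 1 1 "Extalg (\<omega> c z)" j] b by (simp add: E coef_power)
  have d: "ext_d m (\<omega> c) z = (\<lambda>_. 0)"
  proof
    fix K
    have "form_d X \<omega> c z = form_zero c z" using \<omega>(3) c unfolding form_eq_def by blast
    then have "form_d X \<omega> c z K = form_zero c z K" by simp
    then show "ext_d m (\<omega> c) z K = 0" by (simp add: form_d_def form_zero_def)
  qed
  have b': "has_bidegree 1 1 (\<omega> c x)" if "x \<in> chart_image c" for x
    using p[OF that] unfolding positive_11_def by blast
  show "del m (\<omega> c) z = (\<lambda>_. 0)" "delbar m (\<omega> c) z = (\<lambda>_. 0)"
    using del_delbar_zero_if_ext_d_zero[OF is_chart_facts(3)[OF complex_manifold_chart[OF X c(1)]] c(2) b' d]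
    by blast+
qed

lemma prod_form_charts:
  assumes "C \<in> atlas Z"
  obtains c c' where "c \<in> atlas X" "c' \<in> atlas Y" "open_Cn (m + n) (chart_image C)"
    "fst_coords m ` chart_image C \<subseteq> chart_image c" "snd_coords m ` chart_image C \<subseteq> chart_image c'"
    "\<And>s \<beta>. prod_form X Y s \<omega> \<beta> C = conv_form m s (\<omega> c) (\<lambda>t. \<beta> t c')"
proof -
  obtain c c' where c: "factor_charts X Y C = (c, c')" "c \<in> atlas X" "c' \<in> atlas Y" "C = prod_chart m c c'"
    using assms by (rule factor_charts)
  note cX = complex_manifold_chart[OF X c(2)] and cY = complex_manifold_chart[OF Y c(3)]
  have "open_Cn (m + n) (chart_image C)"
    unfolding c(4) by (rule is_chart_facts(3)[OF is_chart_prod_chart[OF cX cY]])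
  moreover have "fst_coords m ` chart_image C \<subseteq> chart_image c" "snd_coords m ` chart_image C \<subseteq> chart_image c'"
    unfolding c(4) chart_image_prod_chart[OF is_chart_facts(4)[OF cX]] by blast+
  moreover have "prod_form X Y s \<omega> \<beta> C = conv_form m s (\<omega> c) (\<lambda>t. \<beta> t c')" for s \<beta>
    by (simp add: prod_form_def c(1))
  ultimately show ?thesis using that c(2,3) by blast
qed

lemma prod_form_cong:
  assumes "\<And>t c z. c \<in> atlas Y \<Longrightarrow> z \<in> chart_image c \<Longrightarrow> \<beta> t c z = \<gamma> t c z"
  shows "form_eq Z (prod_form X Y s \<omega> \<beta>) (prod_form X Y s \<omega> \<gamma>)"
  unfolding form_eq_def
proof (intro ballI)
  fix C z assume C: "C \<in> atlas Z" and z: "z \<in> chart_image C"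
  from C obtain c c' where c: "c \<in> atlas X" "c' \<in> atlas Y" "open_Cn (m + n) (chart_image C)"
    "fst_coords m ` chart_image C \<subseteq> chart_image c" "snd_coords m ` chart_image C \<subseteq> chart_image c'"
    and pf: "\<And>s \<beta>. prod_form X Y s \<omega> \<beta> C = conv_form m s (\<omega> c) (\<lambda>t. \<beta> t c')"
    by (rule prod_form_charts) blast
  have "snd_coords m z \<in> chart_image c'" using c(5) z by blast
  then show "prod_form X Y s \<omega> \<beta> C z = prod_form X Y s \<omega> \<gamma> C z"
    unfolding pf by (intro conv_form_cong assms c(2))
qed

lemma prod_form_zero:
  assumes "\<And>t c z. c \<in> atlas Y \<Longrightarrow> z \<in> chart_image c \<Longrightarrow> \<beta> t c z = (\<lambda>_. 0)"
  shows "form_eq Z (prod_form X Y s \<omega> \<beta>) form_zero"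
  unfolding form_eq_def
proof (intro ballI)
  fix C z assume C: "C \<in> atlas Z" and z: "z \<in> chart_image C"
  from C obtain c c' where c: "c \<in> atlas X" "c' \<in> atlas Y" "open_Cn (m + n) (chart_image C)"
    "fst_coords m ` chart_image C \<subseteq> chart_image c" "snd_coords m ` chart_image C \<subseteq> chart_image c'"
    and pf: "\<And>s \<beta>. prod_form X Y s \<omega> \<beta> C = conv_form m s (\<omega> c) (\<lambda>t. \<beta> t c')"
    by (rule prod_form_charts) blast
  have "snd_coords m z \<in> chart_image c'" using c(5) z by blast
  then have "prod_form X Y s \<omega> \<beta> C z = (\<lambda>_. 0)"
    unfolding pf by (intro conv_form_zero assms c(2))
  then show "prod_form X Y s \<omega> \<beta> C z = form_zero C z" by (intro ext) (simp add: form_zero_def)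
qed

text \<open>Smoothness is assumed chart by chart only, so that the lemma also applies to
  \<open>form_delbar Y (\<beta> t)\<close> without a proof that this is compatible with chart
  changes.\<close>

lemma del_prod_form:
  assumes \<beta>: "\<And>t c. c \<in> atlas Y \<Longrightarrow> smooth_local n (chart_image c) (\<beta> t c)"
  shows "form_eq Z (form_del Z (prod_form X Y s \<omega> \<beta>)) (prod_form X Y s \<omega> (\<lambda>t. form_del Y (\<beta> t)))"
    and "form_eq Z (form_delbar Z (prod_form X Y s \<omega> \<beta>)) (prod_form X Y s \<omega> (\<lambda>t. form_delbar Y (\<beta> t)))"
    and "form_eq Z (form_d Z (prod_form X Y s \<omega> \<beta>)) (prod_form X Y s \<omega> (\<lambda>t. form_d Y (\<beta> t)))"
proof -
  have *: "form_del Z (prod_form X Y s \<omega> \<beta>) C z = prod_form X Y s \<omega> (\<lambda>t. form_del Y (\<beta> t)) C z"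
    "form_delbar Z (prod_form X Y s \<omega> \<beta>) C z = prod_form X Y s \<omega> (\<lambda>t. form_delbar Y (\<beta> t)) C z"
    "form_d Z (prod_form X Y s \<omega> \<beta>) C z = prod_form X Y s \<omega> (\<lambda>t. form_d Y (\<beta> t)) C z"
    if C: "C \<in> atlas Z" and z: "z \<in> chart_image C" for C z
  proof -
    from C obtain c c' where c: "c \<in> atlas X" "c' \<in> atlas Y" "open_Cn (m + n) (chart_image C)"
      "fst_coords m ` chart_image C \<subseteq> chart_image c" "snd_coords m ` chart_image C \<subseteq> chart_image c'"
      and pf: "\<And>s \<beta>. prod_form X Y s \<omega> \<beta> C = conv_form m s (\<omega> c) (\<lambda>t. \<beta> t c')"
      by (rule prod_form_charts) blast
    have z1: "fst_coords m z \<in> chart_image c" using c(4) z by blast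
    note f = kaehler_form_facts[OF c(1) z1]
    have d: "del (m + n) (conv_form m s (\<omega> c) (\<lambda>t. \<beta> t c')) z = conv_form m s (\<omega> c) (\<lambda>t. del n (\<beta> t c')) z"
      "delbar (m + n) (conv_form m s (\<omega> c) (\<lambda>t. \<beta> t c')) z = conv_form m s (\<omega> c) (\<lambda>t. delbar n (\<beta> t c')) z"
      by (rule del_delbar_conv_form[OF c(3,4,5) smooth_formD(2)[OF \<omega>(1) c(1)] _ z f(2,5,6)], rule \<beta>[OF c(2)])+
    show "form_del Z (prod_form X Y s \<omega> \<beta>) C z = prod_form X Y s \<omega> (\<lambda>t. form_del Y (\<beta> t)) C z"
      "form_delbar Z (prod_form X Y s \<omega> \<beta>) C z = prod_form X Y s \<omega> (\<lambda>t. form_delbar Y (\<beta> t)) C z"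
      using d by (simp_all add: form_del_def form_delbar_def pf)
    have "ext_d n (\<beta> t c') = (\<lambda>z K. del n (\<beta> t c') z K + delbar n (\<beta> t c') z K)" for t
      by (intro ext) (simp add: ext_d_def)
    then show "form_d Z (prod_form X Y s \<omega> \<beta>) C z = prod_form X Y s \<omega> (\<lambda>t. form_d Y (\<beta> t)) C z"
      by (intro ext) (simp add: form_d_def pf ext_d_def[of "m + n"] d conv_form_add)
  qed
  show "form_eq Z (form_del Z (prod_form X Y s \<omega> \<beta>)) (prod_form X Y s \<omega> (\<lambda>t. form_del Y (\<beta> t)))"
    "form_eq Z (form_delbar Z (prod_form X Y s \<omega> \<beta>)) (prod_form X Y s \<omega> (\<lambda>t. form_delbar Y (\<beta> t)))"
    "form_eq Z (form_d Z (prod_form X Y s \<omega> \<beta>)) (prod_form X Y s \<omega> (\<lambda>t. form_d Y (\<beta> t)))"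
    unfolding form_eq_def using * by blast+
qed

lemma smooth_local_form_delbar:
  assumes "smooth_form Y \<beta>" "c \<in> atlas Y"
  shows "smooth_local n (chart_image c) (form_delbar Y \<beta> c)"
  unfolding form_delbar_def delbar_eq_dolb
  by (rule smooth_local_dolb[OF is_chart_facts(3)[OF complex_manifold_chart[OF Y assms(2)]] smooth_formD(2)[OF assms]])

text \<open>The formula for the inner derivative holds on chart images; these are open, so it may be
  differentiated once more.\<close>

lemma del_delbar_prod_form:
  assumes \<beta>: "\<And>t. smooth_form Y (\<beta> t)"
  shows "form_eq Z (form_del Z (form_delbar Z (prod_form X Y s \<omega> \<beta>)))
    (prod_form X Y s \<omega> (\<lambda>t. form_del Y (form_delbar Y (\<beta> t))))"
  unfolding form_eq_def
proof (intro ballI)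
  fix C z assume C: "C \<in> atlas Z" and z: "z \<in> chart_image C"
  have o: "open_Cn (m + n) (chart_image C)" by (rule prod_form_charts[OF C]) blast
  have e: "form_delbar Z (prod_form X Y s \<omega> \<beta>) C x = prod_form X Y s \<omega> (\<lambda>t. form_delbar Y (\<beta> t)) C x"
    if "x \<in> chart_image C" for x
    using del_prod_form(2)[of \<beta> s] smooth_formD(2)[OF \<beta>] C that unfolding form_eq_def by blast
  have "form_del Z (form_delbar Z (prod_form X Y s \<omega> \<beta>)) C z =
      form_del Z (prod_form X Y s \<omega> (\<lambda>t. form_delbar Y (\<beta> t))) C z"
    unfolding form_del_def del_eq_dolb cdim_prod_manifold by (rule dolb_cong[OF o z e])
  also have "\<dots> = prod_form X Y s \<omega> (\<lambda>t. form_del Y (form_delbar Y (\<beta> t))) C z"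
    using del_prod_form(1)[of "\<lambda>t. form_delbar Y (\<beta> t)" s] smooth_local_form_delbar[OF \<beta>] C z
    unfolding form_eq_def by blast
  finally show "form_del Z (form_delbar Z (prod_form X Y s \<omega> \<beta>)) C z =
      prod_form X Y s \<omega> (\<lambda>t. form_del Y (form_delbar Y (\<beta> t))) C z" .
qed

lemma prod_form_pointwise:
  assumes \<beta>: "\<And>t. smooth_form Y (\<beta> t)" and C: "C \<in> atlas Z" and z: "z \<in> chart_image C"
  obtains c z1 c' z2 where "c \<in> atlas X" "z1 \<in> chart_image c" "c' \<in> atlas Y" "z2 \<in> chart_image c'"
    "\<And>s. prod_form X Y s \<omega> \<beta> C z = coef (exp_conv (Extalg (\<omega> c z1)) (\<lambda>t. shift m (Extalg (\<beta> t c' z2))) s)"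
    "z1 = fst_coords m z" "z2 = snd_coords m z" "\<And>s. prod_form X Y s \<omega> \<beta> C z = conv_form m s (\<omega> c) (\<lambda>t. \<beta> t c') z"
proof -
  from C obtain c c' where c: "c \<in> atlas X" "c' \<in> atlas Y" "open_Cn (m + n) (chart_image C)"
    "fst_coords m ` chart_image C \<subseteq> chart_image c" "snd_coords m ` chart_image C \<subseteq> chart_image c'"
    and pf: "\<And>s \<beta>. prod_form X Y s \<omega> \<beta> C = conv_form m s (\<omega> c) (\<lambda>t. \<beta> t c')"
    by (rule prod_form_charts) blast
  have z12: "fst_coords m z \<in> chart_image c" "snd_coords m z \<in> chart_image c'" using c(4,5) z by blast+
  have "conv_form m s (\<omega> c) (\<lambda>t. \<beta> t c') z = coef (exp_conv (Extalg (\<omega> c (fst_coords m z)))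
      (\<lambda>t. shift m (Extalg (\<beta> t c' (snd_coords m z)))) s)" for s
    by (rule conv_form_eq) (rule kaehler_form_facts(3)[OF c(1) z12(1)] smooth_formD(1)[OF \<beta> c(2) z12(2)])+
  then show ?thesis using that[OF c(1) z12(1) c(2) z12(2)] pf by simp
qed

lemma ext_real_prod_form:
  assumes \<beta>: "\<And>t. smooth_form Y (\<beta> t)" and real: "\<And>t. form_all Y ext_real (\<beta> t)"
  shows "form_all Z ext_real (prod_form X Y s \<omega> \<beta>)"
  unfolding form_all_def
proof (intro ballI)
  fix C z assume "C \<in> atlas Z" "z \<in> chart_image C"
  then obtain c z1 c' z2 where c: "c \<in> atlas X" "z1 \<in> chart_image c" "c' \<in> atlas Y" "z2 \<in> chart_image c'"
    and pf: "\<And>s. prod_form X Y s \<omega> \<beta> C z = coef (exp_conv (Extalg (\<omega> c z1)) (\<lambda>t. shift m (Extalg (\<beta> t c' z2))) s)"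
    by (rule prod_form_pointwise[where \<beta> = \<beta>, OF \<beta>]) blast
  have "econj (Extalg (\<omega> c z1)) = Extalg (\<omega> c z1)"
    using kaehler_form_facts(4,8)[OF c(1,2)] ext_real_iff by metis
  moreover have "econj (Extalg (\<beta> t c' z2)) = Extalg (\<beta> t c' z2)" for t
  proof -
    have "ext_real (\<beta> t c' z2)" using real c unfolding form_all_def by blast
    moreover have "ext_on n (\<beta> t c' z2)" by (rule smooth_formD(1)[OF \<beta> c(3,4)])
    ultimately show ?thesis using ext_real_iff[of "Extalg (\<beta> t c' z2)"]
      by (simp add: coef_Extalg)
  qed
  ultimately show "ext_real (prod_form X Y s \<omega> \<beta> C z)"
    unfolding pf ext_real_iff by (intro econj_exp_conv) (simp_all add: econj_shift)
qed

lemma transverse_form_prod_form: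
  assumes \<Omega>: "\<And>t. smooth_form Y (\<Omega> t)" and real: "\<And>t. form_all Y ext_real (\<Omega> t)"
    and bi: "\<And>t. form_all Y (has_bidegree t t) (\<Omega> t)"
    and tr: "\<And>t. q \<le> t \<Longrightarrow> t \<le> n \<Longrightarrow> form_all Y (transverse n t) (\<Omega> t)"
    and s: "m + q \<le> s" "s \<le> m + n"
  shows "transverse_form Z s (prod_form X Y s \<omega> \<Omega>)"
  unfolding transverse_form_def form_all_def cdim_prod_manifold
proof (intro conjI ballI smooth_form_prod_form[OF X Y \<omega>(1) \<Omega>])
  fix C z assume Cz: "C \<in> atlas Z" "z \<in> chart_image C"
  then obtain c z1 c' z2 where c: "c \<in> atlas X" "z1 \<in> chart_image c" "c' \<in> atlas Y" "z2 \<in> chart_image c'"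
    and pf: "\<And>s. prod_form X Y s \<omega> \<Omega> C z = coef (exp_conv (Extalg (\<omega> c z1)) (\<lambda>t. shift m (Extalg (\<Omega> t c' z2))) s)"
    by (rule prod_form_pointwise[where \<beta> = \<Omega>, OF \<Omega>]) blast
  have e: "ext_on n (\<Omega> t c' z2)" for t by (rule smooth_formD(1)[OF \<Omega> c(3,4)])
  have E: "coef (Extalg (\<Omega> t c' z2)) = \<Omega> t c' z2" for t by (rule coef_Extalg[OF e])
  have "trans_form 0 (m + n) s (exp_conv (Extalg (\<omega> c z1)) (\<lambda>t. shift m (Extalg (\<Omega> t c' z2))) s)"
  proof (rule trans_form_exp_conv_positive_11[where q = q])
    show "positive_11 m (coef (Extalg (\<omega> c z1)))" by (rule kaehler_form_facts(7)[OF c(1,2)])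
    show "supported (coframe_range m (m + n)) (shift m (Extalg (\<Omega> t c' z2)))" for t
      by (intro supported_shift supported_Extalg e)
    show "bideg t t (shift m (Extalg (\<Omega> t c' z2)))" for t
      using bi c by (intro bideg_shift) (auto simp: form_all_def E)
    show "trans_form m (m + n) t (shift m (Extalg (\<Omega> t c' z2)))" if "q \<le> t" "t \<le> n" for t
    proof (rule trans_form_shift)
      have "transverse n t (coef (Extalg (\<Omega> t c' z2)))"
        using tr[OF that] c unfolding form_all_def E by blast
      then show "trans_form 0 n t (Extalg (\<Omega> t c' z2))" unfolding transverse_iff by blast
    qed
  qed (use s in auto)
  moreover have "form_all Z ext_real (prod_form X Y s \<omega> \<Omega>)"
    by (rule ext_real_prod_form) (rule \<Omega> real)+
  then have "ext_real (prod_form X Y s \<omega> \<Omega> C z)"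
    using Cz unfolding form_all_def by blast
  ultimately show "transverse (m + n) s (prod_form X Y s \<omega> \<Omega> C z)"
    unfolding pf transverse_iff ext_real_iff by blast
qed

lemma has_degree_prod_form:
  assumes \<beta>: "\<And>t. smooth_form Y (\<beta> t)"
    and deg: "\<And>j c z. j \<le> s \<Longrightarrow> c \<in> atlas Y \<Longrightarrow> z \<in> chart_image c \<Longrightarrow>
      2 * j \<le> R \<and> has_degree (R - 2 * j) (\<beta> (s - j) c z) \<or> \<beta> (s - j) c z = (\<lambda>_. 0)"
  shows "form_all Z (has_degree R) (prod_form X Y s \<omega> \<beta>)"
  unfolding form_all_def
proof (intro ballI)
  fix C z assume "C \<in> atlas Z" "z \<in> chart_image C"
  then obtain c z1 c' z2 where c: "c \<in> atlas X" "z1 \<in> chart_image c" "c' \<in> atlas Y" "z2 \<in> chart_image c'"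
    "z1 = fst_coords m z" "z2 = snd_coords m z"
    and pf: "\<And>s. prod_form X Y s \<omega> \<beta> C z = conv_form m s (\<omega> c) (\<lambda>t. \<beta> t c') z"
    by (rule prod_form_pointwise[where \<beta> = \<beta>, OF \<beta>]) blast
  show "has_degree R (prod_form X Y s \<omega> \<beta> C z)"
    unfolding pf
  proof (rule has_degree_conv_form)
    show "has_degree 2 (\<omega> c (fst_coords m z))" using kaehler_form_facts(2)[OF c(1,2)] c(5) by simp
  qed (use deg[OF _ c(3,4)] c(6) in simp)
qed

lemma form_component_prod_form:
  assumes \<beta>: "\<And>t. smooth_form Y (\<beta> t)"
  shows "form_eq Z (prod_form X Y s \<omega> (\<lambda>t. form_component t t (\<beta> t))) (form_component s s (prod_form X Y s \<omega> \<beta>))"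
  unfolding form_eq_def
proof (intro ballI)
  fix C z assume C: "C \<in> atlas Z" and z: "z \<in> chart_image C"
  from C obtain c c' where c: "c \<in> atlas X" "c' \<in> atlas Y" "open_Cn (m + n) (chart_image C)"
    "fst_coords m ` chart_image C \<subseteq> chart_image c" "snd_coords m ` chart_image C \<subseteq> chart_image c'"
    and pf: "\<And>s \<beta>. prod_form X Y s \<omega> \<beta> C = conv_form m s (\<omega> c) (\<lambda>t. \<beta> t c')"
    by (rule prod_form_charts) blast
  have z1: "fst_coords m z \<in> chart_image c" using c(4) z by blast
  have "form_component t t (\<beta> t) c' = (\<lambda>z. ext_component t t (\<beta> t c' z))" for t
    by (rule ext) (simp add: form_component_def)
  moreover have "ext_component s s (conv_form m s (\<omega> c) (\<lambda>t. \<beta> t c') z) =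
      conv_form m s (\<omega> c) (\<lambda>t z. ext_component t t (\<beta> t c' z)) z"
    by (rule ext_component_conv_form) (rule kaehler_form_facts(9)[OF c(1) z1])
  ultimately show "prod_form X Y s \<omega> (\<lambda>t. form_component t t (\<beta> t)) C z = form_component s s (prod_form X Y s \<omega> \<beta>) C z"
    unfolding form_component_def[of s] pf by simp
qed

end

text \<open>The top member is a parameter because the construction serves several families: the
  transverse or closed forms are completed by a volume form, the primitives of type WK by
  \<open>form_zero\<close>.\<close>

definition ext_family :: "nat \<Rightarrow> nat \<Rightarrow> 'b form \<Rightarrow> (nat \<Rightarrow> 'b form) \<Rightarrow> nat \<Rightarrow> 'b form" where
  "ext_family q n V \<Omega> t = (if q \<le> t \<and> t < n then \<Omega> t else if t = n then V else form_zero)"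

lemma ext_family_cases:
  assumes "\<And>t. q \<le> t \<Longrightarrow> t < n \<Longrightarrow> P t (\<Omega> t)" "P n V" "\<And>t. P t form_zero"
  shows "P t (ext_family q n V \<Omega> t)"
  using assms by (auto simp: ext_family_def)

lemma form_zero_eq: "form_zero c z = (\<lambda>_. 0)"
  by (rule ext) (simp add: form_zero_def)

lemma form_all_zero:
  "form_all Y ext_real form_zero" "form_all Y (has_bidegree p r) form_zero" "form_all Y (has_degree r) form_zero"
  by (simp_all add: form_all_def form_zero_eq ext_real_def has_bidegree_def has_degree_def ext_cnj_def fun_eq_iff)

lemma transverse_facts:
  "form_all Y (transverse n p) w \<Longrightarrow> form_all Y ext_real w" "form_all Y (transverse n p) w \<Longrightarrow> form_all Y (has_bidegree p p) w"
  unfolding form_all_def transverse_def by blast+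

lemma form_eq_trans: "form_eq X u v \<Longrightarrow> form_eq X v w \<Longrightarrow> form_eq X u w"
  unfolding form_eq_def by simp

theorem theorem5p5:
  fixes T :: kaehler_type
    and X :: "'a cmanifold" and Y :: "'b cmanifold"
    and m n q :: nat
  assumes "kaehler_manifold X" and "cdim X = m"
    and "complex_manifold Y" and "cdim Y = n"
    and "1 \<le> q" and "q \<le> n - 1"
    and "\<forall>s. q \<le> s \<and> s < n \<longrightarrow> generalized_kaehler T s Y"
  shows "\<forall>s. m + q \<le> s \<and> s < m + n \<longrightarrow> generalized_kaehler T s (prod_manifold X Y)"
proof (intro allI impI)
  fix s assume s: "m + q \<le> s \<and> s < m + n"
  let ?Z = "prod_manifold X Y"
  have X: "complex_manifold X" and Y: "complex_manifold Y" using assms by (auto simp: kaehler_manifold_def)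
  have dims: "cdim X = m" "cdim Y = n" using assms by auto
  obtain \<omega> where \<omega>: "smooth_form X \<omega>" "form_all X (positive_11 (cdim X)) \<omega>" "form_eq X (form_d X \<omega>) form_zero"
    using assms(1) unfolding kaehler_manifold_def by blast
  \<comment> \<open>The bounds on q leave room for the index n - 1, whose transverse form on Y
    yields the volume form.\<close>
  have n2: "2 \<le> n" and q: "q \<le> n - 1" "n - 1 < n" using assms(5,6) by auto
  have base: "complex_manifold ?Z" "1 \<le> s" "s < cdim ?Z"
    using complex_manifold_prod_manifold[OF X Y] s assms by auto
  have gk: "generalized_kaehler T t Y" if "q \<le> t" "t < n" for t using assms(7) that by blast
  have vol: "\<exists>V. smooth_form Y V \<and> form_all Y (transverse n n) V" if "transverse_form Y (n - 1) \<Omega>" for \<Omega>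
    using exists_volume_form[OF Y dims(2) n2 that] by blast
  have s': "cdim X + q \<le> s" "s \<le> cdim X + cdim Y" using s dims by auto
  have trans: "transverse_form ?Z s (prod_form X Y s \<omega> (ext_family q n V \<Omega>))"
    and smooth: "\<And>t. smooth_form Y (ext_family q n V \<Omega> t)"
    if \<Omega>: "\<And>t. q \<le> t \<Longrightarrow> t < n \<Longrightarrow> transverse_form Y t (\<Omega> t)" and V: "smooth_form Y V" "form_all Y (transverse n n) V"
    for V \<Omega>
  proof -
    have \<Omega>': "smooth_form Y (\<Omega> t)" "form_all Y (transverse n t) (\<Omega> t)" if "q \<le> t" "t < n" for t
      using \<Omega>[OF that] dims(2) by (auto simp: transverse_form_def)
    show sm: "smooth_form Y (ext_family q n V \<Omega> t)" for t
      by (rule ext_family_cases[where P = "\<lambda>t. smooth_form Y"]) (use \<Omega>' V smooth_form_zero in auto)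
    show "transverse_form ?Z s (prod_form X Y s \<omega> (ext_family q n V \<Omega>))"
    proof (rule transverse_form_prod_form[OF X Y \<omega> sm _ _ _ s'])
      show "form_all Y ext_real (ext_family q n V \<Omega> t)" for t
        by (rule ext_family_cases[where P = "\<lambda>t. form_all Y ext_real"])
          (use transverse_facts(1) \<Omega>'(2) V(2) form_all_zero(1) in blast)+
      show "form_all Y (has_bidegree t t) (ext_family q n V \<Omega> t)" for t
        by (rule ext_family_cases[where P = "\<lambda>t. form_all Y (has_bidegree t t)"])
          (use transverse_facts(2) \<Omega>'(2) V(2) form_all_zero(2) in blast)+
      show "form_all Y (transverse (cdim Y) t) (ext_family q n V \<Omega> t)" if "q \<le> t" "t \<le> cdim Y" for t
        using that \<Omega>'(2) V(2) dims(2) by (cases "t = n") (auto simp: ext_family_def)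
    qed
  qed
  have Vd: "form_del Y V c z = (\<lambda>_. 0)" "form_delbar Y V c z = (\<lambda>_. 0)" "form_d Y V c z = (\<lambda>_. 0)"
    if "smooth_form Y V" "form_all Y (transverse n n) V" "c \<in> atlas Y" "z \<in> chart_image c" for V c z
    using derivatives_top_form[OF Y that(1) _ that(3,4)] transverse_facts(2)[OF that(2)] dims(2) by auto
  show "generalized_kaehler T s ?Z"
  proof (cases T)
    case Type_K
    \<comment> \<open>The range condition stands inside the existential quantifier, so that one
      choice function covers all indices.\<close>
    have "\<forall>t. \<exists>\<Omega>. q \<le> t \<and> t < n \<longrightarrow> transverse_form Y t \<Omega> \<and> form_eq Y (form_d Y \<Omega>) form_zero"
      using gk unfolding generalized_kaehler_def Type_K by auto
    then obtain \<Omega> where \<Omega>: "\<And>t. q \<le> t \<Longrightarrow> t < n \<Longrightarrow> transverse_form Y t (\<Omega> t)"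
      "\<And>t. q \<le> t \<Longrightarrow> t < n \<Longrightarrow> form_eq Y (form_d Y (\<Omega> t)) form_zero" by metis
    obtain V where V: "smooth_form Y V" "form_all Y (transverse n n) V"
      using vol[OF \<Omega>(1)[OF q]] by blast
    let ?\<Omega> = "ext_family q n V \<Omega>"
    have sm: "smooth_form Y (?\<Omega> t)" for t by (rule smooth[OF _ V]) (rule \<Omega>(1))
    have tr: "transverse_form ?Z s (prod_form X Y s \<omega> ?\<Omega>)" by (rule trans[OF _ V]) (rule \<Omega>(1))
    have closed: "form_d Y (?\<Omega> t) c z = (\<lambda>_. 0)" if "c \<in> atlas Y" "z \<in> chart_image c" for t c z
    proof (rule ext_family_cases[where P = "\<lambda>t w. form_d Y w c z = (\<lambda>_. 0)"])
      show "form_d Y (\<Omega> t) c z = (\<lambda>_. 0)" if "q \<le> t" "t < n" for t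
        using \<Omega>(2)[OF that] \<open>c \<in> atlas Y\<close> \<open>z \<in> chart_image c\<close> unfolding form_eq_def form_zero_eq by blast
    qed (rule Vd(3)[OF V that] derivatives_form_zero(3))+
    have "form_eq ?Z (form_d ?Z (prod_form X Y s \<omega> ?\<Omega>)) (prod_form X Y s \<omega> (\<lambda>t. form_d Y (?\<Omega> t)))"
      by (rule del_prod_form(3)[OF X Y \<omega>]) (rule smooth_formD(2)[OF sm])
    moreover have "form_eq ?Z (prod_form X Y s \<omega> (\<lambda>t. form_d Y (?\<Omega> t))) form_zero"
      by (rule prod_form_zero[OF X Y \<omega>]) (rule closed)
    ultimately have "form_eq ?Z (form_d ?Z (prod_form X Y s \<omega> ?\<Omega>)) form_zero"
      by (rule form_eq_trans)
    then show ?thesis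
      unfolding generalized_kaehler_def Type_K using base tr by auto
  next
    case Type_PL
    have "\<forall>t. \<exists>\<Omega>. q \<le> t \<and> t < n \<longrightarrow> transverse_form Y t \<Omega> \<and> form_eq Y (form_del Y (form_delbar Y \<Omega>)) form_zero"
      using gk unfolding generalized_kaehler_def Type_PL by auto
    then obtain \<Omega> where \<Omega>: "\<And>t. q \<le> t \<Longrightarrow> t < n \<Longrightarrow> transverse_form Y t (\<Omega> t)"
      "\<And>t. q \<le> t \<Longrightarrow> t < n \<Longrightarrow> form_eq Y (form_del Y (form_delbar Y (\<Omega> t))) form_zero" by metis
    obtain V where V: "smooth_form Y V" "form_all Y (transverse n n) V"
      using vol[OF \<Omega>(1)[OF q]] by blast
    let ?\<Omega> = "ext_family q n V \<Omega>"
    have sm: "smooth_form Y (?\<Omega> t)" for t by (rule smooth[OF _ V]) (rule \<Omega>(1))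
    have tr: "transverse_form ?Z s (prod_form X Y s \<omega> ?\<Omega>)" by (rule trans[OF _ V]) (rule \<Omega>(1))
    \<comment> \<open>The inner derivative is known to vanish on the chart image only;
      differentiating this uses that the chart image is open.\<close>
    have dd: "form_del Y (form_delbar Y w) c z = (\<lambda>_. 0)"
      if "c \<in> atlas Y" "z \<in> chart_image c" "\<And>x. x \<in> chart_image c \<Longrightarrow> form_delbar Y w c x = (\<lambda>_. 0)" for c z w
    proof -
      have "form_del Y (form_delbar Y w) c z = dolb n 1 Dz (\<lambda>_ _. 0) z"
        unfolding form_del_def del_eq_dolb dims(2)
        using is_chart_facts(3)[OF complex_manifold_chart[OF Y that(1)]] dims(2) that(2,3)
        by (intro dolb_cong[where V = "chart_image c"]) auto
      then show ?thesis by (simp add: dolb_const)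
    qed
    have closed: "form_del Y (form_delbar Y (?\<Omega> t)) c z = (\<lambda>_. 0)" if "c \<in> atlas Y" "z \<in> chart_image c" for t c z
    proof (rule ext_family_cases[where P = "\<lambda>t w. form_del Y (form_delbar Y w) c z = (\<lambda>_. 0)"])
      show "form_del Y (form_delbar Y (\<Omega> t)) c z = (\<lambda>_. 0)" if "q \<le> t" "t < n" for t
        using \<Omega>(2)[OF that] \<open>c \<in> atlas Y\<close> \<open>z \<in> chart_image c\<close> unfolding form_eq_def form_zero_eq by blast
    qed (rule dd[OF that], rule Vd(2)[OF V that(1)] derivatives_form_zero(2); assumption?)+
    have "form_eq ?Z (form_del ?Z (form_delbar ?Z (prod_form X Y s \<omega> ?\<Omega>)))
        (prod_form X Y s \<omega> (\<lambda>t. form_del Y (form_delbar Y (?\<Omega> t))))"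
      by (rule del_delbar_prod_form[OF X Y \<omega>]) (rule sm)
    moreover have "form_eq ?Z (prod_form X Y s \<omega> (\<lambda>t. form_del Y (form_delbar Y (?\<Omega> t)))) form_zero"
      by (rule prod_form_zero[OF X Y \<omega>]) (rule closed)
    ultimately have "form_eq ?Z (form_del ?Z (form_delbar ?Z (prod_form X Y s \<omega> ?\<Omega>))) form_zero"
      by (rule form_eq_trans)
    then show ?thesis
      unfolding generalized_kaehler_def Type_PL using base tr by auto
  next
    case Type_WK
    have "\<forall>t. \<exists>\<Omega> \<alpha>. q \<le> t \<and> t < n \<longrightarrow> transverse_form Y t \<Omega> \<and> smooth_form Y \<alpha> \<and>
        form_all Y (has_degree (2 * t - 1)) \<alpha> \<and> form_eq Y (form_del Y \<Omega>) (form_del Y (form_delbar Y \<alpha>))"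
      using gk unfolding generalized_kaehler_def Type_WK by auto
    then obtain \<Omega> \<alpha> where *: "\<forall>t. q \<le> t \<and> t < n \<longrightarrow> transverse_form Y t (\<Omega> t) \<and> smooth_form Y (\<alpha> t) \<and>
        form_all Y (has_degree (2 * t - 1)) (\<alpha> t) \<and> form_eq Y (form_del Y (\<Omega> t)) (form_del Y (form_delbar Y (\<alpha> t)))"
      unfolding choice_iff by blast
    have \<Omega>: "transverse_form Y t (\<Omega> t)"
      and \<alpha>: "smooth_form Y (\<alpha> t)" "form_all Y (has_degree (2 * t - 1)) (\<alpha> t)"
        "form_eq Y (form_del Y (\<Omega> t)) (form_del Y (form_delbar Y (\<alpha> t)))" if "q \<le> t" "t < n" for t
      using * that by blast+
    obtain V where V: "smooth_form Y V" "form_all Y (transverse n n) V"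
      using vol[OF \<Omega>(1)[OF q]] by blast
    \<comment> \<open>For t = n the primitive may be taken as zero, since \<open>V\<close> is
      annihilated by \<open>form_del\<close> for reasons of degree.\<close>
    let ?\<Omega> = "ext_family q n V \<Omega>" and ?\<alpha> = "ext_family q n form_zero \<alpha>"
    have sm: "smooth_form Y (?\<Omega> t)" for t by (rule smooth[OF _ V]) (rule \<Omega>(1))
    have tr: "transverse_form ?Z s (prod_form X Y s \<omega> ?\<Omega>)" by (rule trans[OF _ V]) (rule \<Omega>(1))
    have sm\<alpha>: "smooth_form Y (?\<alpha> t)" for t
      by (rule ext_family_cases[where P = "\<lambda>t. smooth_form Y"]) (use \<alpha>(1) smooth_form_zero in auto)
    have z: "form_del Y (form_delbar Y form_zero) c z = (\<lambda>_. 0)" for c z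
    proof -
      have "form_delbar Y form_zero = (form_zero :: 'b form)"
        by (intro ext) (simp add: derivatives_form_zero(2) form_zero_def)
      then show ?thesis by (simp add: derivatives_form_zero(1))
    qed
    have eq: "form_del Y (?\<Omega> t) c z = form_del Y (form_delbar Y (?\<alpha> t)) c z"
      if "c \<in> atlas Y" "z \<in> chart_image c" for t c z
    proof (cases "q \<le> t \<and> t < n")
      case True
      then show ?thesis using \<alpha>(3)[of t] that by (simp add: ext_family_def form_eq_def)
    next
      case False
      then show ?thesis using Vd(1)[OF V that] z[of c z] derivatives_form_zero(1)[of Y c z] by (auto simp: ext_family_def)
    qed
    have "form_eq ?Z (form_del ?Z (prod_form X Y s \<omega> ?\<Omega>)) (prod_form X Y s \<omega> (\<lambda>t. form_del Y (?\<Omega> t)))"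
      by (rule del_prod_form(1)[OF X Y \<omega>]) (rule smooth_formD(2)[OF sm])
    moreover have "form_eq ?Z (prod_form X Y s \<omega> (\<lambda>t. form_del Y (?\<Omega> t)))
        (prod_form X Y s \<omega> (\<lambda>t. form_del Y (form_delbar Y (?\<alpha> t))))"
      by (rule prod_form_cong[OF X Y \<omega>]) (rule eq)
    moreover have "form_eq ?Z (form_del ?Z (form_delbar ?Z (prod_form X Y s \<omega> ?\<alpha>)))
        (prod_form X Y s \<omega> (\<lambda>t. form_del Y (form_delbar Y (?\<alpha> t))))"
      by (rule del_delbar_prod_form[OF X Y \<omega>]) (rule sm\<alpha>)
    ultimately have "form_eq ?Z (form_del ?Z (prod_form X Y s \<omega> ?\<Omega>)) (form_del ?Z (form_delbar ?Z (prod_form X Y s \<omega> ?\<alpha>)))"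
      unfolding form_eq_def by simp
    moreover have "form_all ?Z (has_degree (2 * s - 1)) (prod_form X Y s \<omega> ?\<alpha>)"
    proof (rule has_degree_prod_form[OF X Y \<omega>, where \<beta> = ?\<alpha>, OF sm\<alpha>])
      fix j c z assume j: "j \<le> s" and c: "c \<in> atlas Y" "z \<in> chart_image c"
      show "2 * j \<le> 2 * s - 1 \<and> has_degree (2 * s - 1 - 2 * j) (?\<alpha> (s - j) c z) \<or> ?\<alpha> (s - j) c z = (\<lambda>_. 0)"
      proof (cases "q \<le> s - j \<and> s - j < n")
        case True
        then have "has_degree (2 * (s - j) - 1) (?\<alpha> (s - j) c z)"
          using \<alpha>(2)[of "s - j"] c by (simp add: ext_family_def form_all_def)
        \<comment> \<open>In natural numbers this needs s - j \<ge> 1, which follows from q \<ge>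
          1.\<close>
        moreover have "2 * (s - j) - 1 = 2 * s - 1 - 2 * j" "2 * j \<le> 2 * s - 1" using True assms(5) j by auto
        ultimately show ?thesis by simp
      next
        case False
        then have "?\<alpha> (s - j) = form_zero" unfolding ext_family_def by (simp only: if_False if_cancel)
        then show ?thesis by (simp only: form_zero_eq simp_thms)
      qed
    qed
    ultimately show ?thesis
      unfolding generalized_kaehler_def Type_WK
      using base tr smooth_form_prod_form[OF X Y \<omega>(1), where \<beta> = ?\<alpha>, OF sm\<alpha>] by auto
  next
    case Type_S
    have "\<forall>t. \<exists>\<Psi>. q \<le> t \<and> t < n \<longrightarrow> smooth_form Y \<Psi> \<and> form_all Y (has_degree (2 * t)) \<Psi> \<and>
        form_all Y ext_real \<Psi> \<and> form_eq Y (form_d Y \<Psi>) form_zero \<and> transverse_form Y t (form_component t t \<Psi>)"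
      using gk unfolding generalized_kaehler_def Type_S by auto
    then obtain \<Psi> where *: "\<forall>t. q \<le> t \<and> t < n \<longrightarrow> smooth_form Y (\<Psi> t) \<and>
        form_all Y (has_degree (2 * t)) (\<Psi> t) \<and> form_all Y ext_real (\<Psi> t) \<and>
        form_eq Y (form_d Y (\<Psi> t)) form_zero \<and> transverse_form Y t (form_component t t (\<Psi> t))"
      unfolding choice_iff by blast
    have \<Psi>: "smooth_form Y (\<Psi> t)" "form_all Y (has_degree (2 * t)) (\<Psi> t)"
      "form_all Y ext_real (\<Psi> t)" "form_eq Y (form_d Y (\<Psi> t)) form_zero"
      "transverse_form Y t (form_component t t (\<Psi> t))" if "q \<le> t" "t < n" for t
      using * that by blast+
    \<comment> \<open>Closedness belongs to the full forms and transversality to their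
      (t,t)-components, so two families run in parallel. \<open>V\<close> completes both, being
      closed and of pure type.\<close>
    define \<Omega> where "\<Omega> t = form_component t t (\<Psi> t)" for t
    have \<Omega>: "transverse_form Y t (\<Omega> t)" if "q \<le> t" "t < n" for t using \<Psi>(5)[OF that] by (simp add: \<Omega>_def)
    obtain V where V: "smooth_form Y V" "form_all Y (transverse n n) V"
      using vol[OF \<Omega>[OF q]] by blast
    let ?\<Omega> = "ext_family q n V \<Omega>" and ?\<Psi> = "ext_family q n V \<Psi>"
    have sm: "smooth_form Y (?\<Psi> t)" for t
      by (rule ext_family_cases[where P = "\<lambda>t. smooth_form Y"]) (use \<Psi>(1) V(1) smooth_form_zero in auto)
    have real: "form_all Y ext_real (?\<Psi> t)" for t
      by (rule ext_family_cases[where P = "\<lambda>t. form_all Y ext_real"])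
        (use \<Psi>(3) transverse_facts(1)[OF V(2)] form_all_zero(1) in auto)
    have Vn: "has_bidegree n n (V c z)" "ext_on n (V c z)" if "c \<in> atlas Y" "z \<in> chart_image c" for c z
      using transverse_facts(2)[OF V(2)] smooth_formD(1)[OF V(1) that] that dims(2) unfolding form_all_def by auto
    have Vdeg: "has_degree (2 * n) (V c z)" if "c \<in> atlas Y" "z \<in> chart_image c" for c z
      using bideg_degree[of n n "Extalg (V c z)"] Vn[OF that] by (simp add: coef_Extalg mult_2)
    have deg: "has_degree (2 * t) (?\<Psi> t c z)" if "c \<in> atlas Y" "z \<in> chart_image c" for t c z
      using \<Psi>(2)[of t] Vdeg[OF that] that form_all_zero(3)[of Y "2 * t"]
      by (auto simp: ext_family_def form_all_def)
    have closed: "form_d Y (?\<Psi> t) c z = (\<lambda>_. 0)" if "c \<in> atlas Y" "z \<in> chart_image c" for t c z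
    proof (rule ext_family_cases[where P = "\<lambda>t w. form_d Y w c z = (\<lambda>_. 0)"])
      show "form_d Y (\<Psi> t) c z = (\<lambda>_. 0)" if "q \<le> t" "t < n" for t
        using \<Psi>(4)[OF that] \<open>c \<in> atlas Y\<close> \<open>z \<in> chart_image c\<close> unfolding form_eq_def form_zero_eq by blast
    qed (rule Vd(3)[OF V that] derivatives_form_zero(3))+
    have comp: "?\<Omega> t c z = form_component t t (?\<Psi> t) c z" if "c \<in> atlas Y" "z \<in> chart_image c" for t c z
    proof -
      have "ext_component n n (V c z) = V c z"
        using Vn(1)[OF that] by (intro ext) (auto simp: ext_component_def has_bidegree_def)
      moreover have "ext_component t t (\<lambda>_. 0) = (\<lambda>_. 0)" for t
        by (intro ext) (simp add: ext_component_def)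
      ultimately show ?thesis
        by (auto simp: ext_family_def \<Omega>_def form_component_def form_zero_eq)
    qed
    let ?P = "prod_form X Y s \<omega> ?\<Psi>"
    have eq: "form_eq ?Z (prod_form X Y s \<omega> ?\<Omega>) (form_component s s ?P)"
    proof (rule form_eq_trans)
      show "form_eq ?Z (prod_form X Y s \<omega> ?\<Omega>) (prod_form X Y s \<omega> (\<lambda>t. form_component t t (?\<Psi> t)))"
        by (rule prod_form_cong[OF X Y \<omega>]) (rule comp)
      show "form_eq ?Z (prod_form X Y s \<omega> (\<lambda>t. form_component t t (?\<Psi> t))) (form_component s s ?P)"
        by (rule form_component_prod_form[OF X Y \<omega>]) (rule sm)
    qed
    have "transverse_form ?Z s (prod_form X Y s \<omega> ?\<Omega>)" by (rule trans[OF _ V]) (rule \<Omega>)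
    then have "transverse_form ?Z s (form_component s s ?P)"
      using smooth_form_cong[OF base(1) eq] form_all_cong[OF eq]
      unfolding transverse_form_def by blast
    moreover have "form_all ?Z (has_degree (2 * s)) ?P"
    proof (rule has_degree_prod_form[OF X Y \<omega>, where \<beta> = ?\<Psi>, OF sm])
      fix j c z assume "j \<le> s" and c: "c \<in> atlas Y" "z \<in> chart_image c"
      then show "2 * j \<le> 2 * s \<and> has_degree (2 * s - 2 * j) (?\<Psi> (s - j) c z) \<or> ?\<Psi> (s - j) c z = (\<lambda>_. 0)"
        using deg[OF c, of "s - j"] by (simp add: diff_mult_distrib2)
    qed
    moreover have "form_eq ?Z (form_d ?Z ?P) form_zero"
    proof (rule form_eq_trans)
      show "form_eq ?Z (form_d ?Z ?P) (prod_form X Y s \<omega> (\<lambda>t. form_d Y (?\<Psi> t)))"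
        by (rule del_prod_form(3)[OF X Y \<omega>]) (rule smooth_formD(2)[OF sm])
      show "form_eq ?Z (prod_form X Y s \<omega> (\<lambda>t. form_d Y (?\<Psi> t))) form_zero"
        by (rule prod_form_zero[OF X Y \<omega>]) (rule closed)
    qed
    ultimately show ?thesis
      unfolding generalized_kaehler_def Type_S
      using base smooth_form_prod_form[OF X Y \<omega>(1), where \<beta> = ?\<Psi>, OF sm]
        ext_real_prod_form[OF X Y \<omega>, where \<beta> = ?\<Psi>, OF sm real] by auto
  qed
qed

end
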